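(* Let $(\mathcal C,\otimes,1)$ be an abelian, closed symmetric monoidal category that is locally finitely generated and such that filtered colimits commute with finite limits in $A\text{-}Mod$ for every $A\in Comm(\mathcal C)$. Let $X$ be a Noetherian integral scheme over $(\mathcal C,\otimes,1)$. Then $X$ is irreducible.
   Context: Monoids and modules. $Comm(\mathcal C)$ is the category of commutative monoid objects of $(\mathcal C,\otimes,1)$; for $A\in Comm(\mathcal C)$, $A\text{-}Mod$ is the category of $A$-module objects in $\mathcal C$, which is abelian and closed symmetric monoidal under $\otimes_A$. The (small) colimits used below are assumed to exist. $M\in A\text{-}Mod$ is finitely generated if $Hom_{A\text{-}Mod}(M,-)$ preserves filtered colimits of monomorphisms (filtered systems with monomorphic transition maps); $M$ is finitely presented if $M\cong colim(0\longleftarrow A^m\overset{q}{\longrightarrow}A^n)$ (i.e. $M\cong Coker(q)$) for some morphism $q:A^m\to A^n$ of finite free $A$-modules. "$\mathcal C$ is locally finitely generated" means: for every $A\in Comm(\mathcal C)$, every $M\in A\text{-}Mod$ is the filtered colimit of its finitely generated submodules. Put $\mathcal E(A):=Hom_{A\text{-}Mod}(A,A)$, a commutative ring. $A$ is integral if $\mathcal E(A)$ is an integral domain; $A$ is Noetherian if, for $M\in A\text{-}Mod$, $M$ is finitely generated if and only if $M$ is finitely presented. Schemes (Toën–Vaquié). $Aff_{\mathcal C}:=Comm(\mathcal C)^{op}$; $Spec(A)$ is the object corresponding to $A$. A morphism $Spec(B)\to Spec(A)$ is a Zariski open immersion if $A\to B$ is an epimorphism in $Comm(\mathcal C)$, is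 flat ($-\otimes_AB:A\text{-}Mod\to B\text{-}Mod$ is exact), and is of finite presentation ($Hom(B,-)$ on commutative $A$-algebra objects preserves filtered colimits). A family of Zariski open immersions $\{Spec(A_i)\to Spec(A)\}_{i\in I}$ is a Zariski covering if for some finite $J\subseteq I$ the family of functors $(-\otimes_AA_j)_{j\in J}$ is jointly conservative. $Sh(Aff_{\mathcal C})$ is the category of sheaves of sets for this topology; affine schemes are viewed as representable sheaves. A subsheaf $F\subseteq Spec(A)$ is Zariski open if it is the image of $\coprod_iSpec(A_i)\to Spec(A)$ for some family of affine Zariski open immersions; a morphism $F\to G$ in $Sh(Aff_{\mathcal C})$ is a Zariski open immersion if for every affine scheme $Z\to G$, $F\times_GZ\to Z$ is a monomorphism with Zariski open image. A scheme over $(\mathcal C,\otimes,1)$ is an $X\in Sh(Aff_{\mathcal C})$ admitting an epimorphism $\coprod_{i\in I}X_i\to X$ with each $X_i$ affine and each $X_i\to X$ a Zariski open immersion. $ZarAff(X)$ is the category of Zariski open immersions $U=Spec(A)\to X$ with $U$ affine (morphisms over $X$). An object is trivial if it is isomorphic to $Spec(0)$, non-trivial otherwise. $X$ is integral (resp. Noetherian) if for every $Spec(A)\in ZarAff(X)$ (with $A\ne0$ in the integral case), $A$ is integral (resp. Noetherian). $X$ is irreducible if for all non-trivial $V,W\in ZarAff(X)$, the fibre product $V\times_XW$ is non-trivial. *)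

theory Defs
  imports "HOL-Algebra.Ring" "HOL-Library.Equipollence"
begin

section \<open>Categories\<close>

text \<open>
  Hom-sets need not be disjoint, so that monoid and module objects can share the arrows and the
  composition of the ambient category. Whatever depends on source and target (the arrow part of a
  functor, restriction maps of presheaves) therefore takes them as arguments.
\<close>

record ('o, 'm) cat =
  Ob :: "'o set"
  Hom :: "'o \<Rightarrow> 'o \<Rightarrow> 'm set"
  Idn :: "'o \<Rightarrow> 'm"
  Comp :: "'m \<Rightarrow> 'm \<Rightarrow> 'm"  (infixl "\<cdot>\<index>" 75)

locale category =
  fixes C :: "('o, 'm, 'z) cat_scheme" (structure)
  assumes id_in_hom: "x \<in> Ob C \<Longrightarrow> Idn C x \<in> Hom C x x"
    and comp_in_hom: "\<lbrakk>x \<in> Ob C; y \<in> Ob C; z \<in> Ob C; f \<in> Hom C x y; g \<in> Hom C y z\<rbrakk>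
      \<Longrightarrow> g \<cdot> f \<in> Hom C x z"
    and comp_id_right: "\<lbrakk>x \<in> Ob C; y \<in> Ob C; f \<in> Hom C x y\<rbrakk> \<Longrightarrow> f \<cdot> Idn C x = f"
    and comp_id_left: "\<lbrakk>x \<in> Ob C; y \<in> Ob C; f \<in> Hom C x y\<rbrakk> \<Longrightarrow> Idn C y \<cdot> f = f"
    and comp_assoc: "\<lbrakk>w \<in> Ob C; x \<in> Ob C; y \<in> Ob C; z \<in> Ob C;
        f \<in> Hom C w x; g \<in> Hom C x y; h \<in> Hom C y z\<rbrakk>
      \<Longrightarrow> (h \<cdot> g) \<cdot> f = h \<cdot> (g \<cdot> f)"

definition Arr :: "('o, 'm, 'z) cat_scheme \<Rightarrow> 'm set" where
  "Arr C = (\<Union>x\<in>Ob C. \<Union>y\<in>Ob C. Hom C x y)"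

definition is_iso :: "('o, 'm, 'z) cat_scheme \<Rightarrow> 'o \<Rightarrow> 'o \<Rightarrow> 'm \<Rightarrow> bool" where
  "is_iso C x y f \<longleftrightarrow> f \<in> Hom C x y \<and>
     (\<exists>g\<in>Hom C y x. g \<cdot>\<^bsub>C\<^esub> f = Idn C x \<and> f \<cdot>\<^bsub>C\<^esub> g = Idn C y)"

definition monic :: "('o, 'm, 'z) cat_scheme \<Rightarrow> 'o \<Rightarrow> 'o \<Rightarrow> 'm \<Rightarrow> bool" where
  "monic C x y f \<longleftrightarrow> f \<in> Hom C x y \<and>
     (\<forall>z\<in>Ob C. \<forall>g\<in>Hom C z x. \<forall>h\<in>Hom C z x. f \<cdot>\<^bsub>C\<^esub> g = f \<cdot>\<^bsub>C\<^esub> h \<longrightarrow> g = h)"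

definition epic :: "('o, 'm, 'z) cat_scheme \<Rightarrow> 'o \<Rightarrow> 'o \<Rightarrow> 'm \<Rightarrow> bool" where
  "epic C x y f \<longleftrightarrow> f \<in> Hom C x y \<and>
     (\<forall>z\<in>Ob C. \<forall>g\<in>Hom C y z. \<forall>h\<in>Hom C y z. g \<cdot>\<^bsub>C\<^esub> f = h \<cdot>\<^bsub>C\<^esub> f \<longrightarrow> g = h)"

definition zero_object :: "('o, 'm, 'z) cat_scheme \<Rightarrow> 'o \<Rightarrow> bool" where
  "zero_object C z \<longleftrightarrow> z \<in> Ob C \<and>
     (\<forall>x\<in>Ob C. (\<exists>!f. f \<in> Hom C z x) \<and> (\<exists>!f. f \<in> Hom C x z))"

definition zero_arrow :: "('o, 'm, 'z) cat_scheme \<Rightarrow> 'o \<Rightarrow> 'o \<Rightarrow> 'm" where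
  "zero_arrow C x y =
     (THE f. \<exists>z a b. zero_object C z \<and> a \<in> Hom C x z \<and> b \<in> Hom C z y \<and> f = b \<cdot>\<^bsub>C\<^esub> a)"

definition is_kernel :: "('o, 'm, 'z) cat_scheme \<Rightarrow> 'o \<Rightarrow> 'o \<Rightarrow> 'o \<Rightarrow> 'm \<Rightarrow> 'm \<Rightarrow> bool" where
  "is_kernel C k x y i f \<longleftrightarrow> k \<in> Ob C \<and> i \<in> Hom C k x \<and> f \<in> Hom C x y \<and>
     f \<cdot>\<^bsub>C\<^esub> i = zero_arrow C k y \<and>
     (\<forall>z\<in>Ob C. \<forall>g\<in>Hom C z x. f \<cdot>\<^bsub>C\<^esub> g = zero_arrow C z y \<longrightarrow>
        (\<exists>!h. h \<in> Hom C z k \<and> i \<cdot>\<^bsub>C\<^esub> h = g))"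

definition is_cokernel :: "('o, 'm, 'z) cat_scheme \<Rightarrow> 'o \<Rightarrow> 'o \<Rightarrow> 'o \<Rightarrow> 'm \<Rightarrow> 'm \<Rightarrow> bool" where
  "is_cokernel C x y q f p \<longleftrightarrow> q \<in> Ob C \<and> f \<in> Hom C x y \<and> p \<in> Hom C y q \<and>
     p \<cdot>\<^bsub>C\<^esub> f = zero_arrow C x q \<and>
     (\<forall>z\<in>Ob C. \<forall>g\<in>Hom C y z. g \<cdot>\<^bsub>C\<^esub> f = zero_arrow C x z \<longrightarrow>
        (\<exists>!h. h \<in> Hom C q z \<and> h \<cdot>\<^bsub>C\<^esub> p = g))"

definition is_coequalizer ::
  "('o, 'm, 'z) cat_scheme \<Rightarrow> 'o \<Rightarrow> 'o \<Rightarrow> 'm \<Rightarrow> 'm \<Rightarrow> 'o \<Rightarrow> 'm \<Rightarrow> bool" where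
  "is_coequalizer C x y f g q p \<longleftrightarrow> q \<in> Ob C \<and> p \<in> Hom C y q \<and> p \<cdot>\<^bsub>C\<^esub> f = p \<cdot>\<^bsub>C\<^esub> g \<and>
     (\<forall>z\<in>Ob C. \<forall>r\<in>Hom C y z. r \<cdot>\<^bsub>C\<^esub> f = r \<cdot>\<^bsub>C\<^esub> g \<longrightarrow> (\<exists>!h. h \<in> Hom C q z \<and> h \<cdot>\<^bsub>C\<^esub> p = r))"

definition is_product ::
  "('o, 'm, 'z) cat_scheme \<Rightarrow> 'i set \<Rightarrow> ('i \<Rightarrow> 'o) \<Rightarrow> 'o \<Rightarrow> ('i \<Rightarrow> 'm) \<Rightarrow> bool" where
  "is_product C I X P p \<longleftrightarrow> P \<in> Ob C \<and> (\<forall>i\<in>I. X i \<in> Ob C \<and> p i \<in> Hom C P (X i)) \<and>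
     (\<forall>Y\<in>Ob C. \<forall>g. (\<forall>i\<in>I. g i \<in> Hom C Y (X i)) \<longrightarrow>
        (\<exists>!h. h \<in> Hom C Y P \<and> (\<forall>i\<in>I. p i \<cdot>\<^bsub>C\<^esub> h = g i)))"

definition is_coproduct ::
  "('o, 'm, 'z) cat_scheme \<Rightarrow> 'i set \<Rightarrow> ('i \<Rightarrow> 'o) \<Rightarrow> 'o \<Rightarrow> ('i \<Rightarrow> 'm) \<Rightarrow> bool" where
  "is_coproduct C I X P j \<longleftrightarrow> P \<in> Ob C \<and> (\<forall>i\<in>I. X i \<in> Ob C \<and> j i \<in> Hom C (X i) P) \<and>
     (\<forall>Y\<in>Ob C. \<forall>g. (\<forall>i\<in>I. g i \<in> Hom C (X i) Y) \<longrightarrow>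
        (\<exists>!h. h \<in> Hom C P Y \<and> (\<forall>i\<in>I. h \<cdot>\<^bsub>C\<^esub> j i = g i)))"

definition is_pushout ::
  "('o, 'm, 'z) cat_scheme \<Rightarrow> 'o \<Rightarrow> 'o \<Rightarrow> 'o \<Rightarrow> 'm \<Rightarrow> 'm \<Rightarrow> 'o \<Rightarrow> 'm \<Rightarrow> 'm \<Rightarrow> bool" where
  "is_pushout C a x y f g P p q \<longleftrightarrow> P \<in> Ob C \<and> f \<in> Hom C a x \<and> g \<in> Hom C a y \<and>
     p \<in> Hom C x P \<and> q \<in> Hom C y P \<and> p \<cdot>\<^bsub>C\<^esub> f = q \<cdot>\<^bsub>C\<^esub> g \<and>
     (\<forall>Z\<in>Ob C. \<forall>r\<in>Hom C x Z. \<forall>s\<in>Hom C y Z. r \<cdot>\<^bsub>C\<^esub> f = s \<cdot>\<^bsub>C\<^esub> g \<longrightarrow>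
        (\<exists>!h. h \<in> Hom C P Z \<and> h \<cdot>\<^bsub>C\<^esub> p = r \<and> h \<cdot>\<^bsub>C\<^esub> q = s))"


subsection \<open>Functors, limits and colimits\<close>

definition is_functor ::
  "('i, 'a, 'y) cat_scheme \<Rightarrow> ('o, 'm, 'z) cat_scheme \<Rightarrow> ('i \<Rightarrow> 'o) \<Rightarrow> ('i \<Rightarrow> 'i \<Rightarrow> 'a \<Rightarrow> 'm) \<Rightarrow> bool" where
  "is_functor J D FO FM \<longleftrightarrow>
     (\<forall>i\<in>Ob J. FO i \<in> Ob D) \<and>
     (\<forall>i\<in>Ob J. \<forall>j\<in>Ob J. \<forall>u\<in>Hom J i j. FM i j u \<in> Hom D (FO i) (FO j)) \<and>
     (\<forall>i\<in>Ob J. FM i i (Idn J i) = Idn D (FO i)) \<and>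
     (\<forall>i\<in>Ob J. \<forall>j\<in>Ob J. \<forall>k\<in>Ob J. \<forall>u\<in>Hom J i j. \<forall>v\<in>Hom J j k.
        FM i k (v \<cdot>\<^bsub>J\<^esub> u) = FM j k v \<cdot>\<^bsub>D\<^esub> FM i j u)"

definition is_cocone ::
  "('i, 'a, 'y) cat_scheme \<Rightarrow> ('o, 'm, 'z) cat_scheme \<Rightarrow> ('i \<Rightarrow> 'o) \<Rightarrow> ('i \<Rightarrow> 'i \<Rightarrow> 'a \<Rightarrow> 'm)
     \<Rightarrow> 'o \<Rightarrow> ('i \<Rightarrow> 'm) \<Rightarrow> bool" where
  "is_cocone J D FO FM L c \<longleftrightarrow> L \<in> Ob D \<and> (\<forall>i\<in>Ob J. c i \<in> Hom D (FO i) L) \<and>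
     (\<forall>i\<in>Ob J. \<forall>j\<in>Ob J. \<forall>u\<in>Hom J i j. c j \<cdot>\<^bsub>D\<^esub> FM i j u = c i)"

definition is_colimit ::
  "('i, 'a, 'y) cat_scheme \<Rightarrow> ('o, 'm, 'z) cat_scheme \<Rightarrow> ('i \<Rightarrow> 'o) \<Rightarrow> ('i \<Rightarrow> 'i \<Rightarrow> 'a \<Rightarrow> 'm)
     \<Rightarrow> 'o \<Rightarrow> ('i \<Rightarrow> 'm) \<Rightarrow> bool" where
  "is_colimit J D FO FM L c \<longleftrightarrow> is_cocone J D FO FM L c \<and>
     (\<forall>M d. is_cocone J D FO FM M d \<longrightarrow>
        (\<exists>!h. h \<in> Hom D L M \<and> (\<forall>i\<in>Ob J. h \<cdot>\<^bsub>D\<^esub> c i = d i)))"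

definition is_cone ::
  "('i, 'a, 'y) cat_scheme \<Rightarrow> ('o, 'm, 'z) cat_scheme \<Rightarrow> ('i \<Rightarrow> 'o) \<Rightarrow> ('i \<Rightarrow> 'i \<Rightarrow> 'a \<Rightarrow> 'm)
     \<Rightarrow> 'o \<Rightarrow> ('i \<Rightarrow> 'm) \<Rightarrow> bool" where
  "is_cone J D FO FM L p \<longleftrightarrow> L \<in> Ob D \<and> (\<forall>i\<in>Ob J. p i \<in> Hom D L (FO i)) \<and>
     (\<forall>i\<in>Ob J. \<forall>j\<in>Ob J. \<forall>u\<in>Hom J i j. FM i j u \<cdot>\<^bsub>D\<^esub> p i = p j)"

definition is_limit ::
  "('i, 'a, 'y) cat_scheme \<Rightarrow> ('o, 'm, 'z) cat_scheme \<Rightarrow> ('i \<Rightarrow> 'o) \<Rightarrow> ('i \<Rightarrow> 'i \<Rightarrow> 'a \<Rightarrow> 'm)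
     \<Rightarrow> 'o \<Rightarrow> ('i \<Rightarrow> 'm) \<Rightarrow> bool" where
  "is_limit J D FO FM L p \<longleftrightarrow> is_cone J D FO FM L p \<and>
     (\<forall>M d. is_cone J D FO FM M d \<longrightarrow>
        (\<exists>!h. h \<in> Hom D M L \<and> (\<forall>i\<in>Ob J. p i \<cdot>\<^bsub>D\<^esub> h = d i)))"

definition prod_cat ::
  "('i, 'a, 'y) cat_scheme \<Rightarrow> ('k, 'b, 'z) cat_scheme \<Rightarrow> ('i \<times> 'k, 'a \<times> 'b) cat" where
  "prod_cat J K = \<lparr>Ob = Ob J \<times> Ob K,
     Hom = (\<lambda>x y. Hom J (fst x) (fst y) \<times> Hom K (snd x) (snd y)),
     Idn = (\<lambda>x. (Idn J (fst x), Idn K (snd x))),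
     Comp = (\<lambda>g f. (fst g \<cdot>\<^bsub>J\<^esub> fst f, snd g \<cdot>\<^bsub>K\<^esub> snd f))\<rparr>"

definition is_filtered :: "('i, 'a, 'z) cat_scheme \<Rightarrow> bool" where
  "is_filtered J \<longleftrightarrow> Ob J \<noteq> {} \<and>
     (\<forall>i\<in>Ob J. \<forall>j\<in>Ob J. \<exists>k\<in>Ob J. Hom J i k \<noteq> {} \<and> Hom J j k \<noteq> {}) \<and>
     (\<forall>i\<in>Ob J. \<forall>j\<in>Ob J. \<forall>u\<in>Hom J i j. \<forall>v\<in>Hom J i j.
        \<exists>k\<in>Ob J. \<exists>w\<in>Hom J j k. w \<cdot>\<^bsub>J\<^esub> u = w \<cdot>\<^bsub>J\<^esub> v)"

text \<open>
  The universe is represented by an infinite set \<open>U\<close>: a set is small if its cardinality is strictly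
  less than that of \<open>U\<close>. If \<open>U\<close> has inaccessible cardinality, these are, up to bijection, the elements
  of a Grothendieck universe. Small index sets and index categories are taken inside the type of
  the elements of \<open>U\<close>, where all of them occur up to isomorphism.
\<close>

definition small_set :: "'u set \<Rightarrow> 'u set \<Rightarrow> bool" where
  "small_set U I \<longleftrightarrow> I \<prec> U"

definition small_cat :: "'u set \<Rightarrow> ('u, 'u) cat \<Rightarrow> bool" where
  "small_cat U J \<longleftrightarrow> category J \<and> small_set U (Ob J) \<and> small_set U (Arr J)"

definition has_small_colimits :: "'u set \<Rightarrow> ('o, 'm, 'z) cat_scheme \<Rightarrow> bool" where
  "has_small_colimits U D \<longleftrightarrow>
     (\<forall>(J :: ('u, 'u) cat) FO FM. small_cat U J \<and> is_functor J D FO FM \<longrightarrow>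
        (\<exists>L c. is_colimit J D FO FM L c))"

text \<open>
  \<open>Hom(P, -)\<close> preserves the colimit \<open>(L, c)\<close>: the map from the colimit of the sets \<open>Hom(P, F i)\<close>,
  i.e. from the quotient of their disjoint union by the equivalence relation generated by the
  transition maps, to \<open>Hom(P, L)\<close> is bijective.
\<close>

definition hom_preserves_colimit ::
  "('i, 'a, 'y) cat_scheme \<Rightarrow> ('o, 'm, 'z) cat_scheme \<Rightarrow> ('i \<Rightarrow> 'o) \<Rightarrow> ('i \<Rightarrow> 'i \<Rightarrow> 'a \<Rightarrow> 'm)
     \<Rightarrow> 'o \<Rightarrow> ('i \<Rightarrow> 'm) \<Rightarrow> 'o \<Rightarrow> bool" where
  "hom_preserves_colimit J D FO FM L c P \<longleftrightarrow>
     (\<forall>f\<in>Hom D P L. \<exists>i\<in>Ob J. \<exists>g\<in>Hom D P (FO i). c i \<cdot>\<^bsub>D\<^esub> g = f) \<and>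
     (\<forall>i\<in>Ob J. \<forall>j\<in>Ob J. \<forall>g\<in>Hom D P (FO i). \<forall>h\<in>Hom D P (FO j).
        c i \<cdot>\<^bsub>D\<^esub> g = c j \<cdot>\<^bsub>D\<^esub> h \<longrightarrow>
        equivclp (\<lambda>(i, g) (j, h). i \<in> Ob J \<and> j \<in> Ob J \<and> g \<in> Hom D P (FO i) \<and>
                   (\<exists>u\<in>Hom J i j. h = FM i j u \<cdot>\<^bsub>D\<^esub> g)) (i, g) (j, h))"

text \<open>
  Filtered colimits commute with finite limits: for \<open>F : J \<times> K \<rightarrow> D\<close>, with colimits \<open>CO k\<close> of
  \<open>F(-, k)\<close> and limits \<open>LO j\<close> of \<open>F(j, -)\<close>, the limit \<open>L\<close> of \<open>CO\<close> is, via the comparison maps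
  \<open>t j : LO j \<rightarrow> L\<close>, a colimit of \<open>LO\<close>; i.e. the canonical map
  \<open>colim lim F \<rightarrow> lim colim F\<close> is an isomorphism. Every finite category is isomorphic
  to one whose objects and arrows are natural numbers.
\<close>

definition filtered_colimits_commute_with_finite_limits ::
  "'u set \<Rightarrow> ('o, 'm, 'z) cat_scheme \<Rightarrow> bool" where
  "filtered_colimits_commute_with_finite_limits U D \<longleftrightarrow>
     (\<forall>(J :: ('u, 'u) cat) (K :: (nat, nat) cat) FO FM CO CM c LO LM p L q t.
        small_cat U J \<and> is_filtered J \<and> category K \<and> finite (Ob K) \<and> finite (Arr K) \<and>
        is_functor (prod_cat J K) D FO FM \<and>
        is_functor K D CO CM \<and>
        (\<forall>k\<in>Ob K. is_colimit J D (\<lambda>j. FO (j, k)) (\<lambda>j j' u. FM (j, k) (j', k) (u, Idn K k))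
                     (CO k) (\<lambda>j. c j k)) \<and>
        (\<forall>j\<in>Ob J. \<forall>k\<in>Ob K. \<forall>k'\<in>Ob K. \<forall>v\<in>Hom K k k'.
           CM k k' v \<cdot>\<^bsub>D\<^esub> c j k = c j k' \<cdot>\<^bsub>D\<^esub> FM (j, k) (j, k') (Idn J j, v)) \<and>
        is_functor J D LO LM \<and>
        (\<forall>j\<in>Ob J. is_limit K D (\<lambda>k. FO (j, k)) (\<lambda>k k' v. FM (j, k) (j, k') (Idn J j, v))
                     (LO j) (\<lambda>k. p j k)) \<and>
        (\<forall>k\<in>Ob K. \<forall>j\<in>Ob J. \<forall>j'\<in>Ob J. \<forall>u\<in>Hom J j j'.
           p j' k \<cdot>\<^bsub>D\<^esub> LM j j' u = FM (j, k) (j', k) (u, Idn K k) \<cdot>\<^bsub>D\<^esub> p j k) \<and>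
        is_limit K D CO CM L q \<and>
        (\<forall>j\<in>Ob J. t j \<in> Hom D (LO j) L \<and> (\<forall>k\<in>Ob K. q k \<cdot>\<^bsub>D\<^esub> t j = c j k \<cdot>\<^bsub>D\<^esub> p j k))
        \<longrightarrow> is_colimit J D LO LM L t)"


section \<open>Abelian closed symmetric monoidal categories\<close>

record ('o, 'm) smcat = "('o, 'm) cat" +
  Add :: "'m \<Rightarrow> 'm \<Rightarrow> 'm"
  TensO :: "'o \<Rightarrow> 'o \<Rightarrow> 'o"  (infixr "\<boxtimes>\<index>" 80)
  TensM :: "'m \<Rightarrow> 'm \<Rightarrow> 'm"  (infixr "\<star>\<index>" 80)
  TUnit :: "'o"
  Assoc :: "'o \<Rightarrow> 'o \<Rightarrow> 'o \<Rightarrow> 'm"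
  LUnit :: "'o \<Rightarrow> 'm"
  RUnit :: "'o \<Rightarrow> 'm"
  Braid :: "'o \<Rightarrow> 'o \<Rightarrow> 'm"

locale abelian_category = category C for C :: "('o, 'm, 'z) smcat_scheme" (structure) +
  assumes hom_group: "\<lbrakk>x \<in> Ob C; y \<in> Ob C\<rbrakk>
      \<Longrightarrow> \<exists>n. comm_group \<lparr>carrier = Hom C x y, mult = Add C, one = n\<rparr>"
    and comp_add_left: "\<lbrakk>x \<in> Ob C; y \<in> Ob C; z \<in> Ob C;
        f \<in> Hom C x y; g \<in> Hom C y z; h \<in> Hom C y z\<rbrakk>
      \<Longrightarrow> Add C g h \<cdot> f = Add C (g \<cdot> f) (h \<cdot> f)"
    and comp_add_right: "\<lbrakk>x \<in> Ob C; y \<in> Ob C; z \<in> Ob C;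
        f \<in> Hom C x y; g \<in> Hom C x y; h \<in> Hom C y z\<rbrakk>
      \<Longrightarrow> h \<cdot> Add C f g = Add C (h \<cdot> f) (h \<cdot> g)"
    and ex_zero_object: "\<exists>z. zero_object C z"
    and ex_binary_product: "\<lbrakk>x \<in> Ob C; y \<in> Ob C\<rbrakk>
      \<Longrightarrow> \<exists>P p. is_product C (UNIV :: bool set) (\<lambda>b. if b then x else y) P p"
    and ex_binary_coproduct: "\<lbrakk>x \<in> Ob C; y \<in> Ob C\<rbrakk>
      \<Longrightarrow> \<exists>P j. is_coproduct C (UNIV :: bool set) (\<lambda>b. if b then x else y) P j"
    and ex_kernel: "\<lbrakk>x \<in> Ob C; y \<in> Ob C; f \<in> Hom C x y\<rbrakk> \<Longrightarrow> \<exists>k i. is_kernel C k x y i f"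
    and ex_cokernel: "\<lbrakk>x \<in> Ob C; y \<in> Ob C; f \<in> Hom C x y\<rbrakk> \<Longrightarrow> \<exists>q p. is_cokernel C x y q f p"
    and monic_normal: "\<lbrakk>x \<in> Ob C; y \<in> Ob C; monic C x y i\<rbrakk>
      \<Longrightarrow> \<exists>z\<in>Ob C. \<exists>f. is_kernel C x y z i f"
    and epic_normal: "\<lbrakk>x \<in> Ob C; y \<in> Ob C; epic C x y p\<rbrakk>
      \<Longrightarrow> \<exists>z\<in>Ob C. \<exists>f. is_cokernel C z x y f p"

locale closed_symmetric_monoidal_category =
  category C for C :: "('o, 'm, 'z) smcat_scheme" (structure) +
  assumes tens_ob: "\<lbrakk>x \<in> Ob C; y \<in> Ob C\<rbrakk> \<Longrightarrow> x \<boxtimes> y \<in> Ob C"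
    and unit_ob: "TUnit C \<in> Ob C"
    and tens_in_hom: "\<lbrakk>x \<in> Ob C; x' \<in> Ob C; y \<in> Ob C; y' \<in> Ob C;
        f \<in> Hom C x x'; g \<in> Hom C y y'\<rbrakk> \<Longrightarrow> f \<star> g \<in> Hom C (x \<boxtimes> y) (x' \<boxtimes> y')"
    and tens_id: "\<lbrakk>x \<in> Ob C; y \<in> Ob C\<rbrakk> \<Longrightarrow> Idn C x \<star> Idn C y = Idn C (x \<boxtimes> y)"
    and tens_comp: "\<lbrakk>x \<in> Ob C; x' \<in> Ob C; x'' \<in> Ob C; y \<in> Ob C; y' \<in> Ob C; y'' \<in> Ob C;
        f \<in> Hom C x x'; f' \<in> Hom C x' x''; g \<in> Hom C y y'; g' \<in> Hom C y' y''\<rbrakk>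
      \<Longrightarrow> (f' \<cdot> f) \<star> (g' \<cdot> g) = (f' \<star> g') \<cdot> (f \<star> g)"
    and assoc_iso: "\<lbrakk>x \<in> Ob C; y \<in> Ob C; z \<in> Ob C\<rbrakk>
      \<Longrightarrow> is_iso C ((x \<boxtimes> y) \<boxtimes> z) (x \<boxtimes> (y \<boxtimes> z)) (Assoc C x y z)"
    and assoc_natural: "\<lbrakk>x \<in> Ob C; x' \<in> Ob C; y \<in> Ob C; y' \<in> Ob C; z \<in> Ob C; z' \<in> Ob C;
        f \<in> Hom C x x'; g \<in> Hom C y y'; h \<in> Hom C z z'\<rbrakk>
      \<Longrightarrow> Assoc C x' y' z' \<cdot> ((f \<star> g) \<star> h) = (f \<star> (g \<star> h)) \<cdot> Assoc C x y z"
    and lunit_iso: "x \<in> Ob C \<Longrightarrow> is_iso C (TUnit C \<boxtimes> x) x (LUnit C x)"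
    and lunit_natural: "\<lbrakk>x \<in> Ob C; x' \<in> Ob C; f \<in> Hom C x x'\<rbrakk>
      \<Longrightarrow> LUnit C x' \<cdot> (Idn C (TUnit C) \<star> f) = f \<cdot> LUnit C x"
    and runit_iso: "x \<in> Ob C \<Longrightarrow> is_iso C (x \<boxtimes> TUnit C) x (RUnit C x)"
    and runit_natural: "\<lbrakk>x \<in> Ob C; x' \<in> Ob C; f \<in> Hom C x x'\<rbrakk>
      \<Longrightarrow> RUnit C x' \<cdot> (f \<star> Idn C (TUnit C)) = f \<cdot> RUnit C x"
    and pentagon: "\<lbrakk>w \<in> Ob C; x \<in> Ob C; y \<in> Ob C; z \<in> Ob C\<rbrakk>
      \<Longrightarrow> Assoc C w x (y \<boxtimes> z) \<cdot> Assoc C (w \<boxtimes> x) y z =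
          (Idn C w \<star> Assoc C x y z) \<cdot> (Assoc C w (x \<boxtimes> y) z \<cdot> (Assoc C w x y \<star> Idn C z))"
    and triangle: "\<lbrakk>x \<in> Ob C; y \<in> Ob C\<rbrakk>
      \<Longrightarrow> (Idn C x \<star> LUnit C y) \<cdot> Assoc C x (TUnit C) y = RUnit C x \<star> Idn C y"
    and braid_in_hom: "\<lbrakk>x \<in> Ob C; y \<in> Ob C\<rbrakk> \<Longrightarrow> Braid C x y \<in> Hom C (x \<boxtimes> y) (y \<boxtimes> x)"
    and braid_natural: "\<lbrakk>x \<in> Ob C; x' \<in> Ob C; y \<in> Ob C; y' \<in> Ob C;
        f \<in> Hom C x x'; g \<in> Hom C y y'\<rbrakk>
      \<Longrightarrow> Braid C x' y' \<cdot> (f \<star> g) = (g \<star> f) \<cdot> Braid C x y"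
    and braid_symmetric: "\<lbrakk>x \<in> Ob C; y \<in> Ob C\<rbrakk>
      \<Longrightarrow> Braid C y x \<cdot> Braid C x y = Idn C (x \<boxtimes> y)"
    and hexagon: "\<lbrakk>x \<in> Ob C; y \<in> Ob C; z \<in> Ob C\<rbrakk>
      \<Longrightarrow> Assoc C y z x \<cdot> (Braid C x (y \<boxtimes> z) \<cdot> Assoc C x y z) =
          (Idn C y \<star> Braid C x z) \<cdot> (Assoc C y x z \<cdot> (Braid C x y \<star> Idn C z))"
    and closed: "\<lbrakk>y \<in> Ob C; z \<in> Ob C\<rbrakk>
      \<Longrightarrow> \<exists>H\<in>Ob C. \<exists>ev\<in>Hom C (H \<boxtimes> y) z. \<forall>x\<in>Ob C. \<forall>f\<in>Hom C (x \<boxtimes> y) z.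
            \<exists>!g. g \<in> Hom C x H \<and> ev \<cdot> (g \<star> Idn C y) = f"


section \<open>Commutative monoids and modules\<close>

record ('o, 'm) mon =
  mon_ob :: 'o
  mon_mul :: 'm
  mon_unit :: 'm

definition comm_monoid_object :: "('o, 'm, 'z) smcat_scheme \<Rightarrow> ('o, 'm) mon \<Rightarrow> bool" where
  "comm_monoid_object C A \<longleftrightarrow>
     (let a = mon_ob A; \<mu> = mon_mul A; \<eta> = mon_unit A in
      a \<in> Ob C \<and> \<mu> \<in> Hom C (a \<boxtimes>\<^bsub>C\<^esub> a) a \<and> \<eta> \<in> Hom C (TUnit C) a \<and>
      \<mu> \<cdot>\<^bsub>C\<^esub> (\<mu> \<star>\<^bsub>C\<^esub> Idn C a) = \<mu> \<cdot>\<^bsub>C\<^esub> ((Idn C a \<star>\<^bsub>C\<^esub> \<mu>) \<cdot>\<^bsub>C\<^esub> Assoc C a a a) \<and>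
      \<mu> \<cdot>\<^bsub>C\<^esub> (\<eta> \<star>\<^bsub>C\<^esub> Idn C a) = LUnit C a \<and>
      \<mu> \<cdot>\<^bsub>C\<^esub> (Idn C a \<star>\<^bsub>C\<^esub> \<eta>) = RUnit C a \<and>
      \<mu> \<cdot>\<^bsub>C\<^esub> Braid C a a = \<mu>)"

definition CommMon :: "('o, 'm, 'z) smcat_scheme \<Rightarrow> (('o, 'm) mon, 'm) cat" where
  "CommMon C = \<lparr>Ob = {A. comm_monoid_object C A},
     Hom = (\<lambda>A B. {f \<in> Hom C (mon_ob A) (mon_ob B).
                f \<cdot>\<^bsub>C\<^esub> mon_mul A = mon_mul B \<cdot>\<^bsub>C\<^esub> (f \<star>\<^bsub>C\<^esub> f) \<and>
                f \<cdot>\<^bsub>C\<^esub> mon_unit A = mon_unit B}),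
     Idn = (\<lambda>A. Idn C (mon_ob A)),
     Comp = Comp C\<rparr>"

record ('o, 'm) mdl =
  mdl_ob :: 'o
  mdl_act :: 'm

definition module_object ::
  "('o, 'm, 'z) smcat_scheme \<Rightarrow> ('o, 'm) mon \<Rightarrow> ('o, 'm) mdl \<Rightarrow> bool" where
  "module_object C A M \<longleftrightarrow>
     (let a = mon_ob A; m = mdl_ob M; r = mdl_act M in
      m \<in> Ob C \<and> r \<in> Hom C (a \<boxtimes>\<^bsub>C\<^esub> m) m \<and>
      r \<cdot>\<^bsub>C\<^esub> (mon_mul A \<star>\<^bsub>C\<^esub> Idn C m) = r \<cdot>\<^bsub>C\<^esub> ((Idn C a \<star>\<^bsub>C\<^esub> r) \<cdot>\<^bsub>C\<^esub> Assoc C a a m) \<and>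
      r \<cdot>\<^bsub>C\<^esub> (mon_unit A \<star>\<^bsub>C\<^esub> Idn C m) = LUnit C m)"

definition Mod :: "('o, 'm, 'z) smcat_scheme \<Rightarrow> ('o, 'm) mon \<Rightarrow> (('o, 'm) mdl, 'm) cat" where
  "Mod C A = \<lparr>Ob = {M. module_object C A M},
     Hom = (\<lambda>M N. {f \<in> Hom C (mdl_ob M) (mdl_ob N).
                f \<cdot>\<^bsub>C\<^esub> mdl_act M = mdl_act N \<cdot>\<^bsub>C\<^esub> (Idn C (mon_ob A) \<star>\<^bsub>C\<^esub> f)}),
     Idn = (\<lambda>M. Idn C (mdl_ob M)),
     Comp = Comp C\<rparr>"

definition self_mdl :: "('o, 'm) mon \<Rightarrow> ('o, 'm) mdl" where
  "self_mdl A = \<lparr>mdl_ob = mon_ob A, mdl_act = mon_mul A\<rparr>"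

definition End_ring :: "('o, 'm, 'z) smcat_scheme \<Rightarrow> ('o, 'm) mon \<Rightarrow> 'm ring" where
  "End_ring C A = \<lparr>carrier = Hom (Mod C A) (self_mdl A) (self_mdl A),
     mult = Comp C, one = Idn C (mon_ob A),
     zero = zero_arrow (Mod C A) (self_mdl A) (self_mdl A), add = Add C\<rparr>"

definition integral_monoid :: "('o, 'm, 'z) smcat_scheme \<Rightarrow> ('o, 'm) mon \<Rightarrow> bool" where
  "integral_monoid C A \<longleftrightarrow> domain (End_ring C A)"

definition zero_monoid :: "('o, 'm, 'z) smcat_scheme \<Rightarrow> ('o, 'm) mon \<Rightarrow> bool" where
  "zero_monoid C A \<longleftrightarrow> A \<in> Ob (CommMon C) \<and> zero_object C (mon_ob A)"

definition fin_gen ::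
  "'u set \<Rightarrow> ('o, 'm, 'z) smcat_scheme \<Rightarrow> ('o, 'm) mon \<Rightarrow> ('o, 'm) mdl \<Rightarrow> bool" where
  "fin_gen U C A M \<longleftrightarrow> M \<in> Ob (Mod C A) \<and>
     (\<forall>(J :: ('u, 'u) cat) FO FM L c.
        small_cat U J \<and> is_filtered J \<and> is_functor J (Mod C A) FO FM \<and>
        (\<forall>i\<in>Ob J. \<forall>j\<in>Ob J. \<forall>u\<in>Hom J i j. monic (Mod C A) (FO i) (FO j) (FM i j u)) \<and>
        is_colimit J (Mod C A) FO FM L c
        \<longrightarrow> hom_preserves_colimit J (Mod C A) FO FM L c M)"

definition fin_pres ::
  "('o, 'm, 'z) smcat_scheme \<Rightarrow> ('o, 'm) mon \<Rightarrow> ('o, 'm) mdl \<Rightarrow> bool" where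
  "fin_pres C A M \<longleftrightarrow>
     (\<exists>(m :: nat) (n :: nat) F i G j q p.
        is_coproduct (Mod C A) {..<m} (\<lambda>_. self_mdl A) F i \<and>
        is_coproduct (Mod C A) {..<n} (\<lambda>_. self_mdl A) G j \<and>
        is_cokernel (Mod C A) F G M q p)"

definition noetherian_monoid ::
  "'u set \<Rightarrow> ('o, 'm, 'z) smcat_scheme \<Rightarrow> ('o, 'm) mon \<Rightarrow> bool" where
  "noetherian_monoid U C A \<longleftrightarrow> (\<forall>M\<in>Ob (Mod C A). fin_gen U C A M \<longleftrightarrow> fin_pres C A M)"

definition fin_gen_submodules ::
  "'u set \<Rightarrow> ('o, 'm, 'z) smcat_scheme \<Rightarrow> ('o, 'm) mon \<Rightarrow> ('o, 'm) mdl
     \<Rightarrow> (('o, 'm) mdl \<times> 'm, 'm) cat" where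
  "fin_gen_submodules U C A M = \<lparr>Ob = {(N, i). fin_gen U C A N \<and> monic (Mod C A) N M i},
     Hom = (\<lambda>x y. {h \<in> Hom (Mod C A) (fst x) (fst y). snd y \<cdot>\<^bsub>C\<^esub> h = snd x}),
     Idn = (\<lambda>x. Idn C (mdl_ob (fst x))),
     Comp = Comp C\<rparr>"

definition locally_finitely_generated :: "'u set \<Rightarrow> ('o, 'm, 'z) smcat_scheme \<Rightarrow> bool" where
  "locally_finitely_generated U C \<longleftrightarrow>
     (\<forall>A\<in>Ob (CommMon C). \<forall>M\<in>Ob (Mod C A).
        is_filtered (fin_gen_submodules U C A M) \<and>
        is_colimit (fin_gen_submodules U C A M) (Mod C A) fst (\<lambda>_ _ h. h) M snd)"


section \<open>Extension of scalars and flatness\<close>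

text \<open>
  \<open>M \<otimes>\<^sub>A N\<close> is the coequalizer of the two maps \<open>(M \<otimes> A) \<otimes> N \<rightarrow> M \<otimes> N\<close> given by the
  actions on \<open>M\<close> (turned into a right action by the symmetry) and on \<open>N\<close>. A coequalizer is chosen.
\<close>

definition tens_over ::
  "('o, 'm, 'z) smcat_scheme \<Rightarrow> ('o, 'm) mon \<Rightarrow> ('o, 'm) mdl \<Rightarrow> ('o, 'm) mdl \<Rightarrow> 'o \<times> 'm" where
  "tens_over C A M N =
     (let a = mon_ob A; m = mdl_ob M; n = mdl_ob N in
      SOME Q. is_coequalizer C ((m \<boxtimes>\<^bsub>C\<^esub> a) \<boxtimes>\<^bsub>C\<^esub> n) (m \<boxtimes>\<^bsub>C\<^esub> n)
        ((mdl_act M \<cdot>\<^bsub>C\<^esub> Braid C m a) \<star>\<^bsub>C\<^esub> Idn C n)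
        ((Idn C m \<star>\<^bsub>C\<^esub> mdl_act N) \<cdot>\<^bsub>C\<^esub> Assoc C m a n)
        (fst Q) (snd Q))"

text \<open>\<open>B\<close> as an \<open>A\<close>-module along \<open>f : A \<rightarrow> B\<close>.\<close>

definition restr_mdl ::
  "('o, 'm, 'z) smcat_scheme \<Rightarrow> ('o, 'm) mon \<Rightarrow> 'm \<Rightarrow> ('o, 'm) mdl" where
  "restr_mdl C B f = \<lparr>mdl_ob = mon_ob B, mdl_act = mon_mul B \<cdot>\<^bsub>C\<^esub> (f \<star>\<^bsub>C\<^esub> Idn C (mon_ob B))\<rparr>"

text \<open>
  \<open>M \<otimes>\<^sub>A B\<close> with the \<open>B\<close>-action induced by
  \<open>B \<otimes> (M \<otimes> B) \<rightarrow> (M \<otimes> B) \<otimes> B \<rightarrow> M \<otimes> (B \<otimes> B) \<rightarrow> M \<otimes> B\<close>.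
\<close>

definition ext_ob ::
  "('o, 'm, 'z) smcat_scheme \<Rightarrow> ('o, 'm) mon \<Rightarrow> ('o, 'm) mon \<Rightarrow> 'm
     \<Rightarrow> ('o, 'm) mdl \<Rightarrow> ('o, 'm) mdl" where
  "ext_ob C A B f M =
     (let b = mon_ob B; m = mdl_ob M;
          Q = fst (tens_over C A M (restr_mdl C B f));
          q = snd (tens_over C A M (restr_mdl C B f))
      in \<lparr>mdl_ob = Q,
          mdl_act = (THE r. r \<in> Hom C (b \<boxtimes>\<^bsub>C\<^esub> Q) Q \<and>
             r \<cdot>\<^bsub>C\<^esub> (Idn C b \<star>\<^bsub>C\<^esub> q) =
             q \<cdot>\<^bsub>C\<^esub> ((Idn C m \<star>\<^bsub>C\<^esub> mon_mul B) \<cdot>\<^bsub>C\<^esub> (Assoc C m b b \<cdot>\<^bsub>C\<^esub> Braid C b (m \<boxtimes>\<^bsub>C\<^esub> b))))\<rparr>)"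

definition ext_mor ::
  "('o, 'm, 'z) smcat_scheme \<Rightarrow> ('o, 'm) mon \<Rightarrow> ('o, 'm) mon \<Rightarrow> 'm
     \<Rightarrow> ('o, 'm) mdl \<Rightarrow> ('o, 'm) mdl \<Rightarrow> 'm \<Rightarrow> 'm" where
  "ext_mor C A B f M N g =
     (THE h. h \<in> Hom C (fst (tens_over C A M (restr_mdl C B f))) (fst (tens_over C A N (restr_mdl C B f))) \<and>
        h \<cdot>\<^bsub>C\<^esub> snd (tens_over C A M (restr_mdl C B f)) =
        snd (tens_over C A N (restr_mdl C B f)) \<cdot>\<^bsub>C\<^esub> (g \<star>\<^bsub>C\<^esub> Idn C (mon_ob B)))"

definition short_exact ::
  "('o, 'm, 'z) cat_scheme \<Rightarrow> 'o \<Rightarrow> 'o \<Rightarrow> 'o \<Rightarrow> 'm \<Rightarrow> 'm \<Rightarrow> bool" where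
  "short_exact D x y z f g \<longleftrightarrow> is_kernel D x y z f g \<and> is_cokernel D x y z f g"

definition exact_functor ::
  "('i, 'a, 'y) cat_scheme \<Rightarrow> ('o, 'm, 'z) cat_scheme \<Rightarrow> ('i \<Rightarrow> 'o) \<Rightarrow> ('i \<Rightarrow> 'i \<Rightarrow> 'a \<Rightarrow> 'm) \<Rightarrow> bool" where
  "exact_functor D E FO FM \<longleftrightarrow>
     (\<forall>x\<in>Ob D. \<forall>y\<in>Ob D. \<forall>z\<in>Ob D. \<forall>f g. short_exact D x y z f g \<longrightarrow>
        short_exact E (FO x) (FO y) (FO z) (FM x y f) (FM y z g))"

definition flat ::
  "('o, 'm, 'z) smcat_scheme \<Rightarrow> ('o, 'm) mon \<Rightarrow> ('o, 'm) mon \<Rightarrow> 'm \<Rightarrow> bool" where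
  "flat C A B f \<longleftrightarrow> exact_functor (Mod C A) (Mod C B) (ext_ob C A B f) (ext_mor C A B f)"


section \<open>The Zariski topology\<close>

text \<open>Commutative \<open>A\<close>-algebras are objects of the coslice category of \<open>A\<close> in \<open>Comm(C)\<close>.\<close>

definition CommAlg ::
  "('o, 'm, 'z) smcat_scheme \<Rightarrow> ('o, 'm) mon \<Rightarrow> (('o, 'm) mon \<times> 'm, 'm) cat" where
  "CommAlg C A = \<lparr>Ob = {(B, f). B \<in> Ob (CommMon C) \<and> f \<in> Hom (CommMon C) A B},
     Hom = (\<lambda>x y. {g \<in> Hom (CommMon C) (fst x) (fst y). g \<cdot>\<^bsub>C\<^esub> snd x = snd y}),
     Idn = (\<lambda>x. Idn C (mon_ob (fst x))),
     Comp = Comp C\<rparr>"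

definition fin_pres_alg ::
  "'u set \<Rightarrow> ('o, 'm, 'z) smcat_scheme \<Rightarrow> ('o, 'm) mon \<Rightarrow> ('o, 'm) mon \<Rightarrow> 'm \<Rightarrow> bool" where
  "fin_pres_alg U C A B f \<longleftrightarrow>
     (\<forall>(J :: ('u, 'u) cat) FO FM L c.
        small_cat U J \<and> is_filtered J \<and> is_functor J (CommAlg C A) FO FM \<and>
        is_colimit J (CommAlg C A) FO FM L c
        \<longrightarrow> hom_preserves_colimit J (CommAlg C A) FO FM L c (B, f))"

text \<open>Throughout, \<open>Spec(B) \<rightarrow> Spec(A)\<close> is represented by the monoid morphism \<open>A \<rightarrow> B\<close>.\<close>

definition aff_zariski_open ::
  "'u set \<Rightarrow> ('o, 'm, 'z) smcat_scheme \<Rightarrow> ('o, 'm) mon \<Rightarrow> ('o, 'm) mon \<Rightarrow> 'm \<Rightarrow> bool" where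
  "aff_zariski_open U C A B f \<longleftrightarrow> A \<in> Ob (CommMon C) \<and> B \<in> Ob (CommMon C) \<and>
     epic (CommMon C) A B f \<and> flat C A B f \<and> fin_pres_alg U C A B f"

definition jointly_conservative ::
  "('o, 'm, 'z) smcat_scheme \<Rightarrow> ('o, 'm) mon \<Rightarrow> 'i set \<Rightarrow> ('i \<Rightarrow> ('o, 'm) mon) \<Rightarrow> ('i \<Rightarrow> 'm) \<Rightarrow> bool" where
  "jointly_conservative C A J As fs \<longleftrightarrow>
     (\<forall>M\<in>Ob (Mod C A). \<forall>N\<in>Ob (Mod C A). \<forall>g\<in>Hom (Mod C A) M N.
        (\<forall>j\<in>J. is_iso (Mod C (As j)) (ext_ob C A (As j) (fs j) M) (ext_ob C A (As j) (fs j) N)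
                  (ext_mor C A (As j) (fs j) M N g))
        \<longrightarrow> is_iso (Mod C A) M N g)"

text \<open>The family may be empty; the empty family covers \<open>Spec(A)\<close> iff \<open>A = 0\<close>.\<close>

definition zariski_cover ::
  "'u set \<Rightarrow> ('o, 'm, 'z) smcat_scheme \<Rightarrow> ('o, 'm) mon \<Rightarrow> 'u set
     \<Rightarrow> ('u \<Rightarrow> ('o, 'm) mon) \<Rightarrow> ('u \<Rightarrow> 'm) \<Rightarrow> bool" where
  "zariski_cover U C A I As fs \<longleftrightarrow> A \<in> Ob (CommMon C) \<and> small_set U I \<and>
     (\<forall>i\<in>I. aff_zariski_open U C A (As i) (fs i)) \<and>
     (\<exists>J\<subseteq>I. finite J \<and> jointly_conservative C A J As fs)"


section \<open>Sheaves\<close>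

text \<open>
  A presheaf on \<open>Aff\<^sub>C = Comm(C)\<^sup>o\<^sup>p\<close> is a covariant functor on \<open>Comm(C)\<close>; its sections are elements of
  an arbitrary type \<open>'x\<close>, and \<open>res F A B f : F(A) \<rightarrow> F(B)\<close> for \<open>f : A \<rightarrow> B\<close>. Morphisms between
  presheaves with different section types are allowed; in particular \<open>Spec(A)\<close> has
  sections of type \<open>'m\<close>.
\<close>

record ('o, 'm, 'x) presheaf =
  sec :: "('o, 'm) mon \<Rightarrow> 'x set"
  res :: "('o, 'm) mon \<Rightarrow> ('o, 'm) mon \<Rightarrow> 'm \<Rightarrow> 'x \<Rightarrow> 'x"

definition is_presheaf :: "('o, 'm, 'z) smcat_scheme \<Rightarrow> ('o, 'm, 'x) presheaf \<Rightarrow> bool" where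
  "is_presheaf C F \<longleftrightarrow>
     (\<forall>A\<in>Ob (CommMon C). \<forall>B\<in>Ob (CommMon C). \<forall>f\<in>Hom (CommMon C) A B. \<forall>s\<in>sec F A.
        res F A B f s \<in> sec F B) \<and>
     (\<forall>A\<in>Ob (CommMon C). \<forall>s\<in>sec F A. res F A A (Idn (CommMon C) A) s = s) \<and>
     (\<forall>A\<in>Ob (CommMon C). \<forall>B\<in>Ob (CommMon C). \<forall>D\<in>Ob (CommMon C).
      \<forall>f\<in>Hom (CommMon C) A B. \<forall>g\<in>Hom (CommMon C) B D. \<forall>s\<in>sec F A.
        res F A D (g \<cdot>\<^bsub>C\<^esub> f) s = res F B D g (res F A B f s))"

text \<open>
  The fibre product \<open>Spec(A\<^sub>i) \<times>\<^bsub>Spec(A)\<^esub> Spec(A\<^sub>j)\<close> in \<open>Aff\<^sub>C\<close> is a pushout \<open>P\<close> in \<open>Comm(C)\<close>.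
\<close>

definition is_sheaf ::
  "'u set \<Rightarrow> ('o, 'm, 'z) smcat_scheme \<Rightarrow> ('o, 'm, 'x) presheaf \<Rightarrow> bool" where
  "is_sheaf U C F \<longleftrightarrow> is_presheaf C F \<and>
     (\<forall>A I As fs s.
        zariski_cover U C A I As fs \<and>
        (\<forall>i\<in>I. s i \<in> sec F (As i)) \<and>
        (\<forall>i\<in>I. \<forall>j\<in>I. \<forall>P p q. is_pushout (CommMon C) A (As i) (As j) (fs i) (fs j) P p q \<longrightarrow>
           res F (As i) P p (s i) = res F (As j) P q (s j))
        \<longrightarrow> (\<exists>!t. t \<in> sec F A \<and> (\<forall>i\<in>I. res F A (As i) (fs i) t = s i)))"

definition psh_mor ::
  "('o, 'm, 'z) smcat_scheme \<Rightarrow> ('o, 'm, 'x) presheaf \<Rightarrow> ('o, 'm, 'y) presheaf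
     \<Rightarrow> (('o, 'm) mon \<Rightarrow> 'x \<Rightarrow> 'y) \<Rightarrow> bool" where
  "psh_mor C F G \<phi> \<longleftrightarrow>
     (\<forall>A\<in>Ob (CommMon C). \<forall>s\<in>sec F A. \<phi> A s \<in> sec G A) \<and>
     (\<forall>A\<in>Ob (CommMon C). \<forall>B\<in>Ob (CommMon C). \<forall>f\<in>Hom (CommMon C) A B. \<forall>s\<in>sec F A.
        \<phi> B (res F A B f s) = res G A B f (\<phi> A s))"

definition psh_iso ::
  "('o, 'm, 'z) smcat_scheme \<Rightarrow> ('o, 'm, 'x) presheaf \<Rightarrow> ('o, 'm, 'y) presheaf \<Rightarrow> bool" where
  "psh_iso C F G \<longleftrightarrow>
     (\<exists>\<phi>. psh_mor C F G \<phi> \<and> (\<forall>A\<in>Ob (CommMon C). bij_betw (\<phi> A) (sec F A) (sec G A)))"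

definition Spec ::
  "('o, 'm, 'z) smcat_scheme \<Rightarrow> ('o, 'm) mon \<Rightarrow> ('o, 'm, 'm) presheaf" where
  "Spec C A = \<lparr>sec = (\<lambda>B. Hom (CommMon C) A B), res = (\<lambda>B D g h. g \<cdot>\<^bsub>C\<^esub> h)\<rparr>"

definition fibre_product ::
  "('o, 'm, 'x) presheaf \<Rightarrow> (('o, 'm) mon \<Rightarrow> 'x \<Rightarrow> 'w) \<Rightarrow>
   ('o, 'm, 'y) presheaf \<Rightarrow> (('o, 'm) mon \<Rightarrow> 'y \<Rightarrow> 'w) \<Rightarrow> ('o, 'm, 'x \<times> 'y) presheaf" where
  "fibre_product F \<phi> G \<psi> =
     \<lparr>sec = (\<lambda>A. {(s, t). s \<in> sec F A \<and> t \<in> sec G A \<and> \<phi> A s = \<psi> A t}),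
      res = (\<lambda>A B f (s, t). (res F A B f s, res G A B f t))\<rparr>"

text \<open>Limits of sheaves are computed on sections, so monomorphisms are the maps injective on sections.\<close>

definition sheaf_mono ::
  "('o, 'm, 'z) smcat_scheme \<Rightarrow> ('o, 'm, 'x) presheaf \<Rightarrow> (('o, 'm) mon \<Rightarrow> 'x \<Rightarrow> 'y) \<Rightarrow> bool" where
  "sheaf_mono C F \<phi> \<longleftrightarrow> (\<forall>A\<in>Ob (CommMon C). inj_on (\<phi> A) (sec F A))"

definition is_subsheaf ::
  "'u set \<Rightarrow> ('o, 'm, 'z) smcat_scheme \<Rightarrow> ('o, 'm, 'x) presheaf
     \<Rightarrow> (('o, 'm) mon \<Rightarrow> 'x set) \<Rightarrow> bool" where
  "is_subsheaf U C G S \<longleftrightarrow> (\<forall>A\<in>Ob (CommMon C). S A \<subseteq> sec G A) \<and>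
     is_sheaf U C \<lparr>sec = S, res = res G\<rparr>"

text \<open>
  The image in sheaves of a morphism to \<open>G\<close>, or of the morphism to \<open>G\<close> out of a coproduct induced by a
  family, is the least subsheaf of \<open>G\<close> through which it factors, i.e. which contains
  the sections \<open>P\<close> that are hit.
\<close>

definition is_sheaf_image ::
  "'u set \<Rightarrow> ('o, 'm, 'z) smcat_scheme \<Rightarrow> ('o, 'm, 'x) presheaf
     \<Rightarrow> (('o, 'm) mon \<Rightarrow> 'x set) \<Rightarrow> (('o, 'm) mon \<Rightarrow> 'x set) \<Rightarrow> bool" where
  "is_sheaf_image U C G P S \<longleftrightarrow> is_subsheaf U C G S \<and> (\<forall>A\<in>Ob (CommMon C). P A \<subseteq> S A) \<and>
     (\<forall>T. is_subsheaf U C G T \<and> (\<forall>A\<in>Ob (CommMon C). P A \<subseteq> T A) \<longrightarrow>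
        (\<forall>A\<in>Ob (CommMon C). S A \<subseteq> T A))"

definition zariski_open_subsheaf ::
  "'u set \<Rightarrow> ('o, 'm, 'z) smcat_scheme \<Rightarrow> ('o, 'm) mon \<Rightarrow> (('o, 'm) mon \<Rightarrow> 'm set) \<Rightarrow> bool" where
  "zariski_open_subsheaf U C A S \<longleftrightarrow>
     (\<exists>I As fs. small_set U I \<and> (\<forall>i\<in>I. aff_zariski_open U C A (As i) (fs i)) \<and>
        is_sheaf_image U C (Spec C A)
          (\<lambda>B. \<Union>i\<in>I. {g \<cdot>\<^bsub>C\<^esub> fs i | g. g \<in> Hom (CommMon C) (As i) B}) S)"

definition zariski_open_immersion ::
  "'u set \<Rightarrow> ('o, 'm, 'z) smcat_scheme \<Rightarrow> ('o, 'm, 'x) presheaf \<Rightarrow> ('o, 'm, 'y) presheaf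
     \<Rightarrow> (('o, 'm) mon \<Rightarrow> 'x \<Rightarrow> 'y) \<Rightarrow> bool" where
  "zariski_open_immersion U C F G \<phi> \<longleftrightarrow> psh_mor C F G \<phi> \<and>
     (\<forall>A\<in>Ob (CommMon C). \<forall>\<zeta>. psh_mor C (Spec C A) G \<zeta> \<longrightarrow>
        (let P = fibre_product F \<phi> (Spec C A) \<zeta> in
         sheaf_mono C P (\<lambda>_. snd) \<and>
         (\<exists>S. is_sheaf_image U C (Spec C A) (\<lambda>B. snd ` sec P B) S \<and>
              zariski_open_subsheaf U C A S)))"

text \<open>
  The morphism \<open>\<Coprod>\<^bsub>i\<in>I\<^esub> Spec(A\<^sub>i) \<rightarrow> X\<close> induced by a family is an epimorphism of sheaves: morphisms
  out of \<open>X\<close> that agree after composition with each member of the family are equal. The test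
  sheaves \<open>T\<close> have sections of type \<^typ>\<open>(('o, 'm) mon \<times> 'm) set\<close>. This type accommodates the
  subobject classifier (closed sieves on \<open>Spec(A)\<close> are sets of arrows with source \<open>A\<close> in \<open>Comm(C)\<close>),
  which detects epimorphisms, so allowing test sheaves with sections of other types would not change the
  notion.
\<close>

definition sheaf_epi_family ::
  "'u set \<Rightarrow> ('o, 'm, 'z) smcat_scheme \<Rightarrow> 'i set \<Rightarrow> ('i \<Rightarrow> ('o, 'm) mon)
     \<Rightarrow> ('i \<Rightarrow> ('o, 'm) mon \<Rightarrow> 'm \<Rightarrow> 'x) \<Rightarrow> ('o, 'm, 'x) presheaf \<Rightarrow> bool" where
  "sheaf_epi_family U C I As \<phi> X \<longleftrightarrow>
     (\<forall>(T :: ('o, 'm, (('o, 'm) mon \<times> 'm) set) presheaf) \<alpha> \<beta>.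
        is_sheaf U C T \<and> psh_mor C X T \<alpha> \<and> psh_mor C X T \<beta> \<and>
        (\<forall>i\<in>I. \<forall>B\<in>Ob (CommMon C). \<forall>h\<in>sec (Spec C (As i)) B. \<alpha> B (\<phi> i B h) = \<beta> B (\<phi> i B h))
        \<longrightarrow> (\<forall>B\<in>Ob (CommMon C). \<forall>s\<in>sec X B. \<alpha> B s = \<beta> B s))"


section \<open>Schemes\<close>

text \<open>Objects of \<open>ZarAff(X)\<close>: Zariski open immersions \<open>Spec(A) \<rightarrow> X\<close>.\<close>

definition ZarAff ::
  "'u set \<Rightarrow> ('o, 'm, 'z) smcat_scheme \<Rightarrow> ('o, 'm, 'x) presheaf
     \<Rightarrow> (('o, 'm) mon \<times> (('o, 'm) mon \<Rightarrow> 'm \<Rightarrow> 'x)) set" where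
  "ZarAff U C X = {(A, \<phi>). A \<in> Ob (CommMon C) \<and> zariski_open_immersion U C (Spec C A) X \<phi>}"

definition is_scheme ::
  "'u set \<Rightarrow> ('o, 'm, 'z) smcat_scheme \<Rightarrow> ('o, 'm, 'x) presheaf \<Rightarrow> bool" where
  "is_scheme U C X \<longleftrightarrow> is_sheaf U C X \<and>
     (\<exists>I As \<phi>. small_set U I \<and> (\<forall>i\<in>I. (As i, \<phi> i) \<in> ZarAff U C X) \<and>
        sheaf_epi_family U C I As \<phi> X)"

definition integral_scheme ::
  "'u set \<Rightarrow> ('o, 'm, 'z) smcat_scheme \<Rightarrow> ('o, 'm, 'x) presheaf \<Rightarrow> bool" where
  "integral_scheme U C X \<longleftrightarrow> is_scheme U C X \<and>
     (\<forall>(A, \<phi>)\<in>ZarAff U C X. \<not> zero_monoid C A \<longrightarrow> integral_monoid C A)"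

definition noetherian_scheme ::
  "'u set \<Rightarrow> ('o, 'm, 'z) smcat_scheme \<Rightarrow> ('o, 'm, 'x) presheaf \<Rightarrow> bool" where
  "noetherian_scheme U C X \<longleftrightarrow> is_scheme U C X \<and>
     (\<forall>(A, \<phi>)\<in>ZarAff U C X. noetherian_monoid U C A)"

definition trivial_sheaf :: "('o, 'm, 'z) smcat_scheme \<Rightarrow> ('o, 'm, 'x) presheaf \<Rightarrow> bool" where
  "trivial_sheaf C F \<longleftrightarrow> (\<exists>Z. zero_monoid C Z \<and> psh_iso C F (Spec C Z))"

definition irreducible_scheme ::
  "'u set \<Rightarrow> ('o, 'm, 'z) smcat_scheme \<Rightarrow> ('o, 'm, 'x) presheaf \<Rightarrow> bool" where
  "irreducible_scheme U C X \<longleftrightarrow> is_scheme U C X \<and>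
     (\<forall>(A, \<phi>)\<in>ZarAff U C X. \<forall>(B, \<psi>)\<in>ZarAff U C X.
        \<not> trivial_sheaf C (Spec C A) \<and> \<not> trivial_sheaf C (Spec C B) \<longrightarrow>
        \<not> trivial_sheaf C (fibre_product (Spec C A) \<phi> (Spec C B) \<psi>))"

end

theory Submission
  imports Defs
begin

text \<open>
  Let \<open>V = Spec A\<close> and \<open>W = Spec B\<close> be non-trivial members of \<open>ZarAff X\<close> whose fibre product over \<open>X\<close> is
  trivial, and let \<open>D = A \<times> B\<close> be the product monoid, carried by the biproduct. Its projections are flat
  epimorphisms, since extension of scalars along them amounts to splitting an idempotent, and they are
  finitely presented: if \<open>R \<rightarrow> colim R\<^sub>i\<close> inverts one idempotent, the complementary factors of the \<open>R\<^sub>i\<close> have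
  colimit \<open>0\<close>, and as \<open>B\<close> is a finitely generated module over itself (\<open>X\<close> is Noetherian) one of these
  factors is already \<open>0\<close>. So \<open>V\<close> and \<open>W\<close> cover \<open>Spec D\<close>, with trivial overlap, and the sheaf \<open>X\<close> receives a
  glued morphism from \<open>Spec D\<close>. It is a Zariski open immersion: every section of \<open>Spec D\<close> decomposes into a
  section of \<open>V\<close> and one of \<open>W\<close> after splitting the base accordingly, which gives injectivity, and shows, as
  affine schemes are sheaves, that the image is the union of the images of \<open>V\<close> and \<open>W\<close>. Hence \<open>D\<close> is a
  member of \<open>ZarAff X\<close> and must be integral, but its two complementary idempotents have product \<open>0\<close>.
\<close>

text \<open>Finite generation of a chart over itself is a real condition: \<open>Hom(A, -)\<close>
  need not preserve filtered unions in a general \<open>C\<close>, and inverting an idempotent is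
  then not visibly of finite presentation. The condition is available for the charts only, not for
  the monoids \<open>E\<close> over which sections of \<open>Spec D\<close> are tested. Finite
  presentation is therefore proved for every projection whose complementary factor is an algebra
  over a chart, and the pieces into which \<open>E\<close> splits are of this kind.

  Images are least subsheaves and are constructed inside a sheaf, so affine schemes must be shown to
  be sheaves for all Zariski covers. This is descent along finite flat conservative families. It
  uses a single cokernel instead of an exact complex: a compatible family lies in the image of the
  base if its class in the cokernel dies after each base change. The sheaf condition quantifies over
  pushouts of commutative monoids and says nothing on an overlap unless a pushout exists; for this
  reason the tensor product of two algebras is made into a monoid explicitly.\<close>

section \<open>Typed arrows\<close>

text \<open>
  Arrows of \<open>C\<close> together with their domain and codomain. The middle component is \<open>None\<close> for ill-typed
  composites; this makes composition total and associative without side conditions.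
\<close>

datatype ('o, 'm) tarr = Tarr (dm: 'o) (md: "'m option") (cd: 'o)

locale abelian_symmetric_monoidal =
  abelian_category C + closed_symmetric_monoidal_category C
  for C :: "('o, 'm, 'z) smcat_scheme" (structure)
begin

definition un :: "('o, 'm) tarr \<Rightarrow> 'm" where "un f = the (md f)"

definition ar :: "('o, 'm) tarr \<Rightarrow> bool" where
  "ar f \<longleftrightarrow> (\<exists>x y m. f = Tarr x (Some m) y \<and> x \<in> Ob C \<and> y \<in> Ob C \<and> m \<in> Hom C x y)"

definition mk :: "'o \<Rightarrow> 'm \<Rightarrow> 'o \<Rightarrow> ('o, 'm) tarr" where
  "mk x m y = Tarr x (if x \<in> Ob C \<and> y \<in> Ob C \<and> m \<in> Hom C x y then Some m else None) y"

definition cmp :: "('o, 'm) tarr \<Rightarrow> ('o, 'm) tarr \<Rightarrow> ('o, 'm) tarr"  (infixr "**" 65) where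
  "g ** f = Tarr (dm f) (if ar f \<and> ar g \<and> dm g = cd f then Some (un g \<cdot> un f) else None) (cd g)"

definition tns :: "('o, 'm) tarr \<Rightarrow> ('o, 'm) tarr \<Rightarrow> ('o, 'm) tarr"  (infixr "><" 75) where
  "f >< g = Tarr (dm f \<boxtimes> dm g) (if ar f \<and> ar g then Some (un f \<star> un g) else None) (cd f \<boxtimes> cd g)"

definition add :: "('o, 'm) tarr \<Rightarrow> ('o, 'm) tarr \<Rightarrow> ('o, 'm) tarr"  (infixl "\<boxplus>" 60) where
  "f \<boxplus> g = Tarr (dm f) (if ar f \<and> ar g \<and> dm f = dm g \<and> cd f = cd g then Some (Add C (un f) (un g)) else None) (cd f)"

definition I :: "'o \<Rightarrow> ('o, 'm) tarr" where "I x = mk x (Idn C x) x"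
definition zr :: "'o \<Rightarrow> 'o \<Rightarrow> ('o, 'm) tarr" where "zr x y = mk x (zero_arrow C x y) y"

section \<open>Ends and typing of arrows\<close>

lemma dm_mk [simp]: "dm (mk x f y) = x" and cd_mk [simp]: "cd (mk x f y) = y"
  by (simp_all add: mk_def)
lemma dm_cmp [simp]: "dm (g ** f) = dm f" and cd_cmp [simp]: "cd (g ** f) = cd g"
  by (simp_all add: cmp_def)
lemma dm_tns [simp]: "dm (f >< g) = dm f \<boxtimes> dm g" and cd_tns [simp]: "cd (f >< g) = cd f \<boxtimes> cd g"
  by (simp_all add: tns_def)
lemma dm_add [simp]: "dm (f \<boxplus> g) = dm f" and cd_add [simp]: "cd (f \<boxplus> g) = cd f"
  by (simp_all add: add_def)
lemma dm_I [simp]: "dm (I x) = x" and cd_I [simp]: "cd (I x) = x"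
  by (simp_all add: I_def)
lemma dm_zr [simp]: "dm (zr x y) = x" and cd_zr [simp]: "cd (zr x y) = y"
  by (simp_all add: zr_def)

lemma ar_mk: "ar (mk x f y) \<longleftrightarrow> x \<in> Ob C \<and> y \<in> Ob C \<and> f \<in> Hom C x y"
  by (auto simp: ar_def mk_def)

lemma un_mk [simp]: "ar (mk x f y) \<Longrightarrow> un (mk x f y) = f"
  by (auto simp: ar_def mk_def un_def split: if_splits)

lemma arE:
  assumes "ar f"
  shows "dm f \<in> Ob C" "cd f \<in> Ob C" "un f \<in> Hom C (dm f) (cd f)" "f = mk (dm f) (un f) (cd f)"
  using assms by (auto simp: ar_def un_def mk_def)

lemma mk_un: "ar f \<Longrightarrow> mk (dm f) (un f) (cd f) = f"
  using arE by metis

lemma mk_inject: "ar (mk x f y) \<Longrightarrow> mk x f y = mk x g y \<Longrightarrow> f = g"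
  by (auto simp: ar_def mk_def split: if_splits)

lemma un_inject: "ar f \<Longrightarrow> ar g \<Longrightarrow> dm f = dm g \<Longrightarrow> cd f = cd g \<Longrightarrow> un f = un g \<Longrightarrow> f = g"
  using mk_un by metis

lemma dm_Ob [simp]: "ar f \<Longrightarrow> dm f \<in> Ob C" and cd_Ob [simp]: "ar f \<Longrightarrow> cd f \<in> Ob C"
  using arE by auto

lemma cmp_mk:
  "f \<in> Hom C x y \<Longrightarrow> g \<in> Hom C y z \<Longrightarrow> x \<in> Ob C \<Longrightarrow> y \<in> Ob C \<Longrightarrow> z \<in> Ob C \<Longrightarrow>
    mk x (g \<cdot> f) z = mk y g z ** mk x f y"
  by (auto simp: cmp_def mk_def ar_def un_def comp_in_hom)

lemma ar_cmp [simp]: "ar (g ** f) \<longleftrightarrow> ar g \<and> ar f \<and> dm g = cd f"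
  using comp_in_hom[of "dm f" "cd f" "cd g" "un f" "un g"] arE[of f] arE[of g]
  by (auto simp: cmp_def ar_def)

lemma ar_tns [simp]: "ar (f >< g) \<longleftrightarrow> ar f \<and> ar g"
  using tens_in_hom[of "dm f" "cd f" "dm g" "cd g" "un f" "un g"] arE[of f] arE[of g]
  by (auto simp: tns_def ar_def tens_ob)

lemma hom_add: "\<lbrakk>x \<in> Ob C; y \<in> Ob C; f \<in> Hom C x y; g \<in> Hom C x y\<rbrakk> \<Longrightarrow> Add C f g \<in> Hom C x y"
proof -
  assume a: "x \<in> Ob C" "y \<in> Ob C" "f \<in> Hom C x y" "g \<in> Hom C x y"
  obtain n where "comm_group \<lparr>carrier = Hom C x y, mult = Add C, one = n\<rparr>"
    using hom_group a by blast
  then interpret G: comm_group "\<lparr>carrier = Hom C x y, mult = Add C, one = n\<rparr>" .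
  show ?thesis using G.m_closed a by auto
qed

lemma ar_add [simp]: "ar (f \<boxplus> g) \<longleftrightarrow> ar f \<and> ar g \<and> dm f = dm g \<and> cd f = cd g"
  using hom_add[of "dm f" "cd f" "un f" "un g"] arE[of f] arE[of g]
  by (auto simp: add_def ar_def)

lemma ar_I [simp]: "ar (I x) \<longleftrightarrow> x \<in> Ob C"
  by (auto simp: I_def ar_mk id_in_hom)

lemma un_cmp: "ar (g ** f) \<Longrightarrow> un (g ** f) = un g \<cdot> un f"
  unfolding ar_cmp by (simp add: cmp_def un_def)

lemma un_tns: "ar (g >< f) \<Longrightarrow> un (g >< f) = un g \<star> un f"
  unfolding ar_tns by (simp add: tns_def un_def)

lemma un_add: "ar (g \<boxplus> f) \<Longrightarrow> un (g \<boxplus> f) = Add C (un g) (un f)"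
  unfolding ar_add by (simp add: add_def un_def)

lemma un_I: "x \<in> Ob C \<Longrightarrow> un (I x) = Idn C x"
  by (simp add: I_def ar_mk id_in_hom)

lemma mid_cmp: "\<not> ar (g ** f) \<Longrightarrow> md ((g ** f)) = None"
  unfolding ar_cmp by (auto simp: cmp_def)

lemma mid_tns: "\<not> ar (g >< f) \<Longrightarrow> md ((g >< f)) = None"
  unfolding ar_tns by (auto simp: tns_def)

lemma mid_add: "\<not> ar (g \<boxplus> f) \<Longrightarrow> md ((g \<boxplus> f)) = None"
  unfolding ar_add by (auto simp: add_def)

text \<open>Ill-typed composites with equal ends coincide, since both middles are
  \<open>None\<close>. Equations between composites thus need no typing hypotheses beyond agreement
  in the well-typed case.\<close>

lemma eq_if_ar:
  assumes "dm f = dm g" "cd f = cd g" "ar f \<longleftrightarrow> ar g" "ar f \<Longrightarrow> un f = un g"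
    "\<not> ar f \<Longrightarrow> md f = None" "\<not> ar g \<Longrightarrow> md g = None"
  shows "f = g"
proof (cases "ar f")
  case True
  then show ?thesis using assms un_inject by auto
next
  case False
  then show ?thesis using assms by (cases f; cases g) simp
qed

text \<open>As a simplification rule it fixes right-nested composites as the normal form of all
  later calculations.\<close>

lemma cmp_assoc [simp]: "(h ** g) ** f = h ** (g ** f)"
proof (rule eq_if_ar)
  assume a: "ar ((h ** g) ** f)"
  then show "un ((h ** g) ** f) = un (h ** g ** f)"
    using comp_assoc[of "dm f" "cd f" "cd g" "cd h" "un f" "un g" "un h"] arE[of f] arE[of g] arE[of h]
    by (simp add: un_cmp)
qed (auto simp: mid_cmp)

text \<open>In right-nested normal form the left side \<open>g ** f\<close> of an equation is not a
  subterm of a longer chain. Carrying a tail \<open>k\<close> lets the equation rewrite in the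
  middle of a composite.\<close>

lemma ra: "g ** f = h \<Longrightarrow> g ** (f ** k) = h ** k"
  by (subst cmp_assoc[symmetric]) simp

lemma cmp_I_left [simp]: "ar f \<Longrightarrow> cd f = y \<Longrightarrow> I y ** f = f"
  by (rule un_inject) (auto simp: un_cmp un_I comp_id_left[OF dm_Ob cd_Ob] arE)

lemma cmp_I_right [simp]: "ar f \<Longrightarrow> dm f = y \<Longrightarrow> f ** I y = f"
  by (rule un_inject) (auto simp: un_cmp un_I comp_id_right[OF dm_Ob cd_Ob] arE)

lemma cmp_I_left2 [simp]: "ar f \<Longrightarrow> cd f = y \<Longrightarrow> I y ** f ** g = f ** g"
  by (rule ra) simp

lemma I_tns [simp]: "x \<in> Ob C \<Longrightarrow> y \<in> Ob C \<Longrightarrow> I x >< I y = I (x \<boxtimes> y)"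
  by (rule un_inject) (auto simp: un_tns un_I tens_ob tens_id)

lemma tens_Ob [simp]: "x \<in> Ob C \<Longrightarrow> y \<in> Ob C \<Longrightarrow> x \<boxtimes> y \<in> Ob C"
  by (rule tens_ob)

lemma unit_Ob [simp]: "TUnit C \<in> Ob C"
  by (rule unit_ob)

text \<open>The interchange law. Only the inner ends have to match, because an ill-typed factor
  spoils both sides alike. With its tailed form \<open>mrg2\<close> it collects a composite of
  tensor products into a single tensor product.\<close>

lemma mrg:
  assumes "dm f' = cd f" "dm g' = cd g"
  shows "(f' >< g') ** (f >< g) = (f' ** f) >< (g' ** g)"
proof (rule eq_if_ar)
  assume a: "ar ((f' >< g') ** (f >< g))"
  then show "un ((f' >< g') ** (f >< g)) = un ((f' ** f) >< (g' ** g))"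
    using tens_comp[of "dm f" "cd f" "cd f'" "dm g" "cd g" "cd g'" "un f" "un f'" "un g" "un g'"] assms
      arE[of f] arE[of g] arE[of f'] arE[of g'] by (simp add: un_cmp un_tns)
qed (use assms in \<open>auto simp: mid_cmp mid_tns\<close>)

lemma mrg2:
  assumes "dm f' = cd f" "dm g' = cd g"
  shows "(f' >< g') ** ((f >< g) ** k) = ((f' ** f) >< (g' ** g)) ** k"
  by (rule ra) (rule mrg[OF assms])

lemmas mg = mrg mrg2

end

section \<open>Abelian structure\<close>

context category
begin

text \<open>Two zero objects are linked by an arrow \<open>i\<close>, and uniqueness gives
  \<open>i \<cdot> a = a'\<close> and \<open>b' \<cdot> i = b\<close>. The composite therefore does
  not depend on the zero object, and the definite description denotes. The category is arbitrary so
  that the lemma also serves for modules.\<close>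

lemma zero_arrow_eq:
  assumes z: "zero_object C z" and x: "x \<in> Ob C" and y: "y \<in> Ob C"
    and a: "a \<in> Hom C x z" and b: "b \<in> Hom C z y"
  shows "zero_arrow C x y = b \<cdot> a"
  unfolding zero_arrow_def
proof (rule the_equality)
  show "\<exists>z a' b'. zero_object C z \<and> a' \<in> Hom C x z \<and> b' \<in> Hom C z y \<and> b \<cdot> a = b' \<cdot> a'"
    using z a b by blast
  fix f assume "\<exists>z a b. zero_object C z \<and> a \<in> Hom C x z \<and> b \<in> Hom C z y \<and> f = b \<cdot> a"
  then obtain z' a' b' where z': "zero_object C z'" and a': "a' \<in> Hom C x z'"
    and b': "b' \<in> Hom C z' y" and f: "f = b' \<cdot> a'" by blast
  have zo: "z \<in> Ob C" "z' \<in> Ob C" using z z' by (auto simp: zero_object_def)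
  obtain i where i: "i \<in> Hom C z z'" using z zo(2) unfolding zero_object_def by blast
  have "i \<cdot> a \<in> Hom C x z'" using comp_in_hom[OF x zo a i] .
  moreover have "\<exists>!f. f \<in> Hom C x z'" using z' x unfolding zero_object_def by blast
  ultimately have 1: "i \<cdot> a = a'" using a' by blast
  have "b' \<cdot> i \<in> Hom C z y" using comp_in_hom[OF zo y i b'] .
  moreover have "\<exists>!f. f \<in> Hom C z y" using z y unfolding zero_object_def by blast
  ultimately have 2: "b' \<cdot> i = b" using b by blast
  show "f = b \<cdot> a" using comp_assoc[OF x zo y a i b'] 1 2 f by simp
qed

end

context abelian_symmetric_monoidal
begin

lemma zr_Ob: "x \<in> Ob C \<Longrightarrow> y \<in> Ob C \<Longrightarrow> zero_arrow C x y \<in> Hom C x y"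
proof -
  assume x: "x \<in> Ob C" and y: "y \<in> Ob C"
  obtain z where z: "zero_object C z" using ex_zero_object by blast
  obtain a where a: "a \<in> Hom C x z" using z x unfolding zero_object_def by blast
  obtain b where b: "b \<in> Hom C z y" using z y unfolding zero_object_def by blast
  have "z \<in> Ob C" using z by (simp add: zero_object_def)
  then show ?thesis using zero_arrow_eq[OF z x y a b] comp_in_hom[OF x _ y a b] by simp
qed

lemma ar_zr [simp]: "ar (zr x y) \<longleftrightarrow> x \<in> Ob C \<and> y \<in> Ob C"
  using zr_Ob by (auto simp: zr_def ar_mk)

definition null :: "'o" where "null = (SOME z. zero_object C z)"

lemma null: "zero_object C null"
  unfolding null_def using someI_ex[OF ex_zero_object] .

lemma null_Ob [simp]: "null \<in> Ob C"
  using null by (simp add: zero_object_def)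

lemma to_null: "ar f \<Longrightarrow> cd f = null \<Longrightarrow> f = zr (dm f) null"
proof -
  assume a: "ar f" "cd f = null"
  have "\<exists>!h. h \<in> Hom C (dm f) null" using null a unfolding zero_object_def by auto
  then have "un f = un (zr (dm f) null)"
    using arE(3)[of f] arE(3)[of "zr (dm f) null"] a by auto
  then show ?thesis using a by (intro un_inject) auto
qed

lemma from_null: "ar f \<Longrightarrow> dm f = null \<Longrightarrow> f = zr null (cd f)"
proof -
  assume a: "ar f" "dm f = null"
  have "\<exists>!h. h \<in> Hom C null (cd f)" using null a unfolding zero_object_def by auto
  then have "un f = un (zr null (cd f))"
    using arE(3)[of f] arE(3)[of "zr null (cd f)"] a by auto
  then show ?thesis using a by (intro un_inject) auto
qed

lemma zr_via_null: "x \<in> Ob C \<Longrightarrow> y \<in> Ob C \<Longrightarrow> zr x y = zr null y ** zr x null"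
proof -
  assume a: "x \<in> Ob C" "y \<in> Ob C"
  have "zero_arrow C x y = un (zr null y) \<cdot> un (zr x null)"
    by (rule zero_arrow_eq[OF null]) (use a arE(3)[of "zr x null"] arE(3)[of "zr null y"] in auto)
  then show ?thesis using a zr_Ob[OF a]
    by (intro un_inject) (auto simp: un_cmp, simp add: zr_def ar_mk)
qed

lemma cmp_zr [simp]:
  assumes "ar f" "dm f = y" "x \<in> Ob C" shows "f ** zr x y = zr x (cd f)"
proof -
  have "f ** zr null y = zr null (cd f)" using from_null[of "f ** zr null y"] assms by auto
  note 1 = ra[OF this, of "zr x null"]
  have "y \<in> Ob C" "cd f \<in> Ob C" using assms by auto
  then show ?thesis using 1 assms zr_via_null[of x y] zr_via_null[of x "cd f"] by metis
qed

lemma zr_cmp [simp]: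
  assumes "ar f" "cd f = x" "y \<in> Ob C" shows "zr x y ** f = zr (dm f) y"
proof -
  have "zr x null ** f = zr (dm f) null" using to_null[of "zr x null ** f"] assms by auto
  moreover have "x \<in> Ob C" "dm f \<in> Ob C" using assms by auto
  ultimately show ?thesis using assms zr_via_null[of x y] zr_via_null[of "dm f" y] by (metis cmp_assoc)
qed

lemma zr_cmp2 [simp]: "ar f \<Longrightarrow> cd f = x \<Longrightarrow> y \<in> Ob C \<Longrightarrow> zr x y ** f ** g = zr (dm f) y ** g"
  by (rule ra) simp

section \<open>Addition of arrows\<close>

lemma add_assoc: "(f \<boxplus> g) \<boxplus> h = f \<boxplus> (g \<boxplus> h)"
proof (rule eq_if_ar)
  assume "ar (f \<boxplus> g \<boxplus> h)"
  then have a: "ar f" "ar g" "ar h" "dm g = dm f" "dm h = dm f" "cd g = cd f" "cd h = cd f" by auto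
  obtain n where "comm_group \<lparr>carrier = Hom C (dm f) (cd f), mult = Add C, one = n\<rparr>"
    using hom_group[of "dm f" "cd f"] a by auto
  then interpret G: comm_group "\<lparr>carrier = Hom C (dm f) (cd f), mult = Add C, one = n\<rparr>" .
  have h: "un f \<in> Hom C (dm f) (cd f)" "un g \<in> Hom C (dm f) (cd f)" "un h \<in> Hom C (dm f) (cd f)"
    using a arE(3)[of f] arE(3)[of g] arE(3)[of h] by auto
  show "un (f \<boxplus> g \<boxplus> h) = un (f \<boxplus> (g \<boxplus> h))"
    using G.m_assoc[of "un f" "un g" "un h"] h a by (simp add: un_add)
qed (auto simp: mid_add)

lemma cmp_add_l: "(g \<boxplus> h) ** f = (g ** f) \<boxplus> (h ** f)"
proof (rule eq_if_ar)
  assume "ar ((g \<boxplus> h) ** f)"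
  then show "un ((g \<boxplus> h) ** f) = un ((g ** f) \<boxplus> (h ** f))"
    using comp_add_left[of "dm f" "cd f" "cd g" "un f" "un g" "un h"] arE[of f] arE[of g] arE[of h]
    by (auto simp: un_add un_cmp)
qed (auto simp: mid_add mid_cmp)

lemma cmp_add_r: "h ** (f \<boxplus> g) = (h ** f) \<boxplus> (h ** g)"
proof (rule eq_if_ar)
  assume "ar (h ** (f \<boxplus> g))"
  then show "un (h ** (f \<boxplus> g)) = un ((h ** f) \<boxplus> (h ** g))"
    using comp_add_right[of "dm f" "cd f" "cd h" "un f" "un g" "un h"] arE[of f] arE[of g] arE[of h]
    by (auto simp: un_add un_cmp)
qed (auto simp: mid_add mid_cmp)

text \<open>The axioms do not say that the neutral element of a hom-group is the zero arrow. Both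
  summands factor through \<open>null\<close>, where parallel arrows agree, so the zero arrow is
  idempotent in the group; an idempotent in a group is neutral.\<close>

lemma zr_add_zr: "x \<in> Ob C \<Longrightarrow> y \<in> Ob C \<Longrightarrow> zr x y \<boxplus> zr x y = zr x y"
  using to_null[of "zr x null \<boxplus> zr x null"] cmp_add_r[of "zr null y" "zr x null" "zr x null"]
  by simp

lemma hom_comm_group:
  assumes "x \<in> Ob C" "y \<in> Ob C"
  shows "comm_group \<lparr>carrier = Hom C x y, mult = Add C, one = zero_arrow C x y\<rparr>"
proof -
  obtain n where G: "comm_group \<lparr>carrier = Hom C x y, mult = Add C, one = n\<rparr>"
    using hom_group assms by auto
  then interpret G: comm_group "\<lparr>carrier = Hom C x y, mult = Add C, one = n\<rparr>" .
  have a: "ar (mk x (zero_arrow C x y) y)" using assms by (simp flip: zr_def)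
  have "Add C (zero_arrow C x y) (zero_arrow C x y) = zero_arrow C x y"
    using zr_add_zr[OF assms] un_add[of "zr x y" "zr x y"] assms
    by (simp add: zr_def a)
  then have "n = zero_arrow C x y"
    using G.l_cancel_one[of "zero_arrow C x y" "zero_arrow C x y"] zr_Ob[OF assms] by auto
  then show ?thesis using G by simp
qed

lemma ex_ng:
  assumes "ar f"
  shows "\<exists>g. ar g \<and> dm g = dm f \<and> cd g = cd f \<and> f \<boxplus> g = zr (dm f) (cd f)"
proof -
  interpret G: comm_group "\<lparr>carrier = Hom C (dm f) (cd f), mult = Add C, one = zero_arrow C (dm f) (cd f)\<rparr>"
    using hom_comm_group assms by auto
  obtain g where g: "g \<in> Hom C (dm f) (cd f)" "Add C (un f) g = zero_arrow C (dm f) (cd f)"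
    using G.r_inv_ex[of "un f"] arE(3)[OF assms] by auto
  have a: "ar (mk (dm f) g (cd f))" using g assms by (simp add: ar_mk)
  have "un (zr (dm f) (cd f)) = zero_arrow C (dm f) (cd f)"
    using assms zr_Ob[of "dm f" "cd f"] by (auto simp: zr_def ar_mk)
  then have "f \<boxplus> mk (dm f) g (cd f) = zr (dm f) (cd f)" using assms g a
    by (intro un_inject) (auto simp: un_add)
  then show ?thesis using a by (intro exI[of _ "mk (dm f) g (cd f)"]) auto
qed

text \<open>The wrapping in \<open>mk\<close> gives \<open>ng f\<close> known ends even for an
  ill-typed \<open>f\<close>, so that \<open>dm_ng\<close> and \<open>cd_ng\<close> are
  unconditional. The inverse \<open>iv\<close> is built in the same way.\<close>

definition ng :: "('o, 'm) tarr \<Rightarrow> ('o, 'm) tarr" where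
  "ng f = mk (dm f) (un (SOME g. ar g \<and> dm g = dm f \<and> cd g = cd f \<and> f \<boxplus> g = zr (dm f) (cd f))) (cd f)"

lemma dm_ng [simp]: "dm (ng f) = dm f" and cd_ng [simp]: "cd (ng f) = cd f"
  by (simp_all add: ng_def)

lemma ng_props:
  assumes "ar f"
  shows "ar (ng f)" "f \<boxplus> ng f = zr (dm f) (cd f)"
proof -
  let ?g = "SOME g. ar g \<and> dm g = dm f \<and> cd g = cd f \<and> f \<boxplus> g = zr (dm f) (cd f)"
  have s: "ar ?g \<and> dm ?g = dm f \<and> cd ?g = cd f \<and> f \<boxplus> ?g = zr (dm f) (cd f)"
    using someI_ex[OF ex_ng[OF assms]] .
  then have "ng f = ?g" unfolding ng_def using mk_un[of ?g] by auto
  then show "ar (ng f)" "f \<boxplus> ng f = zr (dm f) (cd f)" using s by auto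
qed

lemma ar_ng [simp]: "ar f \<Longrightarrow> ar (ng f)"
  by (rule ng_props)

lemma add_comm: "dm f = dm g \<Longrightarrow> cd f = cd g \<Longrightarrow> f \<boxplus> g = g \<boxplus> f"
proof (rule eq_if_ar)
  assume a: "ar (f \<boxplus> g)" "dm f = dm g" "cd f = cd g"
  interpret G: comm_group "\<lparr>carrier = Hom C (dm f) (cd f), mult = Add C, one = zero_arrow C (dm f) (cd f)\<rparr>"
    using hom_comm_group a by auto
  show "un (f \<boxplus> g) = un (g \<boxplus> f)"
    using a G.m_comm[of "un f" "un g"] arE(3)[of f] arE(3)[of g] by (auto simp: un_add)
qed (auto simp: mid_add)

lemma add_zr [simp]: "ar f \<Longrightarrow> dm f = x \<Longrightarrow> cd f = y \<Longrightarrow> f \<boxplus> zr x y = f"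
proof -
  assume a: "ar f" "dm f = x" "cd f = y"
  interpret G: comm_group "\<lparr>carrier = Hom C (dm f) (cd f), mult = Add C, one = zero_arrow C (dm f) (cd f)\<rparr>"
    using hom_comm_group a by auto
  have "un (zr x y) = zero_arrow C x y" using a zr_Ob[of x y] by (auto simp: zr_def ar_mk)
  then show ?thesis
    using a G.r_one[of "un f"] arE(3)[of f] by (intro un_inject) (auto simp: un_add)
qed

lemma zr_add [simp]: "ar f \<Longrightarrow> dm f = x \<Longrightarrow> cd f = y \<Longrightarrow> zr x y \<boxplus> f = f"
  using add_comm[of f "zr x y"] by simp

lemma add_cancel:
  assumes "ar f" "ar g" "ar h" "f \<boxplus> h = g \<boxplus> h" "dm f = dm h" "dm g = dm h" "cd f = cd h" "cd g = cd h"
  shows "f = g"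
proof -
  have "(f \<boxplus> h) \<boxplus> ng h = (g \<boxplus> h) \<boxplus> ng h" using assms by simp
  then have "f \<boxplus> (h \<boxplus> ng h) = g \<boxplus> (h \<boxplus> ng h)" by (simp only: add_assoc)
  then show ?thesis using assms ng_props[of h] by simp
qed

lemma add_ng_eq_zr:
  assumes "ar f" "ar g" "dm f = dm g" "cd f = cd g"
  shows "f \<boxplus> ng g = zr (dm f) (cd f) \<longleftrightarrow> f = g"
proof
  assume "f \<boxplus> ng g = zr (dm f) (cd f)"
  then have "f \<boxplus> ng g = g \<boxplus> ng g" using ng_props(2)[OF assms(2)] assms by simp
  then show "f = g" by (rule add_cancel[rotated 3]) (use assms in auto)
next
  assume "f = g"
  then show "f \<boxplus> ng g = zr (dm f) (cd f)" using ng_props(2)[OF assms(2)] by simp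
qed

lemma ng_add:
  assumes "ar f" shows "ng f \<boxplus> f = zr (dm f) (cd f)"
proof -
  have "ng f \<boxplus> f = f \<boxplus> ng f" by (rule add_comm) auto
  then show ?thesis using ng_props(2)[OF assms] by simp
qed

lemma ng_cmp:
  assumes "ar f" "ar g" "dm g = cd f" shows "ng g ** f = ng (g ** f)"
proof (rule add_cancel[of _ _ "g ** f"])
  have "(ng g ** f) \<boxplus> (g ** f) = (ng g \<boxplus> g) ** f" by (simp only: cmp_add_l)
  also have "\<dots> = zr (dm f) (cd g)" using assms by (simp add: ng_add)
  also have "\<dots> = ng (g ** f) \<boxplus> (g ** f)" using assms by (subst ng_add) simp_all
  finally show "(ng g ** f) \<boxplus> (g ** f) = ng (g ** f) \<boxplus> (g ** f)" .
qed (use assms in auto)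

lemma cmp_ng:
  assumes "ar f" "ar g" "dm g = cd f" shows "g ** ng f = ng (g ** f)"
proof (rule add_cancel[of _ _ "g ** f"])
  have "(g ** ng f) \<boxplus> (g ** f) = g ** (ng f \<boxplus> f)" by (simp only: cmp_add_r)
  also have "\<dots> = zr (dm f) (cd g)" using assms by (simp add: ng_add)
  also have "\<dots> = ng (g ** f) \<boxplus> (g ** f)" using assms by (subst ng_add) simp_all
  finally show "(g ** ng f) \<boxplus> (g ** f) = ng (g ** f) \<boxplus> (g ** f)" .
qed (use assms in auto)

section \<open>Monomorphisms, epimorphisms, kernels and coequalizers\<close>

definition mono :: "('o, 'm) tarr \<Rightarrow> bool" where
  "mono k \<longleftrightarrow> ar k \<and> (\<forall>g h. ar g \<longrightarrow> ar h \<longrightarrow> cd g = dm k \<longrightarrow> cd h = dm k \<longrightarrow> k ** g = k ** h \<longrightarrow> g = h)"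

definition epi :: "('o, 'm) tarr \<Rightarrow> bool" where
  "epi k \<longleftrightarrow> ar k \<and> (\<forall>g h. ar g \<longrightarrow> ar h \<longrightarrow> dm g = cd k \<longrightarrow> dm h = cd k \<longrightarrow> g ** k = h ** k \<longrightarrow> g = h)"

definition kernel :: "('o, 'm) tarr \<Rightarrow> ('o, 'm) tarr \<Rightarrow> bool" where
  "kernel f k \<longleftrightarrow> ar f \<and> mono k \<and> cd k = dm f \<and> f ** k = zr (dm k) (cd f) \<and>
     (\<forall>g. ar g \<longrightarrow> cd g = dm f \<longrightarrow> f ** g = zr (dm g) (cd f) \<longrightarrow> (\<exists>h. ar h \<and> dm h = dm g \<and> cd h = dm k \<and> k ** h = g))"

text \<open>Uniqueness of the induced arrow is expressed by \<open>epi p\<close>, as it is by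
  \<open>mono k\<close> for kernels. With a zero arrow for \<open>g\<close> this is a cokernel, so
  cokernels and relative tensor products share their lemmas.\<close>

definition coeq :: "('o, 'm) tarr \<Rightarrow> ('o, 'm) tarr \<Rightarrow> ('o, 'm) tarr \<Rightarrow> bool" where
  "coeq f g p \<longleftrightarrow> ar f \<and> ar g \<and> dm f = dm g \<and> cd f = cd g \<and> epi p \<and> dm p = cd f \<and> p ** f = p ** g \<and>
     (\<forall>r. ar r \<longrightarrow> dm r = cd f \<longrightarrow> r ** f = r ** g \<longrightarrow> (\<exists>h. ar h \<and> dm h = cd p \<and> cd h = cd r \<and> h ** p = r))"

lemma monoD: "mono k \<Longrightarrow> k ** g = k ** h \<Longrightarrow> ar g \<Longrightarrow> ar h \<Longrightarrow> cd g = dm k \<Longrightarrow> cd h = dm k \<Longrightarrow> g = h"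
  by (simp add: mono_def)
lemma epiD: "epi k \<Longrightarrow> g ** k = h ** k \<Longrightarrow> ar g \<Longrightarrow> ar h \<Longrightarrow> dm g = cd k \<Longrightarrow> dm h = cd k \<Longrightarrow> g = h"
  by (simp add: epi_def)
lemma coeqD:
  assumes "coeq f g p"
  shows "ar f" "ar g" "dm f = dm g" "cd f = cd g" "epi p" "ar p" "dm p = cd f" "p ** f = p ** g"
  using assms by (auto simp: coeq_def epi_def)

lemma coeq_ex:
  assumes "coeq f g p" "ar r" "dm r = cd f" "r ** f = r ** g"
  obtains h where "ar h" "dm h = cd p" "cd h = cd r" "h ** p = r"
  using assms unfolding coeq_def by blast

lemma cokerD:
  assumes "coeq f (zr x y) p"
  shows "ar f" "epi p" "ar p" "dm p = cd f" "p ** f = zr (dm f) (cd p)" "x = dm f" "y = cd f"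
  using coeqD[OF assms] by auto

lemma coker_ex:
  assumes "coeq f (zr x y) p" "ar r" "dm r = cd f" "r ** f = zr (dm f) (cd r)"
  obtains h where "ar h" "dm h = cd p" "cd h = cd r" "h ** p = r"
proof -
  have "r ** f = r ** zr x y" using assms cokerD[OF assms(1)] by simp
  then show ?thesis using coeq_ex[OF assms(1,2,3)] that by blast
qed

lemma kernelD:
  assumes "kernel f k"
  shows "ar f" "mono k" "ar k" "cd k = dm f" "f ** k = zr (dm k) (cd f)"
  using assms by (auto simp: kernel_def mono_def)

lemma kernel_ex:
  assumes "kernel f k" "ar g" "cd g = dm f" "f ** g = zr (dm g) (cd f)"
  obtains h where "ar h" "dm h = dm g" "cd h = dm k" "k ** h = g"
  using assms unfolding kernel_def by blast

lemma ar_mono: "mono k \<Longrightarrow> ar k" by (simp add: mono_def)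
lemma ar_epi: "epi k \<Longrightarrow> ar k" by (simp add: epi_def)

lemma mono_monic: "ar k \<Longrightarrow> mono k \<longleftrightarrow> monic C (dm k) (cd k) (un k)"
proof
  assume k: "ar k" "mono k"
  show "monic C (dm k) (cd k) (un k)"
    unfolding monic_def
  proof (intro conjI ballI impI)
    fix z g h assume a: "z \<in> Ob C" "g \<in> Hom C z (dm k)" "h \<in> Hom C z (dm k)" "un k \<cdot> g = un k \<cdot> h"
    have "k ** mk z g (dm k) = k ** mk z h (dm k)"
      using a k by (intro un_inject) (auto simp: ar_mk un_cmp)
    then have "mk z g (dm k) = mk z h (dm k)" by (rule monoD[OF k(2)]) (use a k in \<open>auto simp: ar_mk\<close>)
    then show "g = h" using a k by (auto simp: ar_mk dest: mk_inject[rotated])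
  qed (use k arE in auto)
next
  assume k: "ar k" "monic C (dm k) (cd k) (un k)"
  show "mono k" unfolding mono_def
  proof (intro conjI allI impI k(1))
    fix g h assume a: "ar g" "ar h" "cd g = dm k" "cd h = dm k" "k ** g = k ** h"
    have d: "dm g = dm h" using arg_cong[OF a(5), of dm] by simp
    have "un k \<cdot> un g = un k \<cdot> un h" using a k un_cmp[of k g] un_cmp[of k h] by simp
    then have "un g = un h" using k a d arE(1,3)[of g] arE(3)[of h] unfolding monic_def by (metis (no_types))
    then show "g = h" using a d by (intro un_inject) auto
  qed
qed

lemma epi_epic: "ar k \<Longrightarrow> epi k \<longleftrightarrow> epic C (dm k) (cd k) (un k)"
proof
  assume k: "ar k" "epi k"
  show "epic C (dm k) (cd k) (un k)"
    unfolding epic_def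
  proof (intro conjI ballI impI)
    fix z g h assume a: "z \<in> Ob C" "g \<in> Hom C (cd k) z" "h \<in> Hom C (cd k) z" "g \<cdot> un k = h \<cdot> un k"
    have "mk (cd k) g z ** k = mk (cd k) h z ** k"
      using a k by (intro un_inject) (auto simp: ar_mk un_cmp)
    then have "mk (cd k) g z = mk (cd k) h z" by (rule epiD[OF k(2)]) (use a k in \<open>auto simp: ar_mk\<close>)
    then show "g = h" using a k by (auto simp: ar_mk dest: mk_inject[rotated])
  qed (use k arE in auto)
next
  assume k: "ar k" "epic C (dm k) (cd k) (un k)"
  show "epi k" unfolding epi_def
  proof (intro conjI allI impI k(1))
    fix g h assume a: "ar g" "ar h" "dm g = cd k" "dm h = cd k" "g ** k = h ** k"
    have d: "cd g = cd h" using arg_cong[OF a(5), of cd] by simp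
    have "un g \<cdot> un k = un h \<cdot> un k" using a k un_cmp[of g k] un_cmp[of h k] by simp
    then have "un g = un h" using k a d arE(2,3)[of g] arE(3)[of h] unfolding epic_def by (metis (no_types))
    then show "g = h" using a d by (intro un_inject) auto
  qed
qed

lemma is_kernel_kernel:
  assumes "is_kernel C k x y i f" "y \<in> Ob C" "x \<in> Ob C"
  shows "kernel (mk x f y) (mk k i x)"
proof -
  have a: "k \<in> Ob C" "i \<in> Hom C k x" "f \<in> Hom C x y" "f \<cdot> i = zero_arrow C k y"
    and u: "\<And>z g. z \<in> Ob C \<Longrightarrow> g \<in> Hom C z x \<Longrightarrow> f \<cdot> g = zero_arrow C z y \<Longrightarrow> \<exists>!h. h \<in> Hom C z k \<and> i \<cdot> h = g"
    using assms(1) unfolding is_kernel_def by auto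
  have ar: "ar (mk x f y)" "ar (mk k i x)" using a assms by (auto simp: ar_mk)
  have u': "\<exists>h. ar h \<and> dm h = dm g \<and> cd h = k \<and> mk k i x ** h = g"
    if g: "ar g" "cd g = x" "mk x f y ** g = zr (dm g) y" for g
  proof -
    have "f \<cdot> un g = zero_arrow C (dm g) y"
      using arg_cong[OF g(3), of un] g(1,2) ar assms by (auto simp: un_cmp zr_def ar_mk zr_Ob)
    then obtain h where "h \<in> Hom C (dm g) k" "i \<cdot> h = un g"
      using u[of "dm g" "un g"] g arE(1,3)[of g] by auto
    then show ?thesis using g a ar
      by (intro exI[of _ "mk (dm g) h k"]) (auto intro!: un_inject simp: ar_mk un_cmp)
  qed
  have "mono (mk k i x)"
    unfolding mono_def
  proof (intro conjI allI impI ar)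
    fix g h assume g: "ar g" "ar h" "cd g = dm (mk k i x)" "cd h = dm (mk k i x)" "mk k i x ** g = mk k i x ** h"
    have d: "dm g = dm h" using arg_cong[OF g(5), of dm] by simp
    have e: "i \<cdot> un g = i \<cdot> un h" using g ar un_cmp[of "mk k i x" g] un_cmp[of "mk k i x" h] by simp
    have "f \<cdot> (i \<cdot> un g) = zero_arrow C (dm g) y"
      using a(4) comp_assoc[of "dm g" k x y "un g" i f] g a assms arE(1,3)[of g]
        zr_cmp[of g k y] un_cmp[of "zr k y" g] by (auto simp: zr_def ar_mk zr_Ob)
    then have "un g = un h" using u[of "dm g" "i \<cdot> un g"] e g a assms arE(1,3)[of g] arE(3)[of h] d
        comp_in_hom[of "dm g" k x "un g" i] by auto
    then show "g = h" using g d by (intro un_inject) auto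
  qed
  moreover have "mk x f y ** mk k i x = zr k y"
    using a ar assms by (intro un_inject) (auto simp: un_cmp zr_def ar_mk zr_Ob)
  ultimately show ?thesis unfolding kernel_def using ar u' by auto
qed

lemma is_coequalizer_coeq:
  assumes "is_coequalizer C x y f g q p" "f \<in> Hom C x y" "g \<in> Hom C x y" "y \<in> Ob C" "x \<in> Ob C"
  shows "coeq (mk x f y) (mk x g y) (mk y p q)"
proof -
  have a: "q \<in> Ob C" "p \<in> Hom C y q" "p \<cdot> f = p \<cdot> g"
    and u: "\<And>z r. z \<in> Ob C \<Longrightarrow> r \<in> Hom C y z \<Longrightarrow> r \<cdot> f = r \<cdot> g \<Longrightarrow> \<exists>!h. h \<in> Hom C q z \<and> h \<cdot> p = r"
    using assms(1) unfolding is_coequalizer_def by auto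
  have ar: "ar (mk x f y)" "ar (mk x g y)" "ar (mk y p q)" using a assms by (auto simp: ar_mk)
  have u': "\<exists>h. ar h \<and> dm h = q \<and> cd h = cd r \<and> h ** mk y p q = r"
    if g: "ar r" "dm r = y" "r ** mk x f y = r ** mk x g y" for r
  proof -
    have "un r \<cdot> f = un r \<cdot> g" using arg_cong[OF g(3), of un] g(1,2) ar by (simp add: un_cmp)
    then obtain h where "h \<in> Hom C q (cd r)" "h \<cdot> p = un r"
      using u[of "cd r" "un r"] g arE(2,3)[of r] by auto
    then show ?thesis using g a ar
      by (intro exI[of _ "mk q h (cd r)"]) (auto intro!: un_inject simp: ar_mk un_cmp)
  qed
  have "epi (mk y p q)"
    unfolding epi_def
  proof (intro conjI allI impI ar)
    fix r h assume g: "ar r" "ar h" "dm r = cd (mk y p q)" "dm h = cd (mk y p q)" "r ** mk y p q = h ** mk y p q"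
    have d: "cd r = cd h" using arg_cong[OF g(5), of cd] by simp
    have e: "un r \<cdot> p = un h \<cdot> p" using g ar un_cmp[of r "mk y p q"] un_cmp[of h "mk y p q"] by simp
    have r: "un r \<in> Hom C q (cd r)" "un h \<in> Hom C q (cd r)" "cd r \<in> Ob C"
      using g arE(2,3)[of r] arE(3)[of h] d by auto
    have "(un r \<cdot> p) \<cdot> f = (un r \<cdot> p) \<cdot> g"
      using a(3) comp_assoc[of x y q "cd r" f p "un r"] comp_assoc[of x y q "cd r" g p "un r"] a assms r by simp
    then have "un r = un h" using u[of "cd r" "un r \<cdot> p"] e r a assms comp_in_hom[of y q "cd r" p "un r"] by auto
    then show "r = h" using g d by (intro un_inject) auto
  qed
  moreover have "mk y p q ** mk x f y = mk y p q ** mk x g y"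
    using a ar assms by (intro un_inject) (auto simp: un_cmp)
  ultimately show ?thesis unfolding coeq_def using ar u' by auto
qed

lemma coeq_is_coequalizer:
  assumes "coeq f g p"
  shows "is_coequalizer C (dm f) (cd f) (un f) (un g) (cd p) (un p)"
proof -
  have a: "ar f" "ar g" "dm f = dm g" "cd f = cd g" "epi p" "ar p" "dm p = cd f" "p ** f = p ** g"
    and u: "\<And>r. ar r \<Longrightarrow> dm r = cd f \<Longrightarrow> r ** f = r ** g \<Longrightarrow> (\<exists>h. ar h \<and> dm h = cd p \<and> cd h = cd r \<and> h ** p = r)"
    using assms unfolding coeq_def epi_def by auto
  show ?thesis unfolding is_coequalizer_def
  proof (intro conjI ballI impI)
    show "un p \<cdot> un f = un p \<cdot> un g" using a un_cmp[of p f] un_cmp[of p g] by simp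
    fix z r assume r: "z \<in> Ob C" "r \<in> Hom C (cd f) z" "r \<cdot> un f = r \<cdot> un g"
    have ar: "ar (mk (cd f) r z)" using r a by (simp add: ar_mk)
    have "mk (cd f) r z ** f = mk (cd f) r z ** g" using ar a r by (intro un_inject) (auto simp: un_cmp)
    then obtain h where h: "ar h" "dm h = cd p" "cd h = z" "h ** p = mk (cd f) r z" using u ar by fastforce
    have hp: "un h \<cdot> un p = r" using un_cmp[of h p] h a ar by simp
    show "\<exists>!h. h \<in> Hom C (cd p) z \<and> h \<cdot> un p = r"
    proof (rule ex1I[of _ "un h"])
      show "un h \<in> Hom C (cd p) z \<and> un h \<cdot> un p = r" using hp h arE(3)[of h] by auto
      fix h' assume h': "h' \<in> Hom C (cd p) z \<and> h' \<cdot> un p = r"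
      have ar': "ar (mk (cd p) h' z)" using h' r a by (simp add: ar_mk)
      have "mk (cd p) h' z ** p = h ** p" using h' h a ar ar' hp by (intro un_inject) (auto simp: un_cmp)
      then have "mk (cd p) h' z = h" by (rule epiD[OF a(5)]) (use ar' h in auto)
      then show "h' = un h" using ar' by auto
    qed
  qed (use a arE(3)[of p] in auto)
qed

lemma ex_kernelT: assumes "ar f" obtains k where "kernel f k"
proof -
  obtain k i where "is_kernel C k (dm f) (cd f) i (un f)" using ex_kernel arE[OF assms] by blast
  then have "kernel (mk (dm f) (un f) (cd f)) (mk k i (dm f))"
    using is_kernel_kernel assms by simp
  then show ?thesis using that mk_un[OF assms] by simp
qed

lemma is_cokernel_is_coequalizer:
  assumes "is_cokernel C x y q f p" "x \<in> Ob C" "y \<in> Ob C"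
  shows "is_coequalizer C x y f (zero_arrow C x y) q p"
proof -
  have *: "r \<cdot> zero_arrow C x y = zero_arrow C x z" if "z \<in> Ob C" "r \<in> Hom C y z" for r z
    using cmp_zr[of "mk y r z" y x] un_cmp[of "mk y r z" "zr x y"] assms(2,3) that
    by (auto simp: ar_mk zr_def zr_Ob)
  show ?thesis using assms(1) unfolding is_cokernel_def is_coequalizer_def by (auto simp: *)
qed

lemma ex_cokernelT: assumes "ar f" obtains p where "coeq f (zr (dm f) (cd f)) p"
proof -
  obtain q p where "is_cokernel C (dm f) (cd f) q (un f) p" using ex_cokernel arE[OF assms] by blast
  note is_coequalizer_coeq[OF is_cokernel_is_coequalizer[OF this]]
  then have "coeq (mk (dm f) (un f) (cd f)) (mk (dm f) (zero_arrow C (dm f) (cd f)) (cd f)) (mk (cd f) p q)"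
    using assms arE[OF assms] zr_Ob by auto
  then show ?thesis using that mk_un[OF assms] by (auto simp: zr_def)
qed

text \<open>A cokernel of the difference of \<open>f\<close> and \<open>g\<close> is a coequalizer
  of the two.\<close>

lemma ex_coeq: assumes "ar f" "ar g" "dm f = dm g" "cd f = cd g" obtains p where "coeq f g p"
proof -
  let ?d = "f \<boxplus> ng g"
  obtain p where p: "coeq ?d (zr (dm ?d) (cd ?d)) p" using assms by (metis ex_cokernelT ar_add ar_ng dm_ng cd_ng)
  have *: "r ** ?d = r ** zr (dm ?d) (cd ?d) \<longleftrightarrow> r ** f = r ** g" if "ar r" "dm r = cd f" for r
    using add_ng_eq_zr[of "r ** f" "r ** g"] that assms by (auto simp: cmp_add_r cmp_ng)
  have "coeq f g p" using p * assms unfolding coeq_def epi_def by auto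
  then show ?thesis by (rule that)
qed

lemma mono_is_kernel:
  assumes "mono k" obtains f where "kernel f k"
proof -
  obtain z f where "z \<in> Ob C" "is_kernel C (dm k) (cd k) z (un k) f"
    using monic_normal[of "dm k" "cd k" "un k"] mono_monic ar_mono assms by (metis cd_Ob dm_Ob)
  then have "kernel (mk (cd k) f z) (mk (dm k) (un k) (cd k))"
    using is_kernel_kernel ar_mono[OF assms] by simp
  then show ?thesis using that mk_un ar_mono[OF assms] by auto
qed

lemma epi_is_cokernel:
  assumes "epi p" obtains f where "coeq f (zr (dm f) (cd f)) p" "cd f = dm p"
proof -
  obtain z f where z: "z \<in> Ob C" "is_cokernel C z (dm p) (cd p) f (un p)"
    using epic_normal[of "dm p" "cd p" "un p"] epi_epic ar_epi assms by (metis cd_Ob dm_Ob)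
  have "f \<in> Hom C z (dm p)" using z by (auto simp: is_cokernel_def)
  then have "coeq (mk z f (dm p)) (mk z (zero_arrow C z (dm p)) (dm p)) (mk (dm p) (un p) (cd p))"
    using is_coequalizer_coeq[OF is_cokernel_is_coequalizer[OF z(2,1)]] z ar_epi[OF assms] zr_Ob by auto
  then show ?thesis using that[of "mk z f (dm p)"] mk_un ar_epi[OF assms] by (auto simp: zr_def)
qed

text \<open>By the abelian axioms \<open>p\<close> is a cokernel of some \<open>f\<close>, and
  \<open>f\<close> factors through \<open>k\<close>. An arrow that kills \<open>k\<close> therefore
  kills \<open>f\<close> and factors through \<open>p\<close>.\<close>

lemma epi_coeq_kernel:
  assumes p: "epi p" and k: "kernel p k" shows "coeq k (zr (dm k) (cd k)) p"
proof -
  obtain f where f: "coeq f (zr (dm f) (cd f)) p" using epi_is_cokernel p by blast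
  note af = cokerD[OF f] and ak = kernelD[OF k]
  obtain j where j: "ar j" "dm j = dm f" "cd j = dm k" "k ** j = f"
    using kernel_ex[OF k af(1)] af by metis
  have "\<exists>h. ar h \<and> dm h = cd p \<and> cd h = cd r \<and> h ** p = r"
    if r: "ar r" "dm r = cd k" "r ** k = r ** zr (dm k) (cd k)" for r
  proof -
    have "r ** f = r ** k ** j" by (simp add: j(4))
    also have "\<dots> = zr (dm f) (cd r)" using r(1,2) ak(1-4) j(1-3) by (simp add: ra[OF r(3)])
    finally show ?thesis using coker_ex[OF f r(1)] r(2) ak(4) af(4) by metis
  qed
  then show ?thesis using ak af(3) p unfolding coeq_def by auto
qed

text \<open>Dually, \<open>k\<close> is a kernel of some \<open>f\<close>, and \<open>f\<close>
  factors through the cokernel \<open>p\<close>. Whatever \<open>p\<close> kills is killed by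
  \<open>f\<close> and factors through \<open>k\<close>.\<close>

lemma mono_kernel_coker:
  assumes k: "mono k" and p: "coeq k (zr (dm k) (cd k)) p" shows "kernel p k"
proof -
  obtain f where f: "kernel f k" using mono_is_kernel k by blast
  note af = kernelD[OF f] and ap = cokerD[OF p]
  obtain h where h: "ar h" "dm h = cd p" "cd h = cd f" "h ** p = f"
    using coker_ex[OF p af(1)] af by metis
  have "\<exists>j. ar j \<and> dm j = dm g \<and> cd j = dm k \<and> k ** j = g"
    if g: "ar g" "cd g = dm p" "p ** g = zr (dm g) (cd p)" for g
  proof -
    have "f ** g = h ** p ** g" by (simp add: ra[OF h(4)])
    also have "\<dots> = zr (dm g) (cd f)" using g(1,2) h(1-3) ap(3) by (simp add: g(3))
    finally show ?thesis using kernel_ex[OF f g(1)] g(2) af(4) ap(4) by metis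
  qed
  then show ?thesis using k ap unfolding kernel_def by auto
qed

text \<open>Built from the product: the injections are the pairings of identity with zero and of
  zero with identity, and the last equation holds because the projections are jointly monic.\<close>

lemma ex_biproduct:
  assumes "x \<in> Ob C" "y \<in> Ob C"
  obtains P i j p q where "P \<in> Ob C" "ar i" "ar j" "ar p" "ar q" "dm i = x" "dm j = y" "cd i = P" "cd j = P"
    "dm p = P" "dm q = P" "cd p = x" "cd q = y" "p ** i = I x" "q ** j = I y" "p ** j = zr y x" "q ** i = zr x y"
    "(i ** p) \<boxplus> (j ** q) = I P"
proof -
  obtain P p where P: "is_product C (UNIV :: bool set) (\<lambda>b. if b then x else y) P p"
    using ex_binary_product assms by blast
  define p1 p2 where "p1 = mk P (p True) x" and "p2 = mk P (p False) y"
  have a: "P \<in> Ob C" "p True \<in> Hom C P x" "p False \<in> Hom C P y"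
    and u: "\<And>Y g. Y \<in> Ob C \<Longrightarrow> (\<forall>b. g b \<in> Hom C Y (if b then x else y)) \<Longrightarrow>
        \<exists>!h. h \<in> Hom C Y P \<and> (\<forall>b. p b \<cdot> h = g b)"
    using P unfolding is_product_def by (auto split: if_splits)
  have ar: "ar p1" "ar p2" "dm p1 = P" "dm p2 = P" "cd p1 = x" "cd p2 = y" "un p1 = p True" "un p2 = p False"
    using a assms by (auto simp: p1_def p2_def ar_mk)
  have e: "\<exists>h. ar h \<and> dm h = dm g1 \<and> cd h = P \<and> p1 ** h = g1 \<and> p2 ** h = g2"
    if g: "ar g1" "ar g2" "cd g1 = x" "cd g2 = y" "dm g1 = dm g2" for g1 g2
  proof -
    obtain h where h: "h \<in> Hom C (dm g1) P" "p True \<cdot> h = un g1" "p False \<cdot> h = un g2"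
      using u[of "dm g1" "\<lambda>b. if b then un g1 else un g2"] g arE[of g1] arE[of g2]
      by (auto split: if_splits) (metis (full_types))
    then show ?thesis using g a ar
      by (intro exI[of _ "mk (dm g1) h P"]) (auto intro!: un_inject simp: ar_mk un_cmp)
  qed
  have jm: "g = h" if g: "ar g" "ar h" "cd g = P" "cd h = P" "p1 ** g = p1 ** h" "p2 ** g = p2 ** h" for g h
  proof -
    have d: "dm g = dm h" using arg_cong[OF g(5), of dm] by simp
    have "p True \<cdot> un g = p True \<cdot> un h" "p False \<cdot> un g = p False \<cdot> un h"
      using g ar un_cmp[of p1 g] un_cmp[of p1 h] un_cmp[of p2 g] un_cmp[of p2 h] by auto
    then have "\<forall>b. p b \<cdot> un g = p b \<cdot> un h" by (metis (full_types))
    moreover have "\<forall>b. p b \<cdot> un g \<in> Hom C (dm g) (if b then x else y)"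
      using g(1-4) ar arE(3)[of "p1 ** g"] arE(3)[of "p2 ** g"] un_cmp[of p1 g] un_cmp[of p2 g]
      by (auto split: if_splits) 
    ultimately have "un g = un h" using u[of "dm g" "\<lambda>b. p b \<cdot> un g"] g arE(1,3)[of g] arE(3)[of h] d
      by (metis)
    then show "g = h" using g d by (intro un_inject) auto
  qed
  obtain i where i: "ar i" "dm i = x" "cd i = P" "p1 ** i = I x" "p2 ** i = zr x y"
    using e[of "I x" "zr x y"] assms by auto
  obtain j where j: "ar j" "dm j = y" "cd j = P" "p2 ** j = I y" "p1 ** j = zr y x"
    using e[of "zr y x" "I y"] assms by auto
  have "(i ** p1) \<boxplus> (j ** p2) = I P"
    by (rule jm) (use ar i j a assms in \<open>auto simp: cmp_add_r ra[OF i(4)] ra[OF i(5)] ra[OF j(4)] ra[OF j(5)]\<close>)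
  then show ?thesis using that[of P i j p1 p2] ar i j a by blast
qed

text \<open>The image of \<open>e\<close> is the kernel \<open>s\<close> of the difference
  \<open>d\<close> of the identity and \<open>e\<close>. As \<open>d ** e\<close> is zero,
  \<open>e\<close> factors as \<open>s ** r\<close>; then \<open>s ** r ** s = e ** s = s\<close>,
  and \<open>s\<close> can be cancelled.\<close>

lemma idempotent_splits:
  assumes "ar e" "cd e = dm e" "e ** e = e"
  obtains s r where "ar s" "ar r" "cd s = dm e" "dm r = dm e" "cd r = dm s" "s ** r = e" "r ** s = I (dm s)"
proof -
  define d where "d = I (dm e) \<boxplus> ng e"
  have d: "ar d" "dm d = dm e" "cd d = dm e" using assms by (auto simp: d_def)
  have de: "d ** e = zr (dm e) (dm e)"
    using assms add_ng_eq_zr[of e e] by (simp add: d_def cmp_add_l ng_cmp)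
  obtain s where s: "kernel d s" using ex_kernelT d by blast
  have as: "ar s" "cd s = dm e" "mono s" "d ** s = zr (dm s) (dm e)"
    using s d by (auto simp: kernel_def mono_def)
  obtain r where r: "ar r" "dm r = dm e" "cd r = dm s" "s ** r = e"
    using s d de assms(1,2) unfolding kernel_def by metis
  have "e ** s = s"
    using as(4) add_ng_eq_zr[of s "e ** s"] as assms by (simp add: d_def cmp_add_l ng_cmp)
  then have "s ** (r ** s) = s ** I (dm s)" using as by (simp add: ra[OF r(4)])
  then have "r ** s = I (dm s)" by (rule monoD[OF as(3)]) (use as r in auto)
  then show ?thesis using that as r by blast
qed

lemma split_epi: "ar r \<Longrightarrow> ar s \<Longrightarrow> r ** s = I (cd r) \<Longrightarrow> dm r = cd s \<Longrightarrow> epi r"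
  unfolding epi_def by (metis cmp_I_right cmp_assoc)

lemma epi_cmp: "epi p \<Longrightarrow> epi q \<Longrightarrow> dm q = cd p \<Longrightarrow> epi (q ** p)"
  unfolding epi_def by (auto simp flip: cmp_assoc)

section \<open>Monoidal structure\<close>

abbreviation one :: "'o" where "one \<equiv> TUnit C"

definition isoT :: "('o, 'm) tarr \<Rightarrow> bool" where
  "isoT f \<longleftrightarrow> ar f \<and> (\<exists>g. ar g \<and> dm g = cd f \<and> cd g = dm f \<and> g ** f = I (dm f) \<and> f ** g = I (cd f))"

definition iv :: "('o, 'm) tarr \<Rightarrow> ('o, 'm) tarr" where
  "iv f = mk (cd f) (un (SOME g. ar g \<and> dm g = cd f \<and> cd g = dm f \<and> g ** f = I (dm f) \<and> f ** g = I (cd f))) (dm f)"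

lemma dm_iv [simp]: "dm (iv f) = cd f" and cd_iv [simp]: "cd (iv f) = dm f"
  by (simp_all add: iv_def)

lemma iv:
  assumes "isoT f"
  shows "ar f" "ar (iv f)" "iv f ** f = I (dm f)" "f ** iv f = I (cd f)"
proof -
  let ?g = "SOME g. ar g \<and> dm g = cd f \<and> cd g = dm f \<and> g ** f = I (dm f) \<and> f ** g = I (cd f)"
  have "\<exists>g. ar g \<and> dm g = cd f \<and> cd g = dm f \<and> g ** f = I (dm f) \<and> f ** g = I (cd f)"
    using assms by (simp add: isoT_def)
  note s = someI_ex[OF this]
  then have "iv f = ?g" unfolding iv_def using mk_un[of ?g] by auto
  then show "ar f" "ar (iv f)" "iv f ** f = I (dm f)" "f ** iv f = I (cd f)"
    using s assms by (auto simp: isoT_def)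
qed

lemma is_iso_isoT:
  assumes "is_iso C x y f" "x \<in> Ob C" "y \<in> Ob C" shows "isoT (mk x f y)"
proof -
  obtain g where g: "f \<in> Hom C x y" "g \<in> Hom C y x" "g \<cdot> f = Idn C x" "f \<cdot> g = Idn C y"
    using assms by (auto simp: is_iso_def)
  have "mk y g x ** mk x f y = I x" "mk x f y ** mk y g x = I y"
    using g assms by (simp_all add: I_def flip: cmp_mk)
  then show ?thesis unfolding isoT_def using g assms
    by (auto simp: ar_mk intro!: exI[of _ "mk y g x"])
qed

lemma isoT_cancel_left:
  assumes "isoT f" and e: "f ** g = f ** h" and "ar g" "ar h" "cd g = dm f" "cd h = dm f" shows "g = h"
proof -
  have "iv f ** f ** g = iv f ** f ** h" by (simp only: e)
  then show ?thesis using assms(3-) by (simp add: ra[OF iv(3)[OF assms(1)]])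
qed

lemma isoT_cancel_right:
  assumes "isoT f" and e: "g ** f = h ** f" and "ar g" "ar h" "dm g = cd f" "dm h = cd f" shows "g = h"
proof -
  have "(g ** f) ** iv f = (h ** f) ** iv f" by (simp only: e)
  then show ?thesis using assms(3-) by (simp add: iv(4)[OF assms(1)])
qed

section \<open>The associator, the unitors and the braiding\<close>

definition al where "al x y z = mk ((x \<boxtimes> y) \<boxtimes> z) (Assoc C x y z) (x \<boxtimes> (y \<boxtimes> z))"
definition la where "la x = mk (one \<boxtimes> x) (LUnit C x) x"
definition ro where "ro x = mk (x \<boxtimes> one) (RUnit C x) x"
definition br where "br x y = mk (x \<boxtimes> y) (Braid C x y) (y \<boxtimes> x)"
definition ai where "ai x y z = iv (al x y z)"
definition li where "li x = iv (la x)"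
definition ri where "ri x = iv (ro x)"

lemma dm_cd_struct [simp]:
  "dm (al x y z) = (x \<boxtimes> y) \<boxtimes> z" "cd (al x y z) = x \<boxtimes> (y \<boxtimes> z)"
  "dm (ai x y z) = x \<boxtimes> (y \<boxtimes> z)" "cd (ai x y z) = (x \<boxtimes> y) \<boxtimes> z"
  "dm (la x) = one \<boxtimes> x" "cd (la x) = x" "dm (li x) = x" "cd (li x) = one \<boxtimes> x"
  "dm (ro x) = x \<boxtimes> one" "cd (ro x) = x" "dm (ri x) = x" "cd (ri x) = x \<boxtimes> one"
  "dm (br x y) = x \<boxtimes> y" "cd (br x y) = y \<boxtimes> x"
  by (simp_all add: al_def la_def ro_def br_def ai_def li_def ri_def)

lemma al_iso: "x \<in> Ob C \<Longrightarrow> y \<in> Ob C \<Longrightarrow> z \<in> Ob C \<Longrightarrow> isoT (al x y z)"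
  unfolding al_def by (rule is_iso_isoT[OF assoc_iso]) auto
lemma la_iso: "x \<in> Ob C \<Longrightarrow> isoT (la x)"
  unfolding la_def by (rule is_iso_isoT[OF lunit_iso]) auto
lemma ro_iso: "x \<in> Ob C \<Longrightarrow> isoT (ro x)"
  unfolding ro_def by (rule is_iso_isoT[OF runit_iso]) auto

lemma ar_struct [simp]:
  "x \<in> Ob C \<Longrightarrow> y \<in> Ob C \<Longrightarrow> z \<in> Ob C \<Longrightarrow> ar (al x y z)"
  "x \<in> Ob C \<Longrightarrow> y \<in> Ob C \<Longrightarrow> z \<in> Ob C \<Longrightarrow> ar (ai x y z)"
  "x \<in> Ob C \<Longrightarrow> ar (la x)" "x \<in> Ob C \<Longrightarrow> ar (li x)"
  "x \<in> Ob C \<Longrightarrow> ar (ro x)" "x \<in> Ob C \<Longrightarrow> ar (ri x)"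
  "x \<in> Ob C \<Longrightarrow> y \<in> Ob C \<Longrightarrow> ar (br x y)"
  using iv[OF al_iso] iv[OF la_iso] iv[OF ro_iso]
  by (auto simp: ai_def li_def ri_def br_def ar_mk braid_in_hom)

lemma al_ai [simp]: "x \<in> Ob C \<Longrightarrow> y \<in> Ob C \<Longrightarrow> z \<in> Ob C \<Longrightarrow> al x y z ** ai x y z = I (x \<boxtimes> (y \<boxtimes> z))"
  and ai_al [simp]: "x \<in> Ob C \<Longrightarrow> y \<in> Ob C \<Longrightarrow> z \<in> Ob C \<Longrightarrow> ai x y z ** al x y z = I ((x \<boxtimes> y) \<boxtimes> z)"
  and la_li [simp]: "x \<in> Ob C \<Longrightarrow> la x ** li x = I x"
  and li_la [simp]: "x \<in> Ob C \<Longrightarrow> li x ** la x = I (one \<boxtimes> x)"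
  and ro_ri [simp]: "x \<in> Ob C \<Longrightarrow> ro x ** ri x = I x"
  and ri_ro [simp]: "x \<in> Ob C \<Longrightarrow> ri x ** ro x = I (x \<boxtimes> one)"
  using iv[OF al_iso] iv[OF la_iso] iv[OF ro_iso] by (auto simp: ai_def li_def ri_def)

lemma br_br [simp]: "x \<in> Ob C \<Longrightarrow> y \<in> Ob C \<Longrightarrow> br y x ** br x y = I (x \<boxtimes> y)"
  using braid_symmetric[of x y] braid_in_hom[of x y] braid_in_hom[of y x]
  by (simp add: br_def I_def flip: cmp_mk)

lemmas al_ai2 [simp] = ra[OF al_ai] and ai_al2 [simp] = ra[OF ai_al]
  and la_li2 [simp] = ra[OF la_li] and li_la2 [simp] = ra[OF li_la]
  and ro_ri2 [simp] = ra[OF ro_ri] and ri_ro2 [simp] = ra[OF ri_ro]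
  and br_br2 [simp] = ra[OF br_br]

lemma un_al: "x \<in> Ob C \<Longrightarrow> y \<in> Ob C \<Longrightarrow> z \<in> Ob C \<Longrightarrow> un (al x y z) = Assoc C x y z"
  using ar_struct(1)[of x y z] by (simp add: al_def)
lemma un_la: "x \<in> Ob C \<Longrightarrow> un (la x) = LUnit C x"
  using ar_struct(3)[of x] by (simp add: la_def)
lemma un_ro: "x \<in> Ob C \<Longrightarrow> un (ro x) = RUnit C x"
  using ar_struct(5)[of x] by (simp add: ro_def)
lemma un_br: "x \<in> Ob C \<Longrightarrow> y \<in> Ob C \<Longrightarrow> un (br x y) = Braid C x y"
  using ar_struct(7)[of x y] by (simp add: br_def)
lemmas un_simps = un_al un_la un_ro un_br un_cmp un_tns un_I un_add

lemma al_nat: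
  assumes "ar f" "ar g" "ar h" "cd f = x" "cd g = y" "cd h = z"
  shows "al x y z ** ((f >< g) >< h) = (f >< (g >< h)) ** al (dm f) (dm g) (dm h)"
  using assms assoc_natural[OF dm_Ob cd_Ob dm_Ob cd_Ob dm_Ob cd_Ob, of f f g g h h "un f" "un g" "un h"]
  by (intro un_inject) (auto simp: un_simps arE)

lemma ai_nat:
  assumes "ar f" "ar g" "ar h" "cd f = x" "cd g = y" "cd h = z"
  shows "ai x y z ** (f >< (g >< h)) = ((f >< g) >< h) ** ai (dm f) (dm g) (dm h)"
proof (rule isoT_cancel_left[OF al_iso, of x y z])
  show "al x y z ** ai x y z ** f >< g >< h = al x y z ** ((f >< g) >< h) ** ai (dm f) (dm g) (dm h)"
    using assms by (auto simp: ra[OF al_nat])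
qed (use assms in auto)

lemma la_nat:
  assumes "ar f" "cd f = x" shows "la x ** (I one >< f) = f ** la (dm f)"
  using assms lunit_natural[OF dm_Ob cd_Ob, of f f "un f"]
  by (intro un_inject) (auto simp: un_simps arE)

lemma ro_nat:
  assumes "ar f" "cd f = x" shows "ro x ** (f >< I one) = f ** ro (dm f)"
  using assms runit_natural[OF dm_Ob cd_Ob, of f f "un f"]
  by (intro un_inject) (auto simp: un_simps arE)

lemma li_nat:
  assumes "ar f" "cd f = x" shows "li x ** f = (I one >< f) ** li (dm f)"
proof (rule isoT_cancel_left[OF la_iso, of x])
  show "la x ** li x ** f = la x ** (I one >< f) ** li (dm f)"
    using assms by (auto simp: ra[OF la_nat])
qed (use assms in auto)

lemma ri_nat:
  assumes "ar f" "cd f = x" shows "ri x ** f = (f >< I one) ** ri (dm f)"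
proof (rule isoT_cancel_left[OF ro_iso, of x])
  show "ro x ** ri x ** f = ro x ** (f >< I one) ** ri (dm f)"
    using assms by (auto simp: ra[OF ro_nat])
qed (use assms in auto)

lemma br_nat:
  assumes "ar f" "ar g" "cd f = x" "cd g = y" shows "br x y ** (f >< g) = (g >< f) ** br (dm f) (dm g)"
  using assms braid_natural[OF dm_Ob cd_Ob dm_Ob cd_Ob, of f f g g "un f" "un g"]
  by (intro un_inject) (auto simp: un_simps arE)

lemmas nat2 = al_nat[THEN ra, simplified cmp_assoc] ai_nat[THEN ra, simplified cmp_assoc]
  la_nat[THEN ra, simplified cmp_assoc] ro_nat[THEN ra, simplified cmp_assoc]
  br_nat[THEN ra, simplified cmp_assoc]
lemmas al_nat2 = nat2(1) and ai_nat2 = nat2(2) and la_nat2 = nat2(3) and ro_nat2 = nat2(4) and br_nat2 = nat2(5)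
lemmas li_nat2 = li_nat[THEN ra, simplified cmp_assoc] and ri_nat2 = ri_nat[THEN ra, simplified cmp_assoc]

lemma pentagonT:
  assumes [simp]: "w \<in> Ob C" "x \<in> Ob C" "y \<in> Ob C" "z \<in> Ob C"
  shows "al w x (y \<boxtimes> z) ** al (w \<boxtimes> x) y z = (I w >< al x y z) ** al w (x \<boxtimes> y) z ** (al w x y >< I z)"
  using pentagon[of w x y z] by (intro un_inject) (auto simp: un_simps)

lemma triangleT:
  assumes [simp]: "x \<in> Ob C" "y \<in> Ob C"
  shows "(I x >< la y) ** al x one y = ro x >< I y"
  using triangle[of x y] by (intro un_inject) (auto simp: un_simps)

lemma hexagonT:
  assumes [simp]: "x \<in> Ob C" "y \<in> Ob C" "z \<in> Ob C"
  shows "al y z x ** br x (y \<boxtimes> z) ** al x y z = (I y >< br x z) ** al y x z ** (br x y >< I z)"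
  using hexagon[of x y z] by (intro un_inject) (auto simp: un_simps)

section \<open>Coherence laws derived from pentagon, triangle and hexagon\<close>

lemma faithful_R:
  assumes "f >< I one = g >< I one" "ar f" "ar g" "dm f = dm g" "cd f = cd g" shows "f = g"
proof (rule isoT_cancel_right[OF ro_iso, of "dm f"])
  show "f ** ro (dm f) = g ** ro (dm f)"
    using ro_nat[of f "cd f"] ro_nat[of g "cd g"] assms by simp
qed (use assms in auto)

lemma faithful_L:
  assumes "I one >< f = I one >< g" "ar f" "ar g" "dm f = dm g" "cd f = cd g" shows "f = g"
proof (rule isoT_cancel_right[OF la_iso, of "dm f"])
  show "f ** la (dm f) = g ** la (dm f)"
    using la_nat[of f "cd f"] la_nat[of g "cd g"] assms by simp
qed (use assms in auto)

text \<open>Kelly's argument: tensoring with the unit is faithful, and after it both sides can be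
  compared through the pentagon at \<open>x, y, one, one\<close> and the triangle.\<close>

lemma kelly_ro:
  assumes [simp]: "x \<in> Ob C" "y \<in> Ob C"
  shows "(I x >< ro y) ** al x y one = ro (x \<boxtimes> y)"
proof (rule faithful_R, rule isoT_cancel_left[OF al_iso, of x y one])
  have "al x y one ** ((I x >< ro y) ** al x y one) >< I one
      = al x y one ** ((I x >< ro y) >< I one) ** (al x y one >< I one)"
    by (simp add: mg)
  also have "\<dots> = (I x >< (ro y >< I one)) ** al x (y \<boxtimes> one) one ** (al x y one >< I one)"
    by (simp add: al_nat2)
  also have "ro y >< I one = (I y >< la one) ** al y one one"
    by (simp add: triangleT)
  also have "I x >< ((I y >< la one) ** al y one one) = (I x >< (I y >< la one)) ** (I x >< al y one one)"
    by (simp add: mg)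
  also have "\<dots> ** al x (y \<boxtimes> one) one ** (al x y one >< I one)
      = (I x >< (I y >< la one)) ** al x y (one \<boxtimes> one) ** al (x \<boxtimes> y) one one"
    by (simp add: pentagonT)
  also have "\<dots> = al x y one ** ((I x >< I y) >< la one) ** al (x \<boxtimes> y) one one"
    by (simp add: al_nat2 del: I_tns)
  also have "\<dots> = al x y one ** (ro (x \<boxtimes> y) >< I one)"
    by (simp add: triangleT)
  finally show "al x y one ** ((I x >< ro y) ** al x y one) >< I one = al x y one ** ro (x \<boxtimes> y) >< I one" .
qed auto

text \<open>The mirror image of \<open>kelly_ro\<close>. After tensoring with the unit on the left,
  two associators have to be cancelled on the right.\<close>

lemma kelly_la:
  assumes [simp]: "x \<in> Ob C" "y \<in> Ob C"
  shows "la (x \<boxtimes> y) ** al one x y = la x >< I y"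
proof -
  have "isoT (al one one x)" by (simp add: al_iso)
  note i = iv[OF this]
  have iso: "isoT (al one one x >< I y)"
    unfolding isoT_def using i by (intro conjI exI[of _ "iv (al one one x) >< I y"]) (auto simp: mg)
  have "((I one >< (la (x \<boxtimes> y) ** al one x y)) ** al one (one \<boxtimes> x) y) ** (al one one x >< I y)
      = (I one >< la (x \<boxtimes> y)) ** (I one >< al one x y) ** al one (one \<boxtimes> x) y ** (al one one x >< I y)"
    by (simp add: mg)
  also have "\<dots> = (I one >< la (x \<boxtimes> y)) ** al one one (x \<boxtimes> y) ** al (one \<boxtimes> one) x y"
    by (simp add: pentagonT)
  also have "\<dots> = (ro one >< (I x >< I y)) ** al (one \<boxtimes> one) x y"
    by (simp add: ra[OF triangleT])
  also have "\<dots> = al one x y ** ((ro one >< I x) >< I y)"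
    by (simp add: al_nat del: I_tns)
  also have "\<dots> = al one x y ** ((I one >< la x) >< I y) ** (al one one x >< I y)"
    by (simp add: mg triangleT)
  also have "\<dots> = ((I one >< (la x >< I y)) ** al one (one \<boxtimes> x) y) ** (al one one x >< I y)"
    by (simp add: al_nat2)
  finally have "(I one >< (la (x \<boxtimes> y) ** al one x y)) ** al one (one \<boxtimes> x) y = (I one >< (la x >< I y)) ** al one (one \<boxtimes> x) y"
    by (rule isoT_cancel_right[OF iso]) auto
  then have "I one >< (la (x \<boxtimes> y) ** al one x y) = I one >< (la x >< I y)"
    by (rule isoT_cancel_right[OF al_iso, rotated 3]) auto
  then show ?thesis by (rule faithful_L) auto
qed

lemma br_iso: "x \<in> Ob C \<Longrightarrow> y \<in> Ob C \<Longrightarrow> isoT (br x y)"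
  unfolding isoT_def by (intro conjI exI[of _ "br y x"]) auto

text \<open>The hexagon at \<open>x, one, one\<close>, read after tensoring with the unit and
  composing with the isomorphism \<open>br x one\<close>.\<close>

lemma la_br:
  assumes [simp]: "x \<in> Ob C"
  shows "la x ** br x one = ro x"
proof (rule faithful_R, rule isoT_cancel_left[OF br_iso, of x one])
  have "br x one ** ((la x ** br x one) >< I one) = br x one ** (la x >< I one) ** (br x one >< I one)"
    by (simp add: mg)
  also have "\<dots> = br x one ** la (x \<boxtimes> one) ** al one x one ** (br x one >< I one)"
    by (simp add: ra[OF kelly_la])
  also have "\<dots> = la (one \<boxtimes> x) ** (I one >< br x one) ** al one x one ** (br x one >< I one)"
    by (simp add: la_nat2)
  also have "\<dots> = la (one \<boxtimes> x) ** al one one x ** br x (one \<boxtimes> one) ** al x one one"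
    by (simp add: hexagonT)
  also have "\<dots> = (la one >< I x) ** br x (one \<boxtimes> one) ** al x one one"
    by (simp add: ra[OF kelly_la])
  also have "\<dots> = br x one ** (I x >< la one) ** al x one one"
    by (simp add: br_nat2)
  also have "\<dots> = br x one ** (ro x >< I one)"
    by (simp add: triangleT)
  finally show "br x one ** ((la x ** br x one) >< I one) = br x one ** (ro x >< I one)" .
qed auto

lemma ro_br:
  assumes [simp]: "x \<in> Ob C"
  shows "ro x ** br one x = la x"
  by (simp flip: la_br)

lemma br_tens_right:
  assumes [simp]: "x \<in> Ob C" "y \<in> Ob C" "z \<in> Ob C"
  shows "br x (y \<boxtimes> z) = ai y z x ** (I y >< br x z) ** al y x z ** (br x y >< I z) ** ai x y z"
proof -
  have "ai y z x ** (al y z x ** br x (y \<boxtimes> z) ** al x y z) ** ai x y z = br x (y \<boxtimes> z)" by simp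
  then show ?thesis unfolding hexagonT[OF assms] by simp
qed

text \<open>The second hexagon. Since the braiding is symmetric, it suffices to compose with
  \<open>br z (x \<boxtimes> y)\<close>, which \<open>br_tens_right\<close> expands into the inverse
  factors.\<close>

lemma br_tens_left:
  assumes [simp]: "x \<in> Ob C" "y \<in> Ob C" "z \<in> Ob C"
  shows "br (x \<boxtimes> y) z = al z x y ** (br x z >< I y) ** ai x z y ** (I x >< br y z) ** al x y z"
    (is "_ = ?r")
proof (rule isoT_cancel_left[OF br_iso, of z "x \<boxtimes> y"])
  have "br z (x \<boxtimes> y) ** ?r = ai x y z ** (I x >< br z y) ** al x z y ** ((br z x >< I y) ** (br x z >< I y)) ** ai x z y ** (I x >< br y z) ** al x y z"
    by (simp add: br_tens_right)
  also have "\<dots> = ai x y z ** ((I x >< br z y) ** (I x >< br y z)) ** al x y z"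
    by (simp add: mg)
  also have "\<dots> = I ((x \<boxtimes> y) \<boxtimes> z)" by (simp add: mg)
  finally show "br z (x \<boxtimes> y) ** br (x \<boxtimes> y) z = br z (x \<boxtimes> y) ** ?r" by simp
qed auto

section \<open>Closedness, and what the tensor product preserves because of it\<close>

definition exponential :: "'o \<Rightarrow> 'o \<Rightarrow> 'o \<Rightarrow> ('o, 'm) tarr \<Rightarrow> bool" where
  "exponential y z H ev \<longleftrightarrow> H \<in> Ob C \<and> ar ev \<and> dm ev = H \<boxtimes> y \<and> cd ev = z \<and>
     (\<forall>x f. x \<in> Ob C \<longrightarrow> ar f \<longrightarrow> dm f = x \<boxtimes> y \<longrightarrow> cd f = z \<longrightarrow>
       (\<exists>g. ar g \<and> dm g = x \<and> cd g = H \<and> ev ** (g >< I y) = f)) \<and>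
     (\<forall>g g'. ar g \<longrightarrow> ar g' \<longrightarrow> dm g = dm g' \<longrightarrow> cd g = H \<longrightarrow> cd g' = H \<longrightarrow>
       ev ** (g >< I y) = ev ** (g' >< I y) \<longrightarrow> g = g')"

lemma ex_exponential:
  assumes "y \<in> Ob C" "z \<in> Ob C" obtains H ev where "exponential y z H ev"
proof -
  obtain H ev where H: "H \<in> Ob C" "ev \<in> Hom C (H \<boxtimes> y) z"
    and u: "\<And>x f. x \<in> Ob C \<Longrightarrow> f \<in> Hom C (x \<boxtimes> y) z \<Longrightarrow> \<exists>!g. g \<in> Hom C x H \<and> ev \<cdot> (g \<star> Idn C y) = f"
    using closed[OF assms] by blast
  let ?ev = "mk (H \<boxtimes> y) ev z"
  have aev: "ar ?ev" using H assms by (simp add: ar_mk)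
  have unev: "un (?ev ** (g >< I y)) = ev \<cdot> (un g \<star> Idn C y)" if "ar g" "cd g = H" for g
    using that assms aev by (simp add: un_simps)
  show ?thesis
  proof (rule that[of H ?ev], unfold exponential_def, intro conjI allI impI)
    show "ar ?ev" by (rule aev)
    fix x f assume a: "x \<in> Ob C" "ar f" "dm f = x \<boxtimes> y" "cd f = z"
    then obtain g where g: "g \<in> Hom C x H" "ev \<cdot> (g \<star> Idn C y) = un f"
      using u[of x "un f"] arE(3)[of f] by auto
    have ag: "ar (mk x g H)" using g a H by (simp add: ar_mk)
    have "?ev ** (mk x g H >< I y) = f"
      using unev[of "mk x g H"] ag aev g a assms by (intro un_inject) auto
    then show "\<exists>g. ar g \<and> dm g = x \<and> cd g = H \<and> ?ev ** (g >< I y) = f" using ag by (intro exI[of _ "mk x g H"]) auto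
  next
    fix g g' assume a: "ar g" "ar g'" "dm g = dm g'" "cd g = H" "cd g' = H"
      and e: "?ev ** (g >< I y) = ?ev ** (g' >< I y)"
    have eq: "ev \<cdot> (un g \<star> Idn C y) = ev \<cdot> (un g' \<star> Idn C y)"
      using arg_cong[OF e, of un] a unev by simp
    have h: "ev \<cdot> (un g \<star> Idn C y) \<in> Hom C (dm g \<boxtimes> y) z"
      using arE(3)[of "?ev ** (g >< I y)"] unev[of g] a aev assms by simp
    have "un g = un g'" using u[of "dm g", OF _ h] a eq arE(1,3)[of g] arE(3)[of g'] by auto
    then show "g = g'" using a by (intro un_inject) auto
  qed (use H in simp_all)
qed

lemma exponentialD:
  assumes "exponential y z H ev"
  shows "H \<in> Ob C" "ar ev" "dm ev = H \<boxtimes> y" "cd ev = z"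
    and "\<And>x f. x \<in> Ob C \<Longrightarrow> ar f \<Longrightarrow> dm f = x \<boxtimes> y \<Longrightarrow> cd f = z \<Longrightarrow>
       \<exists>g. ar g \<and> dm g = x \<and> cd g = H \<and> ev ** (g >< I y) = f"
    and "\<And>g g'. ev ** (g >< I y) = ev ** (g' >< I y) \<Longrightarrow> ar g \<Longrightarrow> ar g' \<Longrightarrow> dm g = dm g' \<Longrightarrow>
       cd g = H \<Longrightarrow> cd g' = H \<Longrightarrow> g = g'"
  using assms unfolding exponential_def by blast+

text \<open>Joint epicity of a family serves for single epimorphisms, for the cocone of a colimit
  and, with \<open>S\<close> empty, for objects that have at most one arrow to each target.\<close>

definition jepi :: "('o, 'm) tarr set \<Rightarrow> 'o \<Rightarrow> bool" where
  "jepi S L \<longleftrightarrow> (\<forall>c\<in>S. ar c \<and> cd c = L) \<and>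
     (\<forall>g h. ar g \<longrightarrow> ar h \<longrightarrow> dm g = L \<longrightarrow> dm h = L \<longrightarrow> cd g = cd h \<longrightarrow> (\<forall>c\<in>S. g ** c = h ** c) \<longrightarrow> g = h)"

lemma jepiD: "jepi S L \<Longrightarrow> ar g \<Longrightarrow> ar h \<Longrightarrow> dm g = L \<Longrightarrow> dm h = L \<Longrightarrow> cd g = cd h \<Longrightarrow>
  (\<And>c. c \<in> S \<Longrightarrow> g ** c = h ** c) \<Longrightarrow> g = h"
  unfolding jepi_def by blast

text \<open>Transposition to the internal hom turns composition with \<open>c >< I y\<close> into
  composition with \<open>c\<close>, so the transposes of \<open>g\<close> and \<open>h\<close>
  agree on the family and hence are equal.\<close>

lemma jepi_tns_right:
  assumes "jepi S L" "y \<in> Ob C" "L \<in> Ob C" shows "jepi ((\<lambda>c. c >< I y) ` S) (L \<boxtimes> y)"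
  unfolding jepi_def
proof (intro conjI allI impI ballI)
  fix g h assume a: "ar g" "ar h" "dm g = L \<boxtimes> y" "dm h = L \<boxtimes> y" "cd g = cd h"
    and e: "\<forall>c\<in>(\<lambda>c. c >< I y) ` S. g ** c = h ** c"
  have "cd g \<in> Ob C" using a by simp
  then obtain H ev where "exponential y (cd g) H ev" using ex_exponential assms(2) by blast
  note H = exponentialD(1-4)[OF this] and ex = exponentialD(5)[OF this] and un = exponentialD(6)[OF this]
  obtain g' where g': "ar g'" "dm g' = L" "cd g' = H" "ev ** (g' >< I y) = g" using ex[of L g] a assms by auto
  obtain h' where h': "ar h'" "dm h' = L" "cd h' = H" "ev ** (h' >< I y) = h" using ex[of L h] a assms by auto
  have "g' = h'"
  proof (rule jepiD[OF assms(1)])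
    fix c assume c: "c \<in> S"
    have ac: "ar c" "cd c = L" using assms(1) c by (auto simp: jepi_def)
    have "ev ** ((k ** c) >< I y) = (ev ** (k >< I y)) ** (c >< I y)" if "ar k" "dm k = L" for k
      using that ac assms(2) by (simp add: mg)
    then have "ev ** ((g' ** c) >< I y) = ev ** ((h' ** c) >< I y)"
      using g' h' e c by auto
    then show "g' ** c = h' ** c" by (rule un) (use g' h' ac in auto)
  qed (use g' h' in auto)
  then show "g = h" using g' h' by simp
qed (use assms in \<open>auto simp: jepi_def\<close>)

lemma jepi_epi: "ar p \<Longrightarrow> jepi {p} (cd p) \<longleftrightarrow> epi p"
proof -
  assume a: "ar p"
  show ?thesis
  proof
    assume j: "jepi {p} (cd p)"
    show "epi p" unfolding epi_def
    proof (intro conjI allI impI a)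
      fix g h assume g: "ar g" "ar h" "dm g = cd p" "dm h = cd p" "g ** p = h ** p"
      have "cd g = cd h" using arg_cong[OF g(5), of cd] by simp
      then show "g = h" by (rule jepiD[OF j g(1-4)]) (use g(5) in blast)
    qed
  next
    assume "epi p" then show "jepi {p} (cd p)"
      unfolding jepi_def using a by (blast intro: epiD)
  qed
qed

lemma jepi_iso:
  assumes "jepi S L" "isoT f" "dm f = L" shows "jepi ((\<lambda>c. f ** c) ` S) (cd f)"
  unfolding jepi_def
proof (intro conjI allI impI ballI)
  fix g h assume a: "ar g" "ar h" "dm g = cd f" "dm h = cd f" "cd g = cd h"
    and e: "\<forall>c\<in>(\<lambda>c. f ** c) ` S. g ** c = h ** c"
  have "g ** f = h ** f" by (rule jepiD[OF assms(1)]) (use a e iv[OF assms(2)] assms(3) in auto)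
  then show "g = h" by (rule isoT_cancel_right[OF assms(2)]) (use a in auto)
qed (use assms iv[OF assms(2)] in \<open>auto simp: jepi_def\<close>)

lemma jepi_tns_left:
  assumes "jepi S L" "y \<in> Ob C" "L \<in> Ob C" shows "jepi ((\<lambda>c. I y >< c) ` S) (y \<boxtimes> L)"
proof -
  have s: "ar c" "cd c = L" if "c \<in> S" for c using assms(1) that by (auto simp: jepi_def)
  have 1: "jepi ((\<lambda>c. br L y ** c) ` (\<lambda>c. c >< I y) ` S) (y \<boxtimes> L)"
    using jepi_iso[OF jepi_tns_right[OF assms] br_iso[of L y]] assms by simp
  have "(\<lambda>c. br L y ** c) ` (\<lambda>c. c >< I y) ` S = (\<lambda>c. (I y >< c) ** br (dm c) y) ` S"
    unfolding image_image by (rule image_cong) (use s assms in \<open>auto simp: br_nat\<close>)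
  then have 2: "jepi ((\<lambda>c. (I y >< c) ** br (dm c) y) ` S) (y \<boxtimes> L)" using 1 by simp
  show ?thesis
    unfolding jepi_def
  proof (intro conjI allI impI ballI)
    fix g h assume a: "ar g" "ar h" "dm g = y \<boxtimes> L" "dm h = y \<boxtimes> L" "cd g = cd h"
      and e: "\<forall>c\<in>(\<lambda>c. I y >< c) ` S. g ** c = h ** c"
    show "g = h"
    proof (rule jepiD[OF 2 a])
      fix c assume "c \<in> (\<lambda>c. (I y >< c) ** br (dm c) y) ` S"
      then obtain d where d: "d \<in> S" "c = (I y >< d) ** br (dm d) y" by auto
      then have "g ** (I y >< d) = h ** (I y >< d)" using e by auto
      from ra[OF this, of "br (dm d) y"] show "g ** c = h ** c" using d by simp
    qed
  qed (use assms s in auto)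
qed

lemma epi_tns_right: "epi p \<Longrightarrow> y \<in> Ob C \<Longrightarrow> epi (p >< I y)"
  using jepi_tns_right[of "{p}" "cd p" y] jepi_epi[of p] jepi_epi[of "p >< I y"] ar_epi[of p] by auto

lemma epi_tns_left: "epi p \<Longrightarrow> y \<in> Ob C \<Longrightarrow> epi (I y >< p)"
  using jepi_tns_left[of "{p}" "cd p" y] jepi_epi[of p] jepi_epi[of "I y >< p"] ar_epi[of p] by auto

lemma epi_tns: "epi p \<Longrightarrow> epi q \<Longrightarrow> epi (p >< q)"
  using epi_cmp[of "I (dm p) >< q" "p >< I (cd q)"] epi_tns_left[of q "dm p"] epi_tns_right[of p "cd q"]
    ar_epi[of p] ar_epi[of q] by (simp add: mg)

text \<open>A left adjoint preserves coequalizers: transpose \<open>r\<close>, factor the transpose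
  through \<open>p\<close>, and transpose back.\<close>

lemma coeq_tns_right:
  assumes "coeq f g p" "y \<in> Ob C" shows "coeq (f >< I y) (g >< I y) (p >< I y)"
proof -
  note p = coeqD[OF assms(1)]
  have "\<exists>h. ar h \<and> dm h = cd p \<boxtimes> y \<and> cd h = cd r \<and> h ** (p >< I y) = r"
    if r: "ar r" "dm r = cd f \<boxtimes> y" "r ** (f >< I y) = r ** (g >< I y)" for r
  proof -
    have "cd r \<in> Ob C" using r by simp
    then obtain H ev where "exponential y (cd r) H ev" using ex_exponential assms(2) by blast
    note H = exponentialD(1-4)[OF this] and ex = exponentialD(5)[OF this] and un = exponentialD(6)[OF this]
    obtain r' where r': "ar r'" "dm r' = cd f" "cd r' = H" "ev ** (r' >< I y) = r"
      using ex[of "cd f" r] r p by auto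
    have c: "ev ** ((r' ** k) >< I y) = r ** (k >< I y)" if "ar k" "cd k = cd f" for k
      using ra[OF r'(4), of "k >< I y"] that assms(2) r'(1-3) by (simp add: mg)
    have "ev ** ((r' ** f) >< I y) = ev ** ((r' ** g) >< I y)" using c[of f] c[of g] r(3) p by simp
    then have "r' ** f = r' ** g" by (rule un) (use p r' in auto)
    then obtain h where h: "ar h" "dm h = cd p" "cd h = H" "h ** p = r'"
      using coeq_ex[OF assms(1) r'(1,2)] r'(3) by metis
    have "(ev ** (h >< I y)) ** (p >< I y) = r"
      using h(1-3) p(1-6) assms(2) r'(4) H by (simp add: mg h(4))
    then show ?thesis using h H assms(2) by (intro exI[of _ "ev ** (h >< I y)"]) auto
  qed
  moreover have "(p >< I y) ** (f >< I y) = (p >< I y) ** (g >< I y)"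
    using p assms(2) by (simp add: mg)
  ultimately show ?thesis using p assms(2) epi_tns_right[OF p(5)] unfolding coeq_def by auto
qed

lemma coeq_tns_left:
  assumes "coeq f g p" "y \<in> Ob C" shows "coeq (I y >< f) (I y >< g) (I y >< p)"
proof -
  note p = coeqD[OF assms(1)]
  have o: "cd f \<in> Ob C" "dm f \<in> Ob C" "cd p \<in> Ob C" "cd g \<in> Ob C" "dm g \<in> Ob C" using p by auto
  have "\<exists>h. ar h \<and> dm h = y \<boxtimes> cd p \<and> cd h = cd r \<and> h ** (I y >< p) = r"
    if r: "ar r" "dm r = y \<boxtimes> cd f" "r ** (I y >< f) = r ** (I y >< g)" for r
  proof -
    have "(r ** br (cd f) y) ** (f >< I y) = (r ** (I y >< f)) ** br (dm f) y"
      using p(1-4) r(1-2) assms(2) o by (simp add: br_nat)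
    also have "\<dots> = (r ** br (cd f) y) ** (g >< I y)"
      unfolding r(3) using p(1-4) r(1-2) assms(2) o by (simp add: br_nat)
    finally obtain h where h: "ar h" "dm h = cd p \<boxtimes> y" "cd h = cd r" "h ** (p >< I y) = r ** br (cd f) y"
      using coeq_ex[OF coeq_tns_right[OF assms], of "r ** br (cd f) y"] r p assms(2) by auto
    have "(h ** br y (cd p)) ** (I y >< p) = (h ** (p >< I y)) ** br y (dm p)"
      using p h(1-3) assms(2) o by (simp add: br_nat)
    also have "\<dots> = r" unfolding h(4) using r(1,2) p o assms(2) by simp
    finally show ?thesis using h assms(2) o by (intro exI[of _ "h ** br y (cd p)"]) auto
  qed
  moreover have "(I y >< p) ** (I y >< f) = (I y >< p) ** (I y >< g)"
    using p assms(2) by (simp add: mg)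
  ultimately show ?thesis using p assms(2) epi_tns_left[OF p(5)] unfolding coeq_def by auto
qed

text \<open>The empty family is jointly epic on a zero object, and it remains so after
  tensoring.\<close>

lemma null_tns_right:
  assumes "ar f" "ar g" "dm f = null \<boxtimes> y" "dm g = null \<boxtimes> y" "cd f = cd g" "y \<in> Ob C"
  shows "f = g"
proof -
  have "jepi {} null" unfolding jepi_def by (metis empty_iff from_null)
  from jepi_tns_right[OF this assms(6)] have "jepi {} (null \<boxtimes> y)" by simp
  then show ?thesis by (rule jepiD) (use assms in auto)
qed

lemma zr_tns [simp]:
  assumes "ar f" "x \<in> Ob C" "y \<in> Ob C" shows "zr x y >< f = zr (x \<boxtimes> dm f) (y \<boxtimes> cd f)"
proof -
  have "zr x y >< f = (zr null y >< f) ** (zr x null >< I (dm f))"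
    using assms zr_via_null[of x y] by (simp add: mg)
  also have "zr null y >< f = zr (null \<boxtimes> dm f) (y \<boxtimes> cd f)"
    by (rule null_tns_right[where y = "dm f"]) (use assms in auto)
  finally show ?thesis using assms by simp
qed

lemma tns_zr [simp]:
  assumes "ar f" "x \<in> Ob C" "y \<in> Ob C" shows "f >< zr x y = zr (dm f \<boxtimes> x) (cd f \<boxtimes> y)"
proof -
  have "f >< zr x y = br y (cd f) ** (zr x y >< f) ** br (dm f) x"
    using assms by (simp add: br_nat2 del: zr_tns)
  then show ?thesis using assms by simp
qed

text \<open>Write \<open>f \<boxplus> g\<close> as \<open>k ** l\<close>, with \<open>l\<close> the
  diagonal into the biproduct \<open>P\<close> and \<open>k\<close> the copairing of
  \<open>f\<close> and \<open>g\<close>. The identity of the tensored biproduct still decomposes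
  into its two summands, because closedness keeps the injections jointly epic.\<close>

lemma add_tns:
  assumes "ar f" "ar g" "ar h" "dm f = dm g" "cd f = cd g"
  shows "(f \<boxplus> g) >< h = (f >< h) \<boxplus> (g >< h)"
proof -
  let ?x = "dm g" and ?y = "dm h"
  have o: "?x \<in> Ob C" "?y \<in> Ob C" "cd h \<in> Ob C" using assms by auto
  obtain P i j p q where P: "P \<in> Ob C" "ar i" "ar j" "ar p" "ar q" "dm i = ?x" "dm j = ?x" "cd i = P" "cd j = P"
    "dm p = P" "dm q = P" "cd p = ?x" "cd q = ?x" "p ** i = I ?x" "q ** j = I ?x" "p ** j = zr ?x ?x" "q ** i = zr ?x ?x"
    "(i ** p) \<boxplus> (j ** q) = I P"
    using ex_biproduct[OF o(1) o(1)] by metis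
  have je: "jepi {i, j} P"
    unfolding jepi_def
  proof (intro conjI allI impI ballI)
    fix g h assume a: "ar g" "ar h" "dm g = P" "dm h = P" "cd g = cd h" and e: "\<forall>c\<in>{i, j}. g ** c = h ** c"
    then have ij: "g ** i = h ** i" "g ** j = h ** j" by auto
    have k: "k = ((k ** i) ** p) \<boxplus> ((k ** j) ** q)" if "ar k" "dm k = P" for k
      using that cmp_add_r[of k "i ** p" "j ** q"] P(18) by simp
    show "g = h" using k[of g] k[of h] a ij by simp
  qed (use P in auto)
  have js: "jepi {i >< I ?y, j >< I ?y} (P \<boxtimes> ?y)" using jepi_tns_right[OF je o(2)] P by simp
  have d: "((i >< I ?y) ** (p >< I ?y)) \<boxplus> ((j >< I ?y) ** (q >< I ?y)) = I (P \<boxtimes> ?y)"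
    by (rule jepiD[OF js]) (use P o in \<open>auto simp: cmp_add_l mg\<close>)
  define k where "k = (f ** p) \<boxplus> (g ** q)"
  define l where "l = i \<boxplus> j"
  have k: "ar k" "dm k = P" "cd k = cd f" "k ** i = f" "k ** j = g"
    using P assms o by (auto simp: k_def cmp_add_l)
  have l: "ar l" "dm l = ?x" "cd l = P" "p ** l = I ?x" "q ** l = I ?x"
    using P assms o by (auto simp: l_def cmp_add_r)
  have kl: "k ** l = f \<boxplus> g" using k by (simp add: l_def cmp_add_r)
  have "(f \<boxplus> g) >< h = (k >< h) ** I (P \<boxtimes> ?y) ** (l >< I ?y)"
    using k(1-3) l(1-3) o assms by (simp add: mg kl)
  also have "\<dots> = ((k >< h) ** (i >< I ?y) ** (p >< I ?y) ** (l >< I ?y)) \<boxplus> ((k >< h) ** (j >< I ?y) ** (q >< I ?y) ** (l >< I ?y))"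
    unfolding d[symmetric] by (simp add: cmp_add_l cmp_add_r)
  also have "\<dots> = (f >< h) \<boxplus> (g >< h)"
    using k l P o assms by (simp add: mg)
  finally show ?thesis .
qed

section \<open>Monoids and modules\<close>

abbreviation CM :: "('o, 'm) mon \<Rightarrow> bool" where "CM A \<equiv> comm_monoid_object C A"
abbreviation MD :: "('o, 'm) mon \<Rightarrow> ('o, 'm) mdl \<Rightarrow> bool" where "MD A M \<equiv> module_object C A M"

definition mu where "mu A = mk (mon_ob A \<boxtimes> mon_ob A) (mon_mul A) (mon_ob A)"
definition et where "et A = mk one (mon_unit A) (mon_ob A)"
definition ac where "ac A M = mk (mon_ob A \<boxtimes> mdl_ob M) (mdl_act M) (mdl_ob M)"

lemma dm_cd_mon [simp]:
  "dm (mu A) = mon_ob A \<boxtimes> mon_ob A" "cd (mu A) = mon_ob A" "dm (et A) = one" "cd (et A) = mon_ob A"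
  "dm (ac A M) = mon_ob A \<boxtimes> mdl_ob M" "cd (ac A M) = mdl_ob M"
  by (simp_all add: mu_def et_def ac_def)

lemma CM_ar [simp]:
  assumes "CM A" shows "mon_ob A \<in> Ob C" "ar (mu A)" "ar (et A)"
  using assms by (auto simp: comm_monoid_object_def Let_def mu_def et_def ar_mk)

lemma un_mu [simp]: "CM A \<Longrightarrow> un (mu A) = mon_mul A"
  using CM_ar(2)[of A] by (simp add: mu_def)
lemma un_et [simp]: "CM A \<Longrightarrow> un (et A) = mon_unit A"
  using CM_ar(3)[of A] by (simp add: et_def)

lemma CM_iff:
  "CM A \<longleftrightarrow> mon_ob A \<in> Ob C \<and> ar (mu A) \<and> ar (et A) \<and>
    mu A ** (mu A >< I (mon_ob A)) = mu A ** (I (mon_ob A) >< mu A) ** al (mon_ob A) (mon_ob A) (mon_ob A) \<and>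
    mu A ** (et A >< I (mon_ob A)) = la (mon_ob A) \<and>
    mu A ** (I (mon_ob A) >< et A) = ro (mon_ob A) \<and>
    mu A ** br (mon_ob A) (mon_ob A) = mu A" (is "?l \<longleftrightarrow> ?r")
proof -
  let ?a = "mon_ob A"
  have *: "x = y \<longleftrightarrow> un x = un y" if "ar x" "ar y" "dm x = dm y" "cd x = cd y" for x y
    using un_inject that by auto
  have "?l \<longleftrightarrow> ?r" if t: "?a \<in> Ob C" "ar (mu A)" "ar (et A)"
  proof -
    have u: "un (mu A) = mon_mul A" "un (et A) = mon_unit A" using t by (auto simp: mu_def et_def)
    show ?thesis using t
      by (auto simp: comm_monoid_object_def Let_def * un_simps u) (auto simp: mu_def et_def ar_mk)
  qed
  then show ?thesis using CM_ar by blast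
qed

lemma mu_assoc: "CM A \<Longrightarrow> mu A ** (mu A >< I (mon_ob A)) = mu A ** (I (mon_ob A) >< mu A) ** al (mon_ob A) (mon_ob A) (mon_ob A)"
  and mu_et_left: "CM A \<Longrightarrow> mu A ** (et A >< I (mon_ob A)) = la (mon_ob A)"
  and mu_et_right: "CM A \<Longrightarrow> mu A ** (I (mon_ob A) >< et A) = ro (mon_ob A)"
  and mu_comm: "CM A \<Longrightarrow> mu A ** br (mon_ob A) (mon_ob A) = mu A"
  unfolding CM_iff by blast+

definition mkmon :: "('o, 'm) tarr \<Rightarrow> ('o, 'm) tarr \<Rightarrow> ('o, 'm) mon" where
  "mkmon m u = \<lparr>mon_ob = cd m, mon_mul = un m, mon_unit = un u\<rparr>"

lemma mon_ob_mkmon [simp]: "mon_ob (mkmon m u) = cd m"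
  by (simp add: mkmon_def)

lemma mkmon:
  assumes "ar m" "ar u" "cd m = a" "dm m = a \<boxtimes> a" "dm u = one" "cd u = a"
  shows "mu (mkmon m u) = m" "et (mkmon m u) = u"
  using assms mk_un[of m] mk_un[of u] by (auto simp: mu_def et_def mkmon_def)

text \<open>The right unit law is recovered from the left one through commutativity and
  \<open>la_br\<close>.\<close>

lemma CM_mkmon:
  assumes "ar m" "ar u" "cd m = a" "dm m = a \<boxtimes> a" "dm u = one" "cd u = a"
    "m ** (m >< I a) = m ** (I a >< m) ** al a a a" "m ** (u >< I a) = la a" "m ** br a a = m"
  shows "CM (mkmon m u)"
proof -
  have a: "a \<in> Ob C" using assms by auto
  have "m ** (I a >< u) = (m ** br a a) ** (I a >< u)" by (simp only: assms(9))
  also have "\<dots> = (m ** (u >< I a)) ** br a one" using assms(1-6) a by (simp add: br_nat)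
  also have "\<dots> = ro a" by (simp only: assms(8) la_br[OF a])
  finally show ?thesis
    unfolding CM_iff using mkmon[OF assms(1-6)] assms a by simp
qed

definition MM :: "('o, 'm) mon \<Rightarrow> ('o, 'm) mon \<Rightarrow> ('o, 'm) tarr \<Rightarrow> bool" where
  "MM A B f \<longleftrightarrow> CM A \<and> CM B \<and> ar f \<and> dm f = mon_ob A \<and> cd f = mon_ob B \<and>
     f ** mu A = mu B ** (f >< f) \<and> f ** et A = et B"

lemma MM_D:
  assumes "MM A B f"
  shows "CM A" "CM B" "ar f" "dm f = mon_ob A" "cd f = mon_ob B" "f ** mu A = mu B ** (f >< f)" "f ** et A = et B"
  using assms by (auto simp: MM_def)

lemma Ob_CommMon: "A \<in> Ob (CommMon C) \<longleftrightarrow> CM A"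
  by (simp add: CommMon_def)

lemma Hom_CommMon:
  assumes "CM A" "CM B"
  shows "f \<in> Hom (CommMon C) A B \<longleftrightarrow> MM A B (mk (mon_ob A) f (mon_ob B))"
proof (cases "f \<in> Hom C (mon_ob A) (mon_ob B)")
  case True
  let ?f = "mk (mon_ob A) f (mon_ob B)"
  have f: "ar ?f" using True assms by (simp add: ar_mk)
  have "f \<cdot> mon_mul A = mon_mul B \<cdot> (f \<star> f) \<longleftrightarrow> ?f ** mu A = mu B ** (?f >< ?f)"
    using un_inject[of "?f ** mu A" "mu B ** (?f >< ?f)"] f assms by (auto simp: un_simps dest: arg_cong[of _ _ un])
  moreover have "f \<cdot> mon_unit A = mon_unit B \<longleftrightarrow> ?f ** et A = et B"
    using un_inject[of "?f ** et A" "et B"] f assms by (auto simp: un_simps dest: arg_cong[of _ _ un])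
  ultimately show ?thesis using True f assms by (auto simp: CommMon_def MM_def)
next
  case False
  then show ?thesis by (auto simp: CommMon_def MM_def ar_mk)
qed

lemma MM_un: "MM A B f \<Longrightarrow> un f \<in> Hom (CommMon C) A B"
  using Hom_CommMon[of A B "un f"] MM_D[of A B f] mk_un[of f] by auto

lemma MM_mk_un: "MM A B f \<Longrightarrow> mk (mon_ob A) (un f) (mon_ob B) = f"
  using MM_D[of A B f] mk_un[of f] by auto

lemma MM_I: "CM A \<Longrightarrow> MM A A (I (mon_ob A))"
  by (simp add: MM_def)

lemma MM_cmp:
  assumes "MM A B f" "MM B D g" shows "MM A D (g ** f)"
proof -
  note f = MM_D[OF assms(1)] and g = MM_D[OF assms(2)]
  have "(g ** f) ** mu A = (g ** mu B) ** (f >< f)" using f(6) by simp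
  also have "\<dots> = mu D ** ((g ** f) >< (g ** f))" unfolding g(6) using f(1-5) g(1-5) by (simp add: mg)
  finally have 1: "(g ** f) ** mu A = mu D ** ((g ** f) >< (g ** f))" .
  have "(g ** f) ** et A = et D" using f(7) g(7) by simp
  then show ?thesis using 1 f(1-5) g(1-5) unfolding MM_def by simp
qed

lemma CommMon_comp [simp]: "Comp (CommMon C) = Comp C" and CommMon_Idn [simp]: "Idn (CommMon C) A = Idn C (mon_ob A)"
  by (simp_all add: CommMon_def)

lemma Mod_comp [simp]: "Comp (Mod C A) = Comp C" and Mod_Idn [simp]: "Idn (Mod C A) M = Idn C (mdl_ob M)"
  by (simp_all add: Mod_def)

lemma category_CommMon: "category (CommMon C)"
proof
  fix A assume "A \<in> Ob (CommMon C)"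
  then have "CM A" by (simp add: Ob_CommMon)
  then show "Idn (CommMon C) A \<in> Hom (CommMon C) A A"
    using MM_un[OF MM_I, of A] un_I[of "mon_ob A"] by simp
next
  fix A B D f g assume "A \<in> Ob (CommMon C)" "B \<in> Ob (CommMon C)" "D \<in> Ob (CommMon C)"
    and h: "f \<in> Hom (CommMon C) A B" "g \<in> Hom (CommMon C) B D"
  then have c: "CM A" "CM B" "CM D" by (auto simp: Ob_CommMon)
  have "MM A D (mk (mon_ob B) g (mon_ob D) ** mk (mon_ob A) f (mon_ob B))"
    using h c Hom_CommMon by (blast intro: MM_cmp)
  moreover have "un (mk (mon_ob B) g (mon_ob D) ** mk (mon_ob A) f (mon_ob B)) = g \<cdot> f"
    using h c by (subst un_cmp) (auto simp: CommMon_def ar_mk)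
  ultimately have "g \<cdot> f \<in> Hom (CommMon C) A D" using MM_un by metis
  then show "g \<cdot>\<^bsub>CommMon C\<^esub> f \<in> Hom (CommMon C) A D" by simp
next
  fix A B f assume "A \<in> Ob (CommMon C)" "B \<in> Ob (CommMon C)" "f \<in> Hom (CommMon C) A B"
  then have "mon_ob A \<in> Ob C" "mon_ob B \<in> Ob C" "f \<in> Hom C (mon_ob A) (mon_ob B)"
    by (simp_all add: Ob_CommMon) (simp add: CommMon_def)
  then show "f \<cdot>\<^bsub>CommMon C\<^esub> Idn (CommMon C) A = f" "Idn (CommMon C) B \<cdot>\<^bsub>CommMon C\<^esub> f = f"
    by (simp_all add: comp_id_left comp_id_right)
next
  fix A B D E f g h
  assume "A \<in> Ob (CommMon C)" "B \<in> Ob (CommMon C)" "D \<in> Ob (CommMon C)" "E \<in> Ob (CommMon C)"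
    "f \<in> Hom (CommMon C) A B" "g \<in> Hom (CommMon C) B D" "h \<in> Hom (CommMon C) D E"
  then have "mon_ob A \<in> Ob C" "mon_ob B \<in> Ob C" "mon_ob D \<in> Ob C" "mon_ob E \<in> Ob C"
    "f \<in> Hom C (mon_ob A) (mon_ob B)" "g \<in> Hom C (mon_ob B) (mon_ob D)" "h \<in> Hom C (mon_ob D) (mon_ob E)"
    by (simp_all add: Ob_CommMon) (simp_all add: CommMon_def)
  then show "(h \<cdot>\<^bsub>CommMon C\<^esub> g) \<cdot>\<^bsub>CommMon C\<^esub> f = h \<cdot>\<^bsub>CommMon C\<^esub> (g \<cdot>\<^bsub>CommMon C\<^esub> f)"
    using comp_assoc by simp
qed

section \<open>Modules over a commutative monoid\<close>

lemma MD_Ob [simp]: "MD A M \<Longrightarrow> mdl_ob M \<in> Ob C"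
  by (simp add: module_object_def Let_def)

lemma MD_ar [simp]: "CM A \<Longrightarrow> MD A M \<Longrightarrow> ar (ac A M)"
  unfolding module_object_def Let_def ac_def ar_mk by (blast intro: tens_ob CM_ar(1))

lemma un_ac [simp]: "CM A \<Longrightarrow> MD A M \<Longrightarrow> un (ac A M) = mdl_act M"
  using MD_ar[of A M] by (simp add: ac_def)

lemma MD_iff:
  assumes [simp]: "CM A"
  shows "MD A M \<longleftrightarrow> mdl_ob M \<in> Ob C \<and> ar (ac A M) \<and>
    ac A M ** (mu A >< I (mdl_ob M)) = ac A M ** (I (mon_ob A) >< ac A M) ** al (mon_ob A) (mon_ob A) (mdl_ob M) \<and>
    ac A M ** (et A >< I (mdl_ob M)) = la (mdl_ob M)" (is "?l \<longleftrightarrow> ?r")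
proof -
  have *: "x = y \<longleftrightarrow> un x = un y" if "ar x" "ar y" "dm x = dm y" "cd x = cd y" for x y
    using un_inject that by auto
  have "?l \<longleftrightarrow> ?r" if t: "mdl_ob M \<in> Ob C" "ar (ac A M)"
  proof -
    let ?a = "mon_ob A" and ?m = "mdl_ob M" and ?r = "mdl_act M"
    have u: "un (ac A M) = ?r" using t by (auto simp: ac_def)
    have h: "?r \<in> Hom C (?a \<boxtimes> ?m) ?m" using t(2) by (auto simp: ac_def ar_mk)
    have 1: "ac A M ** (mu A >< I ?m) = ac A M ** (I ?a >< ac A M) ** al ?a ?a ?m \<longleftrightarrow>
      ?r \<cdot> (mon_mul A \<star> Idn C ?m) = ?r \<cdot> ((Idn C ?a \<star> ?r) \<cdot> Assoc C ?a ?a ?m)"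
      using t by (subst *) (simp_all add: un_simps u)
    have 2: "ac A M ** (et A >< I ?m) = la ?m \<longleftrightarrow> ?r \<cdot> (mon_unit A \<star> Idn C ?m) = LUnit C ?m"
      using t by (subst *) (simp_all add: un_simps u)
    show ?thesis unfolding module_object_def Let_def 1 2 using t h by blast
  qed
  then show ?thesis using MD_Ob MD_ar[OF assms] by blast
qed

lemma ac_mu: "CM A \<Longrightarrow> MD A M \<Longrightarrow>
    ac A M ** (mu A >< I (mdl_ob M)) = ac A M ** (I (mon_ob A) >< ac A M) ** al (mon_ob A) (mon_ob A) (mdl_ob M)"
  and ac_et: "CM A \<Longrightarrow> MD A M \<Longrightarrow> ac A M ** (et A >< I (mdl_ob M)) = la (mdl_ob M)"
  by (simp_all add: MD_iff)

definition mkmdl :: "('o, 'm) tarr \<Rightarrow> ('o, 'm) mdl" where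
  "mkmdl r = \<lparr>mdl_ob = cd r, mdl_act = un r\<rparr>"

lemma mdl_ob_mkmdl [simp]: "mdl_ob (mkmdl r) = cd r"
  by (simp add: mkmdl_def)

lemma ac_mkmdl [simp]: "ar r \<Longrightarrow> dm r = mon_ob A \<boxtimes> cd r \<Longrightarrow> ac A (mkmdl r) = r"
  using mk_un[of r] by (simp add: ac_def mkmdl_def)

lemma MD_mkmdl:
  assumes "CM A" "ar r" "dm r = mon_ob A \<boxtimes> x" "cd r = x"
    "r ** (mu A >< I x) = r ** (I (mon_ob A) >< r) ** al (mon_ob A) (mon_ob A) x"
    "r ** (et A >< I x) = la x"
  shows "MD A (mkmdl r)"
proof -
  have "x \<in> Ob C" using assms by auto
  then show ?thesis using assms by (simp add: MD_iff)
qed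

definition LM :: "('o, 'm) mon \<Rightarrow> ('o, 'm) mdl \<Rightarrow> ('o, 'm) mdl \<Rightarrow> ('o, 'm) tarr \<Rightarrow> bool" where
  "LM A M N f \<longleftrightarrow> MD A M \<and> MD A N \<and> ar f \<and> dm f = mdl_ob M \<and> cd f = mdl_ob N \<and>
     f ** ac A M = ac A N ** (I (mon_ob A) >< f)"

lemma LM_D:
  assumes "LM A M N f"
  shows "MD A M" "MD A N" "ar f" "dm f = mdl_ob M" "cd f = mdl_ob N" "f ** ac A M = ac A N ** (I (mon_ob A) >< f)"
  using assms by (auto simp: LM_def)

lemma Ob_Mod: "M \<in> Ob (Mod C A) \<longleftrightarrow> MD A M"
  by (simp add: Mod_def)

lemma Hom_Mod:
  assumes [simp]: "CM A" "MD A M" "MD A N"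
  shows "f \<in> Hom (Mod C A) M N \<longleftrightarrow> LM A M N (mk (mdl_ob M) f (mdl_ob N))"
proof (cases "f \<in> Hom C (mdl_ob M) (mdl_ob N)")
  case True
  let ?f = "mk (mdl_ob M) f (mdl_ob N)"
  note [simp] = MD_Ob[OF assms(2)] MD_Ob[OF assms(3)]
  have f: "ar ?f" using True by (simp add: ar_mk)
  have "f \<cdot> mdl_act M = mdl_act N \<cdot> (Idn C (mon_ob A) \<star> f) \<longleftrightarrow> ?f ** ac A M = ac A N ** (I (mon_ob A) >< ?f)"
    using un_inject[of "?f ** ac A M" "ac A N ** (I (mon_ob A) >< ?f)"] f
    by (auto simp: un_simps dest: arg_cong[of _ _ un])
  then show ?thesis using True f by (auto simp: Mod_def LM_def)
next
  case False
  then show ?thesis by (auto simp: Mod_def LM_def ar_mk)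
qed

lemma LM_un: "CM A \<Longrightarrow> LM A M N f \<Longrightarrow> un f \<in> Hom (Mod C A) M N"
  using Hom_Mod[of A M N "un f"] LM_D[of A M N f] mk_un[of f] by auto

lemma LM_I: "CM A \<Longrightarrow> MD A M \<Longrightarrow> LM A M M (I (mdl_ob M))"
  by (simp add: LM_def)

lemma LM_cmp:
  assumes [simp]: "CM A" and "LM A M N f" "LM A N K g" shows "LM A M K (g ** f)"
proof -
  note f = LM_D[OF assms(2)] and g = LM_D[OF assms(3)]
  have "(g ** f) ** ac A M = (g ** ac A N) ** (I (mon_ob A) >< f)" using f(6) by simp
  also have "\<dots> = ac A K ** (I (mon_ob A) >< (g ** f))" unfolding g(6) using f(1-5) g(1-5) by (simp add: mg)
  finally show ?thesis using f(1-5) g(1-5) unfolding LM_def by simp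
qed

lemma LM_zr: "CM A \<Longrightarrow> MD A M \<Longrightarrow> MD A N \<Longrightarrow> LM A M N (zr (mdl_ob M) (mdl_ob N))"
  by (simp add: LM_def)

lemma un_zr: "x \<in> Ob C \<Longrightarrow> y \<in> Ob C \<Longrightarrow> un (zr x y) = zero_arrow C x y"
  using ar_zr[of x y] by (simp add: zr_def)

lemma category_Mod: assumes [simp]: "CM A" shows "category (Mod C A)"
proof
  fix M assume "M \<in> Ob (Mod C A)"
  then have "MD A M" by (simp add: Ob_Mod)
  then show "Idn (Mod C A) M \<in> Hom (Mod C A) M M"
    using LM_un[OF assms LM_I[OF assms]] un_I[of "mdl_ob M"] MD_Ob by fastforce
next
  fix M N K f g assume "M \<in> Ob (Mod C A)" "N \<in> Ob (Mod C A)" "K \<in> Ob (Mod C A)"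
    and h: "f \<in> Hom (Mod C A) M N" "g \<in> Hom (Mod C A) N K"
  then have c: "MD A M" "MD A N" "MD A K" by (auto simp: Ob_Mod)
  have "LM A M K (mk (mdl_ob N) g (mdl_ob K) ** mk (mdl_ob M) f (mdl_ob N))"
    using h c Hom_Mod[OF assms] by (blast intro: LM_cmp[OF assms])
  moreover have "un (mk (mdl_ob N) g (mdl_ob K) ** mk (mdl_ob M) f (mdl_ob N)) = g \<cdot> f"
    using h c by (subst un_cmp) (auto simp: Mod_def ar_mk)
  ultimately have "g \<cdot> f \<in> Hom (Mod C A) M K" using LM_un[OF assms] by metis
  then show "g \<cdot>\<^bsub>Mod C A\<^esub> f \<in> Hom (Mod C A) M K" by simp
next
  fix M N f assume "M \<in> Ob (Mod C A)" "N \<in> Ob (Mod C A)" "f \<in> Hom (Mod C A) M N"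
  then have "mdl_ob M \<in> Ob C" "mdl_ob N \<in> Ob C" "f \<in> Hom C (mdl_ob M) (mdl_ob N)"
    by (simp_all add: Ob_Mod) (simp add: Mod_def)
  then show "f \<cdot>\<^bsub>Mod C A\<^esub> Idn (Mod C A) M = f" "Idn (Mod C A) N \<cdot>\<^bsub>Mod C A\<^esub> f = f"
    by (simp_all add: comp_id_left comp_id_right)
next
  fix M N K L f g h
  assume "M \<in> Ob (Mod C A)" "N \<in> Ob (Mod C A)" "K \<in> Ob (Mod C A)" "L \<in> Ob (Mod C A)"
    "f \<in> Hom (Mod C A) M N" "g \<in> Hom (Mod C A) N K" "h \<in> Hom (Mod C A) K L"
  then have "mdl_ob M \<in> Ob C" "mdl_ob N \<in> Ob C" "mdl_ob K \<in> Ob C" "mdl_ob L \<in> Ob C"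
    "f \<in> Hom C (mdl_ob M) (mdl_ob N)" "g \<in> Hom C (mdl_ob N) (mdl_ob K)" "h \<in> Hom C (mdl_ob K) (mdl_ob L)"
    by (simp_all add: Ob_Mod) (simp_all add: Mod_def)
  then show "(h \<cdot>\<^bsub>Mod C A\<^esub> g) \<cdot>\<^bsub>Mod C A\<^esub> f = h \<cdot>\<^bsub>Mod C A\<^esub> (g \<cdot>\<^bsub>Mod C A\<^esub> f)"
    using comp_assoc by simp
qed

definition null_mdl :: "('o, 'm) mon \<Rightarrow> ('o, 'm) mdl" where
  "null_mdl A = mkmdl (zr (mon_ob A \<boxtimes> null) null)"

lemma null_mdl_ob [simp]: "mdl_ob (null_mdl A) = null"
  by (simp add: null_mdl_def)

lemma null_mdl [simp]: assumes [simp]: "CM A" shows "MD A (null_mdl A)"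
  unfolding null_mdl_def
proof (rule MD_mkmdl)
  show "zr (mon_ob A \<boxtimes> null) null ** et A >< I null = la null" using to_null[of "la null"] by simp
qed auto

lemma zero_object_Mod: assumes [simp]: "CM A" shows "zero_object (Mod C A) (null_mdl A)"
  unfolding zero_object_def
proof (intro conjI ballI)
  fix M assume "M \<in> Ob (Mod C A)"
  then have M[simp]: "MD A M" by (simp add: Ob_Mod)
  have z: "un (zr null (mdl_ob M)) \<in> Hom (Mod C A) (null_mdl A) M" "un (zr (mdl_ob M) null) \<in> Hom (Mod C A) M (null_mdl A)"
    using LM_un[OF assms LM_zr[OF assms null_mdl M]] LM_un[OF assms LM_zr[OF assms M null_mdl]] by auto
  have "f = un (zr null (mdl_ob M))" if "f \<in> Hom (Mod C A) (null_mdl A) M" for f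
  proof -
    have "ar (mk null f (mdl_ob M))" using Hom_Mod[OF assms null_mdl M, of f] that by (simp add: LM_def)
    then show ?thesis using from_null[of "mk null f (mdl_ob M)"] un_mk[of null f "mdl_ob M"] by simp
  qed
  then show "\<exists>!f. f \<in> Hom (Mod C A) (null_mdl A) M" using z by blast
  have "f = un (zr (mdl_ob M) null)" if "f \<in> Hom (Mod C A) M (null_mdl A)" for f
  proof -
    have "ar (mk (mdl_ob M) f null)" using Hom_Mod[OF assms M null_mdl, of f] that by (simp add: LM_def)
    then show ?thesis using to_null[of "mk (mdl_ob M) f null"] un_mk[of "mdl_ob M" f null] by simp
  qed
  then show "\<exists>!f. f \<in> Hom (Mod C A) M (null_mdl A)" using z by blast
qed (simp add: Ob_Mod)

text \<open>Kernels in the module category refer to its own zero arrows. The zero module is carried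
  by \<open>null\<close>, so these arrows are the zero arrows of \<open>C\<close>.\<close>

lemma zero_arrow_Mod:
  assumes [simp]: "CM A" "MD A M" "MD A N"
  shows "zero_arrow (Mod C A) M N = zero_arrow C (mdl_ob M) (mdl_ob N)"
proof -
  note [simp] = MD_Ob[OF assms(2)] MD_Ob[OF assms(3)]
  have "zero_arrow (Mod C A) M N = un (zr null (mdl_ob N)) \<cdot>\<^bsub>Mod C A\<^esub> un (zr (mdl_ob M) null)"
    by (rule category.zero_arrow_eq[OF category_Mod[OF assms(1)] zero_object_Mod])
      (use LM_un[OF assms(1) LM_zr[OF assms(1) null_mdl assms(3)]] LM_un[OF assms(1) LM_zr[OF assms(1,2) null_mdl]] in \<open>auto simp: Ob_Mod\<close>)
  also have "\<dots> = un (zr null (mdl_ob N) ** zr (mdl_ob M) null)" by (subst un_cmp) auto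
  also have "\<dots> = zero_arrow C (mdl_ob M) (mdl_ob N)" by (simp add: un_zr)
  finally show ?thesis .
qed

lemma ac_self [simp]: "ac A (self_mdl A) = mu A" and mdl_ob_self [simp]: "mdl_ob (self_mdl A) = mon_ob A"
  by (simp_all add: ac_def self_mdl_def mu_def)

lemma MD_self [simp]: "CM A \<Longrightarrow> MD A (self_mdl A)"
  by (simp add: MD_iff mu_assoc mu_et_left)

text \<open>Restriction of scalars along \<open>f\<close>; \<open>restr_mdl\<close> is its value at
  \<open>B\<close> regarded as a module over itself.\<close>

definition rs :: "('o, 'm) tarr \<Rightarrow> ('o, 'm) mon \<Rightarrow> ('o, 'm) mdl \<Rightarrow> ('o, 'm) mdl" where
  "rs f B M = mkmdl (ac B M ** (f >< I (mdl_ob M)))"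

lemma mdl_ob_rs [simp]: "mdl_ob (rs f B M) = mdl_ob M"
  by (simp add: rs_def)

lemma ac_rs: "MM A B f \<Longrightarrow> MD B M \<Longrightarrow> ac A (rs f B M) = ac B M ** (f >< I (mdl_ob M))"
  unfolding rs_def using MM_D[of A B f] by (intro ac_mkmdl) auto

lemma MD_rs:
  assumes f: "MM A B f" and M: "MD B M" shows "MD A (rs f B M)"
proof -
  note [simp] = MM_D(1-5)[OF f] M MD_Ob[OF M]
  let ?m = "mdl_ob M" and ?a = "mon_ob A" and ?b = "mon_ob B"
  let ?r = "ac B M ** (f >< I ?m)"
  have "?r ** (mu A >< I ?m) = ac B M ** (mu B >< I ?m) ** ((f >< f) >< I ?m)"
    by (simp add: mg MM_D(6)[OF f])
  also have "\<dots> = ac B M ** (I ?b >< ac B M) ** al ?b ?b ?m ** ((f >< f) >< I ?m)"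
    by (simp add: ra[OF ac_mu])
  also have "\<dots> = ac B M ** (I ?b >< ac B M) ** (f >< (f >< I ?m)) ** al ?a ?a ?m"
    by (simp add: al_nat)
  also have "\<dots> = ?r ** (I ?a >< ?r) ** al ?a ?a ?m"
    by (simp add: mg)
  finally have 1: "?r ** (mu A >< I ?m) = ?r ** (I ?a >< ?r) ** al ?a ?a ?m" .
  have "?r ** (et A >< I ?m) = la ?m"
    by (simp add: mg MM_D(7)[OF f] ac_et)
  then show ?thesis unfolding rs_def by (intro MD_mkmdl[OF _ _ _ _ 1]) auto
qed

lemma LM_rs:
  assumes f: "MM A B f" and g: "LM B M N g" shows "LM A (rs f B M) (rs f B N) g"
proof -
  note [simp] = MM_D(1-5)[OF f] LM_D(1-5)[OF g] LM_D(1,2)[OF g, THEN MD_Ob]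
  have "g ** ac B M ** (f >< I (mdl_ob M)) = ac B N ** (I (mon_ob B) >< g) ** (f >< I (mdl_ob M))"
    by (simp add: ra[OF LM_D(6)[OF g]])
  also have "\<dots> = ac B N ** (f >< I (mdl_ob N)) ** (I (mon_ob A) >< g)" by (simp add: mg)
  finally show ?thesis unfolding LM_def using MD_rs[OF f] by (simp add: ac_rs[OF f])
qed

lemma restr_mdl_rs:
  assumes "MM A B (mk (mon_ob A) f (mon_ob B))"
  shows "restr_mdl C B f = rs (mk (mon_ob A) f (mon_ob B)) B (self_mdl B)"
proof -
  note [simp] = MM_D(1-3)[OF assms]
  show ?thesis unfolding restr_mdl_def rs_def mkmdl_def by (simp add: un_simps)
qed

text \<open>Multiplication by a global element \<open>e\<close> of \<open>A\<close>. The two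
  idempotents of a product of monoids act on modules in this way.\<close>

definition sc :: "('o, 'm) mon \<Rightarrow> ('o, 'm) mdl \<Rightarrow> ('o, 'm) tarr \<Rightarrow> ('o, 'm) tarr" where
  "sc A M e = ac A M ** (e >< I (mdl_ob M)) ** li (mdl_ob M)"

lemma sc_simps [simp]:
  assumes A: "CM A" "MD A M" "ar e" "dm e = one" "cd e = mon_ob A"
  shows "ar (sc A M e)" "dm (sc A M e) = mdl_ob M" "cd (sc A M e) = mdl_ob M"
  using A MD_Ob[OF A(2)] by (simp_all add: sc_def)

lemma kelly_li:
  assumes [simp]: "x \<in> Ob C" "y \<in> Ob C"
  shows "al one x y ** (li x >< I y) = li (x \<boxtimes> y)"
proof (rule isoT_cancel_left[OF la_iso, of "x \<boxtimes> y"])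
  show "la (x \<boxtimes> y) ** al one x y ** li x >< I y = la (x \<boxtimes> y) ** li (x \<boxtimes> y)"
    by (simp add: ra[OF kelly_la] mg)
qed auto

lemma kelly_ri:
  assumes [simp]: "x \<in> Ob C" "y \<in> Ob C"
  shows "ai x y one ** (I x >< ri y) = ri (x \<boxtimes> y)"
proof (rule isoT_cancel_left[OF ro_iso, of "x \<boxtimes> y"])
  have "ro (x \<boxtimes> y) ** ai x y one = I x >< ro y" by (simp flip: kelly_ro)
  from ra[OF this] show "ro (x \<boxtimes> y) ** ai x y one ** I x >< ri y = ro (x \<boxtimes> y) ** ri (x \<boxtimes> y)"
    by (simp add: mg)
qed auto

text \<open>Associativity of the action with a global element in first place:
  \<open>(e a) m = e (a m)\<close>.\<close>

lemma sc_ac: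
  assumes A: "CM A" "MD A M" "ar e" "dm e = one" "cd e = mon_ob A"
  shows "ac A M ** (sc A (self_mdl A) e >< I (mdl_ob M)) = sc A M e ** ac A M"
proof -
  note [simp] = A MD_Ob[OF A(2)]
  let ?a = "mon_ob A" and ?m = "mdl_ob M"
  have "ac A M ** (sc A (self_mdl A) e >< I ?m)
      = ac A M ** (mu A >< I ?m) ** ((e >< I ?a) >< I ?m) ** (li ?a >< I ?m)"
    by (simp add: sc_def mg)
  also have "\<dots> = ac A M ** (I ?a >< ac A M) ** al ?a ?a ?m ** ((e >< I ?a) >< I ?m) ** (li ?a >< I ?m)"
    by (simp add: ra[OF ac_mu])
  also have "\<dots> = ac A M ** (I ?a >< ac A M) ** (e >< (I ?a >< I ?m)) ** al one ?a ?m ** (li ?a >< I ?m)"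
    by (simp add: al_nat2 del: I_tns)
  also have "\<dots> = ac A M ** (I ?a >< ac A M) ** (e >< (I ?a >< I ?m)) ** li (?a \<boxtimes> ?m)"
    by (simp add: kelly_li)
  also have "\<dots> = ac A M ** (e >< I ?m) ** (I one >< ac A M) ** li (?a \<boxtimes> ?m)"
    by (simp add: mg)
  also have "\<dots> = sc A M e ** ac A M"
    by (simp add: sc_def li_nat)
  finally show ?thesis .
qed

lemma sc_LM:
  assumes A: "CM A" and f: "LM A M N f" and e [simp]: "ar e" "dm e = one" "cd e = mon_ob A"
  shows "f ** sc A M e = sc A N e ** f"
proof -
  note [simp] = A LM_D(1-5)[OF f] LM_D(1,2)[OF f, THEN MD_Ob]
  have "f ** sc A M e = ac A N ** (I (mon_ob A) >< f) ** (e >< I (mdl_ob M)) ** li (mdl_ob M)"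
    by (simp add: sc_def ra[OF LM_D(6)[OF f]])
  also have "\<dots> = ac A N ** (e >< I (mdl_ob N)) ** (I one >< f) ** li (mdl_ob M)"
    by (simp add: mg)
  also have "\<dots> = sc A N e ** f" by (simp add: sc_def li_nat)
  finally show ?thesis .
qed

section \<open>Kernels, cokernels and tensor products of modules\<close>

text \<open>The axioms for \<open>r\<close> may be tested after the monomorphism \<open>k\<close>,
  where they become those of \<open>M\<close>.\<close>

lemma sub_mdl:
  assumes A: "CM A" and M: "MD A M" and k: "mono k" "cd k = mdl_ob M"
    and r: "ar r" "dm r = mon_ob A \<boxtimes> dm k" "cd r = dm k" "k ** r = ac A M ** (I (mon_ob A) >< k)"
  shows "LM A (mkmdl r) M k"
proof -
  note [simp] = A M MD_Ob[OF M] ar_mono[OF k(1)] k(2) r(1-3)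
  let ?a = "mon_ob A" and ?m = "mdl_ob M" and ?x = "dm k"
  have "MD A (mkmdl r)"
  proof (rule MD_mkmdl)
    have "k ** r ** (mu A >< I ?x) = ac A M ** (mu A >< I ?m) ** ((I ?a >< I ?a) >< k)"
      by (simp add: mg ra[OF r(4)])
    also have "\<dots> = ac A M ** (I ?a >< ac A M) ** (I ?a >< (I ?a >< k)) ** al ?a ?a ?x"
      by (simp add: ra[OF ac_mu] al_nat del: I_tns)
    also have "\<dots> = ac A M ** (I ?a >< (k ** r)) ** al ?a ?a ?x"
      unfolding r(4) by (simp add: mg)
    also have "\<dots> = ac A M ** (I ?a >< k) ** (I ?a >< r) ** al ?a ?a ?x"
      by (simp add: mg)
    also have "\<dots> = k ** r ** (I ?a >< r) ** al ?a ?a ?x"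
      by (simp add: ra[OF r(4)])
    finally show "r ** (mu A >< I ?x) = r ** (I ?a >< r) ** al ?a ?a ?x"
      by (rule monoD[OF k(1)]) auto
    have "k ** r ** (et A >< I ?x) = ac A M ** (et A >< I ?m) ** (I one >< k)"
      by (simp add: mg ra[OF r(4)])
    also have "\<dots> = k ** la ?x" by (simp add: ra[OF ac_et] la_nat)
    finally show "r ** (et A >< I ?x) = la ?x"
      by (rule monoD[OF k(1)]) auto
  qed auto
  then show ?thesis unfolding LM_def using r(4) by simp
qed

text \<open>Dually, the axioms are tested by precomposing with \<open>p\<close> tensored with
  objects, which closedness keeps epic.\<close>

lemma quot_mdl:
  assumes A: "CM A" and M: "MD A M" and p: "epi p" "dm p = mdl_ob M"
    and r: "ar r" "dm r = mon_ob A \<boxtimes> cd p" "cd r = cd p" "r ** (I (mon_ob A) >< p) = p ** ac A M"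
  shows "LM A M (mkmdl r) p"
proof -
  note [simp] = A M MD_Ob[OF M] ar_epi[OF p(1)] p(2) r(1-3)
  let ?a = "mon_ob A" and ?m = "mdl_ob M" and ?x = "cd p"
  have ep: "epi (I (?a \<boxtimes> ?a) >< p)" "epi (I one >< p)" using epi_tns_left[OF p(1)] by auto
  have "MD A (mkmdl r)"
  proof (rule MD_mkmdl)
    have "(r ** (mu A >< I ?x)) ** (I (?a \<boxtimes> ?a) >< p) = r ** (I ?a >< p) ** (mu A >< I ?m)"
      by (simp add: mg)
    also have "\<dots> = p ** ac A M ** (I ?a >< ac A M) ** al ?a ?a ?m"
      by (simp add: ra[OF r(4)] ac_mu)
    also have "\<dots> = r ** (I ?a >< p) ** (I ?a >< ac A M) ** al ?a ?a ?m"
      by (simp add: ra[OF r(4)])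
    also have "\<dots> = r ** (I ?a >< (p ** ac A M)) ** al ?a ?a ?m"
      by (simp add: mg)
    also have "\<dots> = r ** (I ?a >< r) ** (I ?a >< (I ?a >< p)) ** al ?a ?a ?m"
      unfolding r(4)[symmetric] by (simp add: mg)
    also have "\<dots> = (r ** (I ?a >< r) ** al ?a ?a ?x) ** ((I ?a >< I ?a) >< p)"
      by (simp add: al_nat del: I_tns)
    also have "\<dots> = (r ** (I ?a >< r) ** al ?a ?a ?x) ** (I (?a \<boxtimes> ?a) >< p)" by simp
    finally show "r ** (mu A >< I ?x) = r ** (I ?a >< r) ** al ?a ?a ?x"
      by (rule epiD[OF ep(1)]) auto
    have "(r ** (et A >< I ?x)) ** (I one >< p) = r ** (I ?a >< p) ** (et A >< I ?m)"
      by (simp add: mg)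
    also have "\<dots> = la ?x ** (I one >< p)" by (simp add: ra[OF r(4)] ac_et la_nat)
    finally show "r ** (et A >< I ?x) = la ?x"
      by (rule epiD[OF ep(2)]) auto
  qed auto
  then show ?thesis unfolding LM_def using r(4) by simp
qed

lemma kernel_mdl:
  assumes A: "CM A" and M: "MD A M" and k: "kernel f k" "dm f = mdl_ob M"
    and z: "f ** ac A M ** (I (mon_ob A) >< k) = zr (mon_ob A \<boxtimes> dm k) (cd f)"
  obtains K where "LM A K M k"
proof -
  note kk = kernelD[OF k(1)]
  obtain r where r: "ar r" "dm r = dm (ac A M ** (I (mon_ob A) >< k))" "cd r = dm k" "k ** r = ac A M ** (I (mon_ob A) >< k)"
    by (rule kernel_ex[OF k(1), of "ac A M ** (I (mon_ob A) >< k)"]) (use A M kk k(2) z in auto)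
  have "LM A (mkmdl r) M k" by (rule sub_mdl[OF A M kk(2)]) (use r kk k in auto)
  then show ?thesis by (rule that)
qed

text \<open>Tensoring with \<open>mon_ob A\<close> keeps \<open>p\<close> a cokernel, and this
  induces the action on its codomain.\<close>

lemma cokernel_mdl:
  assumes A: "CM A" and f: "LM A M N f" and p: "coeq f (zr (dm f) (cd f)) p"
  obtains Q where "LM A N Q p"
proof -
  note fD = LM_D[OF f] and pD = cokerD[OF p]
  note [simp] = A fD(1-5) MD_Ob[OF fD(1)] MD_Ob[OF fD(2)] pD(3,4)
  let ?a = "mon_ob A"
  have c: "coeq (I ?a >< f) (zr (?a \<boxtimes> mdl_ob M) (?a \<boxtimes> mdl_ob N)) (I ?a >< p)"
    using coeq_tns_left[OF p, of ?a] by simp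
  have "(p ** ac A N) ** (I ?a >< f) = p ** f ** ac A M" by (simp add: fD(6))
  also have "\<dots> = zr (?a \<boxtimes> mdl_ob M) (cd p)" by (simp add: ra[OF pD(5)])
  finally obtain r where r: "ar r" "dm r = cd (I ?a >< p)" "cd r = cd p" "r ** (I ?a >< p) = p ** ac A N"
    using coker_ex[OF c, of "p ** ac A N"] by auto
  have "LM A N (mkmdl r) p" by (rule quot_mdl[OF A fD(2) pD(2)]) (use r in auto)
  then show ?thesis by (rule that)
qed

section \<open>Kernels and cokernels in the category of modules\<close>

definition mod_kernel where
  "mod_kernel A K M N k f \<longleftrightarrow> LM A K M k \<and> LM A M N f \<and> f ** k = zr (mdl_ob K) (mdl_ob N) \<and>
    (\<forall>Z g. LM A Z M g \<longrightarrow> f ** g = zr (mdl_ob Z) (mdl_ob N) \<longrightarrow> (\<exists>!h. LM A Z K h \<and> k ** h = g))"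

definition mod_cokernel where
  "mod_cokernel A M N Q f p \<longleftrightarrow> LM A M N f \<and> LM A N Q p \<and> p ** f = zr (mdl_ob M) (mdl_ob Q) \<and>
    (\<forall>Z g. LM A N Z g \<longrightarrow> g ** f = zr (mdl_ob M) (mdl_ob Z) \<longrightarrow> (\<exists>!h. LM A Q Z h \<and> h ** p = g))"

lemma LM_un_zero:
  assumes "CM A" "LM A M N f" "LM A N K g"
  shows "un g \<cdot> un f = zero_arrow (Mod C A) M K \<longleftrightarrow> g ** f = zr (mdl_ob M) (mdl_ob K)"
proof -
  note f = LM_D[OF assms(2)] and g = LM_D[OF assms(3)]
  have "un g \<cdot> un f = un (g ** f)" using f g by (simp add: un_cmp)
  moreover have "zero_arrow (Mod C A) M K = un (zr (mdl_ob M) (mdl_ob K))"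
    using f g assms zero_arrow_Mod[of A M K] un_zr MD_Ob by metis
  ultimately show ?thesis using un_inject[of "g ** f" "zr (mdl_ob M) (mdl_ob K)"] f g MD_Ob by auto
qed

lemma LM_un_cmp:
  assumes "LM A M N f" "LM A N K g" "LM A M K h"
  shows "un g \<cdot> un f = un h \<longleftrightarrow> g ** f = h"
proof -
  note f = LM_D[OF assms(1)] and g = LM_D[OF assms(2)] and h = LM_D[OF assms(3)]
  have "un g \<cdot> un f = un (g ** f)" using f g by (simp add: un_cmp)
  then show ?thesis using un_inject[of "g ** f" h] f g h by auto
qed

lemma Hom_Mod_ex:
  assumes "CM A" "MD A M" "MD A N"
  shows "f \<in> Hom (Mod C A) M N \<longleftrightarrow> (\<exists>g. LM A M N g \<and> f = un g)"
proof
  assume "f \<in> Hom (Mod C A) M N"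
  then have l: "LM A M N (mk (mdl_ob M) f (mdl_ob N))" using Hom_Mod assms by blast
  moreover have "f = un (mk (mdl_ob M) f (mdl_ob N))" using LM_D(3)[OF l] by simp
  ultimately show "\<exists>g. LM A M N g \<and> f = un g" by blast
qed (use LM_un assms in blast)

lemma LM_un_inject: "LM A M N f \<Longrightarrow> LM A M N g \<Longrightarrow> un f = un g \<longleftrightarrow> f = g"
  using un_inject LM_D by metis

text \<open>Unique existence is carried from raw arrows to typed ones along \<open>un\<close>, which
  is injective on the arrows that satisfy \<open>L\<close>.\<close>

lemma ex1_un:
  assumes "\<And>h. P h \<longleftrightarrow> (\<exists>t. L t \<and> h = un t)" "\<And>s t. L s \<Longrightarrow> L t \<Longrightarrow> un s = un t \<Longrightarrow> s = t"
  shows "(\<exists>!h. P h \<and> Q h) \<longleftrightarrow> (\<exists>!t. L t \<and> Q (un t))"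
proof
  assume "\<exists>!h. P h \<and> Q h"
  then obtain h where h: "P h" "Q h" "\<And>h'. P h' \<Longrightarrow> Q h' \<Longrightarrow> h' = h" by blast
  then obtain t where t: "L t" "h = un t" using assms(1) by blast
  show "\<exists>!t. L t \<and> Q (un t)"
  proof (rule ex1I[of _ t])
    fix s assume s: "L s \<and> Q (un s)"
    then have "P (un s)" using assms(1) by blast
    then have "un s = h" using h s by blast
    then show "s = t" using assms(2) s t by blast
  qed (use h t in blast)
next
  assume "\<exists>!t. L t \<and> Q (un t)"
  then obtain t where t: "L t" "Q (un t)" "\<And>t'. L t' \<Longrightarrow> Q (un t') \<Longrightarrow> t' = t" by blast
  show "\<exists>!h. P h \<and> Q h"
  proof (rule ex1I[of _ "un t"])
    show "P (un t) \<and> Q (un t)" using t(1,2) assms(1) by blast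
    fix h assume h: "P h \<and> Q h"
    then obtain s where s: "L s" "h = un s" using assms(1) by blast
    then show "h = un t" using t(3)[of s] h by simp
  qed
qed

lemma ex1_Hom_Mod:
  assumes "CM A" "MD A M" "MD A N"
  shows "(\<exists>!h. h \<in> Hom (Mod C A) M N \<and> Q h) \<longleftrightarrow> (\<exists>!t. LM A M N t \<and> Q (un t))"
  by (rule ex1_un[OF Hom_Mod_ex[OF assms] LM_un_inject[THEN iffD1]])

lemma Ball_Mod_to:
  assumes "CM A" "MD A M"
  shows "(\<forall>Z\<in>Ob (Mod C A). \<forall>g\<in>Hom (Mod C A) Z M. P Z g) \<longleftrightarrow> (\<forall>Z g. LM A Z M g \<longrightarrow> P Z (un g))"
proof (intro iffI allI impI ballI)
  fix Z g assume *: "\<forall>Z\<in>Ob (Mod C A). \<forall>g\<in>Hom (Mod C A) Z M. P Z g" and g: "LM A Z M g"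
  show "P Z (un g)" using * LM_un[OF assms(1) g] LM_D(1)[OF g] Ob_Mod by blast
next
  fix Z g assume *: "\<forall>Z g. LM A Z M g \<longrightarrow> P Z (un g)" and Z: "Z \<in> Ob (Mod C A)" and g: "g \<in> Hom (Mod C A) Z M"
  obtain t where "LM A Z M t" "g = un t" using Hom_Mod_ex[OF assms(1) _ assms(2), of Z g] Z g Ob_Mod by blast
  then show "P Z g" using * by blast
qed

lemma Ball_Mod_from:
  assumes "CM A" "MD A M"
  shows "(\<forall>Z\<in>Ob (Mod C A). \<forall>g\<in>Hom (Mod C A) M Z. P Z g) \<longleftrightarrow> (\<forall>Z g. LM A M Z g \<longrightarrow> P Z (un g))"
proof (intro iffI allI impI ballI)
  fix Z g assume *: "\<forall>Z\<in>Ob (Mod C A). \<forall>g\<in>Hom (Mod C A) M Z. P Z g" and g: "LM A M Z g"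
  show "P Z (un g)" using * LM_un[OF assms(1) g] LM_D(2)[OF g] Ob_Mod by blast
next
  fix Z g assume *: "\<forall>Z g. LM A M Z g \<longrightarrow> P Z (un g)" and Z: "Z \<in> Ob (Mod C A)" and g: "g \<in> Hom (Mod C A) M Z"
  obtain t where "LM A M Z t" "g = un t" using Hom_Mod_ex[OF assms(1,2), of Z g] Z g Ob_Mod by blast
  then show "P Z g" using * by blast
qed

lemma is_kernel_Mod:
  assumes A: "CM A" and k: "LM A K M k" and f: "LM A M N f"
  shows "is_kernel (Mod C A) K M N (un k) (un f) \<longleftrightarrow> mod_kernel A K M N k f"
proof -
  have o: "MD A K" "MD A M" "MD A N" using LM_D[OF k] LM_D[OF f] by auto
  let ?P = "\<lambda>Z g. un f \<cdot> un g = zero_arrow (Mod C A) Z N \<longrightarrow> (\<exists>!h. h \<in> Hom (Mod C A) Z K \<and> un k \<cdot> h = un g)"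
  let ?Q = "\<lambda>Z g. f ** g = zr (mdl_ob Z) (mdl_ob N) \<longrightarrow> (\<exists>!h. LM A Z K h \<and> k ** h = g)"
  have *: "?P Z g \<longleftrightarrow> ?Q Z g" if g: "LM A Z M g" for Z g
  proof -
    have Z: "MD A Z" using LM_D[OF g] by simp
    have "(LM A Z K t \<and> un k \<cdot> un t = un g) \<longleftrightarrow> (LM A Z K t \<and> k ** t = g)" for t
      using LM_un_cmp[OF _ k g] by blast
    then show ?thesis unfolding ex1_Hom_Mod[OF A Z o(1)] LM_un_zero[OF A g f] by simp
  qed
  have "(\<forall>z\<in>Ob (Mod C A). \<forall>g\<in>Hom (Mod C A) z M. un f \<cdot> g = zero_arrow (Mod C A) z N \<longrightarrow>
        (\<exists>!h. h \<in> Hom (Mod C A) z K \<and> un k \<cdot> h = g)) \<longleftrightarrow> (\<forall>Z g. LM A Z M g \<longrightarrow> ?P Z g)"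
    by (rule Ball_Mod_to[OF A o(2)])
  also have "\<dots> \<longleftrightarrow> (\<forall>Z g. LM A Z M g \<longrightarrow> ?Q Z g)" using * by (simp only: cong: imp_cong)
  finally show ?thesis unfolding is_kernel_def mod_kernel_def Mod_comp
    using o k f LM_un[OF A k] LM_un[OF A f] LM_un_zero[OF A k f] by (simp add: Ob_Mod)
qed

lemma is_cokernel_Mod:
  assumes A: "CM A" and p: "LM A N Q p" and f: "LM A M N f"
  shows "is_cokernel (Mod C A) M N Q (un f) (un p) \<longleftrightarrow> mod_cokernel A M N Q f p"
proof -
  have o: "MD A Q" "MD A M" "MD A N" using LM_D[OF p] LM_D[OF f] by auto
  let ?P = "\<lambda>Z g. un g \<cdot> un f = zero_arrow (Mod C A) M Z \<longrightarrow> (\<exists>!h. h \<in> Hom (Mod C A) Q Z \<and> h \<cdot> un p = un g)"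
  let ?Q = "\<lambda>Z g. g ** f = zr (mdl_ob M) (mdl_ob Z) \<longrightarrow> (\<exists>!h. LM A Q Z h \<and> h ** p = g)"
  have *: "?P Z g \<longleftrightarrow> ?Q Z g" if g: "LM A N Z g" for Z g
  proof -
    have Z: "MD A Z" using LM_D[OF g] by simp
    have "(LM A Q Z t \<and> un t \<cdot> un p = un g) \<longleftrightarrow> (LM A Q Z t \<and> t ** p = g)" for t
      using LM_un_cmp[OF p _ g] by blast
    then show ?thesis unfolding ex1_Hom_Mod[OF A o(1) Z] LM_un_zero[OF A f g] by simp
  qed
  have "(\<forall>z\<in>Ob (Mod C A). \<forall>g\<in>Hom (Mod C A) N z. g \<cdot> un f = zero_arrow (Mod C A) M z \<longrightarrow>
        (\<exists>!h. h \<in> Hom (Mod C A) Q z \<and> h \<cdot> un p = g)) \<longleftrightarrow> (\<forall>Z g. LM A N Z g \<longrightarrow> ?P Z g)"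
    by (rule Ball_Mod_from[OF A o(3)])
  also have "\<dots> \<longleftrightarrow> (\<forall>Z g. LM A N Z g \<longrightarrow> ?Q Z g)" using * by (simp only: cong: imp_cong)
  finally show ?thesis unfolding is_cokernel_def mod_cokernel_def Mod_comp
    using o p f LM_un[OF A p] LM_un[OF A f] LM_un_zero[OF A f p] by (simp add: Ob_Mod)
qed

text \<open>A factorization through a kernel in \<open>C\<close> is automatically linear, because
  \<open>k\<close> can be cancelled on the left.\<close>

lemma mod_kernelI:
  assumes A: "CM A" and k: "LM A K M k" and f: "LM A M N f" and kf: "kernel f k"
  shows "mod_kernel A K M N k f"
  unfolding mod_kernel_def
proof (intro conjI allI impI k f)
  note kD = LM_D[OF k] and fD = LM_D[OF f] and kk = kernelD[OF kf]
  show "f ** k = zr (mdl_ob K) (mdl_ob N)" using kk kD fD by simp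
  fix Z g assume g: "LM A Z M g" and z: "f ** g = zr (mdl_ob Z) (mdl_ob N)"
  note gD = LM_D[OF g]
  note [simp] = A kD(1-5) fD(1-5) gD(1-5)
  obtain h where h: "ar h" "dm h = dm g" "cd h = dm k" "k ** h = g"
    by (rule kernel_ex[OF kf, of g]) (use z in auto)
  have "k ** h ** ac A Z = g ** ac A Z" by (simp add: ra[OF h(4)])
  also have "\<dots> = ac A M ** (I (mon_ob A) >< (k ** h))" unfolding h(4) by (rule gD)
  also have "\<dots> = ac A M ** (I (mon_ob A) >< k) ** (I (mon_ob A) >< h)" using h by (simp add: mg)
  also have "\<dots> = k ** ac A K ** (I (mon_ob A) >< h)" by (simp add: ra[OF kD(6)])
  finally have "h ** ac A Z = ac A K ** (I (mon_ob A) >< h)"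
    by (rule monoD[OF kk(2)]) (use h in auto)
  then have "LM A Z K h" using h by (simp add: LM_def)
  then show "\<exists>!h. LM A Z K h \<and> k ** h = g" using h(4) monoD[OF kk(2)] LM_D[of A Z K] kD(4) by (metis (no_types))
qed

text \<open>The induced arrow is linear because \<open>p\<close> stays epic after tensoring with
  \<open>mon_ob A\<close>.\<close>

lemma mod_cokernelI:
  assumes A: "CM A" and p: "LM A N Q p" and f: "LM A M N f" and pf: "coeq f (zr (dm f) (cd f)) p"
  shows "mod_cokernel A M N Q f p"
  unfolding mod_cokernel_def
proof (intro conjI allI impI p f)
  note pD = LM_D[OF p] and fD = LM_D[OF f] and pp = cokerD[OF pf]
  show "p ** f = zr (mdl_ob M) (mdl_ob Q)" using pp pD fD by simp
  fix Z g assume g: "LM A N Z g" and z: "g ** f = zr (mdl_ob M) (mdl_ob Z)"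
  note gD = LM_D[OF g]
  note [simp] = A pD(1-5) fD(1-5) gD(1-5) MD_Ob[OF pD(2)] MD_Ob[OF fD(2)]
  obtain h where h: "ar h" "dm h = cd p" "cd h = cd g" "h ** p = g"
    by (rule coker_ex[OF pf, of g]) (use z in auto)
  have "(h ** ac A Q) ** (I (mon_ob A) >< p) = h ** p ** ac A N" by (simp add: pD(6))
  also have "\<dots> = g ** ac A N" by (simp add: ra[OF h(4)])
  also have "\<dots> = ac A Z ** (I (mon_ob A) >< (h ** p))" unfolding h(4) by (rule gD)
  also have "\<dots> = (ac A Z ** (I (mon_ob A) >< h)) ** (I (mon_ob A) >< p)" using h by (simp add: mg)
  finally have "h ** ac A Q = ac A Z ** (I (mon_ob A) >< h)"
    by (rule epiD[OF epi_tns_left[OF pp(2) CM_ar(1)[OF A]]]) (use h in auto)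
  then have "LM A Q Z h" using h by (simp add: LM_def)
  then show "\<exists>!h. LM A Q Z h \<and> h ** p = g" using h(4) epiD[OF pp(2)] LM_D[of A Q Z] pD(5) by (metis (no_types))
qed

section \<open>The relative tensor product\<close>

definition tq :: "('o, 'm) mon \<Rightarrow> ('o, 'm) mdl \<Rightarrow> ('o, 'm) mdl \<Rightarrow> ('o, 'm) tarr" where
  "tq A M N = mk (mdl_ob M \<boxtimes> mdl_ob N) (snd (tens_over C A M N)) (fst (tens_over C A M N))"

text \<open>The choice made in \<open>tens_over\<close> denotes a coequalizer, since
  \<open>ex_coeq\<close> supplies one.\<close>

lemma tq_coeq:
  assumes "CM A" "MD A M" "MD A N"
  shows "coeq ((ac A M ** br (mdl_ob M) (mon_ob A)) >< I (mdl_ob N))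
    ((I (mdl_ob M) >< ac A N) ** al (mdl_ob M) (mon_ob A) (mdl_ob N)) (tq A M N)"
    (is "coeq ?f ?g _")
proof -
  let ?a = "mon_ob A" and ?m = "mdl_ob M" and ?n = "mdl_ob N"
  note [simp] = assms MD_Ob[OF assms(2)] MD_Ob[OF assms(3)]
  have fg: "ar ?f" "ar ?g" "dm ?f = dm ?g" "cd ?f = cd ?g" by auto
  have un: "un ?f = (mdl_act M \<cdot> Braid C ?m ?a) \<star> Idn C ?n"
    "un ?g = (Idn C ?m \<star> mdl_act N) \<cdot> Assoc C ?m ?a ?n"
    by (simp_all add: un_simps)
  have i: "tens_over C A M N = (SOME Q. is_coequalizer C ((?m \<boxtimes> ?a) \<boxtimes> ?n) (?m \<boxtimes> ?n) (un ?f) (un ?g) (fst Q) (snd Q))"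
    by (simp only: tens_over_def Let_def un)
  obtain p where "coeq ?f ?g p" using ex_coeq fg by blast
  from coeq_is_coequalizer[OF this]
  have "\<exists>Q. is_coequalizer C ((?m \<boxtimes> ?a) \<boxtimes> ?n) (?m \<boxtimes> ?n) (un ?f) (un ?g) (fst Q) (snd Q)"
    by (intro exI[of _ "(cd p, un p)"]) simp
  from someI_ex[OF this]
  have "is_coequalizer C ((?m \<boxtimes> ?a) \<boxtimes> ?n) (?m \<boxtimes> ?n) (un ?f) (un ?g) (fst (tens_over C A M N)) (snd (tens_over C A M N))"
    unfolding i .
  from is_coequalizer_coeq[OF this] have "coeq (mk ((?m \<boxtimes> ?a) \<boxtimes> ?n) (un ?f) (?m \<boxtimes> ?n)) (mk ((?m \<boxtimes> ?a) \<boxtimes> ?n) (un ?g) (?m \<boxtimes> ?n)) (tq A M N)"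
    using arE(3)[OF fg(1)] arE(3)[OF fg(2)] by (simp add: tq_def)
  then show ?thesis using mk_un[OF fg(1)] mk_un[OF fg(2)] by simp
qed

lemma dm_tq [simp]: "dm (tq A M N) = mdl_ob M \<boxtimes> mdl_ob N"
  by (simp add: tq_def)

lemma tq_D:
  assumes "CM A" "MD A M" "MD A N"
  shows "epi (tq A M N)" "ar (tq A M N)"
    "tq A M N ** ((ac A M ** br (mdl_ob M) (mon_ob A)) >< I (mdl_ob N)) =
     tq A M N ** (I (mdl_ob M) >< ac A N) ** al (mdl_ob M) (mon_ob A) (mdl_ob N)"
  using coeqD[OF tq_coeq[OF assms]] by auto

lemma pentagon2:
  assumes [simp]: "w \<in> Ob C" "x \<in> Ob C" "y \<in> Ob C" "z \<in> Ob C"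
  shows "al (w \<boxtimes> x) y z ** (ai w x y >< I z) ** ai w (x \<boxtimes> y) z = ai w x (y \<boxtimes> z) ** (I w >< al x y z)"
proof (rule isoT_cancel_left[OF al_iso, of w x "y \<boxtimes> z"])
  show "al w x (y \<boxtimes> z) ** al (w \<boxtimes> x) y z ** (ai w x y >< I z) ** ai w (x \<boxtimes> y) z
      = al w x (y \<boxtimes> z) ** ai w x (y \<boxtimes> z) ** (I w >< al x y z)"
    by (simp add: ra[OF pentagonT] mg)
qed auto

text \<open>An operator on \<open>N\<close> with a parameter in \<open>y\<close> that commutes with
  the action of \<open>A\<close> respects the relation imposed by the coequalizer. Applied to the
  multiplication of an algebra it gives extended modules their action.\<close>

lemma tens_op_right:
  assumes A: "CM A" "MD A M" "MD A N"
    and o: "ar o'" "dm o' = mdl_ob N \<boxtimes> y" "cd o' = mdl_ob N" "y \<in> Ob C"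
    and l: "o' ** (ac A N >< I y) = ac A N ** (I (mon_ob A) >< o') ** al (mon_ob A) (mdl_ob N) y"
  obtains R where "ar R" "dm R = cd (tq A M N) \<boxtimes> y" "cd R = cd (tq A M N)"
    "R ** (tq A M N >< I y) = tq A M N ** (I (mdl_ob M) >< o') ** al (mdl_ob M) (mdl_ob N) y"
proof -
  let ?a = "mon_ob A" and ?m = "mdl_ob M" and ?n = "mdl_ob N" and ?q = "tq A M N"
  note [simp] = A MD_Ob[OF A(2)] MD_Ob[OF A(3)] o tq_D(2)[OF A]
  let ?A = "ac A M ** br ?m ?a"
  let ?g = "?q ** (I ?m >< o') ** al ?m ?n y"
  note q = tq_D(3)[OF A]
  have "?g ** ((?A >< I ?n) >< I y) = ?q ** (I ?m >< o') ** (?A >< (I ?n >< I y)) ** al (?m \<boxtimes> ?a) ?n y"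
    by (simp add: al_nat del: I_tns)
  also have "\<dots> = (?q ** (?A >< I ?n)) ** (I (?m \<boxtimes> ?a) >< o') ** al (?m \<boxtimes> ?a) ?n y"
    by (simp add: mg)
  also have "\<dots> = ?q ** (I ?m >< ac A N) ** al ?m ?a ?n ** ((I ?m >< I ?a) >< o') ** al (?m \<boxtimes> ?a) ?n y"
    unfolding q by simp
  also have "\<dots> = ?q ** (I ?m >< (ac A N ** (I ?a >< o'))) ** al ?m ?a (?n \<boxtimes> y) ** al (?m \<boxtimes> ?a) ?n y"
    by (simp add: al_nat2 mg del: I_tns)
  also have "\<dots> = ?q ** (I ?m >< (ac A N ** (I ?a >< o') ** al ?a ?n y)) ** al ?m (?a \<boxtimes> ?n) y ** (al ?m ?a ?n >< I y)"
    by (simp add: pentagonT mg)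
  also have "\<dots> = ?q ** (I ?m >< o') ** (I ?m >< (ac A N >< I y)) ** al ?m (?a \<boxtimes> ?n) y ** (al ?m ?a ?n >< I y)"
    unfolding l[symmetric] by (simp add: mg)
  also have "\<dots> = ?g ** ((I ?m >< ac A N) >< I y) ** (al ?m ?a ?n >< I y)"
    by (simp add: al_nat2)
  also have "\<dots> = ?g ** (((I ?m >< ac A N) ** al ?m ?a ?n) >< I y)"
    by (simp add: mg)
  finally show ?thesis
    using coeq_ex[OF coeq_tns_right[OF tq_coeq[OF A] o(4)], of ?g] that by auto
qed

text \<open>The same for operators on the left factor. It lets the first algebra act on a tensor
  product of two algebras.\<close>

lemma tens_op_left:
  assumes A: "CM A" "MD A M" "MD A N"
    and o: "ar o'" "dm o' = y \<boxtimes> mdl_ob M" "cd o' = mdl_ob M" "y \<in> Ob C"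
    and l: "o' ** (I y >< (ac A M ** br (mdl_ob M) (mon_ob A))) =
      (ac A M ** br (mdl_ob M) (mon_ob A)) ** (o' >< I (mon_ob A)) ** ai y (mdl_ob M) (mon_ob A)"
  obtains R where "ar R" "dm R = y \<boxtimes> cd (tq A M N)" "cd R = cd (tq A M N)"
    "R ** (I y >< tq A M N) = tq A M N ** (o' >< I (mdl_ob N)) ** ai y (mdl_ob M) (mdl_ob N)"
proof -
  let ?a = "mon_ob A" and ?m = "mdl_ob M" and ?n = "mdl_ob N" and ?q = "tq A M N"
  note [simp] = A MD_Ob[OF A(2)] MD_Ob[OF A(3)] o tq_D(2)[OF A]
  let ?A = "ac A M ** br ?m ?a"
  let ?g = "?q ** (o' >< I ?n) ** ai y ?m ?n"
  note q = tq_D(3)[OF A]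
  have "?g ** (I y >< (?A >< I ?n)) = ?q ** ((o' ** (I y >< ?A)) >< I ?n) ** ai y (?m \<boxtimes> ?a) ?n"
    by (simp add: ai_nat mg)
  also have "\<dots> = (?q ** (?A >< I ?n)) ** ((o' >< I ?a) >< I ?n) ** (ai y ?m ?a >< I ?n) ** ai y (?m \<boxtimes> ?a) ?n"
    unfolding l by (simp add: mg)
  also have "\<dots> = ?q ** (I ?m >< ac A N) ** al ?m ?a ?n ** ((o' >< I ?a) >< I ?n) ** (ai y ?m ?a >< I ?n) ** ai y (?m \<boxtimes> ?a) ?n"
    unfolding q by simp
  also have "\<dots> = ?q ** (I ?m >< ac A N) ** (o' >< (I ?a >< I ?n)) ** ai y ?m (?a \<boxtimes> ?n) ** (I y >< al ?m ?a ?n)"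
    by (simp add: al_nat2 pentagon2 del: I_tns)
  also have "\<dots> = ?q ** (o' >< I ?n) ** ((I y >< I ?m) >< ac A N) ** ai y ?m (?a \<boxtimes> ?n) ** (I y >< al ?m ?a ?n)"
    by (simp add: mg)
  also have "\<dots> = ?g ** (I y >< (I ?m >< ac A N)) ** (I y >< al ?m ?a ?n)"
    by (simp add: ai_nat2 del: I_tns)
  also have "\<dots> = ?g ** (I y >< ((I ?m >< ac A N) ** al ?m ?a ?n))"
    by (simp add: mg)
  finally show ?thesis
    using coeq_ex[OF coeq_tns_left[OF tq_coeq[OF A] o(4)], of ?g] that by auto
qed

text \<open>Passing from right to left reverses the order of multiplication, which commutativity of
  \<open>S\<close> undoes.\<close>

lemma right_action_MD:
  assumes S[simp]: "CM S" and O[simp]: "ar r" "dm r = x \<boxtimes> mon_ob S" "cd r = x" and x[simp]: "x \<in> Ob C"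
    and assoc: "r ** (r >< I (mon_ob S)) = r ** (I x >< mu S) ** al x (mon_ob S) (mon_ob S)"
    and unit: "r ** (I x >< et S) = ro x"
  shows "MD S (mkmdl (r ** br (mon_ob S) x))"
proof (rule MD_mkmdl)
  let ?b = "mon_ob S" and ?r = "r ** br (mon_ob S) x"
  have hx: "br ?b (?b \<boxtimes> x) ** al ?b ?b x = ai ?b x ?b ** (I ?b >< br ?b x) ** al ?b ?b x ** (br ?b ?b >< I x)"
    by (simp flip: hexagonT)
  have "?r ** (I ?b >< ?r) ** al ?b ?b x = r ** (r >< I ?b) ** (br ?b x >< I ?b) ** br ?b (?b \<boxtimes> x) ** al ?b ?b x"
    by (simp add: br_nat2 mg)
  also have "\<dots> = r ** (I x >< mu S) ** al x ?b ?b ** (br ?b x >< I ?b) ** ai ?b x ?b ** (I ?b >< br ?b x) ** al ?b ?b x ** (br ?b ?b >< I x)"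
    by (simp add: ra[OF assoc] hx)
  also have "\<dots> = r ** (I x >< mu S) ** br (?b \<boxtimes> ?b) x ** (br ?b ?b >< I x)"
    by (simp add: br_tens_left)
  also have "\<dots> = r ** (I x >< (mu S ** br ?b ?b)) ** br (?b \<boxtimes> ?b) x"
    by (simp add: br_nat mg)
  also have "\<dots> = ?r ** (mu S >< I x)"
    by (simp add: mu_comm br_nat)
  finally show "?r ** (mu S >< I x) = ?r ** (I ?b >< ?r) ** al ?b ?b x" by simp
  show "?r ** (et S >< I x) = la x"
    by (simp add: br_nat ra[OF unit] ro_br)
qed auto

section \<open>Extension of scalars\<close>

text \<open>\<open>xq\<close> is the quotient map from \<open>M \<otimes> S\<close> onto the tensor
  product over \<open>R\<close>, and \<open>xo\<close> is the extended module.\<close>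

abbreviation xq where "xq R S f M \<equiv> tq R M (rs f S (self_mdl S))"
abbreviation xo where "xo R S f M \<equiv> ext_ob C R S (un f) M"

text \<open>The unit of extension of scalars: \<open>m\<close> goes to
  \<open>m \<otimes> 1\<close>.\<close>

definition xe where "xe R S f M = xq R S f M ** (I (mdl_ob M) >< et S) ** ri (mdl_ob M)"

lemma MD_rs_self: "MM R S f \<Longrightarrow> MD R (rs f S (self_mdl S))"
  using MD_rs[of R S f "self_mdl S"] MM_D(2) by auto

lemma ac_rs_self: "MM R S f \<Longrightarrow> ac R (rs f S (self_mdl S)) = mu S ** (f >< I (mon_ob S))"
  using ac_rs[of R S f "self_mdl S"] MM_D(2) by auto

lemma xo_ob: "MM R S f \<Longrightarrow> mdl_ob (xo R S f M) = cd (xq R S f M)"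
  using restr_mdl_rs[of R S "un f"] by (simp add: ext_ob_def Let_def tq_def MM_mk_un)

text \<open>The action in \<open>ext_ob\<close> is a definite description. It is realized by the
  right action \<open>r\<close> that multiplication of \<open>S\<close> induces on the quotient,
  turned to the left by the braiding; it is unique because \<open>xq\<close> stays epic under
  tensoring.\<close>

lemma ext_ob_right:
  assumes f: "MM R S f" and M: "MD R M"
  obtains r where "ar r" "dm r = cd (xq R S f M) \<boxtimes> mon_ob S" "cd r = cd (xq R S f M)"
    "r ** (xq R S f M >< I (mon_ob S)) = xq R S f M ** (I (mdl_ob M) >< mu S) ** al (mdl_ob M) (mon_ob S) (mon_ob S)"
    "ac S (xo R S f M) = r ** br (mon_ob S) (cd (xq R S f M))" "MD S (xo R S f M)"
proof -
  let ?N = "rs f S (self_mdl S)" and ?b = "mon_ob S" and ?m = "mdl_ob M" and ?a = "mon_ob R"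
  let ?q = "tq R M ?N" and ?Q = "cd (tq R M ?N)"
  note fD = MM_D[OF f]
  have N: "MD R ?N" by (rule MD_rs_self[OF f])
  note q = tq_D[OF fD(1) M N]
  note [simp] = fD(1-5) M MD_Ob[OF M] N q(2)
  \<comment> \<open>Right multiplication on \<open>S\<close> commutes with the left action of
    \<open>R\<close>, as \<open>tens_op_right\<close> demands.\<close>
  have "mu S ** (ac R ?N >< I ?b) = ac R ?N ** (I ?a >< mu S) ** al ?a ?b ?b"
  proof -
    have "mu S ** (ac R ?N >< I ?b) = mu S ** (mu S >< I ?b) ** ((f >< I ?b) >< I ?b)"
      by (simp add: ac_rs_self[OF f] mg)
    also have "\<dots> = mu S ** (I ?b >< mu S) ** (f >< (I ?b >< I ?b)) ** al ?a ?b ?b"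
      by (simp add: ra[OF mu_assoc] al_nat del: I_tns)
    also have "\<dots> = ac R ?N ** (I ?a >< mu S) ** al ?a ?b ?b"
      by (simp add: ac_rs_self[OF f] mg)
    finally show ?thesis .
  qed
  then obtain r where r: "ar r" "dm r = ?Q \<boxtimes> ?b" "cd r = ?Q"
    "r ** (?q >< I ?b) = ?q ** (I ?m >< mu S) ** al ?m ?b ?b"
    using tens_op_right[OF fD(1) M N, of "mu S" ?b] by auto
  note [simp] = r(1-3)
  have eqq: "epi ((?q >< I ?b) >< I ?b)" "epi (?q >< I one)" using q(1) by (auto intro!: epi_tns_right)
  have assoc: "r ** (r >< I ?b) = r ** (I ?Q >< mu S) ** al ?Q ?b ?b"
  proof (rule epiD[OF eqq(1)])
    have "(r ** (r >< I ?b)) ** ((?q >< I ?b) >< I ?b) = r ** ((r ** (?q >< I ?b)) >< I ?b)"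
      by (simp add: mg)
    also have "\<dots> = r ** (?q >< I ?b) ** ((I ?m >< mu S) >< I ?b) ** (al ?m ?b ?b >< I ?b)"
      unfolding r(4) by (simp add: mg)
    also have "\<dots> = ?q ** (I ?m >< mu S) ** al ?m ?b ?b ** ((I ?m >< mu S) >< I ?b) ** (al ?m ?b ?b >< I ?b)"
      by (simp add: ra[OF r(4)])
    also have "\<dots> = ?q ** (I ?m >< (mu S ** (mu S >< I ?b))) ** al ?m (?b \<boxtimes> ?b) ?b ** (al ?m ?b ?b >< I ?b)"
      by (simp add: al_nat2 mrg2)
    also have "\<dots> = ?q ** (I ?m >< (mu S ** (I ?b >< mu S))) ** (I ?m >< al ?b ?b ?b) ** al ?m (?b \<boxtimes> ?b) ?b ** (al ?m ?b ?b >< I ?b)"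
      by (simp add: mu_assoc mg)
    also have "\<dots> = ?q ** (I ?m >< mu S) ** (I ?m >< (I ?b >< mu S)) ** al ?m ?b (?b \<boxtimes> ?b) ** al (?m \<boxtimes> ?b) ?b ?b"
      by (simp add: pentagonT mg)
    also have "\<dots> = ?q ** (I ?m >< mu S) ** al ?m ?b ?b ** ((I ?m >< I ?b) >< mu S) ** al (?m \<boxtimes> ?b) ?b ?b"
      by (simp add: al_nat2 del: I_tns)
    also have "\<dots> = r ** (?q >< I ?b) ** ((I ?m >< I ?b) >< mu S) ** al (?m \<boxtimes> ?b) ?b ?b"
      by (simp add: ra[OF r(4)])
    also have "\<dots> = r ** (I ?Q >< mu S) ** (?q >< (I ?b >< I ?b)) ** al (?m \<boxtimes> ?b) ?b ?b"
      by (simp add: mg)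
    also have "\<dots> = (r ** (I ?Q >< mu S) ** al ?Q ?b ?b) ** ((?q >< I ?b) >< I ?b)"
      by (simp add: al_nat del: I_tns)
    finally show "(r ** (r >< I ?b)) ** ((?q >< I ?b) >< I ?b) = (r ** (I ?Q >< mu S) ** al ?Q ?b ?b) ** ((?q >< I ?b) >< I ?b)" .
  qed auto
  have unit: "r ** (I ?Q >< et S) = ro ?Q"
  proof (rule epiD[OF eqq(2)])
    have "(r ** (I ?Q >< et S)) ** (?q >< I one) = r ** (?q >< I ?b) ** ((I ?m >< I ?b) >< et S)"
      by (simp add: mg)
    also have "\<dots> = ?q ** (I ?m >< mu S) ** al ?m ?b ?b ** ((I ?m >< I ?b) >< et S)"
      by (simp add: ra[OF r(4)])
    also have "\<dots> = ?q ** (I ?m >< (mu S ** (I ?b >< et S))) ** al ?m ?b one"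
      by (simp add: al_nat mrg2 del: I_tns)
    also have "\<dots> = ro ?Q ** (?q >< I one)"
      by (simp add: mu_et_right kelly_ro ro_nat)
    finally show "(r ** (I ?Q >< et S)) ** (?q >< I one) = ro ?Q ** (?q >< I one)" .
  qed auto
  let ?r = "r ** br ?b ?Q"
  have MDr: "MD S (mkmdl ?r)" by (rule right_action_MD[OF _ _ _ _ _ assoc unit]) auto
  have eq: "?r ** (I ?b >< ?q) = ?q ** (I ?m >< mu S) ** al ?m ?b ?b ** br ?b (?m \<boxtimes> ?b)"
    by (simp add: br_nat ra[OF r(4)])
  have qq: "fst (tens_over C R M (restr_mdl C S (un f))) = ?Q" "snd (tens_over C R M (restr_mdl C S (un f))) = un ?q"
    using restr_mdl_rs[of R S "un f"] f q(2) by (simp_all add: MM_mk_un tq_def)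
  have u: "un (?q ** (I ?m >< mu S) ** al ?m ?b ?b ** br ?b (?m \<boxtimes> ?b)) =
      un ?q \<cdot> ((Idn C ?m \<star> mon_mul S) \<cdot> (Assoc C ?m ?b ?b \<cdot> Braid C ?b (?m \<boxtimes> ?b)))"
    by (simp add: un_simps)
  have the: "(THE r. r \<in> Hom C (?b \<boxtimes> ?Q) ?Q \<and> r \<cdot> (Idn C ?b \<star> un ?q) =
      un ?q \<cdot> ((Idn C ?m \<star> mon_mul S) \<cdot> (Assoc C ?m ?b ?b \<cdot> Braid C ?b (?m \<boxtimes> ?b)))) = un ?r"
  proof (rule the_equality)
    have "un ?r \<cdot> (Idn C ?b \<star> un ?q) = un (?r ** (I ?b >< ?q))"
      by (simp add: un_cmp[of ?r] un_tns un_I del: cmp_assoc)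
    then show "un ?r \<in> Hom C (?b \<boxtimes> ?Q) ?Q \<and> un ?r \<cdot> (Idn C ?b \<star> un ?q) =
      un ?q \<cdot> ((Idn C ?m \<star> mon_mul S) \<cdot> (Assoc C ?m ?b ?b \<cdot> Braid C ?b (?m \<boxtimes> ?b)))"
      unfolding eq u using arE(3)[of ?r] by simp
    fix t assume t: "t \<in> Hom C (?b \<boxtimes> ?Q) ?Q \<and> t \<cdot> (Idn C ?b \<star> un ?q) =
      un ?q \<cdot> ((Idn C ?m \<star> mon_mul S) \<cdot> (Assoc C ?m ?b ?b \<cdot> Braid C ?b (?m \<boxtimes> ?b)))"
    let ?t = "mk (?b \<boxtimes> ?Q) t ?Q"
    have at: "ar ?t" using t by (simp add: ar_mk)
    have "?t ** (I ?b >< ?q) = ?r ** (I ?b >< ?q)"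
    proof (rule un_inject)
      show "un (?t ** (I ?b >< ?q)) = un (?r ** (I ?b >< ?q))"
        unfolding eq u using t at by (simp add: un_cmp un_tns un_I)
    qed (use at in auto)
    then have "?t = ?r" by (rule epiD[OF epi_tns_left[OF q(1) CM_ar(1)[OF fD(2)]]]) (use at in auto)
    then show "t = un ?r" using un_mk[OF at] by simp
  qed
  have xo: "xo R S f M = mkmdl ?r"
    unfolding ext_ob_def Let_def qq the by (simp add: mkmdl_def)
  show ?thesis by (rule that[OF r]) (use MDr in \<open>simp_all add: xo\<close>)
qed

lemma xo_MD: "MM R S f \<Longrightarrow> MD R M \<Longrightarrow> MD S (xo R S f M)"
  using ext_ob_right by metis

lemma ar_xq: "MM R S f \<Longrightarrow> MD R M \<Longrightarrow> ar (xq R S f M)"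
  using tq_D(2)[OF MM_D(1) _ MD_rs_self] by blast

lemma epi_xq: "MM R S f \<Longrightarrow> MD R M \<Longrightarrow> epi (xq R S f M)"
  using tq_D(1)[OF MM_D(1) _ MD_rs_self] by blast

lemma dm_cd_xe [simp]: "dm (xe R S f M) = mdl_ob M" "cd (xe R S f M) = cd (xq R S f M)"
  by (simp_all add: xe_def)

lemma ar_xe: "MM R S f \<Longrightarrow> MD R M \<Longrightarrow> ar (xe R S f M)"
  using ar_xq[of R S f M] MM_D[of R S f] MD_Ob[of R M] by (simp add: xe_def)

lemma ac_xo:
  assumes f: "MM R S f" and M: "MD R M"
  shows "ac S (xo R S f M) ** (I (mon_ob S) >< xq R S f M) =
    xq R S f M ** (I (mdl_ob M) >< mu S) ** al (mdl_ob M) (mon_ob S) (mon_ob S) ** br (mon_ob S) (mdl_ob M \<boxtimes> mon_ob S)"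
proof -
  obtain r where r: "ar r" "dm r = cd (xq R S f M) \<boxtimes> mon_ob S" "cd r = cd (xq R S f M)"
    "r ** (xq R S f M >< I (mon_ob S)) = xq R S f M ** (I (mdl_ob M) >< mu S) ** al (mdl_ob M) (mon_ob S) (mon_ob S)"
    "ac S (xo R S f M) = r ** br (mon_ob S) (cd (xq R S f M))"
    using ext_ob_right[OF f M] by metis
  note [simp] = MM_D(1-5)[OF f] r(1-3) ar_xq[OF f M]
  show ?thesis by (simp add: r(5) br_nat ra[OF r(4)])
qed

text \<open>In elements, \<open>b (m \<otimes> 1) = m \<otimes> b\<close>: the image of
  \<open>xe\<close> generates the extended module over \<open>S\<close>.\<close>

lemma ac_xo_xe:
  assumes f: "MM R S f" and M: "MD R M"
  shows "ac S (xo R S f M) ** (I (mon_ob S) >< xe R S f M) = xq R S f M ** br (mon_ob S) (mdl_ob M)"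
proof -
  let ?b = "mon_ob S" and ?m = "mdl_ob M" and ?q = "xq R S f M"
  obtain r where r: "ar r" "dm r = cd ?q \<boxtimes> ?b" "cd r = cd ?q"
    "r ** (?q >< I ?b) = ?q ** (I ?m >< mu S) ** al ?m ?b ?b"
    "ac S (xo R S f M) = r ** br ?b (cd ?q)"
    using ext_ob_right[OF f M] by metis
  note [simp] = MM_D(1-5)[OF f] r(1-3) ar_xq[OF f M] ar_xe[OF f M] MD_Ob[OF M]
  have "r ** (xe R S f M >< I ?b) = r ** (?q >< I ?b) ** ((I ?m >< et S) >< I ?b) ** (ri ?m >< I ?b)"
    by (simp add: xe_def mg)
  also have "\<dots> = ?q ** (I ?m >< mu S) ** al ?m ?b ?b ** ((I ?m >< et S) >< I ?b) ** (ri ?m >< I ?b)"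
    by (simp add: ra[OF r(4)])
  also have "\<dots> = ?q ** (I ?m >< (mu S ** (et S >< I ?b))) ** al ?m one ?b ** (ri ?m >< I ?b)"
    by (simp add: al_nat2 mrg2)
  also have "\<dots> = ?q ** (I ?m >< la ?b) ** al ?m one ?b ** (ri ?m >< I ?b)"
    by (simp add: mu_et_left)
  also have "\<dots> = ?q" by (simp add: ra[OF triangleT] mg)
  finally have "r ** (xe R S f M >< I ?b) = ?q" .
  from ra[OF this] show ?thesis by (simp add: r(5) br_nat)
qed

text \<open>In elements, \<open>(m a) \<otimes> 1 = m \<otimes> f(a)\<close>: the relation of the
  coequalizer, taken at the unit of \<open>S\<close>.\<close>

lemma xe_ac_br:
  assumes f: "MM R S f" and M: "MD R M"
  shows "xe R S f M ** ac R M ** br (mdl_ob M) (mon_ob R) = xq R S f M ** (I (mdl_ob M) >< f)"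
proof -
  let ?N = "rs f S (self_mdl S)" and ?b = "mon_ob S" and ?m = "mdl_ob M" and ?a = "mon_ob R" and ?q = "xq R S f M"
  note fD = MM_D[OF f]
  note [simp] = fD(1-5) M ar_xq[OF f M] ar_xe[OF f M] MD_Ob[OF M] MD_rs_self[OF f]
  have q: "?q ** ((ac R M ** br ?m ?a) >< I ?b) = ?q ** (I ?m >< ac R ?N) ** al ?m ?a ?b"
    using tq_D(3)[OF fD(1) M MD_rs_self[OF f]] by simp
  have "xe R S f M ** ac R M ** br ?m ?a = ?q ** (I ?m >< et S) ** ((ac R M ** br ?m ?a) >< I one) ** ri (?m \<boxtimes> ?a)"
    using ri_nat[of "ac R M ** br ?m ?a" ?m] by (simp add: xe_def)
  also have "\<dots> = (?q ** ((ac R M ** br ?m ?a) >< I ?b)) ** (I (?m \<boxtimes> ?a) >< et S) ** ri (?m \<boxtimes> ?a)"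
    by (simp add: mg)
  also have "\<dots> = ?q ** (I ?m >< ac R ?N) ** al ?m ?a ?b ** ((I ?m >< I ?a) >< et S) ** ri (?m \<boxtimes> ?a)"
    unfolding q by simp
  also have "\<dots> = ?q ** (I ?m >< ac R ?N) ** (I ?m >< (I ?a >< et S)) ** al ?m ?a one ** ai ?m ?a one ** (I ?m >< ri ?a)"
    by (simp add: al_nat2 kelly_ri del: I_tns)
  also have "\<dots> = ?q ** (I ?m >< (ac R ?N ** (I ?a >< et S) ** ri ?a))"
    by (simp add: mg)
  also have "ac R ?N ** (I ?a >< et S) ** ri ?a = mu S ** (I ?b >< et S) ** (f >< I one) ** ri ?a"
    by (simp add: ac_rs_self[OF f] mg)
  also have "\<dots> = f" by (simp add: ra[OF mu_et_right] ro_nat2)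
  finally show ?thesis .
qed

lemma xe_LM:
  assumes f: "MM R S f" and M: "MD R M"
  shows "LM R M (rs f S (xo R S f M)) (xe R S f M)"
proof -
  let ?b = "mon_ob S" and ?m = "mdl_ob M" and ?a = "mon_ob R" and ?q = "xq R S f M"
  note fD = MM_D[OF f]
  note [simp] = fD(1-5) M ar_xq[OF f M] ar_xe[OF f M] MD_Ob[OF M] xo_MD[OF f M] MD_rs[OF f xo_MD[OF f M]] xo_ob[OF f]
  have "xe R S f M ** ac R M = xe R S f M ** ac R M ** br ?m ?a ** br ?a ?m" by simp
  also have "\<dots> = ?q ** (I ?m >< f) ** br ?a ?m" using ra[OF xe_ac_br[OF f M], of "br ?a ?m"] by simp
  also have "\<dots> = ?q ** br ?b ?m ** (f >< I ?m)" by (simp add: br_nat)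
  also have "\<dots> = ac S (xo R S f M) ** (I ?b >< xe R S f M) ** (f >< I ?m)"
    by (simp add: ra[OF ac_xo_xe[OF f M]])
  also have "\<dots> = ac R (rs f S (xo R S f M)) ** (I ?a >< xe R S f M)"
    by (simp add: ac_rs[OF f] mg)
  finally show ?thesis unfolding LM_def by simp
qed

text \<open>\<open>g \<otimes> 1\<close> respects the defining relation because \<open>g\<close> is
  linear over \<open>R\<close>; that the induced arrow is linear over \<open>S\<close> is tested on
  the epimorphism \<open>xq\<close>.\<close>

lemma ext_mor_LM:
  assumes f: "MM R S f" and g: "LM R M N g"
  obtains h where "LM S (xo R S f M) (xo R S f N) h" "h ** xq R S f M = xq R S f N ** (g >< I (mon_ob S))"
    "ext_mor C R S (un f) M N (un g) = un h" "h ** xe R S f M = xe R S f N ** g"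
proof -
  let ?P = "rs f S (self_mdl S)" and ?b = "mon_ob S" and ?m = "mdl_ob M" and ?n = "mdl_ob N" and ?a = "mon_ob R"
  let ?q = "xq R S f M" and ?p = "xq R S f N"
  note fD = MM_D[OF f] and gD = LM_D[OF g]
  note [simp] = fD(1-5) gD(1-5) ar_xq[OF f gD(1)] ar_xq[OF f gD(2)] MD_Ob[OF gD(1)] MD_Ob[OF gD(2)]
    MD_rs_self[OF f] xo_MD[OF f gD(1)] xo_MD[OF f gD(2)] xo_ob[OF f]
  have p: "?p ** ((ac R N ** br ?n ?a) >< I ?b) = ?p ** (I ?n >< ac R ?P) ** al ?n ?a ?b"
    using tq_D(3)[OF fD(1) gD(2) MD_rs_self[OF f]] by simp
  have "(?p ** (g >< I ?b)) ** ((ac R M ** br ?m ?a) >< I ?b) = ?p ** ((g ** ac R M ** br ?m ?a) >< I ?b)"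
    by (simp add: mg)
  also have "g ** ac R M ** br ?m ?a = (ac R N ** br ?n ?a) ** (g >< I ?a)"
    by (simp add: ra[OF gD(6)] br_nat)
  also have "?p ** (((ac R N ** br ?n ?a) ** (g >< I ?a)) >< I ?b) = (?p ** ((ac R N ** br ?n ?a) >< I ?b)) ** ((g >< I ?a) >< I ?b)"
    by (simp add: mg)
  also have "\<dots> = ?p ** (I ?n >< ac R ?P) ** (g >< (I ?a >< I ?b)) ** al ?m ?a ?b"
    unfolding p by (simp add: al_nat del: I_tns)
  also have "\<dots> = (?p ** (g >< I ?b)) ** (I ?m >< ac R ?P) ** al ?m ?a ?b"
    by (simp add: mg)
  finally have e: "(?p ** (g >< I ?b)) ** ((ac R M ** br ?m ?a) >< I ?b) = (?p ** (g >< I ?b)) ** (I ?m >< ac R ?P) ** al ?m ?a ?b" .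
  obtain h where h: "ar h" "dm h = cd ?q" "cd h = cd ?p" "h ** ?q = ?p ** (g >< I ?b)"
    by (rule coeq_ex[OF tq_coeq[OF fD(1) gD(1) MD_rs_self[OF f]], of "?p ** (g >< I ?b)"]) (use e in auto)
  note [simp] = h(1-3)
  have "(h ** ac S (xo R S f M)) ** (I ?b >< ?q) = ?p ** (g >< I ?b) ** (I ?m >< mu S) ** al ?m ?b ?b ** br ?b (?m \<boxtimes> ?b)"
    by (simp add: ac_xo[OF f] ra[OF h(4)])
  also have "\<dots> = ?p ** (I ?n >< mu S) ** (g >< (I ?b >< I ?b)) ** al ?m ?b ?b ** br ?b (?m \<boxtimes> ?b)"
    by (simp add: mg)
  also have "\<dots> = ?p ** (I ?n >< mu S) ** al ?n ?b ?b ** br ?b (?n \<boxtimes> ?b) ** (I ?b >< (g >< I ?b))"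
    by (simp add: br_nat al_nat2 del: I_tns)
  also have "\<dots> = ac S (xo R S f N) ** (I ?b >< ?p) ** (I ?b >< (g >< I ?b))"
    by (simp add: ra[OF ac_xo[OF f]])
  also have "\<dots> = ac S (xo R S f N) ** (I ?b >< (h ** ?q))"
    unfolding h(4) by (simp add: mg)
  also have "\<dots> = (ac S (xo R S f N) ** (I ?b >< h)) ** (I ?b >< ?q)"
    by (simp add: mg)
  finally have "h ** ac S (xo R S f M) = ac S (xo R S f N) ** (I ?b >< h)"
    by (rule epiD[OF epi_tns_left[OF epi_xq[OF f gD(1)] CM_ar(1)[OF fD(2)]]]) auto
  then have 1: "LM S (xo R S f M) (xo R S f N) h" unfolding LM_def by simp
  have qq: "fst (tens_over C R M (restr_mdl C S (un f))) = cd (xq R S f M)"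
    "snd (tens_over C R M (restr_mdl C S (un f))) = un (xq R S f M)" if "MD R M" for M
    using restr_mdl_rs[of R S "un f"] f ar_xq[OF f that] by (simp_all add: MM_mk_un tq_def)
  have 2: "ext_mor C R S (un f) M N (un g) = un h"
    unfolding ext_mor_def qq[OF gD(1)] qq[OF gD(2)]
  proof (rule the_equality)
    show "un h \<in> Hom C (cd ?q) (cd ?p) \<and> un h \<cdot> un ?q = un ?p \<cdot> (un g \<star> Idn C ?b)"
      using arE(3)[OF h(1)] arg_cong[OF h(4), of un] by (simp add: un_simps)
    fix t assume t: "t \<in> Hom C (cd ?q) (cd ?p) \<and> t \<cdot> un ?q = un ?p \<cdot> (un g \<star> Idn C ?b)"
    have at: "ar (mk (cd ?q) t (cd ?p))" using t by (simp add: ar_mk)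
    have "mk (cd ?q) t (cd ?p) ** ?q = h ** ?q"
      unfolding h(4) using at t by (intro un_inject) (auto simp: un_simps)
    then have "mk (cd ?q) t (cd ?p) = h" by (rule epiD[OF epi_xq[OF f gD(1)]]) (use at in auto)
    then show "t = un h" using un_mk[OF at] by simp
  qed
  have "h ** xe R S f M = ?p ** (g >< I ?b) ** (I ?m >< et S) ** ri ?m"
    by (simp add: xe_def ra[OF h(4)])
  also have "\<dots> = ?p ** (I ?n >< et S) ** (g >< I one) ** ri ?m" by (simp add: mg)
  also have "\<dots> = xe R S f N ** g" by (simp add: xe_def ri_nat)
  finally have 3: "h ** xe R S f M = xe R S f N ** g" .
  show ?thesis by (rule that[OF 1 h(4) 2 3])
qed

text \<open>An inverse in \<open>C\<close> of a linear map is itself linear, so isomorphisms of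
  modules can be recognised on the underlying objects.\<close>

lemma is_iso_Mod:
  assumes A: "CM A" and f: "LM A M N f"
  shows "is_iso (Mod C A) M N (un f) \<longleftrightarrow> (\<exists>g. ar g \<and> dm g = mdl_ob N \<and> cd g = mdl_ob M \<and> g ** f = I (mdl_ob M) \<and> f ** g = I (mdl_ob N))"
proof -
  note fD = LM_D[OF f]
  note [simp] = A fD(1-5) MD_Ob[OF fD(1)] MD_Ob[OF fD(2)]
  have lin: "LM A N M g" if g: "ar g" "dm g = mdl_ob N" "cd g = mdl_ob M" "g ** f = I (mdl_ob M)" "f ** g = I (mdl_ob N)" for g
  proof -
    have "g ** ac A N = g ** ac A N ** (I (mon_ob A) >< (f ** g))" using g(1-3) unfolding g(5) by simp
    also have "\<dots> = g ** ac A N ** (I (mon_ob A) >< f) ** (I (mon_ob A) >< g)" using g(1-3) by (simp add: mg)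
    also have "\<dots> = ac A M ** (I (mon_ob A) >< g)"
      using g(1-3) by (simp add: ra[OF fD(6)[symmetric]] ra[OF g(4)])
    finally show ?thesis unfolding LM_def using g(1-3) by simp
  qed
  have i: "un (I x) = Idn C x" if "x \<in> Ob C" for x using un_I that .
  have *: "un g \<cdot> un f = Idn C (mdl_ob M) \<longleftrightarrow> g ** f = I (mdl_ob M)"
    "un f \<cdot> un g = Idn C (mdl_ob N) \<longleftrightarrow> f ** g = I (mdl_ob N)" if "LM A N M g" for g
    using LM_un_cmp[OF f that LM_I[OF A fD(1)]] LM_un_cmp[OF that f LM_I[OF A fD(2)]] un_I by simp_all
  have "is_iso (Mod C A) M N (un f) \<longleftrightarrow> (\<exists>g. LM A N M g \<and> g ** f = I (mdl_ob M) \<and> f ** g = I (mdl_ob N))"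
  proof
    assume "is_iso (Mod C A) M N (un f)"
    then obtain g where g: "g \<in> Hom (Mod C A) N M" "g \<cdot> un f = Idn C (mdl_ob M)" "un f \<cdot> g = Idn C (mdl_ob N)"
      unfolding is_iso_def Mod_comp Mod_Idn by blast
    then obtain t where "LM A N M t" "g = un t" using Hom_Mod_ex[OF A fD(2,1)] by blast
    then show "\<exists>g. LM A N M g \<and> g ** f = I (mdl_ob M) \<and> f ** g = I (mdl_ob N)" using * g by blast
  next
    assume "\<exists>g. LM A N M g \<and> g ** f = I (mdl_ob M) \<and> f ** g = I (mdl_ob N)"
    then obtain t where t: "LM A N M t" "t ** f = I (mdl_ob M)" "f ** t = I (mdl_ob N)" by blast
    show "is_iso (Mod C A) M N (un f)" unfolding is_iso_def Mod_comp Mod_Idn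
      using LM_un[OF A f] LM_un[OF A t(1)] *[OF t(1)] t(2,3) by blast
  qed
  also have "\<dots> \<longleftrightarrow> (\<exists>g. ar g \<and> dm g = mdl_ob N \<and> cd g = mdl_ob M \<and> g ** f = I (mdl_ob M) \<and> f ** g = I (mdl_ob N))"
    using lin LM_D(3,4,5)[of A N M] by (intro iff_exI) blast
  finally show ?thesis .
qed

text \<open>Linearity over \<open>R\<close> is linearity over \<open>S\<close> precomposed with
  \<open>f\<close> tensored with the source. That arrow is epic, because \<open>f\<close> is epic in
  \<open>C\<close> and not merely among monoids.\<close>

lemma LM_rs_full:
  assumes f: "MM R S f" "epi f" and g: "LM R (rs f S M) (rs f S N) g" and M: "MD S M" "MD S N"
  shows "LM S M N g"
proof -
  note fD = MM_D[OF f(1)] and gD = LM_D[OF g]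
  note [simp] = fD(1-5) gD(3-5) M MD_Ob[OF M(1)] MD_Ob[OF M(2)]
  have "(g ** ac S M) ** (f >< I (mdl_ob M)) = ac S N ** (f >< I (mdl_ob N)) ** (I (mon_ob R) >< g)"
    using gD(6) by (simp add: ac_rs[OF f(1)])
  also have "\<dots> = (ac S N ** (I (mon_ob S) >< g)) ** (f >< I (mdl_ob M))"
    by (simp add: mg)
  finally have "g ** ac S M = ac S N ** (I (mon_ob S) >< g)"
    by (rule epiD[OF epi_tns_right[OF f(2) MD_Ob[OF M(1)]]]) auto
  then show ?thesis unfolding LM_def by simp
qed

text \<open>Commutativity of \<open>R\<close> makes the action, written on the right, satisfy
  \<open>(m a) a' = m (a a')\<close>.\<close>

lemma right_action_assoc:
  assumes R[simp]: "CM R" and M[simp]: "MD R M"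
  shows "(ac R M ** br (mdl_ob M) (mon_ob R)) ** ((ac R M ** br (mdl_ob M) (mon_ob R)) >< I (mon_ob R)) =
    (ac R M ** br (mdl_ob M) (mon_ob R)) ** (I (mdl_ob M) >< mu R) ** al (mdl_ob M) (mon_ob R) (mon_ob R)"
proof -
  let ?m = "mdl_ob M" and ?a = "mon_ob R"
  note [simp] = MD_Ob[OF M]
  have hx: "br ?m (?a \<boxtimes> ?a) ** al ?m ?a ?a = ai ?a ?a ?m ** (I ?a >< br ?m ?a) ** al ?a ?m ?a ** (br ?m ?a >< I ?a)"
    by (simp flip: hexagonT)
  have "(ac R M ** br ?m ?a) ** (I ?m >< mu R) ** al ?m ?a ?a = ac R M ** (mu R >< I ?m) ** br ?m (?a \<boxtimes> ?a) ** al ?m ?a ?a"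
    by (simp add: br_nat2)
  also have "\<dots> = ac R M ** ((mu R ** br ?a ?a) >< I ?m) ** br ?m (?a \<boxtimes> ?a) ** al ?m ?a ?a"
    by (simp add: mu_comm)
  also have "\<dots> = ac R M ** (mu R >< I ?m) ** (br ?a ?a >< I ?m) ** br ?m (?a \<boxtimes> ?a) ** al ?m ?a ?a"
    by (simp add: mg)
  also have "\<dots> = ac R M ** (I ?a >< ac R M) ** br (?a \<boxtimes> ?m) ?a ** (br ?m ?a >< I ?a)"
    by (simp add: ra[OF ac_mu] hx br_tens_left)
  also have "\<dots> = ac R M ** br ?m ?a ** (ac R M >< I ?a) ** (br ?m ?a >< I ?a)"
    by (simp add: br_nat2)
  also have "\<dots> = (ac R M ** br ?m ?a) ** ((ac R M ** br ?m ?a) >< I ?a)"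
    by (simp add: mg)
  finally show ?thesis by simp
qed

section \<open>Products of two monoids\<close>

text \<open>Linearity gives \<open>e(a) = e(1 a) = e(1) a\<close>.\<close>

lemma sc_mu:
  assumes R: "CM R" and e: "ar e" "dm e = mon_ob R" "cd e = mon_ob R" "e ** mu R = mu R ** (e >< I (mon_ob R))"
  shows "sc R (self_mdl R) (e ** et R) = e"
proof -
  let ?a = "mon_ob R"
  note [simp] = R e(1-3)
  have "sc R (self_mdl R) (e ** et R) = mu R ** (e >< I ?a) ** (et R >< I ?a) ** li ?a"
    by (simp add: sc_def mg)
  also have "\<dots> = e" by (simp add: ra[OF e(4)[symmetric]] ra[OF mu_et_left])
  finally show ?thesis .
qed

text \<open>Commutativity turns linearity in the first argument into linearity in the
  second.\<close>

lemma mu_left_right: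
  assumes R: "CM R" and e: "ar e" "dm e = mon_ob R" "cd e = mon_ob R" "e ** mu R = mu R ** (e >< I (mon_ob R))"
  shows "e ** mu R = mu R ** (I (mon_ob R) >< e)"
proof -
  let ?a = "mon_ob R"
  note [simp] = R e(1-3)
  have "mu R ** (I ?a >< e) = mu R ** br ?a ?a ** (I ?a >< e)" by (simp add: ra[OF mu_comm])
  also have "\<dots> = e ** mu R ** br ?a ?a" by (simp add: br_nat ra[OF e(4)[symmetric]])
  finally show ?thesis by (simp add: mu_comm)
qed

lemma sc_et: "CM R \<Longrightarrow> MD R M \<Longrightarrow> sc R M (et R) = I (mdl_ob M)"
  using MD_Ob[of R M] by (simp add: sc_def ra[OF ac_et])

lemma sc_add:
  assumes R: "CM R" and M: "MD R M" and e: "ar e" "dm e = one" "cd e = mon_ob R" "ar e'" "dm e' = one" "cd e' = mon_ob R"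
  shows "sc R M (e \<boxplus> e') = sc R M e \<boxplus> sc R M e'"
  using R M MD_Ob[OF M] e by (simp add: sc_def add_tns cmp_add_l cmp_add_r)

lemma sc_zr: "CM R \<Longrightarrow> MD R M \<Longrightarrow> sc R M (zr one (mon_ob R)) = zr (mdl_ob M) (mdl_ob M)"
  using MD_Ob[of R M] by (simp add: sc_def)

lemma sc_sc:
  assumes R: "CM R" and M: "MD R M" and e: "ar e" "dm e = one" "cd e = mon_ob R" "ar e'" "dm e' = one" "cd e' = mon_ob R"
  shows "sc R M e ** sc R M e' = sc R M (sc R (self_mdl R) e ** e')"
proof -
  note [simp] = R M MD_Ob[OF M] e
  have "sc R M e ** sc R M e' = sc R M e ** ac R M ** (e' >< I (mdl_ob M)) ** li (mdl_ob M)"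
    by (simp add: sc_def[of R M e'])
  also have "\<dots> = ac R M ** (sc R (self_mdl R) e >< I (mdl_ob M)) ** (e' >< I (mdl_ob M)) ** li (mdl_ob M)"
    by (simp add: ra[OF sc_ac])
  also have "\<dots> = sc R M (sc R (self_mdl R) e ** e')"
    by (simp add: sc_def[of R M "sc R (self_mdl R) e ** e'"] mg)
  finally show ?thesis .
qed

lemma sc_mu_lin:
  assumes "CM R" "ar e" "dm e = one" "cd e = mon_ob R"
  shows "sc R (self_mdl R) e ** mu R = mu R ** (sc R (self_mdl R) e >< I (mon_ob R))"
  using sc_ac[of R "self_mdl R" e] assms by simp

lemma triangle_inv:
  assumes [simp]: "x \<in> Ob C" "y \<in> Ob C"
  shows "ai x one y ** (I x >< li y) = ri x >< I y"
proof -
  have i: "isoT (I x >< la y)" unfolding isoT_def by (intro conjI exI[of _ "I x >< li y"]) (auto simp: mg)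
  have "(I x >< la y) ** al x one y ** ai x one y ** (I x >< li y) = (I x >< la y) ** al x one y ** (ri x >< I y)"
    by (simp add: ra[OF triangleT] mg)
  then have "al x one y ** ai x one y ** (I x >< li y) = al x one y ** (ri x >< I y)"
    by (rule isoT_cancel_left[OF i]) auto
  then show ?thesis by (rule isoT_cancel_left[OF al_iso, rotated 3]) auto
qed

text \<open>In elements, \<open>a (e m) = (a e) m = (e a) m\<close>. The hypothesis
  \<open>e 1 = e\<close> allows \<open>a e\<close> to be rewritten as the operator of multiplication
  by \<open>e\<close>, applied to \<open>a\<close>.\<close>

lemma sc_linear:
  assumes R: "CM R" and M: "MD R M" and e: "ar e" "dm e = one" "cd e = mon_ob R" "sc R (self_mdl R) e ** et R = e"
  shows "LM R M M (sc R M e)"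
proof -
  let ?a = "mon_ob R" and ?m = "mdl_ob M"
  note [simp] = R M MD_Ob[OF M] e(1-3)
  let ?e = "sc R (self_mdl R) e"
  have l: "?e ** mu R = mu R ** (I ?a >< ?e)"
    by (rule mu_left_right[OF R _ _ _ sc_mu_lin[OF R e(1-3)]]) auto
  have *: "mu R ** (I ?a >< e) ** ri ?a = ?e"
  proof -
    have "mu R ** (I ?a >< e) ** ri ?a = mu R ** (I ?a >< ?e) ** (I ?a >< et R) ** ri ?a"
      by (simp add: mg e(4))
    also have "\<dots> = ?e ** mu R ** (I ?a >< et R) ** ri ?a"
      by (simp add: ra[OF l[symmetric]])
    also have "\<dots> = ?e" by (simp add: ra[OF mu_et_right])
    finally show ?thesis .
  qed
  have "ac R M ** (I ?a >< sc R M e) = ac R M ** (I ?a >< ac R M) ** (I ?a >< (e >< I ?m)) ** (I ?a >< li ?m)"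
    by (simp add: sc_def mg)
  also have "\<dots> = ac R M ** (I ?a >< ac R M) ** al ?a ?a ?m ** ai ?a ?a ?m ** (I ?a >< (e >< I ?m)) ** (I ?a >< li ?m)"
    by simp
  also have "\<dots> = ac R M ** (mu R >< I ?m) ** ((I ?a >< e) >< I ?m) ** ai ?a one ?m ** (I ?a >< li ?m)"
    by (simp add: ra[OF ac_mu] ai_nat2)
  also have "\<dots> = ac R M ** ((mu R ** (I ?a >< e) ** ri ?a) >< I ?m)"
    by (simp add: triangle_inv mg)
  also have "\<dots> = sc R M e ** ac R M" unfolding * by (simp add: sc_ac)
  finally show ?thesis unfolding LM_def by simp
qed

lemma sc_rs:
  assumes f: "MM R S f" and M: "MD S M" and e: "ar e" "dm e = one" "cd e = mon_ob R"
  shows "sc R (rs f S M) e = sc S M (f ** e)"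
proof -
  note [simp] = MM_D(1-5)[OF f] M MD_Ob[OF M] e
  show ?thesis by (simp add: sc_def ac_rs[OF f] mg)
qed

lemma MM_LM: "MM R S f \<Longrightarrow> LM R (self_mdl R) (rs f S (self_mdl S)) f"
  unfolding LM_def using MD_rs_self[of R S f] MM_D[of R S f] by (simp add: ac_rs_self mg)

text \<open>A multiplicative projection \<open>p\<close> carries the laws of \<open>A\<close> back
  to laws that hold after composing with \<open>p\<close>. Two such projections that are jointly
  monic then prove the laws themselves.\<close>

lemma proj_monoid:
  assumes A: "CM A" and p: "ar p" "dm p = x" "cd p = mon_ob A" and m: "ar m" "dm m = x \<boxtimes> x" "cd m = x"
    and u: "ar u" "dm u = one" "cd u = x" and pm: "p ** m = mu A ** (p >< p)" and pu: "p ** u = et A"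
  shows "p ** m ** (m >< I x) = p ** m ** (I x >< m) ** al x x x"
    "p ** m ** (u >< I x) = p ** la x" "p ** m ** br x x = p ** m"
proof -
  let ?a = "mon_ob A"
  have x: "x \<in> Ob C" using p by auto
  note [simp] = A p m u x
  have "p ** m ** (m >< I x) = mu A ** ((p ** m) >< p)" by (simp add: ra[OF pm] mg)
  also have "\<dots> = mu A ** (mu A >< I ?a) ** ((p >< p) >< p)" unfolding pm by (simp add: mg)
  also have "\<dots> = mu A ** (I ?a >< mu A) ** (p >< (p >< p)) ** al x x x" by (simp add: ra[OF mu_assoc] al_nat)
  also have "\<dots> = mu A ** (p >< (p ** m)) ** al x x x" unfolding pm by (simp add: mg)
  also have "\<dots> = p ** m ** (I x >< m) ** al x x x" by (simp add: ra[OF pm] mg)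
  finally show "p ** m ** (m >< I x) = p ** m ** (I x >< m) ** al x x x" .
  have "p ** m ** (u >< I x) = mu A ** ((p ** u) >< p)" by (simp add: ra[OF pm] mg)
  also have "\<dots> = mu A ** (et A >< I ?a) ** (I one >< p)" unfolding pu by (simp add: mg)
  also have "\<dots> = p ** la x" by (simp add: ra[OF mu_et_left] la_nat)
  finally show "p ** m ** (u >< I x) = p ** la x" .
  have "(p >< p) ** br x x = br ?a ?a ** (p >< p)" by (simp add: br_nat)
  then show "p ** m ** br x x = p ** m" by (simp add: ra[OF pm] pm ra[OF mu_comm])
qed

text \<open>Each law on the quotient is tested on tensor products involving \<open>r\<close>, which
  remain epic.\<close>

lemma epi_monoid:
  assumes R: "CM R" and r: "epi r" "dm r = mon_ob R" and m: "ar m" "dm m = cd r \<boxtimes> cd r" "cd m = cd r"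
    and mr: "m ** (r >< r) = r ** mu R"
  shows "MM R (mkmon m (r ** et R)) r"
proof -
  let ?a = "mon_ob R" and ?x = "cd r" and ?u = "r ** et R"
  have ar: "ar r" using r by (simp add: epi_def)
  then have x: "?x \<in> Ob C" by auto
  note [simp] = R r(2) m ar x
  have e: "epi ((r >< r) >< r)" "epi (I one >< r)" "epi (r >< r)"
    using epi_tns epi_tns_left r(1) by auto
  note mk = mkmon[of m ?u ?x]
  have "CM (mkmon m ?u)"
  proof (rule CM_mkmon)
    have "(m ** (m >< I ?x)) ** ((r >< r) >< r) = m ** ((m ** (r >< r)) >< r)" by (simp add: mg)
    also have "\<dots> = m ** (r >< r) ** (mu R >< I ?a)" unfolding mr by (simp add: mg)
    also have "\<dots> = m ** (r >< r) ** (I ?a >< mu R) ** al ?a ?a ?a" by (simp add: ra[OF mr] mu_assoc)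
    also have "\<dots> = m ** (r >< (m ** (r >< r))) ** al ?a ?a ?a" unfolding mr by (simp add: mg)
    also have "\<dots> = m ** (I ?x >< m) ** (r >< (r >< r)) ** al ?a ?a ?a" by (simp add: mg)
    also have "\<dots> = (m ** (I ?x >< m) ** al ?x ?x ?x) ** ((r >< r) >< r)" by (simp add: al_nat)
    finally show "m ** (m >< I ?x) = m ** (I ?x >< m) ** al ?x ?x ?x" by (rule epiD[OF e(1)]) auto
    have "(m ** (?u >< I ?x)) ** (I one >< r) = m ** (r >< r) ** (et R >< I ?a)" by (simp add: mg)
    also have "\<dots> = la ?x ** (I one >< r)" by (simp add: ra[OF mr] mu_et_left la_nat)
    finally show "m ** (?u >< I ?x) = la ?x" by (rule epiD[OF e(2)]) auto
    have "(m ** br ?x ?x) ** (r >< r) = m ** (r >< r)" by (simp add: br_nat ra[OF mr] mu_comm mr)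
    then show "m ** br ?x ?x = m" by (rule epiD[OF e(3)]) auto
  qed auto
  then show ?thesis unfolding MM_def using mr mk by simp
qed

lemma MM_epi_factor:
  assumes r: "MM R S r" "epi r" and k: "MM R T k" and h: "ar h" "dm h = mon_ob S" "h ** r = k"
  shows "MM S T h"
proof -
  note rD = MM_D[OF r(1)] and kD = MM_D[OF k]
  have c: "cd h = mon_ob T" using arg_cong[OF h(3), of cd] kD by simp
  note [simp] = rD(1-5) kD(1-5) h(1,2) c
  have "(h ** mu S) ** (r >< r) = h ** r ** mu R" by (simp add: rD(6))
  also have "\<dots> = k ** mu R" by (simp add: ra[OF h(3)])
  also have "\<dots> = mu T ** ((h ** r) >< (h ** r))" unfolding h(3) by (rule kD)
  also have "\<dots> = (mu T ** (h >< h)) ** (r >< r)" by (simp add: mg)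
  finally have "h ** mu S = mu T ** (h >< h)" by (rule epiD[OF epi_tns[OF r(2) r(2)]]) auto
  moreover have "h ** et S = et T" using ra[OF h(3), of "et R"] rD(7) kD(7) by simp
  ultimately show ?thesis unfolding MM_def by simp
qed

text \<open>\<open>R\<close> is the product of \<open>S\<close> and \<open>T\<close>, expressed through the biproduct of the underlying objects.\<close>

definition SP where
  "SP R S T r s r' s' \<longleftrightarrow> MM R S r \<and> MM R T r' \<and> ar s \<and> dm s = mon_ob S \<and> cd s = mon_ob R \<and>
     ar s' \<and> dm s' = mon_ob T \<and> cd s' = mon_ob R \<and> r ** s = I (mon_ob S) \<and> r' ** s' = I (mon_ob T) \<and>
     r ** s' = zr (mon_ob T) (mon_ob S) \<and> r' ** s = zr (mon_ob S) (mon_ob T) \<and>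
     (s ** r) \<boxplus> (s' ** r') = I (mon_ob R)"

lemma SP_D:
  assumes "SP R S T r s r' s'"
  shows "MM R S r" "MM R T r'" "ar s" "dm s = mon_ob S" "cd s = mon_ob R"
     "ar s'" "dm s' = mon_ob T" "cd s' = mon_ob R" "r ** s = I (mon_ob S)" "r' ** s' = I (mon_ob T)"
     "r ** s' = zr (mon_ob T) (mon_ob S)" "r' ** s = zr (mon_ob S) (mon_ob T)"
     "(s ** r) \<boxplus> (s' ** r') = I (mon_ob R)" "epi r" "epi r'"
proof -
  note d = assms[unfolded SP_def]
  show "MM R S r" "MM R T r'" "ar s" "dm s = mon_ob S" "cd s = mon_ob R"
     "ar s'" "dm s' = mon_ob T" "cd s' = mon_ob R" "r ** s = I (mon_ob S)" "r' ** s' = I (mon_ob T)"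
     "r ** s' = zr (mon_ob T) (mon_ob S)" "r' ** s = zr (mon_ob S) (mon_ob T)"
     "(s ** r) \<boxplus> (s' ** r') = I (mon_ob R)" using d by blast+
  show "epi r" "epi r'" using d MM_D[of R S r] MM_D[of R T r'] split_epi[of r s] split_epi[of r' s'] by simp_all
qed

lemma SP_sym: "SP R S T r s r' s' \<Longrightarrow> SP R T S r' s' r s"
proof -
  assume a: "SP R S T r s r' s'"
  note d = SP_D[OF a] MM_D[OF SP_D(1)[OF a]] MM_D[OF SP_D(2)[OF a]]
  have "(s' ** r') \<boxplus> (s ** r) = (s ** r) \<boxplus> (s' ** r')" by (rule add_comm) (use d in simp_all)
  then show ?thesis unfolding SP_def using d by simp
qed

lemma SP_jm:
  assumes a: "SP R S T r s r' s'" and g: "ar g" "ar h" "cd g = mon_ob R" "cd h = mon_ob R"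
    and e: "r ** g = r ** h" "r' ** g = r' ** h"
  shows "g = h"
proof -
  have *: "k = (s ** (r ** k)) \<boxplus> (s' ** (r' ** k))" if "ar k" "cd k = mon_ob R" for k
    using that cmp_add_l[of "s ** r" "s' ** r'" k] SP_D(13)[OF a] by simp
  show ?thesis using *[of g] *[of h] g unfolding e by simp
qed

text \<open>\<open>s ** r\<close> is multiplication by the idempotent (1, 0). Its linearity is
  checked in the two components, where it is the identity and zero.\<close>

lemma SP_lin:
  assumes a: "SP R S T r s r' s'"
  shows "(s ** r) ** mu R = mu R ** ((s ** r) >< I (mon_ob R))"
proof -
  note d = SP_D[OF a] and rD = MM_D[OF SP_D(1)[OF a]] and rD' = MM_D[OF SP_D(2)[OF a]]
  note [simp] = d(3-8) rD(1-5) rD'(1-5)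
  show ?thesis
  proof (rule SP_jm[OF a])
    show "r ** (s ** r) ** mu R = r ** mu R ** ((s ** r) >< I (mon_ob R))"
      by (simp add: ra[OF d(9)] ra[OF rD(6)] rD(6) mg)
    show "r' ** (s ** r) ** mu R = r' ** mu R ** ((s ** r) >< I (mon_ob R))"
      by (simp add: ra[OF d(12)] ra[OF rD'(6)] mg)
  qed auto
qed

text \<open>Unit and multiplication are taken componentwise on the biproduct; the laws hold because
  they hold after each projection.\<close>

lemma SP_exists:
  assumes A: "CM A" and B: "CM B"
  obtains D r s r' s' where "SP D A B r s r' s'"
proof -
  let ?a = "mon_ob A" and ?b = "mon_ob B"
  obtain P i j p q where P: "P \<in> Ob C" "ar i" "ar j" "ar p" "ar q" "dm i = ?a" "dm j = ?b" "cd i = P" "cd j = P"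
    "dm p = P" "dm q = P" "cd p = ?a" "cd q = ?b" and e: "p ** i = I ?a" "q ** j = I ?b" "p ** j = zr ?b ?a" "q ** i = zr ?a ?b"
    "(i ** p) \<boxplus> (j ** q) = I P"
    using ex_biproduct[OF CM_ar(1)[OF A] CM_ar(1)[OF B]] by metis
  note [simp] = A B P
  define m where "m = (i ** mu A ** (p >< p)) \<boxplus> (j ** mu B ** (q >< q))"
  define u where "u = (i ** et A) \<boxplus> (j ** et B)"
  have m: "ar m" "dm m = P \<boxtimes> P" "cd m = P" and u: "ar u" "dm u = one" "cd u = P" by (simp_all add: m_def u_def)
  have pq: "p ** m = mu A ** (p >< p)" "p ** u = et A" "q ** m = mu B ** (q >< q)" "q ** u = et B"
    by (simp_all add: m_def u_def cmp_add_r ra[OF e(1)] ra[OF e(2)] ra[OF e(3)] ra[OF e(4)])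
  note pp = proj_monoid[OF A _ _ _ m u pq(1,2)] and qq = proj_monoid[OF B _ _ _ m u pq(3,4)]
  have jm: "g = h" if "ar g" "ar h" "cd g = P" "cd h = P" "p ** g = p ** h" "q ** g = q ** h" for g h
  proof -
    have *: "k = (i ** (p ** k)) \<boxplus> (j ** (q ** k))" if "ar k" "cd k = P" for k
      using that cmp_add_l[of "i ** p" "j ** q" k] e(5) by simp
    show ?thesis using *[of g] *[of h] that(1-4) unfolding that(5,6) by simp
  qed
  have CM: "CM (mkmon m u)"
    by (rule CM_mkmon[OF m(1) u(1) m(3,2) u(2,3)]; rule jm) (use m u pp qq in simp_all)
  note mk = mkmon[OF m(1) u(1) m(3,2) u(2,3)]
  have "SP (mkmon m u) A B p i q j"
    unfolding SP_def MM_def using CM mk m u pq e by simp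
  then show ?thesis by (rule that)
qed

text \<open>\<open>g\<close> sends (1, 0) and (0, 1) to complementary idempotents of
  \<open>R'\<close>, and splitting the multiplications by them yields the two factors. The
  decomposition is obtained without forming a pushout.\<close>

lemma SP_base_change:
  assumes a: "SP R S T r s r' s'" and g: "MM R R' g"
  obtains S' T' q t q' t' h h' where "SP R' S' T' q t q' t'" "MM S S' h" "MM T T' h'"
    "h ** r = q ** g" "h' ** r' = q' ** g"
proof -
  note d = SP_D[OF a] and rD = MM_D[OF SP_D(1)[OF a]] and rD' = MM_D[OF SP_D(2)[OF a]] and gD = MM_D[OF g]
  note d' = SP_D[OF SP_sym[OF a]]
  note [simp] = d(3-8) rD(1-5) rD'(1-5) gD(1-5)
  let ?b = "mon_ob R'"
  let ?N = "self_mdl R'"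
  \<comment> \<open>The global elements (1, 0) and, next, (0, 1) of \<open>R\<close>.\<close>
  define x where "x = s ** r ** et R"
  define x' where "x' = s' ** r' ** et R"
  have x: "ar x" "dm x = one" "cd x = mon_ob R" "ar x'" "dm x' = one" "cd x' = mon_ob R" by (simp_all add: x_def x'_def)
  note [simp] = x
  define e where "e = sc R' ?N (g ** x)"
  define e' where "e' = sc R' ?N (g ** x')"
  have e: "ar e" "dm e = ?b" "cd e = ?b" "ar e'" "dm e' = ?b" "cd e' = ?b" by (simp_all add: e_def e'_def)
  note [simp] = e
  have scx: "sc R (self_mdl R) x = s ** r" "sc R (self_mdl R) x' = s' ** r'"
    using sc_mu[OF rD(1) _ _ _ SP_lin[OF a]] sc_mu[OF rD(1) _ _ _ SP_lin[OF SP_sym[OF a]]] by (simp_all add: x_def x'_def)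
  have eg: "e ** g = g ** s ** r" "e' ** g = g ** s' ** r'"
    using sc_LM[OF rD(1) MM_LM[OF g] x(1-3)] sc_LM[OF rD(1) MM_LM[OF g] x(4-6)]
      sc_rs[OF g, of ?N x] sc_rs[OF g, of ?N x'] by (simp_all add: e_def e'_def scx)
  \<comment> \<open>\<open>g\<close> preserves the unit, so the images of the two idempotents still
    add up to it.\<close>
  have one: "e \<boxplus> e' = I ?b"
  proof -
    have "x \<boxplus> x' = ((s ** r) \<boxplus> (s' ** r')) ** et R" by (simp add: x_def x'_def cmp_add_l)
    then have "(g ** x) \<boxplus> (g ** x') = et R'" using gD(7) by (simp add: d(13) cmp_add_r[symmetric])
    then show ?thesis unfolding e_def e'_def by (simp add: sc_add[symmetric] sc_et)
  qed
  have xx: "e ** g ** x = g ** x" "e ** g ** x' = zr one ?b" "e' ** g ** x' = g ** x'" "e' ** g ** x = zr one ?b"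
    by (simp_all add: ra[OF eg(1)] ra[OF eg(2)] x_def x'_def ra[OF d(9)] ra[OF d(10)] ra[OF d(11)] ra[OF d(12)])
  have ee: "e ** e = e" "e ** e' = zr ?b ?b" "e' ** e' = e'" "e' ** e = zr ?b ?b"
    using xx by (simp_all add: e_def e'_def sc_sc sc_zr)
  have lin: "e ** mu R' = mu R' ** (e >< I ?b)" "e' ** mu R' = mu R' ** (e' >< I ?b)"
    unfolding e_def e'_def by (rule sc_mu_lin; simp)+
  \<comment> \<open>The image of a linear idempotent \<open>f\<close> is a quotient monoid of
    \<open>R'\<close> with multiplication \<open>q ** mu R' ** (t >< t)\<close>; linearity of
    \<open>f\<close> in both arguments makes \<open>q\<close> multiplicative.\<close>
  have half: "\<exists>Q q t. MM R' Q q \<and> ar t \<and> dm t = mon_ob Q \<and> cd t = ?b \<and> q ** t = I (mon_ob Q) \<and> t ** q = f"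
    if f: "ar f" "dm f = ?b" "cd f = ?b" "f ** f = f" "f ** mu R' = mu R' ** (f >< I ?b)" for f
  proof -
    obtain t q where tq: "ar t" "ar q" "cd t = ?b" "dm q = ?b" "cd q = dm t" "t ** q = f" "q ** t = I (dm t)"
      using idempotent_splits[of f] f by metis
    note [simp] = tq(1-5) f(1-3)
    have eq: "epi q" by (rule split_epi[of q t]) (use tq in auto)
    have "(q ** mu R' ** (t >< t)) ** (q >< q) = q ** mu R' ** (f >< I ?b) ** (I ?b >< f)" by (simp add: mg tq(6))
    also have "\<dots> = q ** f ** mu R' ** (I ?b >< f)"
      by (simp add: ra[OF f(5)[symmetric]])
    also have "\<dots> = q ** f ** f ** mu R'"
      by (simp add: mu_left_right[OF gD(2) f(1-3,5), symmetric])
    also have "\<dots> = q ** f ** mu R'" by (simp add: ra[OF f(4)])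
    also have "\<dots> = q ** mu R'" unfolding tq(6)[symmetric] by (simp add: ra[OF tq(7)])
    finally have "MM R' (mkmon (q ** mu R' ** (t >< t)) (q ** et R')) q"
      by (intro epi_monoid[OF gD(2) eq]) auto
    then show ?thesis using tq by (intro exI[of _ "mkmon (q ** mu R' ** (t >< t)) (q ** et R')"] exI[of _ q] exI[of _ t]) auto
  qed
  obtain S' q t where q: "MM R' S' q" and t: "ar t" "dm t = mon_ob S'" "cd t = ?b" "q ** t = I (mon_ob S')" "t ** q = e"
    using half[OF e(1-3) ee(1) lin(1)] by metis
  obtain T' q' t' where q': "MM R' T' q'" and t': "ar t'" "dm t' = mon_ob T'" "cd t' = ?b" "q' ** t' = I (mon_ob T')" "t' ** q' = e'"
    using half[OF e(4-6) ee(3) lin(2)] by metis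
  note [simp] = MM_D(1-5)[OF q] MM_D(1-5)[OF q'] t(1-3) t'(1-3)
  have z1: "q ** t' = zr (mon_ob T') (mon_ob S')"
  proof -
    have "q ** t' = (q ** t) ** q ** (t' ** (q' ** t'))" unfolding t(4) t'(4) by simp
    also have "\<dots> = q ** (e ** e') ** t'" unfolding t(5)[symmetric] t'(5)[symmetric] by simp
    finally show ?thesis by (simp add: ee)
  qed
  have z2: "q' ** t = zr (mon_ob S') (mon_ob T')"
  proof -
    have "q' ** t = (q' ** t') ** q' ** (t ** (q ** t))" unfolding t(4) t'(4) by simp
    also have "\<dots> = q' ** (e' ** e) ** t" unfolding t(5)[symmetric] t'(5)[symmetric] by simp
    finally show ?thesis by (simp add: ee)
  qed
  have sp: "SP R' S' T' q t q' t'"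
    unfolding SP_def using q q' t t' z1 z2 one by simp
  \<comment> \<open>\<open>q\<close> absorbs the idempotent \<open>e\<close>, so
    \<open>q ** g\<close> depends on the first component only; likewise \<open>q'\<close> with
    \<open>e'\<close> and the second.\<close>
  have hr: "(q ** g ** s) ** r = q ** g" "(q' ** g ** s') ** r' = q' ** g"
  proof -
    have "(q ** g ** s) ** r = q ** e ** g" by (simp add: eg)
    then show "(q ** g ** s) ** r = q ** g" unfolding t(5)[symmetric] by (simp add: ra[OF t(4)])
    have "(q' ** g ** s') ** r' = q' ** e' ** g" by (simp add: eg)
    then show "(q' ** g ** s') ** r' = q' ** g" unfolding t'(5)[symmetric] by (simp add: ra[OF t'(4)])
  qed
  have "MM S S' (q ** g ** s)" by (rule MM_epi_factor[OF d(1,14) MM_cmp[OF g q] _ _ hr(1)]) auto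
  moreover have "MM T T' (q' ** g ** s')" by (rule MM_epi_factor[OF d(2,15) MM_cmp[OF g q'] _ _ hr(2)]) auto
  ultimately show ?thesis using that[OF sp _ _ hr] by blast
qed

section \<open>Extension of scalars along the projections of a product\<close>

lemma mod_kernelE:
  assumes "mod_kernel A K M N k f" "LM A Z M g" "f ** g = zr (mdl_ob Z) (mdl_ob N)"
  obtains h where "LM A Z K h" "k ** h = g" "\<And>h'. LM A Z K h' \<Longrightarrow> k ** h' = g \<Longrightarrow> h' = h"
proof -
  have "\<exists>!h. LM A Z K h \<and> k ** h = g" using assms unfolding mod_kernel_def by blast
  then show ?thesis using that by (elim ex1E) blast
qed

lemma mod_cokernelE:
  assumes "mod_cokernel A M N Q f p" "LM A N Z g" "g ** f = zr (mdl_ob M) (mdl_ob Z)"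
  obtains h where "LM A Q Z h" "h ** p = g" "\<And>h'. LM A Q Z h' \<Longrightarrow> h' ** p = g \<Longrightarrow> h' = h"
proof -
  have "\<exists>!h. LM A Q Z h \<and> h ** p = g" using assms unfolding mod_cokernel_def by blast
  then show ?thesis using that by (elim ex1E) blast
qed

text \<open>\<open>r\<close> is already split epic in \<open>C\<close>.\<close>

lemma SP_epic:
  assumes a: "SP R S T r s r' s'"
  shows "epic (CommMon C) R S (un r)"
proof -
  note d = SP_D[OF a] and rD = MM_D[OF SP_D(1)[OF a]]
  have "g = h" if D: "CM D" and g: "g \<in> Hom (CommMon C) S D" "h \<in> Hom (CommMon C) S D" and e: "g \<cdot> un r = h \<cdot> un r" for D g h
  proof -
    let ?g = "mk (mon_ob S) g (mon_ob D)" and ?h = "mk (mon_ob S) h (mon_ob D)"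
    have gh: "MM S D ?g" "MM S D ?h" using g Hom_CommMon[OF rD(2) D] by auto
    note [simp] = MM_D(3)[OF gh(1)] MM_D(3)[OF gh(2)] rD(1-5)
    have "?g ** r = ?h ** r" using e by (intro un_inject) (auto simp: un_cmp)
    then have "?g = ?h" by (rule epiD[OF d(14)]) auto
    then show "g = h" by (rule mk_inject[rotated]) simp
  qed
  then show ?thesis unfolding epic_def CommMon_comp using MM_un[OF d(1)] Ob_CommMon by blast
qed

text \<open>The extension of \<open>M\<close> along a projection is the summand of \<open>M\<close>
  cut out by (1, 0). Its inclusion \<open>z\<close> sends \<open>m \<otimes> b\<close> to
  \<open>m s(b)\<close>, and \<open>xe\<close> is the retraction.\<close>

lemma SP_ext_split:
  assumes a: "SP R S T r s r' s'" and M: "MD R M"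
  obtains z where "ar z" "dm z = mdl_ob (xo R S r M)" "cd z = mdl_ob M"
    "z ** xe R S r M = sc R M (s ** r ** et R)" "xe R S r M ** z = I (mdl_ob (xo R S r M))"
    "LM R (rs r S (xo R S r M)) M z"
proof -
  note d = SP_D[OF a] and rD = MM_D[OF SP_D(1)[OF a]]
  let ?a = "mon_ob R" and ?m = "mdl_ob M" and ?b = "mon_ob S" and ?N = "rs r S (self_mdl S)" and ?q = "xq R S r M"
  note [simp] = d(3-8) rD(1-5) M MD_Ob[OF M] ar_xq[OF d(1) M] ar_xe[OF d(1) M] MD_rs_self[OF d(1)] xo_ob[OF d(1)]
    xo_MD[OF d(1) M] MD_rs[OF d(1) xo_MD[OF d(1) M]]
  let ?A = "ac R M ** br ?m ?a"
  \<comment> \<open>\<open>s\<close> is linear over \<open>R\<close>: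
    \<open>s(r(a) b) = a s(b)\<close>. This makes \<open>z\<close> well defined on the tensor
    product.\<close>
  have sl: "s ** mu S ** (r >< I ?b) = mu R ** (I ?a >< s)"
  proof -
    have "(s ** mu S ** (r >< I ?b)) ** (I ?a >< r) = (s ** r) ** mu R" by (simp add: rD(6) mg)
    also have "\<dots> = mu R ** (I ?a >< (s ** r))" by (rule mu_left_right[OF _ _ _ _ SP_lin[OF a]]) auto
    also have "\<dots> = (mu R ** (I ?a >< s)) ** (I ?a >< r)" by (simp add: mg)
    finally show ?thesis by (rule epiD[OF epi_tns_left[OF d(14) CM_ar(1)[OF rD(1)]]]) auto
  qed
  have "(?A ** (I ?m >< s)) ** (?A >< I ?b) = (?A ** (?A >< I ?a)) ** (I (?m \<boxtimes> ?a) >< s)"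
    by (simp add: mg)
  also have "\<dots> = ?A ** (I ?m >< mu R) ** al ?m ?a ?a ** ((I ?m >< I ?a) >< s)"
    unfolding right_action_assoc[OF rD(1) M] by simp
  also have "\<dots> = ?A ** (I ?m >< (mu R ** (I ?a >< s))) ** al ?m ?a ?b"
    by (simp add: al_nat mrg2 del: I_tns)
  also have "\<dots> = (?A ** (I ?m >< s)) ** (I ?m >< ac R ?N) ** al ?m ?a ?b"
    unfolding sl[symmetric] ac_rs_self[OF d(1)] by (simp add: mg)
  finally have eq: "(?A ** (I ?m >< s)) ** (?A >< I ?b) = (?A ** (I ?m >< s)) ** (I ?m >< ac R ?N) ** al ?m ?a ?b" .
  obtain z where z: "ar z" "dm z = cd ?q" "cd z = ?m" "z ** ?q = ?A ** (I ?m >< s)"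
    by (rule coeq_ex[OF tq_coeq[OF rD(1) M MD_rs_self[OF d(1)]], of "?A ** (I ?m >< s)"]) (use eq in auto)
  note [simp] = z(1-3)
  have brri: "br ?m one ** ri ?m = li ?m"
  proof (rule isoT_cancel_left[OF la_iso, of ?m])
    show "la ?m ** br ?m one ** ri ?m = la ?m ** li ?m" by (simp add: ra[OF la_br])
  qed auto
  have "z ** xe R S r M = ?A ** (I ?m >< s) ** (I ?m >< et S) ** ri ?m" by (simp add: xe_def ra[OF z(4)])
  also have "\<dots> = ac R M ** ((s ** et S) >< I ?m) ** br ?m one ** ri ?m" by (simp add: br_nat2 mg)
  also have "\<dots> = sc R M (s ** r ** et R)" by (simp add: brri sc_def rD(7))
  finally have 1: "z ** xe R S r M = sc R M (s ** r ** et R)" .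
  have "(xe R S r M ** z) ** ?q = (xe R S r M ** ac R M ** br ?m ?a) ** (I ?m >< s)" by (simp add: z(4))
  also have "\<dots> = ?q" unfolding xe_ac_br[OF d(1) M] by (simp add: mg d(9))
  finally have "(xe R S r M ** z) ** ?q = I (cd ?q) ** ?q" by simp
  then have 2: "xe R S r M ** z = I (cd ?q)" by (rule epiD[OF epi_xq[OF d(1) M]]) auto
  note xl = xe_LM[OF d(1) M]
  have ex: "epi (xe R S r M)" by (rule split_epi[of _ z]) (use 2 in auto)
  have scl: "LM R M M (sc R M (s ** r ** et R))"
  proof (rule sc_linear)
    show "sc R (self_mdl R) (s ** r ** et R) ** et R = s ** r ** et R"
      using sc_mu[OF rD(1) _ _ _ SP_lin[OF a]] by simp
  qed auto
  have "(z ** ac R (rs r S (xo R S r M))) ** (I ?a >< xe R S r M) = z ** xe R S r M ** ac R M"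
    by (simp add: LM_D(6)[OF xl])
  also have "\<dots> = sc R M (s ** r ** et R) ** ac R M" by (simp add: ra[OF 1])
  also have "\<dots> = ac R M ** (I ?a >< (z ** xe R S r M))" unfolding 1 by (rule LM_D(6)[OF scl])
  also have "\<dots> = (ac R M ** (I ?a >< z)) ** (I ?a >< xe R S r M)" by (simp add: mg)
  finally have "z ** ac R (rs r S (xo R S r M)) = ac R M ** (I ?a >< z)"
    by (rule epiD[OF epi_tns_left[OF ex CM_ar(1)[OF rD(1)]]]) auto
  then have 3: "LM R (rs r S (xo R S r M)) M z" unfolding LM_def by simp
  show ?thesis by (rule that[OF z(1) _ z(3) 1 _ 3]) (use 2 in auto)
qed

text \<open>The extension is a natural retract of the module. A test map is carried to
  \<open>R\<close>-modules through the retraction or its section, factored there, and carried back;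
  the result is linear over \<open>S\<close> because restriction along \<open>r\<close> is
  full.\<close>

lemma SP_flat:
  assumes a: "SP R S T r s r' s'"
  shows "flat C R S (un r)"
  unfolding flat_def exact_functor_def
proof (intro ballI allI impI)
  note d = SP_D[OF a] and rD = MM_D[OF SP_D(1)[OF a]]
  fix x y z f0 g0
  assume xyz: "x \<in> Ob (Mod C R)" "y \<in> Ob (Mod C R)" "z \<in> Ob (Mod C R)" and se: "short_exact (Mod C R) x y z f0 g0"
  then have M: "MD R x" "MD R y" "MD R z" by (auto simp: Ob_Mod)
  have k0: "is_kernel (Mod C R) x y z f0 g0" and c0: "is_cokernel (Mod C R) x y z f0 g0" using se by (auto simp: short_exact_def)
  obtain f where f: "LM R x y f" "f0 = un f"
    using k0 Hom_Mod_ex[OF rD(1) M(1,2)] unfolding is_kernel_def by blast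
  obtain g where g: "LM R y z g" "g0 = un g"
    using k0 Hom_Mod_ex[OF rD(1) M(2,3)] unfolding is_kernel_def by blast
  have mk: "mod_kernel R x y z f g" using k0 is_kernel_Mod[OF rD(1) f(1) g(1)] f g by simp
  have mc: "mod_cokernel R x y z f g" using c0 is_cokernel_Mod[OF rD(1) g(1) f(1)] f g by simp
  let ?F = "xo R S r"
  let ?e = "\<lambda>w. xe R S r w" and ?x = "s ** r ** et R"
  obtain hf where hf: "LM S (?F x) (?F y) hf" "ext_mor C R S (un r) x y (un f) = un hf" "hf ** ?e x = ?e y ** f"
    using ext_mor_LM[OF d(1) f(1)] by metis
  obtain hg where hg: "LM S (?F y) (?F z) hg" "ext_mor C R S (un r) y z (un g) = un hg" "hg ** ?e y = ?e z ** g"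
    using ext_mor_LM[OF d(1) g(1)] by metis
  obtain tx where tx: "ar tx" "dm tx = mdl_ob (?F x)" "cd tx = mdl_ob x" "tx ** ?e x = sc R x ?x" "?e x ** tx = I (mdl_ob (?F x))"
    "LM R (rs r S (?F x)) x tx" using SP_ext_split[OF a M(1)] by metis
  obtain ty where ty: "ar ty" "dm ty = mdl_ob (?F y)" "cd ty = mdl_ob y" "ty ** ?e y = sc R y ?x" "?e y ** ty = I (mdl_ob (?F y))"
    "LM R (rs r S (?F y)) y ty" using SP_ext_split[OF a M(2)] by metis
  obtain tz where tz: "ar tz" "dm tz = mdl_ob (?F z)" "cd tz = mdl_ob z" "tz ** ?e z = sc R z ?x" "?e z ** tz = I (mdl_ob (?F z))"
    "LM R (rs r S (?F z)) z tz" using SP_ext_split[OF a M(3)] by metis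
  have xob: "mdl_ob (?F w) = cd (xq R S r w)" for w by (rule xo_ob[OF d(1)])
  note [simp] = d(3-8) rD(1-5) M MD_Ob[OF M(1)] MD_Ob[OF M(2)] MD_Ob[OF M(3)] ar_xe[OF d(1) M(1)] ar_xe[OF d(1) M(2)] ar_xe[OF d(1) M(3)]
    LM_D(3-5)[OF f(1)] LM_D(3-5)[OF g(1)] LM_D(3-5)[OF hf(1)] LM_D(3-5)[OF hg(1)] tx(1-3) ty(1-3) tz(1-3) xob
    ar_xq[OF d(1) M(1)] ar_xq[OF d(1) M(2)] ar_xq[OF d(1) M(3)]
  have xe: "epi (?e x)" "epi (?e y)" "epi (?e z)"
    using split_epi[of "?e x" tx] split_epi[of "?e y" ty] split_epi[of "?e z" tz] tx(5) ty(5) tz(5) by simp_all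
  \<comment> \<open>The sections are natural in the module because linear maps commute with
    scalars.\<close>
  have nat: "k ** tv = tw ** hk"
    if k: "LM R v w k" "hk ** ?e v = ?e w ** k" and v: "MD R v" "ar tv" "dm tv = mdl_ob (?F v)" "cd tv = mdl_ob v" "tv ** ?e v = sc R v ?x" "?e v ** tv = I (mdl_ob (?F v))"
      and w: "MD R w" "ar tw" "dm tw = mdl_ob (?F w)" "cd tw = mdl_ob w" "tw ** ?e w = sc R w ?x"
      and hk: "ar hk" "dm hk = mdl_ob (?F v)" "cd hk = mdl_ob (?F w)" for k tv tw hk v w
  proof -
    note [simp] = LM_D(3-5)[OF k(1)] v(1-4) w(1-4) hk ar_xe[OF d(1) v(1)] ar_xe[OF d(1) w(1)]
    have sk: "k ** sc R v ?x = sc R w ?x ** k" by (rule sc_LM[OF rD(1) k(1)]) auto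
    have "k ** tv = k ** tv ** ?e v ** tv" by (simp add: v(6))
    also have "\<dots> = sc R w ?x ** k ** tv" by (simp add: ra[OF v(5)] ra[OF sk])
    also have "\<dots> = tw ** hk ** ?e v ** tv" by (simp add: ra[OF k(2)] w(5)[symmetric])
    finally show ?thesis by (simp add: v(6))
  qed
  have nf: "f ** tx = ty ** hf" by (rule nat[OF f(1) hf(3) M(1) tx(1-5) M(2) ty(1-4)]) auto
  have ng: "g ** ty = tz ** hg" by (rule nat[OF g(1) hg(3) M(2) ty(1-5) M(3) tz(1-4)]) auto
  have gf: "g ** f = zr (mdl_ob x) (mdl_ob z)" using mk by (simp add: mod_kernel_def)
  have hgf: "hg ** hf = zr (mdl_ob (?F x)) (mdl_ob (?F z))"
  proof (rule epiD[OF xe(1)])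
    have "(hg ** hf) ** ?e x = hg ** ?e y ** f" by (simp add: hf(3))
    also have "\<dots> = ?e z ** g ** f" by (simp add: ra[OF hg(3)])
    finally show "(hg ** hf) ** ?e x = zr (mdl_ob (?F x)) (mdl_ob (?F z)) ** ?e x" by (simp add: gf)
  qed auto
  have mk': "mod_kernel S (?F x) (?F y) (?F z) hf hg"
    unfolding mod_kernel_def
  proof (intro conjI hf(1) hg(1) hgf allI impI)
    fix Z t assume t: "LM S Z (?F y) t" and z0: "hg ** t = zr (mdl_ob Z) (mdl_ob (?F z))"
    note tD = LM_D[OF t]
    note [simp] = tD(3-5) MD_Ob[OF tD(1)]
    have t': "LM R (rs r S Z) y (ty ** t)" by (rule LM_cmp[OF rD(1) LM_rs[OF d(1) t] ty(6)])
    have "g ** ty ** t = zr (mdl_ob (rs r S Z)) (mdl_ob z)" by (simp add: ra[OF ng] z0)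
    then obtain u where u: "LM R (rs r S Z) x u" "f ** u = ty ** t" and uu: "\<And>u'. LM R (rs r S Z) x u' \<Longrightarrow> f ** u' = ty ** t \<Longrightarrow> u' = u"
      using mod_kernelE[OF mk t'] by blast
    note [simp] = LM_D(3-5)[OF u(1)]
    have "LM R (rs r S Z) (rs r S (?F x)) (?e x ** u)" by (rule LM_cmp[OF rD(1) u(1) xe_LM[OF d(1) M(1)]])
    then have w: "LM S Z (?F x) (?e x ** u)" by (rule LM_rs_full[OF d(1,14) _ tD(1) xo_MD[OF d(1) M(1)]])
    have "hf ** ?e x ** u = ?e y ** ty ** t" by (simp add: ra[OF hf(3)] u(2))
    also have "\<dots> = t" by (simp add: ra[OF ty(5)])
    finally have w2: "hf ** ?e x ** u = t" .
    have "w' = ?e x ** u" if w': "LM S Z (?F x) w'" "hf ** w' = t" for w'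
    proof -
      note [simp] = LM_D(3-5)[OF w'(1)]
      have "LM R (rs r S Z) x (tx ** w')" by (rule LM_cmp[OF rD(1) LM_rs[OF d(1) w'(1)] tx(6)])
      moreover have "f ** tx ** w' = ty ** t" by (simp add: ra[OF nf] w'(2))
      ultimately have "tx ** w' = u" by (rule uu)
      then have "?e x ** tx ** w' = ?e x ** u" by simp
      then show ?thesis by (simp add: ra[OF tx(5)])
    qed
    then show "\<exists>!h. LM S Z (?F x) h \<and> hf ** h = t" using w w2 by (intro ex1I[of _ "?e x ** u"]) blast+
  qed
  have mc': "mod_cokernel S (?F x) (?F y) (?F z) hf hg"
    unfolding mod_cokernel_def
  proof (intro conjI hf(1) hg(1) hgf allI impI)
    fix Z t assume t: "LM S (?F y) Z t" and z0: "t ** hf = zr (mdl_ob (?F x)) (mdl_ob Z)"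
    note tD = LM_D[OF t]
    note [simp] = tD(3-5) MD_Ob[OF tD(2)]
    have t': "LM R y (rs r S Z) (t ** ?e y)" by (rule LM_cmp[OF rD(1) xe_LM[OF d(1) M(2)] LM_rs[OF d(1) t]])
    have "(t ** ?e y) ** f = t ** hf ** ?e x" by (simp add: hf(3))
    also have "\<dots> = zr (mdl_ob x) (mdl_ob (rs r S Z))" by (simp add: ra[OF z0])
    finally obtain u where u: "LM R z (rs r S Z) u" "u ** g = t ** ?e y" and uu: "\<And>u'. LM R z (rs r S Z) u' \<Longrightarrow> u' ** g = t ** ?e y \<Longrightarrow> u' = u"
      using mod_cokernelE[OF mc t'] by blast
    note [simp] = LM_D(3-5)[OF u(1)]
    have "LM R (rs r S (?F z)) (rs r S Z) (u ** tz)" by (rule LM_cmp[OF rD(1) tz(6) u(1)])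
    then have w: "LM S (?F z) Z (u ** tz)" by (rule LM_rs_full[OF d(1,14) _ xo_MD[OF d(1) M(3)] tD(2)])
    have "(u ** tz) ** hg = u ** g ** ty" by (simp add: ng)
    also have "\<dots> = t" by (simp add: ra[OF u(2)] ty(5))
    finally have w2: "(u ** tz) ** hg = t" .
    have "w' = u ** tz" if w': "LM S (?F z) Z w'" "w' ** hg = t" for w'
    proof -
      note [simp] = LM_D(3-5)[OF w'(1)]
      have "LM R z (rs r S Z) (w' ** ?e z)" by (rule LM_cmp[OF rD(1) xe_LM[OF d(1) M(3)] LM_rs[OF d(1) w'(1)]])
      moreover have "(w' ** ?e z) ** g = t ** ?e y" by (simp add: hg(3)[symmetric] ra[OF w'(2)])
      ultimately have "w' ** ?e z = u" by (rule uu)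
      then have "(w' ** ?e z) ** tz = u ** tz" by simp
      then show ?thesis using tz(5) by simp
    qed
    then show "\<exists>!h. LM S (?F z) Z h \<and> h ** hg = t" using w w2 by (intro ex1I[of _ "u ** tz"]) blast+
  qed
  show "short_exact (Mod C S) (?F x) (?F y) (?F z) (ext_mor C R S (un r) x y f0) (ext_mor C R S (un r) y z g0)"
    unfolding short_exact_def f(2) g(2) hf(2) hg(2)
    using mk' mc' is_kernel_Mod[OF rD(2) hf(1) hg(1)] is_cokernel_Mod[OF rD(2) hg(1) hf(1)] by simp
qed

text \<open>On the summand cut out by each idempotent \<open>g\<close> has an inverse. The two
  partial inverses add up to an inverse of \<open>g\<close> because the idempotents add up to
  1.\<close>

lemma SP_conservative:
  assumes a: "SP R S T r s r' s'" and g: "LM R M N g"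
    and iso: "is_iso (Mod C S) (xo R S r M) (xo R S r N) (ext_mor C R S (un r) M N (un g))"
      "is_iso (Mod C T) (xo R T r' M) (xo R T r' N) (ext_mor C R T (un r') M N (un g))"
  shows "is_iso (Mod C R) M N (un g)"
proof -
  note gD = LM_D[OF g]
  \<comment> \<open>The partial inverse retracts \<open>N\<close> onto its extension, inverts the
    extended map there and includes the result into \<open>M\<close>.\<close>
  have half: "\<exists>k. ar k \<and> dm k = mdl_ob N \<and> cd k = mdl_ob M \<and> g ** k = sc R N (s ** r ** et R) \<and> k ** g = sc R M (s ** r ** et R)"
    if a: "SP R S T r s r' s'" and iso: "is_iso (Mod C S) (xo R S r M) (xo R S r N) (ext_mor C R S (un r) M N (un g))" for S T r s r' s'
  proof -
    note d = SP_D[OF a] and rD = MM_D[OF SP_D(1)[OF a]]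
    let ?F = "xo R S r" and ?e = "xe R S r" and ?x = "s ** r ** et R"
    obtain h where h: "LM S (?F M) (?F N) h" "ext_mor C R S (un r) M N (un g) = un h" "h ** ?e M = ?e N ** g"
      using ext_mor_LM[OF d(1) g] by metis
    obtain tM where tM: "ar tM" "dm tM = mdl_ob (?F M)" "cd tM = mdl_ob M" "tM ** ?e M = sc R M ?x" "?e M ** tM = I (mdl_ob (?F M))"
      using SP_ext_split[OF a gD(1)] by metis
    obtain tN where tN: "ar tN" "dm tN = mdl_ob (?F N)" "cd tN = mdl_ob N" "tN ** ?e N = sc R N ?x" "?e N ** tN = I (mdl_ob (?F N))"
      using SP_ext_split[OF a gD(2)] by metis
    obtain k where k: "ar k" "dm k = mdl_ob (?F N)" "cd k = mdl_ob (?F M)" "k ** h = I (mdl_ob (?F M))" "h ** k = I (mdl_ob (?F N))"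
      using iso unfolding h(2) is_iso_Mod[OF rD(2) h(1)] by blast
    have xob: "mdl_ob (?F w) = cd (xq R S r w)" for w by (rule xo_ob[OF d(1)])
    note [simp] = d(3-8) rD(1-5) gD(1-5) tM(1-3) tN(1-3) k(1-3) LM_D(3-5)[OF h(1)] ar_xe[OF d(1) gD(1)] ar_xe[OF d(1) gD(2)] xob
      ar_xq[OF d(1) gD(1)] ar_xq[OF d(1) gD(2)]
    have s: "g ** sc R M ?x = sc R N ?x ** g" by (rule sc_LM[OF rD(1) g]) auto
    have "g ** tM ** k ** ?e N = g ** (tM ** ?e M) ** tM ** k ** ?e N" by (simp add: ra[OF tM(5)])
    also have "\<dots> = sc R N ?x ** g ** tM ** k ** ?e N" unfolding tM(4) using ra[OF s] by simp
    also have "\<dots> = tN ** (h ** ?e M) ** tM ** k ** ?e N" unfolding tN(4)[symmetric] h(3) by simp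
    also have "\<dots> = sc R N ?x" by (simp add: ra[OF tM(5)] ra[OF k(5)] tN(4))
    finally have 1: "g ** tM ** k ** ?e N = sc R N ?x" .
    have "(tM ** k ** ?e N) ** g = tM ** k ** h ** ?e M" by (simp add: h(3))
    also have "\<dots> = sc R M ?x" by (simp add: ra[OF k(4)] tM(4))
    finally show ?thesis using 1 by (intro exI[of _ "tM ** k ** ?e N"]) auto
  qed
  note d = SP_D[OF a] and rD = MM_D[OF SP_D(1)[OF a]] and rD' = MM_D[OF SP_D(2)[OF a]]
  obtain k where k: "ar k" "dm k = mdl_ob N" "cd k = mdl_ob M" "g ** k = sc R N (s ** r ** et R)" "k ** g = sc R M (s ** r ** et R)"
    using half[OF a iso(1)] by blast
  obtain k' where k': "ar k'" "dm k' = mdl_ob N" "cd k' = mdl_ob M" "g ** k' = sc R N (s' ** r' ** et R)" "k' ** g = sc R M (s' ** r' ** et R)"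
    using half[OF SP_sym[OF a] iso(2)] by blast
  note [simp] = d(3-8) rD(1-5) rD'(1-5) gD(1-5) k(1-3) k'(1-3)
  have one: "sc R M' (s ** r ** et R) \<boxplus> sc R M' (s' ** r' ** et R) = I (mdl_ob M')" if "MD R M'" for M'
  proof -
    have "(s ** r ** et R) \<boxplus> (s' ** r' ** et R) = ((s ** r) \<boxplus> (s' ** r')) ** et R" by (simp add: cmp_add_l)
    then show ?thesis using sc_add[OF rD(1) that, of "s ** r ** et R" "s' ** r' ** et R"] sc_et[OF rD(1) that] by (simp add: d(13))
  qed
  show ?thesis unfolding is_iso_Mod[OF rD(1) g]
    by (rule exI[of _ "k \<boxplus> k'"]) (simp add: cmp_add_l cmp_add_r k(4,5) k'(4,5) one)
qed

section \<open>Pushouts of commutative monoids\<close>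

lemma la_one: "la one = ro one"
proof -
  have i: "la (one \<boxtimes> one) = I one >< la one"
    by (rule isoT_cancel_left[OF la_iso, of one]) (simp_all add: la_nat)
  have "la one >< I one = ro one >< I one"
    using kelly_la[of one one] triangleT[of one one] unfolding i by simp
  then show ?thesis by (rule faithful_R) auto
qed

lemma li_one: "li one = ri one"
  unfolding li_def ri_def la_one ..

lemma br_ri: "x \<in> Ob C \<Longrightarrow> br x one ** ri x = li x"
proof -
  assume [simp]: "x \<in> Ob C"
  show ?thesis
    by (rule isoT_cancel_left[OF la_iso, of x]) (simp_all add: ra[OF la_br])
qed

text \<open>An arrow \<open>x \<otimes> Q \<rightarrow> Q\<close> is regarded as a family of operators on \<open>Q\<close> parametrised by \<open>x\<close>.\<close>

definition opc :: "('o, 'm) tarr \<Rightarrow> ('o, 'm) tarr \<Rightarrow> 'o \<Rightarrow> 'o \<Rightarrow> ('o, 'm) tarr" where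
  "opc f g x y = f ** (I x >< g) ** al x y (cd g)"

definition oper :: "'o \<Rightarrow> 'o \<Rightarrow> ('o, 'm) tarr \<Rightarrow> bool" where
  "oper Q x f \<longleftrightarrow> Q \<in> Ob C \<and> x \<in> Ob C \<and> ar f \<and> dm f = x \<boxtimes> Q \<and> cd f = Q"

definition com :: "'o \<Rightarrow> 'o \<Rightarrow> 'o \<Rightarrow> ('o, 'm) tarr \<Rightarrow> ('o, 'm) tarr \<Rightarrow> bool" where
  "com Q x y f g \<longleftrightarrow> oper Q x f \<and> oper Q y g \<and> opc f g x y = opc g f y x ** (br x y >< I Q)"

lemma oper_D: "oper Q x f \<Longrightarrow> Q \<in> Ob C" "oper Q x f \<Longrightarrow> x \<in> Ob C" "oper Q x f \<Longrightarrow> ar f"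
  "oper Q x f \<Longrightarrow> dm f = x \<boxtimes> Q" "oper Q x f \<Longrightarrow> cd f = Q"
  by (auto simp: oper_def)

lemma oper_opc: "oper Q x f \<Longrightarrow> oper Q y g \<Longrightarrow> oper Q (x \<boxtimes> y) (opc f g x y)"
  by (simp add: oper_def opc_def)

lemma com_sym:
  assumes "com Q x y f g" shows "com Q y x g f"
proof -
  have o: "oper Q x f" "oper Q y g" and e: "opc f g x y = opc g f y x ** (br x y >< I Q)" using assms by (auto simp: com_def)
  note [simp] = oper_D[OF o(1)] oper_D[OF o(2)] oper_D[OF oper_opc[OF o]] oper_D[OF oper_opc[OF o(2,1)]]
  have "opc f g x y ** (br y x >< I Q) = opc g f y x" unfolding e by (simp add: mg)
  then show ?thesis unfolding com_def using o by simp
qed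

lemma opc_assoc:
  assumes o: "oper Q x f" "oper Q y g" "oper Q z h"
  shows "opc (opc f g x y) h (x \<boxtimes> y) z = opc f (opc g h y z) x (y \<boxtimes> z) ** (al x y z >< I Q)"
proof -
  note [simp] = oper_D[OF o(1)] oper_D[OF o(2)] oper_D[OF o(3)]
  have "opc (opc f g x y) h (x \<boxtimes> y) z = f ** (I x >< g) ** al x y Q ** ((I x >< I y) >< h) ** al (x \<boxtimes> y) z Q"
    by (simp add: opc_def)
  also have "\<dots> = f ** (I x >< g) ** (I x >< (I y >< h)) ** (I x >< al y z Q) ** al x (y \<boxtimes> z) Q ** (al x y z >< I Q)"
    by (simp add: al_nat2 pentagonT del: I_tns)
  also have "\<dots> = opc f (opc g h y z) x (y \<boxtimes> z) ** (al x y z >< I Q)"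
    by (simp add: opc_def mg)
  finally show ?thesis .
qed

lemma opc_pre_left:
  assumes o: "oper Q x f" "oper Q y g" and v: "ar v" "cd v = x"
  shows "opc (f ** (v >< I Q)) g (dm v) y = opc f g x y ** ((v >< I y) >< I Q)"
proof -
  note [simp] = oper_D[OF o(1)] oper_D[OF o(2)] v
  have "opc (f ** (v >< I Q)) g (dm v) y = f ** (I x >< g) ** (v >< (I y >< I Q)) ** al (dm v) y Q"
    by (simp add: opc_def mg)
  also have "\<dots> = opc f g x y ** ((v >< I y) >< I Q)"
    by (simp add: opc_def al_nat del: I_tns)
  finally show ?thesis .
qed

lemma opc_pre_right:
  assumes o: "oper Q x f" "oper Q y g" and v: "ar v" "cd v = y"
  shows "opc f (g ** (v >< I Q)) x (dm v) = opc f g x y ** ((I x >< v) >< I Q)"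
proof -
  note [simp] = oper_D[OF o(1)] oper_D[OF o(2)] v
  have "opc f (g ** (v >< I Q)) x (dm v) = f ** (I x >< g) ** (I x >< (v >< I Q)) ** al x (dm v) Q"
    by (simp add: opc_def mg)
  also have "\<dots> = opc f g x y ** ((I x >< v) >< I Q)"
    by (simp add: opc_def al_nat)
  finally show ?thesis .
qed

text \<open>Moving \<open>f\<close> past \<open>g\<close> and then past \<open>h\<close> exchanges
  the parameters one at a time; the hexagon identifies the result with the braiding past
  \<open>y \<boxtimes> z\<close>.\<close>

lemma com_opc:
  assumes c: "com Q x y f g" "com Q x z f h"
  shows "com Q x (y \<boxtimes> z) f (opc g h y z)"
proof -
  have o: "oper Q x f" "oper Q y g" "oper Q z h" and e: "opc f g x y = opc g f y x ** (br x y >< I Q)"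
    "opc f h x z = opc h f z x ** (br x z >< I Q)" using c by (auto simp: com_def)
  note [simp] = oper_D[OF o(1)] oper_D[OF o(2)] oper_D[OF o(3)]
  note oo = oper_opc[OF o(2,3)] oper_opc[OF o(2,1)] oper_opc[OF o(3,1)] oper_opc[OF o(1,2)] oper_opc[OF o(1,3)]
  note [simp] = oper_D[OF oo(1)] oper_D[OF oo(2)] oper_D[OF oo(3)] oper_D[OF oo(4)] oper_D[OF oo(5)]
    oper_D[OF oper_opc[OF o(1) oo(1)]] oper_D[OF oper_opc[OF o(2) oo(3)]] oper_D[OF oper_opc[OF oo(2) o(3)]]
    oper_D[OF oper_opc[OF o(2) oo(5)]] oper_D[OF oper_opc[OF oo(1) o(1)]]
  let ?g = "opc g h y z"
  have "opc f ?g x (y \<boxtimes> z) = opc f ?g x (y \<boxtimes> z) ** (al x y z >< I Q) ** (ai x y z >< I Q)"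
    by (simp add: mg)
  also have "\<dots> = opc (opc f g x y) h (x \<boxtimes> y) z ** (ai x y z >< I Q)"
    by (simp add: ra[OF opc_assoc[OF o, symmetric]])
  also have "opc (opc f g x y) h (x \<boxtimes> y) z = opc (opc g f y x) h (y \<boxtimes> x) z ** ((br x y >< I z) >< I Q)"
    unfolding e(1) using opc_pre_left[OF oo(2) o(3), of "br x y"] by simp
  also have "\<dots> = opc g (opc f h x z) y (x \<boxtimes> z) ** (al y x z >< I Q) ** ((br x y >< I z) >< I Q)"
    by (simp add: opc_assoc[OF o(2,1,3)])
  also have "opc g (opc f h x z) y (x \<boxtimes> z) = opc g (opc h f z x) y (z \<boxtimes> x) ** ((I y >< br x z) >< I Q)"
    unfolding e(2) using opc_pre_right[OF o(2) oo(3), of "br x z"] by simp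
  also have "opc g (opc h f z x) y (z \<boxtimes> x) = opc ?g f (y \<boxtimes> z) x ** (ai y z x >< I Q)"
    by (simp add: opc_assoc[OF o(2,3,1)] mg)
  finally have "opc f ?g x (y \<boxtimes> z) = opc ?g f (y \<boxtimes> z) x ** ((ai y z x ** (I y >< br x z) ** al y x z ** (br x y >< I z) ** ai x y z) >< I Q)"
    by (simp add: mg)
  then show ?thesis unfolding com_def using o oo by (simp add: br_tens_right)
qed

text \<open>
  The multiplication of \<open>Q\<close> is forced to be \<open>(g u) x = g x\<close>; it is well defined because operators that
  agree on the generator \<open>u\<close> are equal by commutativity.
\<close>

lemma commuting_operators_monoid:
  assumes c: "com Q G G act act" and u: "ar u" "dm u = one" "cd u = Q"
    and e: "epi e" "e = act ** (I G >< u) ** ri G"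
  obtains m where "ar m" "dm m = Q \<boxtimes> Q" "cd m = Q" "m ** (e >< I Q) = act" "CM (mkmon m u)"
proof -
  have o: "oper Q G act" and cc: "opc act act G G = opc act act G G ** (br G G >< I Q)" using c by (auto simp: com_def)
  note [simp] = oper_D[OF o] u
  have ar_e[simp]: "ar e" "dm e = G" "cd e = Q" by (simp_all add: e(2))
  have cc': "act ** (I G >< act) ** al G G Q ** (br G G >< I Q) = act ** (I G >< act) ** al G G Q"
    using cc[symmetric] by (simp add: opc_def)
  have "act ** (I G >< e) = act ** (I G >< act) ** (I G >< (I G >< u)) ** (I G >< ri G)"
    unfolding e(2) by (simp add: mg)
  also have "\<dots> = act ** (I G >< act) ** al G G Q ** ai G G Q ** (I G >< (I G >< u)) ** (I G >< ri G)" by simp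
  also have "\<dots> = act ** (I G >< act) ** al G G Q ** ((I G >< I G) >< u) ** ri (G \<boxtimes> G)"
    by (simp add: ai_nat2 kelly_ri del: I_tns)
  finally have ae: "act ** (I G >< e) = act ** (I G >< act) ** al G G Q ** (I (G \<boxtimes> G) >< u) ** ri (G \<boxtimes> G)" by simp
  \<comment> \<open>In elements, \<open>g (g' u)\<close> is symmetric in \<open>g\<close> and
    \<open>g'\<close>, since the operators commute.\<close>
  have aeb: "act ** (I G >< e) ** br G G = act ** (I G >< e)"
  proof -
    have "act ** (I G >< e) ** br G G = act ** (I G >< act) ** al G G Q ** (I (G \<boxtimes> G) >< u) ** (br G G >< I one) ** ri (G \<boxtimes> G)"
      by (simp add: ra[OF ae] ri_nat)
    also have "\<dots> = act ** (I G >< act) ** al G G Q ** (br G G >< I Q) ** (I (G \<boxtimes> G) >< u) ** ri (G \<boxtimes> G)"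
      by (simp add: mg)
    also have "\<dots> = act ** (I G >< e)" unfolding ae using ra[OF cc', of "(I (G \<boxtimes> G) >< u) ** ri (G \<boxtimes> G)"] by simp
    finally show ?thesis .
  qed
  obtain k where k: "kernel e k" using ex_kernelT ar_e(1) by blast
  note kD = kernelD[OF k]
  have ek: "coeq k (zr (dm k) (cd k)) e" by (rule epi_coeq_kernel[OF e(1) k])
  note [simp] = kD(3) kD(4)
  have co: "coeq (k >< I Q) (zr (dm k \<boxtimes> Q) (G \<boxtimes> Q)) (e >< I Q)"
    using coeq_tns_right[OF ek, of Q] by simp
  \<comment> \<open>\<open>m\<close> exists once \<open>act\<close> vanishes on the kernel of
    \<open>e\<close>. This may be tested on generators, by precomposing with \<open>e\<close>; there
    the symmetry moves the kernel onto \<open>u\<close>, where it dies.\<close>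
  have "(act ** (k >< I Q)) ** (I (dm k) >< e) = (act ** (I G >< e)) ** (k >< I G)" by (simp add: mg)
  also have "\<dots> = act ** (I G >< e) ** br G G ** (k >< I G)" unfolding aeb[symmetric] by simp
  also have "\<dots> = act ** (I G >< (e ** k)) ** br (dm k) G" by (simp add: br_nat mg)
  also have "\<dots> = zr (dm k \<boxtimes> Q) Q ** (I (dm k) >< e)" by (simp add: kD(5))
  finally have "act ** (k >< I Q) = zr (dm k \<boxtimes> Q) Q"
    by (rule epiD[OF epi_tns_left[OF e(1) dm_Ob[OF kD(3)]]]) auto
  then obtain m where m: "ar m" "dm m = Q \<boxtimes> Q" "cd m = Q" "m ** (e >< I Q) = act"
    using coker_ex[OF co, of act] by auto
  note [simp] = m(1-3)
  have mee: "m ** (e >< e) = act ** (I G >< e)"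
  proof -
    have "m ** (e >< e) = (m ** (e >< I Q)) ** (I G >< e)" by (simp add: mg)
    then show ?thesis unfolding m(4) .
  qed
  have comm: "m ** br Q Q = m"
  proof -
    have "(m ** br Q Q) ** (e >< e) = m ** (e >< e)" by (simp add: br_nat ra[OF mee] aeb mee)
    then show ?thesis by (rule epiD[OF epi_tns[OF e(1) e(1)]]) auto
  qed
  have unit: "m ** (u >< I Q) = la Q"
  proof -
    have "(m ** (I Q >< u)) ** (e >< I one) = (m ** (e >< I Q)) ** (I G >< u)" by (simp add: mg)
    also have "\<dots> = act ** (I G >< u) ** ri G ** ro G" unfolding m(4) by simp
    also have "\<dots> = ro Q ** (e >< I one)" unfolding e(2) by (simp add: ro_nat)
    finally have r: "m ** (I Q >< u) = ro Q" by (rule epiD[OF epi_tns_right[OF e(1) unit_Ob]]) auto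
    have "m ** (u >< I Q) = (m ** br Q Q) ** (u >< I Q)" unfolding comm ..
    also have "\<dots> = (m ** (I Q >< u)) ** br one Q" by (simp add: br_nat)
    also have "\<dots> = la Q" unfolding r by (simp add: ro_br)
    finally show ?thesis .
  qed
  \<comment> \<open>In elements, \<open>g (x y) = (g x) y\<close>. Tested at
    \<open>y = g' u\<close>, both sides become composites of the operators \<open>g\<close> and
    \<open>g'\<close> at \<open>x\<close>, differing only in their order.\<close>
  have am: "act ** (I G >< m) ** al G Q Q = m ** (act >< I Q)"
  proof -
    have ee: "epi ((I G >< I Q) >< e)" using epi_tns_left[OF e(1), of "G \<boxtimes> Q"] by simp
    have h: "al G G Q ** (br G G >< I Q) ** ai G G Q ** br (G \<boxtimes> Q) G = (I G >< br Q G) ** al G Q G"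
    proof -
      have "al G G Q ** (br G G >< I Q) ** ai G G Q ** br (G \<boxtimes> Q) G
        = al G G Q ** ((br G G >< I Q) ** (br G G >< I Q)) ** ai G G Q ** (I G >< br Q G) ** al G Q G"
        by (simp add: br_tens_left)
      then show ?thesis by (simp add: mg)
    qed
    have "(act ** (I G >< m) ** al G Q Q) ** ((I G >< I Q) >< e) = act ** (I G >< (m ** (I Q >< e))) ** al G Q G"
      by (simp add: al_nat mrg2 del: I_tns)
    also have "m ** (I Q >< e) = (m ** br Q Q) ** (I Q >< e)" unfolding comm ..
    also have "\<dots> = (m ** (e >< I Q)) ** br Q G" by (simp add: br_nat)
    also have "\<dots> = act ** br Q G" unfolding m(4) ..
    finally have "(act ** (I G >< m) ** al G Q Q) ** ((I G >< I Q) >< e) = act ** (I G >< act) ** (I G >< br Q G) ** al G Q G"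
      by (simp add: mg)
    also have "\<dots> = (act ** (I G >< act) ** al G G Q ** (br G G >< I Q)) ** ai G G Q ** br (G \<boxtimes> Q) G" by (simp add: h)
    also have "\<dots> = act ** (I G >< act) ** br (G \<boxtimes> Q) G" unfolding cc' by simp
    also have "\<dots> = (m ** (e >< I Q)) ** (I G >< act) ** br (G \<boxtimes> Q) G" unfolding m(4) ..
    also have "\<dots> = (m ** br Q Q) ** (act >< e)" by (simp add: br_nat mg)
    also have "\<dots> = (m ** (act >< I Q)) ** ((I G >< I Q) >< e)" unfolding comm by (simp add: mg)
    finally show ?thesis by (rule epiD[OF ee]) auto
  qed
  have assoc: "m ** (m >< I Q) = m ** (I Q >< m) ** al Q Q Q"
  proof -
    have "(m ** (m >< I Q)) ** ((e >< I Q) >< I Q) = m ** ((m ** (e >< I Q)) >< I Q)" by (simp add: mg)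
    also have "\<dots> = (m ** (e >< I Q)) ** (I G >< m) ** al G Q Q" unfolding m(4) by (simp add: am)
    also have "\<dots> = m ** (I Q >< m) ** (e >< (I Q >< I Q)) ** al G Q Q" by (simp add: mg)
    also have "\<dots> = (m ** (I Q >< m) ** al Q Q Q) ** ((e >< I Q) >< I Q)" by (simp add: al_nat del: I_tns)
    finally show ?thesis by (rule epiD[OF epi_tns_right[OF epi_tns_right[OF e(1)]], rotated 2]) auto
  qed
  have "CM (mkmon m u)" by (rule CM_mkmon[OF _ _ _ _ _ _ assoc unit comm]) auto
  then show ?thesis by (rule that[OF m])
qed

lemma MD_com:
  assumes R: "CM R" and M: "MD R M" shows "com (mdl_ob M) (mon_ob R) (mon_ob R) (ac R M) (ac R M)"
proof -
  note [simp] = R M MD_Ob[OF M]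
  have "opc (ac R M) (ac R M) (mon_ob R) (mon_ob R) = ac R M ** (mu R >< I (mdl_ob M))"
    by (simp add: opc_def ac_mu)
  moreover have "ac R M ** (mu R >< I (mdl_ob M)) ** (br (mon_ob R) (mon_ob R) >< I (mdl_ob M)) = ac R M ** (mu R >< I (mdl_ob M))"
    by (simp add: mg mu_comm)
  ultimately show ?thesis by (simp add: com_def oper_def)
qed

lemma pentagon3:
  assumes [simp]: "w \<in> Ob C" "x \<in> Ob C" "y \<in> Ob C" "z \<in> Ob C"
  shows "(al w x y >< I z) ** ai (w \<boxtimes> x) y z = ai w (x \<boxtimes> y) z ** (I w >< ai x y z) ** al w x (y \<boxtimes> z)"
proof -
  have i: "isoT (I w >< al x y z)"
    unfolding isoT_def by (intro conjI exI[of _ "I w >< ai x y z"]) (auto simp: mg)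
  have "(I w >< al x y z) ** al w (x \<boxtimes> y) z ** (al w x y >< I z) ** ai (w \<boxtimes> x) y z
    = al w x (y \<boxtimes> z)"
    using ra[OF pentagonT[of w x y z], of "ai (w \<boxtimes> x) y z"] by simp
  also have "\<dots> = (I w >< al x y z) ** al w (x \<boxtimes> y) z ** ai w (x \<boxtimes> y) z ** (I w >< ai x y z) ** al w x (y \<boxtimes> z)"
    by (simp add: mg)
  finally have "al w (x \<boxtimes> y) z ** (al w x y >< I z) ** ai (w \<boxtimes> x) y z
    = al w (x \<boxtimes> y) z ** ai w (x \<boxtimes> y) z ** (I w >< ai x y z) ** al w x (y \<boxtimes> z)"
    by (rule isoT_cancel_left[OF i]) auto
  then show ?thesis by (rule isoT_cancel_left[OF al_iso, rotated 3]) auto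
qed

lemma is_pushout_CommMonI:
  assumes f: "MM T S f" and g: "MM T S' g" and p: "MM S P p" and q: "MM S' P q" and e: "p ** f = q ** g"
    and ex: "\<And>Z r s. MM S Z r \<Longrightarrow> MM S' Z s \<Longrightarrow> r ** f = s ** g \<Longrightarrow> \<exists>h. MM P Z h \<and> h ** p = r \<and> h ** q = s"
    and un: "\<And>Z h h'. MM P Z h \<Longrightarrow> MM P Z h' \<Longrightarrow> h ** p = h' ** p \<Longrightarrow> h ** q = h' ** q \<Longrightarrow> h = h'"
  shows "is_pushout (CommMon C) T S S' (un f) (un g) P (un p) (un q)"
proof -
  note d = MM_D[OF f] MM_D[OF g] MM_D[OF p] MM_D[OF q]
  have uc: "un (b ** a) = un b \<cdot> un a" if "MM X Y a" "MM Y W b" for a b X Y W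
    using MM_D[OF that(1)] MM_D[OF that(2)] by (simp add: un_cmp)
  have ui: "b ** a = b' ** a'" if "MM X Y a" "MM Y W b" "MM X Y' a'" "MM Y' W b'" "un b \<cdot> un a = un b' \<cdot> un a'" for a b a' b' X Y Y' W
    using un_inject[of "b ** a" "b' ** a'"] MM_D(3-5)[OF that(1)] MM_D(3-5)[OF that(2)] MM_D(3-5)[OF that(3)] MM_D(3-5)[OF that(4)] that
    by (simp add: uc)
  have "\<exists>!h. h \<in> Hom (CommMon C) P Z \<and> h \<cdot> un p = r \<and> h \<cdot> un q = s"
    if Z: "Z \<in> Ob (CommMon C)" and r: "r \<in> Hom (CommMon C) S Z" and s: "s \<in> Hom (CommMon C) S' Z" and rs: "r \<cdot> un f = s \<cdot> un g" for Z r s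
  proof -
    have Z: "CM Z" using Z Ob_CommMon by blast
    let ?r = "mk (mon_ob S) r (mon_ob Z)" and ?s = "mk (mon_ob S') s (mon_ob Z)"
    have R: "MM S Z ?r" "MM S' Z ?s" using r s Hom_CommMon d Z by auto
    have u: "un ?r = r" "un ?s = s" using MM_D(3)[OF R(1)] MM_D(3)[OF R(2)] by auto
    have "?r ** f = ?s ** g" by (rule ui[OF f R(1) g R(2)]) (simp add: u rs)
    then obtain h where h: "MM P Z h" "h ** p = ?r" "h ** q = ?s" using ex[OF R] by blast
    show ?thesis
    proof (rule ex1I[of _ "un h"])
      show "un h \<in> Hom (CommMon C) P Z \<and> un h \<cdot> un p = r \<and> un h \<cdot> un q = s"
        using MM_un[OF h(1)] uc[OF p h(1)] uc[OF q h(1)] h u by simp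
      fix h' assume h': "h' \<in> Hom (CommMon C) P Z \<and> h' \<cdot> un p = r \<and> h' \<cdot> un q = s"
      let ?h = "mk (mon_ob P) h' (mon_ob Z)"
      have H: "MM P Z ?h" using h' Hom_CommMon d Z by auto
      have u': "un ?h = h'" using MM_D(3)[OF H] by auto
      have "?h ** p = h ** p" by (rule ui[OF p H p h(1)]) (use h' u' uc[OF p h(1)] h u in simp)
      moreover have "?h ** q = h ** q" by (rule ui[OF q H q h(1)]) (use h' u' uc[OF q h(1)] h u in simp)
      ultimately have "?h = h" by (rule un[OF H h(1)])
      then show "h' = un h" using u' by simp
    qed
  qed
  moreover have "un p \<cdot> un f = un q \<cdot> un g" using uc[OF f p] uc[OF g q] e by simp
  ultimately show ?thesis unfolding is_pushout_def CommMon_comp Ob_CommMon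
    using d MM_un[OF f] MM_un[OF g] MM_un[OF p] MM_un[OF q] by (auto simp: Ob_CommMon)
qed

text \<open>\<open>S\<close> and \<open>S'\<close> act on the tensor product over \<open>T\<close>
  by commuting operators, and \<open>1 \<otimes> 1\<close> generates it, so
  \<open>commuting_operators_monoid\<close> applies. The coprojections \<open>s \<otimes> 1\<close>
  and \<open>1 \<otimes> s'\<close> are given explicitly, because descent compares sections through
  exactly these maps.\<close>

lemma pushout_tens:
  assumes f: "MM T S f" and g: "MM T S' g"
  defines "M \<equiv> rs f S (self_mdl S)"
  obtains P where "MM S P (xe T S' g M)" "MM S' P (xq T S' g M ** (et S >< I (mon_ob S')) ** li (mon_ob S'))"
    "is_pushout (CommMon C) T S S' (un f) (un g) P (un (xe T S' g M)) (un (xq T S' g M ** (et S >< I (mon_ob S')) ** li (mon_ob S')))"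
proof -
  let ?m = "mon_ob S" and ?n = "mon_ob S'" and ?a = "mon_ob T" and ?q = "xq T S' g M"
  let ?Q = "cd ?q"
  note fD = MM_D[OF f] and gD = MM_D[OF g]
  have M: "MD T M" unfolding M_def by (rule MD_rs_self[OF f])
  have Mob[simp]: "mdl_ob M = ?m" by (simp add: M_def)
  have acM: "ac T M = mu S ** (f >< I ?m)" unfolding M_def by (rule ac_rs_self[OF f])
  note [simp] = fD(1-5) gD(1-5) M ar_xq[OF g M] ar_xe[OF g M] MD_rs_self[OF g] xo_ob[OF g] xo_MD[OF g M]
  have A: "ac T M ** br ?m ?a = mu S ** (I ?m >< f)"
  proof -
    have "ac T M ** br ?m ?a = mu S ** br ?m ?m ** (I ?m >< f)" by (simp add: acM br_nat)
    then show ?thesis by (simp add: ra[OF mu_comm])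
  qed
  have eq: "epi ?q" by (rule epi_xq[OF g M])
  have eqs: "epi ((I ?m >< I ?m) >< ?q)" "epi ((I ?m >< ?q) >< I ?n)"
    using epi_tns_left[OF eq, of "?m \<boxtimes> ?m"] epi_tns_right[OF epi_tns_left[OF eq]] by simp_all
  \<comment> \<open>Multiplication of \<open>S\<close> commutes with the right action of
    \<open>T\<close>, hence descends to the operators \<open>a1\<close>.\<close>
  have "mu S ** (I ?m >< (ac T M ** br ?m ?a)) = mu S ** (I ?m >< mu S) ** al ?m ?m ?m ** ai ?m ?m ?m ** (I ?m >< (I ?m >< f))"
    unfolding A by (simp add: mg)
  also have "\<dots> = (ac T M ** br ?m ?a) ** (mu S >< I ?a) ** ai ?m ?m ?a"
  proof -
    have "mu S ** (I ?m >< mu S) ** al ?m ?m ?m ** ai ?m ?m ?m ** (I ?m >< (I ?m >< f))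
      = (mu S ** (I ?m >< mu S) ** al ?m ?m ?m) ** ((I ?m >< I ?m) >< f) ** ai ?m ?m ?a" by (simp add: ai_nat del: I_tns)
    also have "\<dots> = mu S ** (mu S >< I ?m) ** ((I ?m >< I ?m) >< f) ** ai ?m ?m ?a"
      unfolding mu_assoc[OF fD(2), symmetric] by simp
    also have "\<dots> = (ac T M ** br ?m ?a) ** (mu S >< I ?a) ** ai ?m ?m ?a"
      unfolding A by (simp add: mg)
    finally show ?thesis .
  qed
  finally obtain a1 where a1: "ar a1" "dm a1 = ?m \<boxtimes> ?Q" "cd a1 = ?Q" "a1 ** (I ?m >< ?q) = ?q ** (mu S >< I ?n) ** ai ?m ?m ?n"
    using tens_op_left[OF fD(1) M MD_rs_self[OF g], of "mu S" ?m] by auto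
  obtain r where r: "ar r" "dm r = ?Q \<boxtimes> ?n" "cd r = ?Q" "r ** (?q >< I ?n) = ?q ** (I ?m >< mu S') ** al ?m ?n ?n"
    "ac S' (xo T S' g M) = r ** br ?n ?Q"
    using ext_ob_right[OF g M] by auto
  define l2 where "l2 = ac S' (xo T S' g M)"
  have l2: "ar l2" "dm l2 = ?n \<boxtimes> ?Q" "cd l2 = ?Q" "l2 = r ** br ?n ?Q" by (simp_all add: l2_def r(5)[symmetric])
  note [simp] = a1(1-3) r(1-3) l2(1-3)
  have a1_unit: "a1 ** (et S >< I ?Q) = la ?Q"
  proof -
    have "(a1 ** (et S >< I ?Q)) ** (I one >< ?q) = (a1 ** (I ?m >< ?q)) ** (et S >< (I ?m >< I ?n))" by (simp add: mg)
    also have "\<dots> = ?q ** (mu S >< I ?n) ** ((et S >< I ?m) >< I ?n) ** ai one ?m ?n"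
      unfolding a1(4) by (simp add: ai_nat del: I_tns)
    also have "\<dots> = ?q ** (la ?m >< I ?n) ** ai one ?m ?n" by (simp add: mg mu_et_left)
    also have "\<dots> = ?q ** la (?m \<boxtimes> ?n)" by (simp flip: kelly_la)
    also have "\<dots> = la ?Q ** (I one >< ?q)" by (simp add: la_nat)
    finally show ?thesis by (rule epiD[OF epi_tns_left[OF eq unit_Ob]]) auto
  qed
  have a1_assoc: "a1 ** (I ?m >< a1) ** al ?m ?m ?Q = a1 ** (mu S >< I ?Q)"
  proof -
    have "(a1 ** (I ?m >< a1) ** al ?m ?m ?Q) ** ((I ?m >< I ?m) >< ?q)
      = a1 ** (I ?m >< (a1 ** (I ?m >< ?q))) ** al ?m ?m (?m \<boxtimes> ?n)" by (simp add: al_nat mrg2 del: I_tns)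
    also have "\<dots> = a1 ** (I ?m >< ?q) ** (I ?m >< (mu S >< I ?n)) ** (I ?m >< ai ?m ?m ?n) ** al ?m ?m (?m \<boxtimes> ?n)"
      unfolding a1(4) by (simp add: mg)
    also have "\<dots> = ?q ** (mu S >< I ?n) ** ((I ?m >< mu S) >< I ?n) ** ai ?m (?m \<boxtimes> ?m) ?n ** (I ?m >< ai ?m ?m ?n) ** al ?m ?m (?m \<boxtimes> ?n)"
      by (simp add: ra[OF a1(4)] ai_nat2)
    also have "\<dots> = ?q ** ((mu S ** (I ?m >< mu S) ** al ?m ?m ?m) >< I ?n) ** ai (?m \<boxtimes> ?m) ?m ?n"
      by (simp add: pentagon3[symmetric] mg)
    also have "\<dots> = ?q ** (mu S >< I ?n) ** ((mu S >< I ?m) >< I ?n) ** ai (?m \<boxtimes> ?m) ?m ?n"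
      unfolding mu_assoc[OF fD(2), symmetric] by (simp add: mg)
    also have "\<dots> = (?q ** (mu S >< I ?n) ** ai ?m ?m ?n) ** (mu S >< (I ?m >< I ?n))"
      by (simp add: ai_nat del: I_tns)
    also have "\<dots> = (a1 ** (mu S >< I ?Q)) ** ((I ?m >< I ?m) >< ?q)" unfolding a1(4)[symmetric] by (simp add: mg)
    finally show ?thesis by (rule epiD[OF eqs(1)]) auto
  qed
  \<comment> \<open>The operators of \<open>S\<close> and of \<open>S'\<close> act on different
    tensor factors, hence commute.\<close>
  have a1r: "a1 ** (I ?m >< r) ** al ?m ?Q ?n = r ** (a1 >< I ?n)"
  proof -
    have pent: "ai ?m ?m (?n \<boxtimes> ?n) ** (I ?m >< al ?m ?n ?n) ** al ?m (?m \<boxtimes> ?n) ?n = al (?m \<boxtimes> ?m) ?n ?n ** (ai ?m ?m ?n >< I ?n)"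
    proof -
      have "ai ?m ?m (?n \<boxtimes> ?n) ** (I ?m >< al ?m ?n ?n) ** al ?m (?m \<boxtimes> ?n) ?n
        = (al (?m \<boxtimes> ?m) ?n ?n ** (ai ?m ?m ?n >< I ?n) ** ai ?m (?m \<boxtimes> ?n) ?n) ** al ?m (?m \<boxtimes> ?n) ?n"
        unfolding pentagon2[OF CM_ar(1)[OF fD(2)] CM_ar(1)[OF fD(2)] CM_ar(1)[OF gD(2)] CM_ar(1)[OF gD(2)]] by simp
      then show ?thesis by simp
    qed
    have "(a1 ** (I ?m >< r) ** al ?m ?Q ?n) ** ((I ?m >< ?q) >< I ?n) = a1 ** (I ?m >< (r ** (?q >< I ?n))) ** al ?m (?m \<boxtimes> ?n) ?n"
      by (simp add: al_nat mrg2)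
    also have "\<dots> = (a1 ** (I ?m >< ?q)) ** (I ?m >< (I ?m >< mu S')) ** (I ?m >< al ?m ?n ?n) ** al ?m (?m \<boxtimes> ?n) ?n"
      unfolding r(4) by (simp add: mg)
    also have "\<dots> = ?q ** (mu S >< I ?n) ** ((I ?m >< I ?m) >< mu S') ** al (?m \<boxtimes> ?m) ?n ?n ** (ai ?m ?m ?n >< I ?n)"
      unfolding a1(4) by (simp add: ai_nat2 pent del: I_tns)
    also have "\<dots> = ?q ** (I ?m >< mu S') ** (mu S >< (I ?n >< I ?n)) ** al (?m \<boxtimes> ?m) ?n ?n ** (ai ?m ?m ?n >< I ?n)"
      by (simp add: mg)
    also have "\<dots> = (?q ** (I ?m >< mu S') ** al ?m ?n ?n) ** ((mu S >< I ?n) >< I ?n) ** (ai ?m ?m ?n >< I ?n)"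
      by (simp add: al_nat2 del: I_tns)
    also have "\<dots> = r ** ((?q ** (mu S >< I ?n) ** ai ?m ?m ?n) >< I ?n)"
      unfolding r(4)[symmetric] by (simp add: mg)
    also have "\<dots> = (r ** (a1 >< I ?n)) ** ((I ?m >< ?q) >< I ?n)" unfolding a1(4)[symmetric] by (simp add: mg)
    finally show ?thesis by (rule epiD[OF eqs(2)]) auto
  qed
  have MD1: "MD S (mkmdl a1)" by (rule MD_mkmdl[OF _ _ _ _ a1_assoc[symmetric] a1_unit]) auto
  have c11: "com ?Q ?m ?m a1 a1" using MD_com[OF fD(2) MD1] by simp
  have MD2: "MD S' (xo T S' g M)" by simp
  have c22: "com ?Q ?n ?n l2 l2" using MD_com[OF gD(2) MD2] by (simp add: l2_def)
  have l2_assoc: "l2 ** (mu S' >< I ?Q) = l2 ** (I ?n >< l2) ** al ?n ?n ?Q" using ac_mu[OF gD(2) MD2] by (simp add: l2_def)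
  have l2_unit: "l2 ** (et S' >< I ?Q) = la ?Q" using ac_et[OF gD(2) MD2] by (simp add: l2_def)
  have c12: "com ?Q ?m ?n a1 l2"
  proof -
    have "opc l2 a1 ?n ?m ** (br ?m ?n >< I ?Q) = r ** br ?n ?Q ** (I ?n >< a1) ** al ?n ?m ?Q ** (br ?m ?n >< I ?Q)"
      by (simp add: opc_def l2(4))
    also have "\<dots> = (r ** (a1 >< I ?n)) ** br ?n (?m \<boxtimes> ?Q) ** al ?n ?m ?Q ** (br ?m ?n >< I ?Q)"
      by (simp add: br_nat2)
    also have "\<dots> = a1 ** (I ?m >< r) ** (al ?m ?Q ?n ** br ?n (?m \<boxtimes> ?Q) ** al ?n ?m ?Q) ** (br ?m ?n >< I ?Q)"
      unfolding a1r[symmetric] by simp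
    also have "\<dots> = a1 ** (I ?m >< (r ** br ?n ?Q)) ** al ?m ?n ?Q ** ((br ?n ?m >< I ?Q) ** (br ?m ?n >< I ?Q))"
      by (subst hexagonT) (simp_all add: mrg2)
    also have "\<dots> = opc a1 l2 ?m ?n" unfolding l2(4)[symmetric] by (simp add: opc_def mrg)
    finally show ?thesis unfolding com_def oper_def by simp
  qed
  \<comment> \<open>One family of operators with parameters in
    \<open>S \<otimes> S'\<close>.\<close>
  define act where "act = opc a1 l2 ?m ?n"
  have o12: "oper ?Q ?m a1" "oper ?Q ?n l2" by (simp_all add: oper_def)
  have oact: "oper ?Q (?m \<boxtimes> ?n) act" unfolding act_def by (rule oper_opc[OF o12])
  note [simp] = oper_D(3-5)[OF oact]
  have "com ?Q ?m (?m \<boxtimes> ?n) a1 act" "com ?Q ?n (?m \<boxtimes> ?n) l2 act"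
    unfolding act_def using com_opc[OF c11 c12] com_opc[OF com_sym[OF c12] c22] by auto
  then have caa: "com ?Q (?m \<boxtimes> ?n) (?m \<boxtimes> ?n) act act"
    using com_opc[OF com_sym com_sym] unfolding act_def by blast
  let ?e = "xe T S' g M" and ?u = "xe T S' g M ** et S" and ?p = "?q ** (et S >< I ?n) ** li ?n"
  have l2e: "l2 ** (I ?n >< ?e) = ?q ** br ?n ?m" using ac_xo_xe[OF g M] by (simp add: l2_def)
  have pu: "l2 ** (I ?n >< ?u) ** ri ?n = ?p"
  proof -
    have "l2 ** (I ?n >< ?u) ** ri ?n = l2 ** (I ?n >< ?e) ** (I ?n >< et S) ** ri ?n" by (simp add: mrg2)
    also have "\<dots> = ?q ** br ?n ?m ** (I ?n >< et S) ** ri ?n" by (simp add: ra[OF l2e])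
    finally show ?thesis by (simp add: br_nat2 br_ri)
  qed
  have a1p: "a1 ** (I ?m >< ?p) = ?q"
  proof -
    have "a1 ** (I ?m >< ?p) = (a1 ** (I ?m >< ?q)) ** (I ?m >< (et S >< I ?n)) ** (I ?m >< li ?n)" by (simp add: mg)
    also have "\<dots> = ?q ** (mu S >< I ?n) ** ((I ?m >< et S) >< I ?n) ** (ri ?m >< I ?n)"
      unfolding a1(4) by (simp add: ai_nat2 triangle_inv)
    also have "\<dots> = ?q ** ((mu S ** (I ?m >< et S) ** ri ?m) >< I ?n)" by (simp add: mg)
    finally show ?thesis by (simp add: ra[OF mu_et_right])
  qed
  \<comment> \<open>The quotient map is evaluation of \<open>act\<close> at
    \<open>1 \<otimes> 1\<close>; that it is epic says that this element generates.\<close>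
  have qact: "?q = act ** (I (?m \<boxtimes> ?n) >< ?u) ** ri (?m \<boxtimes> ?n)"
  proof -
    have "act ** (I (?m \<boxtimes> ?n) >< ?u) ** ri (?m \<boxtimes> ?n) = a1 ** (I ?m >< l2) ** al ?m ?n ?Q ** ((I ?m >< I ?n) >< ?u) ** ri (?m \<boxtimes> ?n)"
      by (simp add: act_def opc_def)
    also have "\<dots> = a1 ** (I ?m >< l2) ** (I ?m >< (I ?n >< ?u)) ** al ?m ?n one ** ai ?m ?n one ** (I ?m >< ri ?n)"
      by (simp add: al_nat2 kelly_ri del: I_tns)
    also have "\<dots> = a1 ** (I ?m >< (l2 ** (I ?n >< ?u) ** ri ?n))" by (simp add: mg)
    finally show ?thesis unfolding pu a1p by simp
  qed
  obtain k where k: "ar k" "dm k = ?Q \<boxtimes> ?Q" "cd k = ?Q" "k ** (?q >< I ?Q) = act" and P: "CM (mkmon k ?u)"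
    using commuting_operators_monoid[OF caa _ _ _ eq qact] by auto
  note [simp] = k(1-3) P
  note mk = mkmon[of k ?u ?Q]
  have ke: "k ** (?e >< I ?Q) = a1"
  proof -
    have "k ** (?e >< I ?Q) = (k ** (?q >< I ?Q)) ** ((I ?m >< et S') >< I ?Q) ** (ri ?m >< I ?Q)" by (simp add: xe_def mg)
    also have "\<dots> = a1 ** (I ?m >< l2) ** (I ?m >< (et S' >< I ?Q)) ** al ?m one ?Q ** (ri ?m >< I ?Q)"
      unfolding k(4) act_def opc_def by (simp add: al_nat2)
    also have "\<dots> = a1 ** (I ?m >< la ?Q) ** al ?m one ?Q ** (ri ?m >< I ?Q)" by (simp add: mrg2 l2_unit)
    also have "\<dots> = a1" by (simp add: ra[OF triangleT] mg)
    finally show ?thesis .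
  qed
  have kp: "k ** (?p >< I ?Q) = l2"
  proof -
    have "k ** (?p >< I ?Q) = (k ** (?q >< I ?Q)) ** ((et S >< I ?n) >< I ?Q) ** (li ?n >< I ?Q)" by (simp add: mg)
    also have "\<dots> = a1 ** (I ?m >< l2) ** (et S >< (I ?n >< I ?Q)) ** al one ?n ?Q ** (li ?n >< I ?Q)"
      unfolding k(4) act_def opc_def by (simp add: al_nat2 del: I_tns)
    also have "\<dots> = (a1 ** (et S >< I ?Q)) ** (I one >< l2) ** li (?n \<boxtimes> ?Q)" by (simp add: kelly_li mg)
    also have "\<dots> = l2" unfolding a1_unit by (simp add: la_nat2)
    finally show ?thesis .
  qed
  have eP: "MM S (mkmon k ?u) ?e"
  proof -
    have "k ** (?e >< ?e) = (k ** (?e >< I ?Q)) ** (I ?m >< ?e)" by (simp add: mg)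
    also have "\<dots> = a1 ** (I ?m >< ?q) ** (I ?m >< (I ?m >< et S')) ** (I ?m >< ri ?m)" unfolding ke by (simp add: xe_def mg)
    also have "\<dots> = ?q ** (mu S >< I ?n) ** ai ?m ?m ?n ** (I ?m >< (I ?m >< et S')) ** (I ?m >< ri ?m)" using ra[OF a1(4)] by simp
    also have "\<dots> = ?q ** (mu S >< I ?n) ** ((I ?m >< I ?m) >< et S') ** ri (?m \<boxtimes> ?m)" by (simp add: ai_nat2 kelly_ri del: I_tns)
    also have "\<dots> = ?q ** (I ?m >< et S') ** (mu S >< I one) ** ri (?m \<boxtimes> ?m)" by (simp add: mg)
    also have "\<dots> = ?e ** mu S" by (simp add: xe_def ri_nat)
    finally have "?e ** mu S = k ** (?e >< ?e)" by simp
    then show ?thesis unfolding MM_def using mk by simp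
  qed
  have pP: "MM S' (mkmon k ?u) ?p"
  proof -
    have "k ** (?p >< ?p) = (k ** (?p >< I ?Q)) ** (I ?n >< ?p)" by (simp add: mg)
    also have "\<dots> = l2 ** (I ?n >< (l2 ** (I ?n >< ?u) ** ri ?n))" unfolding kp pu ..
    also have "\<dots> = l2 ** (I ?n >< l2) ** al ?n ?n ?Q ** ai ?n ?n ?Q ** (I ?n >< (I ?n >< ?u)) ** (I ?n >< ri ?n)"
      by (simp add: mg)
    also have "\<dots> = (l2 ** (I ?n >< l2) ** al ?n ?n ?Q) ** ((I ?n >< I ?n) >< ?u) ** ri (?n \<boxtimes> ?n)"
      by (simp add: ai_nat2 kelly_ri del: I_tns)
    also have "\<dots> = l2 ** (I ?n >< ?u) ** (mu S' >< I one) ** ri (?n \<boxtimes> ?n)" unfolding l2_assoc[symmetric] by (simp add: mg)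
    also have "\<dots> = (l2 ** (I ?n >< ?u) ** ri ?n) ** mu S'" by (simp add: ri_nat)
    also have "\<dots> = ?p ** mu S'" unfolding pu ..
    finally have 1: "?p ** mu S' = k ** (?p >< ?p)" by simp
    have "?p ** et S' = ?q ** (et S >< et S') ** li one" by (simp add: li_nat mrg2)
    also have "\<dots> = ?u" by (simp add: xe_def ri_nat mrg2 li_one)
    finally have "?p ** et S' = ?u" .
    then show ?thesis unfolding MM_def using mk 1 by simp
  qed
  have cone: "?e ** f = ?p ** g"
  proof -
    have "?e ** f = ?e ** mu S ** (et S >< I ?m) ** (I one >< f) ** li ?a" by (simp add: ra[OF mu_et_left] la_nat2)
    also have "\<dots> = (?e ** mu S ** (I ?m >< f)) ** (et S >< I ?a) ** li ?a" by (simp add: mg)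
    also have "\<dots> = (?e ** ac T M ** br ?m ?a) ** (et S >< I ?a) ** li ?a" unfolding A[symmetric] ..
    also have "\<dots> = ?q ** (et S >< I ?n) ** (I one >< g) ** li ?a" using xe_ac_br[OF g M] by (simp add: mg)
    also have "\<dots> = ?p ** g" by (simp add: li_nat)
    finally show ?thesis .
  qed
  have kep: "k ** (?e >< ?p) = ?q"
  proof -
    have "k ** (?e >< ?p) = (k ** (?e >< I ?Q)) ** (I ?m >< ?p)" by (simp add: mg)
    then show ?thesis unfolding ke a1p .
  qed
  have po: "is_pushout (CommMon C) T S S' (un f) (un g) (mkmon k ?u) (un ?e) (un ?p)"
  proof (rule is_pushout_CommMonI[OF f g eP pP cone])
    fix Z h h' assume h: "MM (mkmon k ?u) Z h" "MM (mkmon k ?u) Z h'" and hh: "h ** ?e = h' ** ?e" "h ** ?p = h' ** ?p"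
    note H = MM_D[OF h(1)] and H' = MM_D[OF h(2)]
    note [simp] = H(1-5) H'(1-5)
    have "h ** ?q = (h ** k) ** (?e >< ?p)" by (simp add: kep)
    also have "\<dots> = mu Z ** ((h ** ?e) >< (h ** ?p))" using H(6) mk by (simp add: mg)
    also have "\<dots> = (h' ** k) ** (?e >< ?p)" unfolding hh using H'(6) mk by (simp add: mg)
    also have "\<dots> = h' ** ?q" by (simp add: kep)
    finally show "h = h'" by (rule epiD[OF eq]) auto
  next
    fix Z a b assume a: "MM S Z a" and b: "MM S' Z b" and ab: "a ** f = b ** g"
    note aD = MM_D[OF a] and bD = MM_D[OF b]
    note [simp] = aD(1-5) bD(1-5)
    let ?z = "mon_ob Z"
    \<comment> \<open>Multiplicativity forces the induced map: \<open>s \<otimes> s'\<close> must go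
      to \<open>a(s) b(s')\<close>. It respects the relation over \<open>T\<close> because
      \<open>a ** f = b ** g\<close>.\<close>
    let ?w = "mu Z ** (a >< b)"
    have "?w ** ((ac T M ** br ?m ?a) >< I ?n) = mu Z ** ((a ** mu S ** (I ?m >< f)) >< b)" unfolding A by (simp add: mg)
    also have "a ** mu S ** (I ?m >< f) = mu Z ** (a >< (a ** f))" by (simp add: ra[OF aD(6)] mg)
    also have "mu Z ** ((mu Z ** (a >< (a ** f))) >< b) = (mu Z ** (mu Z >< I ?z)) ** ((a >< (b ** g)) >< b)"
      unfolding ab by (simp add: mg)
    also have "\<dots> = mu Z ** (I ?z >< mu Z) ** (a >< ((b ** g) >< b)) ** al ?m ?a ?n"
      unfolding mu_assoc[OF aD(2)] by (simp add: al_nat)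
    also have "\<dots> = mu Z ** (a >< (mu Z ** (b >< b) ** (g >< I ?n))) ** al ?m ?a ?n" by (simp add: mg)
    also have "\<dots> = ?w ** (I ?m >< ac T (rs g S' (self_mdl S'))) ** al ?m ?a ?n"
      unfolding ac_rs_self[OF g] using ra[OF bD(6)] by (simp add: mg)
    finally have we: "?w ** ((ac T M ** br ?m ?a) >< I ?n) = ?w ** (I ?m >< ac T (rs g S' (self_mdl S'))) ** al ?m ?a ?n" .
    obtain h where h: "ar h" "dm h = ?Q" "cd h = ?z" "h ** ?q = ?w"
      by (rule coeq_ex[OF tq_coeq[OF fD(1) M MD_rs_self[OF g]], of ?w]) (use we in auto)
    note [simp] = h(1-3)
    have he: "h ** ?e = a"
    proof -
      have "h ** ?e = ?w ** (I ?m >< et S') ** ri ?m" by (simp add: xe_def ra[OF h(4)])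
      also have "\<dots> = mu Z ** (I ?z >< et Z) ** (a >< I one) ** ri ?m" by (simp add: mg bD(7))
      also have "\<dots> = a" by (simp add: ra[OF mu_et_right] ro_nat2)
      finally show ?thesis .
    qed
    have hp: "h ** ?p = b"
    proof -
      have "h ** ?p = ?w ** (et S >< I ?n) ** li ?n" by (simp add: ra[OF h(4)])
      also have "\<dots> = mu Z ** (et Z >< I ?z) ** (I one >< b) ** li ?n" by (simp add: mg aD(7))
      also have "\<dots> = b" by (simp add: ra[OF mu_et_left] la_nat2)
      finally show ?thesis .
    qed
    have ha: "h ** a1 = mu Z ** (a >< h)"
    proof -
      have "(h ** a1) ** (I ?m >< ?q) = (h ** ?q) ** (mu S >< I ?n) ** ai ?m ?m ?n" by (simp add: a1(4))
      also have "\<dots> = mu Z ** ((a ** mu S) >< b) ** ai ?m ?m ?n" unfolding h(4) by (simp add: mg)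
      also have "\<dots> = (mu Z ** (mu Z >< I ?z)) ** ((a >< a) >< b) ** ai ?m ?m ?n" unfolding aD(6) by (simp add: mg)
      also have "\<dots> = mu Z ** (I ?z >< mu Z) ** (a >< (a >< b))" unfolding mu_assoc[OF aD(2)] by (simp add: al_nat2)
      also have "\<dots> = mu Z ** (a >< (h ** ?q))" unfolding h(4) by (simp add: mg)
      also have "\<dots> = (mu Z ** (a >< h)) ** (I ?m >< ?q)" by (simp add: mg)
      finally show ?thesis by (rule epiD[OF epi_tns_left[OF eq CM_ar(1)[OF fD(2)]]]) auto
    qed
    have hr: "h ** r = mu Z ** (h >< b)"
    proof -
      have "(h ** r) ** (?q >< I ?n) = (h ** ?q) ** (I ?m >< mu S') ** al ?m ?n ?n" by (simp add: r(4))
      also have "\<dots> = mu Z ** (a >< (b ** mu S')) ** al ?m ?n ?n" unfolding h(4) by (simp add: mg)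
      also have "\<dots> = mu Z ** (I ?z >< mu Z) ** (a >< (b >< b)) ** al ?m ?n ?n" unfolding bD(6) by (simp add: mg)
      also have "\<dots> = (mu Z ** (I ?z >< mu Z) ** al ?z ?z ?z) ** ((a >< b) >< b)" by (simp add: al_nat)
      also have "\<dots> = mu Z ** ((h ** ?q) >< b)" unfolding mu_assoc[OF aD(2), symmetric] h(4) by (simp add: mg)
      also have "\<dots> = (mu Z ** (h >< b)) ** (?q >< I ?n)" by (simp add: mg)
      finally show ?thesis by (rule epiD[OF epi_tns_right[OF eq CM_ar(1)[OF gD(2)]]]) auto
    qed
    have hl: "h ** l2 = mu Z ** (b >< h)"
    proof -
      have "h ** l2 = mu Z ** (h >< b) ** br ?n ?Q" by (simp add: l2(4) ra[OF hr])
      also have "\<dots> = mu Z ** br ?z ?z ** (b >< h)" by (simp add: br_nat)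
      finally show ?thesis by (simp add: ra[OF mu_comm])
    qed
    \<comment> \<open>On generators multiplicativity reduces to the operators of the two algebras,
      which \<open>ha\<close> and \<open>hl\<close> treat separately.\<close>
    have "(h ** k) ** (?q >< I ?Q) = h ** a1 ** (I ?m >< l2) ** al ?m ?n ?Q" by (simp add: k(4) act_def opc_def)
    also have "\<dots> = mu Z ** (a >< (h ** l2)) ** al ?m ?n ?Q" by (simp add: ra[OF ha] mg)
    also have "\<dots> = mu Z ** (I ?z >< mu Z) ** (a >< (b >< h)) ** al ?m ?n ?Q" unfolding hl by (simp add: mg)
    also have "\<dots> = (mu Z ** (I ?z >< mu Z) ** al ?z ?z ?z) ** ((a >< b) >< h)" by (simp add: al_nat)
    also have "\<dots> = mu Z ** ((h ** ?q) >< h)" unfolding mu_assoc[OF aD(2), symmetric] h(4) by (simp add: mg)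
    also have "\<dots> = (mu Z ** (h >< h)) ** (?q >< I ?Q)" by (simp add: mg)
    finally have hk: "h ** k = mu Z ** (h >< h)"
      by (rule epiD[OF epi_tns_right[OF eq cd_Ob[OF ar_epi[OF eq]]]]) auto
    have "MM (mkmon k ?u) Z h" unfolding MM_def using mk hk by (simp add: ra[OF he] aD(7))
    then show "\<exists>h. MM (mkmon k ?u) Z h \<and> h ** ?e = a \<and> h ** ?p = b" using he hp by blast
  qed
  show ?thesis by (rule that[OF eP pP po])
qed

section \<open>Descent along finite flat covers\<close>

text \<open>The ends are arguments because the empty sum still needs a type.\<close>

primrec sm :: "'o \<Rightarrow> 'o \<Rightarrow> (nat \<Rightarrow> ('o, 'm) tarr) \<Rightarrow> nat \<Rightarrow> ('o, 'm) tarr" where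
  "sm x y g 0 = zr x y"
| "sm x y g (Suc n) = sm x y g n \<boxplus> g n"

lemma sm_simps:
  assumes "x \<in> Ob C" "y \<in> Ob C" "\<And>i. i < n \<Longrightarrow> ar (g i) \<and> dm (g i) = x \<and> cd (g i) = y"
  shows "ar (sm x y g n) \<and> dm (sm x y g n) = x \<and> cd (sm x y g n) = y"
  using assms(3) by (induction n) (use assms(1,2) in auto)

lemma cmp_sm:
  assumes "x \<in> Ob C" "ar h" "\<And>i. i < n \<Longrightarrow> ar (g i) \<and> dm (g i) = x \<and> cd (g i) = dm h"
  shows "h ** sm x (dm h) g n = sm x (cd h) (\<lambda>i. h ** g i) n"
  using assms(3) by (induction n) (use assms(1,2) in \<open>auto simp: cmp_add_r\<close>)

lemma sm_cmp:
  assumes "y \<in> Ob C" "ar h" "\<And>i. i < n \<Longrightarrow> ar (g i) \<and> dm (g i) = cd h \<and> cd (g i) = y"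
  shows "sm (cd h) y g n ** h = sm (dm h) y (\<lambda>i. g i ** h) n"
  using assms(3) by (induction n) (use assms(1,2) in \<open>auto simp: cmp_add_l\<close>)

lemma sm_cong: "(\<And>i. i < n \<Longrightarrow> g i = h i) \<Longrightarrow> sm x y g n = sm x y h n"
  by (induction n) auto

lemma sm_tns:
  assumes "x \<in> Ob C" "y \<in> Ob C" "ar h" "\<And>i. i < n \<Longrightarrow> ar (g i) \<and> dm (g i) = x \<and> cd (g i) = y"
  shows "sm x y g n >< h = sm (x \<boxtimes> dm h) (y \<boxtimes> cd h) (\<lambda>i. g i >< h) n"
  using assms(4)
proof (induction n)
  case (Suc n)
  then show ?case using sm_simps[of x y n g] assms(1-3) by (simp add: add_tns)
qed (use assms(1-3) in simp)

lemma sm_zr: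
  assumes "x \<in> Ob C" "y \<in> Ob C" "\<And>i. i < n \<Longrightarrow> g i = zr x y" shows "sm x y g n = zr x y"
  using assms(3) by (induction n) (use assms(1,2) in auto)

lemma sm_delta:
  assumes "x \<in> Ob C" "y \<in> Ob C" "k < n" "ar (g k)" "dm (g k) = x" "cd (g k) = y" "\<And>i. i < n \<Longrightarrow> i \<noteq> k \<Longrightarrow> g i = zr x y"
  shows "sm x y g n = g k"
  using assms(3,7)
proof (induction n)
  case (Suc n)
  show ?case
  proof (cases "k = n")
    case True
    have "sm x y g n = zr x y" by (rule sm_zr[OF assms(1,2)]) (use Suc.prems True in auto)
    then show ?thesis using True assms(4-6) by simp
  next
    case False
    then show ?thesis using Suc assms(4-6) by simp
  qed
qed simp

section \<open>Finite biproducts of objects and of modules\<close>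

definition biprod where
  "biprod n X P j p \<longleftrightarrow> P \<in> Ob C \<and>
    (\<forall>i<n. ar (j i) \<and> ar (p i) \<and> dm (j i) = X i \<and> cd (j i) = P \<and> dm (p i) = P \<and> cd (p i) = X i \<and> p i ** j i = I (X i)) \<and>
    (\<forall>i<n. \<forall>k<n. i \<noteq> k \<longrightarrow> p k ** j i = zr (X i) (X k)) \<and> sm P P (\<lambda>i. j i ** p i) n = I P"

lemma biprod_D:
  assumes "biprod n X P j p"
  shows "P \<in> Ob C" "i < n \<Longrightarrow> ar (j i)" "i < n \<Longrightarrow> ar (p i)" "i < n \<Longrightarrow> dm (j i) = X i" "i < n \<Longrightarrow> cd (j i) = P"
    "i < n \<Longrightarrow> dm (p i) = P" "i < n \<Longrightarrow> cd (p i) = X i" "i < n \<Longrightarrow> p i ** j i = I (X i)"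
    "i < n \<Longrightarrow> k < n \<Longrightarrow> i \<noteq> k \<Longrightarrow> p k ** j i = zr (X i) (X k)" "sm P P (\<lambda>i. j i ** p i) n = I P"
  using assms by (auto simp: biprod_def)

lemma ex_biprod:
  assumes "\<And>i. i < n \<Longrightarrow> X i \<in> Ob C" shows "\<exists>P j p. biprod n X P j p"
  using assms
proof (induction n)
  case 0
  have "zr null null = I null" using to_null[of "I null"] by simp
  then have "biprod 0 X null undefined undefined" by (simp add: biprod_def)
  then show ?case by blast
next
  case (Suc n)
  then obtain P j p where b: "biprod n X P j p" by auto
  note d = biprod_D[OF b]
  have X: "X n \<in> Ob C" using Suc by simp
  obtain P' a c u v where P: "P' \<in> Ob C" "ar a" "ar c" "ar u" "ar v" "dm a = P" "dm c = X n" "cd a = P'" "cd c = P'"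
    "dm u = P'" "dm v = P'" "cd u = P" "cd v = X n" and e: "u ** a = I P" "v ** c = I (X n)" "u ** c = zr (X n) P" "v ** a = zr P (X n)"
    "(a ** u) \<boxplus> (c ** v) = I P'"
    using ex_biproduct[OF d(1) X] by metis
  note [simp] = P X d(1)
  define j' where "j' i = (if i < n then a ** j i else c)" for i
  define p' where "p' i = (if i < n then p i ** u else v)" for i
  have "sm P' P' (\<lambda>i. j' i ** p' i) n = sm (dm u) (cd a) (\<lambda>i. (a ** (j i ** p i)) ** u) n"
    unfolding P by (rule sm_cong) (simp add: j'_def p'_def)
  also have "\<dots> = sm (cd u) (cd a) (\<lambda>i. a ** (j i ** p i)) n ** u" by (rule sm_cmp[symmetric]) (auto simp: d)
  also have "sm (cd u) (cd a) (\<lambda>i. a ** (j i ** p i)) n = a ** sm P (dm a) (\<lambda>i. j i ** p i) n"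
    unfolding P by (subst cmp_sm[of P a, unfolded P, symmetric]) (auto simp: d)
  finally have s: "sm P' P' (\<lambda>i. j' i ** p' i) n = a ** u" by (simp add: d)
  have "biprod (Suc n) X P' j' p'"
    unfolding biprod_def
  proof (intro conjI allI impI)
    show "sm P' P' (\<lambda>i. j' i ** p' i) (Suc n) = I P'" using s e by (simp add: j'_def p'_def)
    fix i assume i: "i < Suc n"
    show "p' i ** j' i = I (X i)" using i e(2) by (auto simp: p'_def j'_def ra[OF e(1)] d less_Suc_eq)
    fix k assume k: "k < Suc n" "i \<noteq> k"
    show "p' k ** j' i = zr (X i) (X k)" using i k Suc(2) by (auto simp: p'_def j'_def ra[OF e(1)] ra[OF e(3)] ra[OF e(4)] e(3,4) d less_Suc_eq)
  qed (auto simp: p'_def j'_def d less_Suc_eq)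
  then show ?case by blast
qed

lemma biprod_jm:
  assumes b: "biprod n X P j p" and g: "ar g" "ar h" "cd g = P" "cd h = P" "dm g = dm h" "\<And>i. i < n \<Longrightarrow> p i ** g = p i ** h"
  shows "g = h"
proof -
  note d = biprod_D[OF b]
  have *: "k = sm (dm k) P (\<lambda>i. (j i ** p i) ** k) n" if k: "ar k" "cd k = P" for k
  proof -
    have "sm (cd k) P (\<lambda>i. j i ** p i) n ** k = sm (dm k) P (\<lambda>i. (j i ** p i) ** k) n"
      by (rule sm_cmp) (use k d in auto)
    then show ?thesis using d(10) k by simp
  qed
  have "sm (dm g) P (\<lambda>i. (j i ** p i) ** g) n = sm (dm h) P (\<lambda>i. (j i ** p i) ** h) n"
    unfolding g(5) by (rule sm_cong) (simp add: g(6))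
  then show ?thesis using *[of g] *[of h] g(1-4) by metis
qed

lemma biprod_pair:
  assumes b: "biprod n X P j p" and x: "x \<in> Ob C" and h: "\<And>i. i < n \<Longrightarrow> ar (h i) \<and> dm (h i) = x \<and> cd (h i) = X i"
  shows "ar (sm x P (\<lambda>i. j i ** h i) n)" "dm (sm x P (\<lambda>i. j i ** h i) n) = x" "cd (sm x P (\<lambda>i. j i ** h i) n) = P"
    "i < n \<Longrightarrow> p i ** sm x P (\<lambda>i. j i ** h i) n = h i"
proof -
  note d = biprod_D[OF b]
  have t: "\<And>i. i < n \<Longrightarrow> ar (j i ** h i) \<and> dm (j i ** h i) = x \<and> cd (j i ** h i) = P" using d h by auto
  show "ar (sm x P (\<lambda>i. j i ** h i) n)" "dm (sm x P (\<lambda>i. j i ** h i) n) = x" "cd (sm x P (\<lambda>i. j i ** h i) n) = P"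
    using sm_simps[OF x d(1) t] by auto
  assume i: "i < n"
  have Xi: "X i \<in> Ob C" using d(7)[OF i] cd_Ob[OF d(3)[OF i]] by simp
  have "p i ** sm x (dm (p i)) (\<lambda>i. j i ** h i) n = sm x (cd (p i)) (\<lambda>k. p i ** j k ** h k) n"
    by (rule cmp_sm[OF x]) (use d i t in auto)
  also have "\<dots> = p i ** j i ** h i"
  proof (rule sm_delta[OF x _ i])
    fix k assume k: "k < n" "k \<noteq> i"
    have "X i \<in> Ob C" using d(7)[OF i] cd_Ob[OF d(3)[OF i]] by simp
    then show "p i ** j k ** h k = zr x (cd (p i))" using ra[OF d(9)[OF k(1) i k(2)], of "h k"] h[OF k(1)] d(7)[OF i] by simp
  qed (use d h i Xi in auto)
  also have "\<dots> = h i" using ra[OF d(8)[OF i], of "h i"] h[OF i] by simp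
  finally show "p i ** sm x P (\<lambda>i. j i ** h i) n = h i" using d(6)[OF i] by simp
qed

text \<open>The action is the tuple of the actions on the components; module axioms and the
  linearity of the injections are tested after the projections.\<close>

lemma biprod_mdl:
  assumes A: "CM A" and M: "\<And>i. i < n \<Longrightarrow> MD A (M i)" and b: "biprod n (\<lambda>i. mdl_ob (M i)) P j p"
  obtains N where "MD A N" "mdl_ob N = P" "\<And>i. i < n \<Longrightarrow> LM A (M i) N (j i)" "\<And>i. i < n \<Longrightarrow> LM A N (M i) (p i)"
proof -
  let ?a = "mon_ob A"
  note d = biprod_D[OF b]
  note [simp] = A d(1)
  have a: "?a \<boxtimes> P \<in> Ob C" by simp
  define r where "r = sm (?a \<boxtimes> P) P (\<lambda>i. j i ** (ac A (M i) ** (I ?a >< p i))) n"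
  note bp = biprod_pair[OF b a, of "\<lambda>i. ac A (M i) ** (I ?a >< p i)", folded r_def]
  have t: "\<And>i. i < n \<Longrightarrow> ar (ac A (M i) ** (I ?a >< p i)) \<and> dm (ac A (M i) ** (I ?a >< p i)) = ?a \<boxtimes> P \<and> cd (ac A (M i) ** (I ?a >< p i)) = mdl_ob (M i)"
    using d M by auto
  have r: "ar r" "dm r = ?a \<boxtimes> P" "cd r = P" and pr: "\<And>i. i < n \<Longrightarrow> p i ** r = ac A (M i) ** (I ?a >< p i)"
    using bp t by auto
  note [simp] = r
  have MD: "MD A (mkmdl r)"
  proof (rule MD_mkmdl)
    show "r ** (mu A >< I P) = r ** (I ?a >< r) ** al ?a ?a P"
    proof (rule biprod_jm[OF b])
      fix i assume i: "i < n"
      let ?m = "mdl_ob (M i)"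
      note [simp] = M[OF i] MD_Ob[OF M[OF i]] d(2-7)[OF i]
      have "p i ** r ** (mu A >< I P) = ac A (M i) ** (mu A >< I ?m) ** ((I ?a >< I ?a) >< p i)"
        by (simp add: mg ra[OF pr[OF i]])
      also have "\<dots> = ac A (M i) ** (I ?a >< ac A (M i)) ** (I ?a >< (I ?a >< p i)) ** al ?a ?a P"
        by (simp add: ra[OF ac_mu] al_nat del: I_tns)
      also have "\<dots> = ac A (M i) ** (I ?a >< (p i ** r)) ** al ?a ?a P"
        unfolding pr[OF i] by (simp add: mg)
      also have "\<dots> = ac A (M i) ** (I ?a >< p i) ** (I ?a >< r) ** al ?a ?a P" by (simp add: mg)
      finally show "p i ** r ** (mu A >< I P) = p i ** r ** (I ?a >< r) ** al ?a ?a P" by (simp add: ra[OF pr[OF i]])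
    qed auto
    show "r ** (et A >< I P) = la P"
    proof (rule biprod_jm[OF b])
      fix i assume i: "i < n"
      let ?m = "mdl_ob (M i)"
      note [simp] = M[OF i] MD_Ob[OF M[OF i]] d(2-7)[OF i]
      have "p i ** r ** (et A >< I P) = ac A (M i) ** (et A >< I ?m) ** (I one >< p i)"
        by (simp add: mg ra[OF pr[OF i]])
      then show "p i ** r ** (et A >< I P) = p i ** la P" by (simp add: ra[OF ac_et] la_nat)
    qed auto
  qed auto
  have p: "LM A (mkmdl r) (M i) (p i)" if i: "i < n" for i
    unfolding LM_def using MD M[OF i] pr[OF i] d(2-7)[OF i] by simp
  have "LM A (M i) (mkmdl r) (j i)" if i: "i < n" for i
  proof -
    note [simp] = M[OF i] MD_Ob[OF M[OF i]] d(2-7)[OF i]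
    have "j i ** ac A (M i) = r ** (I ?a >< j i)"
    proof (rule biprod_jm[OF b])
      fix k assume k: "k < n"
      note [simp] = M[OF k] MD_Ob[OF M[OF k]] d(2-7)[OF k]
      have "p k ** r ** (I ?a >< j i) = ac A (M k) ** (I ?a >< (p k ** j i))"
        by (simp add: ra[OF pr[OF k]] mg)
      then show "p k ** j i ** ac A (M i) = p k ** r ** (I ?a >< j i)"
        by (cases "k = i") (simp_all add: d(8)[OF i] d(9)[OF i k] ra[OF d(8)[OF i]] ra[OF d(9)[OF i k]])
    qed auto
    then show ?thesis unfolding LM_def using MD by simp
  qed
  then show ?thesis using that[OF MD _ _ p] by simp
qed

text \<open>The part of a Zariski cover on which descent rests, indexed by numbers so that finite
  biproducts apply.\<close>

definition cover :: "('o, 'm) mon \<Rightarrow> nat \<Rightarrow> (nat \<Rightarrow> ('o, 'm) mon) \<Rightarrow> (nat \<Rightarrow> ('o, 'm) tarr) \<Rightarrow> bool" where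
  "cover T n S f \<longleftrightarrow> CM T \<and> (\<forall>k<n. MM T (S k) (f k) \<and> flat C T (S k) (un (f k))) \<and>
    (\<forall>M N g. LM T M N g \<longrightarrow> (\<forall>k<n. is_iso (Mod C (S k)) (xo T (S k) (f k) M) (xo T (S k) (f k) N) (ext_mor C T (S k) (un (f k)) M N (un g)))
       \<longrightarrow> is_iso (Mod C T) M N (un g))"

text \<open>Flatness keeps \<open>k\<close> a kernel after extension. The extended map is zero as
  well, because the image of \<open>xe\<close> generates the extension of \<open>M\<close> and
  \<open>xe ** k\<close> vanishes. A kernel map that is zero has zero source.\<close>

lemma flat_kernel:
  assumes fl: "flat C R S (un f)" and f: "MM R S f" and k: "LM R K M k" "mono k" and z: "xe R S f M ** k = zr (mdl_ob K) (cd (xq R S f M))"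
  shows "I (mdl_ob (xo R S f K)) = zr (mdl_ob (xo R S f K)) (mdl_ob (xo R S f K))"
proof -
  note fD = MM_D[OF f] and kD = LM_D[OF k(1)]
  let ?b = "mon_ob S"
  note [simp] = fD(1-5) kD(1-5) MD_Ob[OF kD(1)] MD_Ob[OF kD(2)] ar_xq[OF f kD(1)] ar_xq[OF f kD(2)] ar_xe[OF f kD(1)] ar_xe[OF f kD(2)] xo_ob[OF f]
    xo_MD[OF f kD(1)] xo_MD[OF f kD(2)]
  obtain c where c: "coeq k (zr (dm k) (cd k)) c" using ex_cokernelT[OF kD(3)] by blast
  obtain N where N: "LM R M N c" using cokernel_mdl[OF fD(1) k(1) c] by blast
  have kc: "kernel c k" by (rule mono_kernel_coker[OF k(2) c])
  have "short_exact (Mod C R) K M N (un k) (un c)"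
    unfolding short_exact_def is_kernel_Mod[OF fD(1) k(1) N] is_cokernel_Mod[OF fD(1) N k(1)]
    using mod_kernelI[OF fD(1) k(1) N kc] mod_cokernelI[OF fD(1) N k(1) c] by blast
  moreover have "K \<in> Ob (Mod C R)" "M \<in> Ob (Mod C R)" "N \<in> Ob (Mod C R)" using LM_D(1,2)[OF k(1)] LM_D(2)[OF N] by (simp_all add: Ob_Mod)
  ultimately have se: "short_exact (Mod C S) (xo R S f K) (xo R S f M) (xo R S f N)
    (ext_mor C R S (un f) K M (un k)) (ext_mor C R S (un f) M N (un c))"
    using fl unfolding flat_def exact_functor_def by blast
  obtain hk where hk: "LM S (xo R S f K) (xo R S f M) hk" "hk ** xq R S f K = xq R S f M ** (k >< I ?b)" "ext_mor C R S (un f) K M (un k) = un hk"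
    using ext_mor_LM[OF f k(1)] by metis
  obtain hc where hc: "LM S (xo R S f M) (xo R S f N) hc" "ext_mor C R S (un f) M N (un c) = un hc"
    using ext_mor_LM[OF f N] by metis
  have mk: "mod_kernel S (xo R S f K) (xo R S f M) (xo R S f N) hk hc"
    using se unfolding short_exact_def hk(3) hc(2) is_kernel_Mod[OF fD(2) hk(1) hc(1)] by blast
  note hkD = LM_D[OF hk(1)] and hcD = LM_D[OF hc(1)]
  note [simp] = hkD(3-5) hcD(3-5)
  have qk: "xq R S f M ** (k >< I ?b) = zr (mdl_ob K \<boxtimes> ?b) (cd (xq R S f M))"
  proof -
    have "xq R S f M = xq R S f M ** br ?b (mdl_ob M) ** br (mdl_ob M) ?b" by simp
    also have "\<dots> = ac S (xo R S f M) ** (I ?b >< xe R S f M) ** br (mdl_ob M) ?b"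
      by (simp add: ra[OF ac_xo_xe[OF f kD(2)]])
    finally have "xq R S f M ** (k >< I ?b) = (ac S (xo R S f M) ** (I ?b >< xe R S f M) ** br (mdl_ob M) ?b) ** (k >< I ?b)" by simp
    also have "\<dots> = ac S (xo R S f M) ** (I ?b >< (xe R S f M ** k)) ** br (mdl_ob K) ?b"
      by (simp add: br_nat mg)
    also have "\<dots> = zr (mdl_ob K \<boxtimes> ?b) (cd (xq R S f M))" by (simp add: z)
    finally show ?thesis .
  qed
  have "hk ** xq R S f K = zr (mdl_ob (xo R S f K)) (mdl_ob (xo R S f M)) ** xq R S f K" by (simp add: hk(2) qk)
  then have hk0: "hk = zr (mdl_ob (xo R S f K)) (mdl_ob (xo R S f M))"
    by (rule epiD[OF epi_xq[OF f kD(1)]]) auto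
  let ?K = "xo R S f K"
  have l: "LM S ?K ?K (I (mdl_ob ?K))" "LM S ?K ?K (zr (mdl_ob ?K) (mdl_ob ?K))" "LM S ?K (xo R S f M) hk"
    using LM_I[OF fD(2) xo_MD[OF f kD(1)]] LM_zr[OF fD(2) xo_MD[OF f kD(1)] xo_MD[OF f kD(1)]] hk(1) by auto
  have "hc ** hk = zr (mdl_ob ?K) (mdl_ob (xo R S f N))" using mk by (simp add: mod_kernel_def)
  then obtain h where "\<And>h'. LM S ?K ?K h' \<Longrightarrow> hk ** h' = hk \<Longrightarrow> h' = h"
    using mod_kernelE[OF mk l(3)] by blast
  \<comment> \<open>The identity and the zero map both factor the zero map \<open>hk\<close> through
    the kernel, so they agree.\<close>
  note this[OF l(1)] this[OF l(2)]
  then show ?thesis unfolding hk0 by simp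
qed

text \<open>Let \<open>K\<close> be the common kernel of the maps from \<open>M\<close> to its
  extensions. By flatness all extensions of \<open>K\<close> vanish, so the zero endomorphism of
  \<open>K\<close> becomes an isomorphism after each extension; by conservativity it is one already,
  and \<open>K\<close> is zero.\<close>

lemma cover_separated:
  assumes c: "cover T n S f" and M: "MD T M" and y: "ar y" "cd y = mdl_ob M"
    and z: "\<And>k. k < n \<Longrightarrow> xe T (S k) (f k) M ** y = zr (dm y) (cd (xq T (S k) (f k) M))"
  shows "y = zr (dm y) (cd y)"
proof -
  have T: "CM T" and f: "\<And>k. k < n \<Longrightarrow> MM T (S k) (f k)" and fl: "\<And>k. k < n \<Longrightarrow> flat C T (S k) (un (f k))" using c by (auto simp: cover_def)
  let ?a = "mon_ob T" and ?m = "mdl_ob M"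
  let ?X = "\<lambda>k. cd (xq T (S k) (f k) M)" and ?e = "\<lambda>k. xe T (S k) (f k) M"
  have e: "\<And>k. k < n \<Longrightarrow> ar (?e k)" using ar_xe f M by blast
  have X: "\<And>k. k < n \<Longrightarrow> ?X k \<in> Ob C" using ar_xq f M by auto
  note [simp] = T M MD_Ob[OF M] y
  obtain P j p where b: "biprod n ?X P j p" using ex_biprod[of n ?X, OF X] by blast
  note d = biprod_D[OF b]
  \<comment> \<open>A single map into the biproduct of all extensions, so that the common kernel is
    an ordinary kernel.\<close>
  define g where "g = sm ?m P (\<lambda>i. j i ** ?e i) n"
  have g: "ar g" "dm g = ?m" "cd g = P" "\<And>i. i < n \<Longrightarrow> p i ** g = ?e i"
    using biprod_pair[OF b MD_Ob[OF M], of ?e] e unfolding g_def by auto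
  note [simp] = g(1-3) d(1)
  obtain k where k: "kernel g k" using ex_kernelT g(1) by blast
  note kD = kernelD[OF k]
  note [simp] = kD(3,4)
  have ek: "?e i ** k = zr (dm k) (?X i)" if i: "i < n" for i
    using ra[OF g(4)[OF i], of k] d(2-7)[OF i] by (simp add: kD(5))
  have gz: "g ** h = zr (dm h) P" if h: "ar h" "cd h = ?m" and eh: "\<And>i. i < n \<Longrightarrow> ?e i ** h = zr (dm h) (?X i)" for h
  proof (rule biprod_jm[OF b])
    fix i assume i: "i < n"
    show "p i ** g ** h = p i ** zr (dm h) P" using ra[OF g(4)[OF i], of h] d(2-7)[OF i] h by (simp add: eh[OF i])
  qed (use h in auto)
  have "g ** ac T M ** (I ?a >< k) = zr (dm (ac T M ** (I ?a >< k))) P"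
  proof (rule gz)
    fix i assume i: "i < n"
    note l = LM_D[OF xe_LM[OF f[OF i] M]]
    note [simp] = l(1-5)
    have "?e i ** ac T M ** (I ?a >< k) = ac T (rs (f i) (S i) (xo T (S i) (f i) M)) ** (I ?a >< (?e i ** k))"
      by (simp add: ra[OF l(6)] mg)
    then show "?e i ** ac T M ** (I ?a >< k) = zr (dm (ac T M ** (I ?a >< k))) (?X i)"
      using X[OF i] xo_ob[OF f[OF i]] by (simp add: ek[OF i])
  qed auto
  then obtain K where K: "LM T K M k" using kernel_mdl[OF T M k] by auto
  have Kob: "mdl_ob K = dm k" using LM_D(4)[OF K] by simp
  have MK: "MD T K" by (rule LM_D[OF K])
  have o: "dm k \<in> Ob C" by auto
  let ?z = "zr (dm k) (dm k)"
  have lz: "LM T K K ?z" using LM_zr[OF T MK MK] Kob by simp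
  have "is_iso (Mod C T) K K (un ?z)"
  proof -
    have "is_iso (Mod C (S i)) (xo T (S i) (f i) K) (xo T (S i) (f i) K) (ext_mor C T (S i) (un (f i)) K K (un ?z))" if i: "i < n" for i
    proof -
      let ?K = "xo T (S i) (f i) K"
      have iz: "I (mdl_ob ?K) = zr (mdl_ob ?K) (mdl_ob ?K)"
        by (rule flat_kernel[OF fl[OF i] f[OF i] K kD(2)]) (use ek[OF i] Kob in simp)
      obtain h where h: "LM (S i) ?K ?K h" "ext_mor C T (S i) (un (f i)) K K (un ?z) = un h"
        using ext_mor_LM[OF f[OF i] lz] by metis
      note hD = LM_D[OF h(1)]
      have "h = h ** I (mdl_ob ?K)" using hD by simp
      then have h0: "h = I (mdl_ob ?K)" unfolding iz using hD MD_Ob[OF hD(1)] by simp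
      show ?thesis unfolding h(2) is_iso_Mod[OF MM_D(2)[OF f[OF i]] h(1)]
        by (rule exI[of _ h]) (use hD h0 MD_Ob[OF hD(1)] in simp)
    qed
    then show ?thesis using c lz unfolding cover_def by blast
  qed
  then have "\<exists>h. ar h \<and> dm h = dm k \<and> cd h = dm k \<and> h ** ?z = I (dm k)"
    unfolding is_iso_Mod[OF T lz] Kob by blast
  then have iz: "I (dm k) = ?z" using o by auto
  have "g ** y = zr (dm y) (cd g)" using gz[of y] z by simp
  then obtain w where w: "ar w" "dm w = dm y" "cd w = dm k" "k ** w = y"
    using kernel_ex[OF k y(1)] by auto
  have "y = k ** I (dm k) ** w" using w by simp
  also have "\<dots> = zr (dm y) (cd y)" unfolding iz using w(1-3) by simp
  finally show ?thesis .
qed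

text \<open>In elements, \<open>a \<otimes> 1 = 1 \<otimes> f(a)\<close>. Whatever \<open>f\<close>
  kills is therefore killed by the unit of extension.\<close>

lemma xe_self:
  assumes f: "MM T S f"
  shows "xe T S f (self_mdl T) = xq T S f (self_mdl T) ** (et T >< I (mon_ob S)) ** li (mon_ob S) ** f"
proof -
  note fD = MM_D[OF f]
  let ?a = "mon_ob T" and ?M = "self_mdl T" and ?b = "mon_ob S"
  have M: "MD T ?M" using fD by simp
  note [simp] = fD(1-5) ar_xq[OF f M] ar_xe[OF f M]
  have "xe T S f ?M = xe T S f ?M ** mu T ** (et T >< I ?a) ** li ?a" by (simp add: ra[OF mu_et_left])
  also have "\<dots> = (xe T S f ?M ** mu T ** br ?a ?a) ** (et T >< I ?a) ** li ?a" by (simp add: mu_comm)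
  also have "\<dots> = xq T S f ?M ** (et T >< I ?b) ** (I one >< f) ** li ?a"
    using xe_ac_br[OF f M] by (simp add: mg)
  also have "\<dots> = xq T S f ?M ** (et T >< I ?b) ** li ?b ** f" by (simp add: li_nat)
  finally show ?thesis .
qed

text \<open>Separatedness of \<open>T\<close> as a module over itself, applied to the difference of
  \<open>y\<close> and \<open>y'\<close>.\<close>

lemma cover_jm:
  assumes c: "cover T n S f" and y: "ar y" "ar y'" "dm y = dm y'" "cd y = mon_ob T" "cd y' = mon_ob T"
    and e: "\<And>k. k < n \<Longrightarrow> f k ** y = f k ** y'"
  shows "y = y'"
proof -
  have T: "CM T" and f: "\<And>k. k < n \<Longrightarrow> MM T (S k) (f k)" using c by (auto simp: cover_def)
  let ?d = "y \<boxplus> ng y'"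
  have d: "ar ?d" "cd ?d = mdl_ob (self_mdl T)" "dm ?d = dm y" using y by auto
  have "?d = zr (dm ?d) (cd ?d)"
  proof (rule cover_separated[OF c _ d(1,2)])
    fix k assume k: "k < n"
    note fD = MM_D[OF f[OF k]]
    have M: "MD T (self_mdl T)" using T by simp
    note [simp] = fD(1-5) ar_xq[OF f[OF k] M] y(1-2,4,5)
    have "f k ** ?d = (f k ** y) \<boxplus> ng (f k ** y')" using y by (simp add: cmp_add_r cmp_ng)
    also have "\<dots> = zr (dm y) (mon_ob (S k))" unfolding e[OF k] using y fD by (subst ng_props(2)) auto
    finally show "xe T (S k) (f k) (self_mdl T) ** ?d = zr (dm ?d) (cd (xq T (S k) (f k) (self_mdl T)))"
      using y by (simp add: xe_self[OF f[OF k]])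
  qed (use T in simp)
  then show ?thesis using add_ng_eq_zr[of y y'] y by simp
qed

text \<open>Let \<open>F\<close> be the map from \<open>T\<close> to the biproduct \<open>N\<close>
  of the \<open>S i\<close>. It is monic by \<open>cover_jm\<close>, hence a kernel of its cokernel
  \<open>q\<close>, so the tuple \<open>H\<close> of the \<open>h i\<close> factors through it once
  \<open>q ** H\<close> is zero. This may be checked after extension to each \<open>S k\<close>.
  There compatibility replaces \<open>h i \<otimes> 1\<close> by \<open>1 \<otimes> h k\<close>, so
  that \<open>H\<close> becomes \<open>F(1) \<otimes> h k\<close>, and \<open>q\<close> kills
  \<open>F\<close>.\<close>

lemma cover_glue:
  assumes c: "cover T n S f" and x: "x \<in> Ob C" and h: "\<And>k. k < n \<Longrightarrow> ar (h k) \<and> dm (h k) = x \<and> cd (h k) = mon_ob (S k)"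
    and compat: "\<And>i k. i < n \<Longrightarrow> k < n \<Longrightarrow> xe T (S k) (f k) (rs (f i) (S i) (self_mdl (S i))) ** h i =
      xq T (S k) (f k) (rs (f i) (S i) (self_mdl (S i))) ** (et (S i) >< I (mon_ob (S k))) ** li (mon_ob (S k)) ** h k"
  obtains y where "ar y" "dm y = x" "cd y = mon_ob T" "\<And>k. k < n \<Longrightarrow> f k ** y = h k"
proof -
  have T: "CM T" and f: "\<And>k. k < n \<Longrightarrow> MM T (S k) (f k)" using c by (auto simp: cover_def)
  let ?a = "mon_ob T"
  define M where "M i = rs (f i) (S i) (self_mdl (S i))" for i
  have M: "\<And>i. i < n \<Longrightarrow> MD T (M i)" unfolding M_def using MD_rs_self f by blast
  have Mob: "mdl_ob (M i) = mon_ob (S i)" for i by (simp add: M_def)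
  have So: "\<And>i. i < n \<Longrightarrow> mon_ob (S i) \<in> Ob C" using h by (metis cd_Ob)
  obtain P j p where b: "biprod n (\<lambda>i. mdl_ob (M i)) P j p" using ex_biprod[of n "\<lambda>i. mdl_ob (M i)", OF MD_Ob[OF M]] by blast
  note d = biprod_D[OF b]
  obtain N where N: "MD T N" "mdl_ob N = P" "\<And>i. i < n \<Longrightarrow> LM T (M i) N (j i)" "\<And>i. i < n \<Longrightarrow> LM T N (M i) (p i)"
    using biprod_mdl[OF T M b] by metis
  note [simp] = T x d(1) N(1,2)
  define F where "F = sm ?a P (\<lambda>i. j i ** f i) n"
  have F: "ar F" "dm F = ?a" "cd F = P" "\<And>i. i < n \<Longrightarrow> p i ** F = f i"
    using biprod_pair[OF b, of ?a f] MM_D(3-5)[OF f] unfolding F_def by (simp_all add: Mob)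
  define H where "H = sm x P (\<lambda>i. j i ** h i) n"
  have H: "ar H" "dm H = x" "cd H = P" "\<And>i. i < n \<Longrightarrow> p i ** H = h i"
    using biprod_pair[OF b x, of h] h unfolding H_def by (simp_all add: Mob)
  note [simp] = F(1-3) H(1-3)
  have FL: "LM T (self_mdl T) N F"
  proof -
    have "F ** mu T = ac T N ** (I ?a >< F)"
    proof (rule biprod_jm[OF b])
      fix i assume i: "i < n"
      note l = LM_D[OF N(4)[OF i]] and fl = LM_D[OF MM_LM[OF f[OF i]]]
      note [simp] = l(1-5) MM_D(1-5)[OF f[OF i]]
      have "p i ** ac T N ** (I ?a >< F) = ac T (M i) ** (I ?a >< (p i ** F))" by (simp add: ra[OF l(6)] mg)
      also have "\<dots> = f i ** mu T" unfolding F(4)[OF i] M_def using fl(6) by simp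
      finally show "p i ** F ** mu T = p i ** ac T N ** (I ?a >< F)" using ra[OF F(4)[OF i], of "mu T"] by simp
    qed auto
    then show ?thesis unfolding LM_def by simp
  qed
  have Fm: "mono F"
    unfolding mono_def
  proof (intro conjI allI impI F(1))
    fix g g' assume g: "ar g" "ar g'" "cd g = dm F" "cd g' = dm F" "F ** g = F ** g'"
    have dg: "dm g = dm g'" using arg_cong[OF g(5), of dm] by simp
    show "g = g'"
    proof (rule cover_jm[OF c g(1,2) dg])
      fix k assume k: "k < n"
      have "p k ** F ** g = p k ** F ** g'" by (simp only: g(5))
      then show "f k ** g = f k ** g'" by (simp add: ra[OF F(4)[OF k]])
    qed (use g in auto)
  qed
  obtain q where q: "coeq F (zr (dm F) (cd F)) q" using ex_cokernelT[OF F(1)] by blast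
  note qD = cokerD[OF q]
  obtain Q where Q: "LM T N Q q" using cokernel_mdl[OF T FL q] by blast
  note QD = LM_D[OF Q]
  note [simp] = qD(3) QD(1-5)
  have "q ** H = zr (dm (q ** H)) (cd (q ** H))"
  proof (rule cover_separated[OF c QD(2)])
    fix k assume k: "k < n"
    let ?b = "mon_ob (S k)"
    let ?e = "\<lambda>M. xe T (S k) (f k) M" and ?q = "\<lambda>M. xq T (S k) (f k) M"
    note fk = f[OF k] MM_D[OF f[OF k]] and hk = h[OF k]
    note [simp] = fk(2-6) conjunct1[OF hk] conjunct1[OF conjunct2[OF hk]] conjunct2[OF conjunct2[OF hk]]
      ar_xq[OF fk(1) N(1)] ar_xe[OF fk(1) N(1)] ar_xq[OF fk(1) QD(2)] ar_xe[OF fk(1) QD(2)] MD_Ob[OF QD(2)]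
    \<comment> \<open>Compatibility on the overlap of \<open>i\<close> and \<open>k\<close>, moved
      into the extension of \<open>N\<close> along the injection \<open>j i\<close>.\<close>
    have step: "?e N ** j i ** h i = ?q N ** ((j i ** et (S i)) >< h k) ** li x" if i: "i < n" for i
    proof -
      note l = LM_D[OF N(3)[OF i]]
      note [simp] = l(1-5) MM_D(1-5)[OF f[OF i]] Mob ar_xq[OF fk(1) M[OF i]] ar_xe[OF fk(1) M[OF i]]
      obtain t where t: "LM (S k) (xo T (S k) (f k) (M i)) (xo T (S k) (f k) N) t" "t ** ?q (M i) = ?q N ** (j i >< I ?b)" "t ** ?e (M i) = ?e N ** j i"
        using ext_mor_LM[OF fk(1) N(3)[OF i]] by metis
      have "?e N ** j i ** h i = t ** ?e (M i) ** h i" by (simp add: ra[OF t(3)])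
      also have "\<dots> = t ** ?q (M i) ** (et (S i) >< I ?b) ** li ?b ** h k"
        using compat[OF i k] unfolding M_def[symmetric] by simp
      also have "\<dots> = ?q N ** (j i >< I ?b) ** (et (S i) >< I ?b) ** li ?b ** h k" by (simp add: ra[OF t(2)])
      also have "\<dots> = ?q N ** ((j i ** et (S i)) >< h k) ** li x" by (simp add: li_nat mg)
      finally show ?thesis .
    qed
    have jt: "ar (j i ** h i) \<and> dm (j i ** h i) = x \<and> cd (j i ** h i) = P" "ar (j i ** et (S i)) \<and> dm (j i ** et (S i)) = one \<and> cd (j i ** et (S i)) = P" if i: "i < n" for i
      using d(2-7)[OF i] h[OF i] MM_D(2)[OF f[OF i]] by (simp_all add: Mob)
    have Fe: "F ** et T = sm one P (\<lambda>i. j i ** et (S i)) n"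
    proof (rule biprod_jm[OF b])
      have *: "i < n \<Longrightarrow> ar (et (S i)) \<and> dm (et (S i)) = one \<and> cd (et (S i)) = mdl_ob (M i)" for i
        using MM_D(2)[OF f] by (simp add: Mob)
      note bp = biprod_pair[OF b unit_Ob, of "\<lambda>i. et (S i)", OF *]
      show "ar (sm one P (\<lambda>i. j i ** et (S i)) n)" "cd (sm one P (\<lambda>i. j i ** et (S i)) n) = P"
        "dm (F ** et T) = dm (sm one P (\<lambda>i. j i ** et (S i)) n)" using bp(1-3) by simp_all
      fix i assume i: "i < n"
      show "p i ** F ** et T = p i ** sm one P (\<lambda>i. j i ** et (S i)) n"
        using ra[OF F(4)[OF i], of "et T"] bp(4)[OF _ i] MM_D(7)[OF f[OF i]] by simp
    qed auto
    have "?e N ** H = ?e N ** sm x (dm (?e N)) (\<lambda>i. j i ** h i) n" by (simp add: H_def)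
    also have "\<dots> = sm x (cd (?e N)) (\<lambda>i. ?e N ** j i ** h i) n" by (rule cmp_sm[OF x]) (use jt in auto)
    also have "\<dots> = sm x (cd (?q N)) (\<lambda>i. (?q N ** ((j i ** et (S i)) >< h k)) ** li x) n"
      by (simp, rule sm_cong) (use step in simp)
    also have "\<dots> = sm (cd (li x)) (cd (?q N)) (\<lambda>i. ?q N ** ((j i ** et (S i)) >< h k)) n ** li x"
      using sm_cmp[of "cd (?q N)" "li x" n "\<lambda>i. ?q N ** ((j i ** et (S i)) >< h k)"] jt by simp
    also have "sm (cd (li x)) (cd (?q N)) (\<lambda>i. ?q N ** ((j i ** et (S i)) >< h k)) n = ?q N ** sm (one \<boxtimes> x) (P \<boxtimes> ?b) (\<lambda>i. (j i ** et (S i)) >< h k) n"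
      using cmp_sm[of "one \<boxtimes> x" "?q N" n "\<lambda>i. (j i ** et (S i)) >< h k"] jt by simp
    also have "sm (one \<boxtimes> x) (P \<boxtimes> ?b) (\<lambda>i. (j i ** et (S i)) >< h k) n = (F ** et T) >< h k"
      unfolding Fe using sm_tns[of one P "h k" n "\<lambda>i. j i ** et (S i)"] jt by simp
    finally have eH: "?e N ** H = ?q N ** ((F ** et T) >< h k) ** li x" by simp
    obtain t where t: "LM (S k) (xo T (S k) (f k) N) (xo T (S k) (f k) Q) t" "t ** ?q N = ?q Q ** (q >< I ?b)" "t ** ?e N = ?e Q ** q"
      using ext_mor_LM[OF fk(1) Q] by metis
    have "?e Q ** q ** H = t ** ?e N ** H" by (simp add: ra[OF t(3)])
    also have "\<dots> = ?q Q ** (q >< I ?b) ** ((F ** et T) >< h k) ** li x" unfolding eH by (simp add: ra[OF t(2)])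
    also have "\<dots> = ?q Q ** ((q ** F ** et T) >< h k) ** li x" by (simp add: mg)
    also have "\<dots> = zr x (cd (?q Q))" by (simp add: ra[OF qD(5)])
    finally show "?e Q ** q ** H = zr (dm (q ** H)) (cd (?q Q))" by simp
  qed auto
  then have "q ** H = zr (dm H) (cd q)" by simp
  then obtain y where y: "ar y" "dm y = dm H" "cd y = dm F" "F ** y = H"
    using kernel_ex[OF mono_kernel_coker[OF Fm q], of H] qD(4) by auto
  have "f k ** y = h k" if k: "k < n" for k
  proof -
    have "f k ** y = p k ** F ** y" by (simp add: ra[OF F(4)[OF k]])
    then show ?thesis unfolding y(4) by (simp add: H(4)[OF k])
  qed
  then show ?thesis using that[OF y(1)] y(2,3) by simp
qed

section \<open>Filtered colimits of commutative monoids\<close>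

definition zeroT :: "'o \<Rightarrow> bool" where "zeroT x \<longleftrightarrow> x \<in> Ob C \<and> I x = zr x x"

lemma zeroT_to: "zeroT x \<Longrightarrow> ar f \<Longrightarrow> cd f = x \<Longrightarrow> f = zr (dm f) x"
proof -
  assume a: "zeroT x" "ar f" "cd f = x"
  have "f = I x ** f" using a by simp
  also have "\<dots> = zr (dm f) x" using a unfolding zeroT_def by (metis cmp_I_left zr_cmp)
  finally show ?thesis .
qed

lemma zeroT_from: "zeroT x \<Longrightarrow> ar f \<Longrightarrow> dm f = x \<Longrightarrow> f = zr x (cd f)"
proof -
  assume a: "zeroT x" "ar f" "dm f = x"
  have "f = f ** I x" using a by simp
  also have "\<dots> = zr x (cd f)" using a unfolding zeroT_def by (metis cmp_I_right cmp_zr)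
  finally show ?thesis .
qed

lemma zero_object_zeroT: "zero_object C x \<longleftrightarrow> zeroT x"
proof
  assume z: "zero_object C x"
  then have x: "x \<in> Ob C" "\<exists>!f. f \<in> Hom C x x" by (auto simp: zero_object_def)
  have "un (I x) = un (zr x x)" using x arE(3)[of "I x"] arE(3)[of "zr x x"] by auto
  then have "I x = zr x x" using x by (intro un_inject) auto
  then show "zeroT x" using x by (simp add: zeroT_def)
next
  assume z: "zeroT x"
  then have x: "x \<in> Ob C" by (simp add: zeroT_def)
  show "zero_object C x"
    unfolding zero_object_def
  proof (intro conjI ballI x)
    fix y assume y: "y \<in> Ob C"
    have "f = un (zr x y)" if "f \<in> Hom C x y" for f
      using zeroT_from[OF z, of "mk x f y"] un_mk[of x f y] that x y by (simp add: ar_mk)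
    then show "\<exists>!f. f \<in> Hom C x y" using arE(3)[of "zr x y"] x y by auto
    have "f = un (zr y x)" if "f \<in> Hom C y x" for f
      using zeroT_to[OF z, of "mk y f x"] un_mk[of y f x] that x y by (simp add: ar_mk)
    then show "\<exists>!f. f \<in> Hom C y x" using arE(3)[of "zr y x"] x y by auto
  qed
qed

lemma zero_monoid_iff: "zero_monoid C A \<longleftrightarrow> CM A \<and> zeroT (mon_ob A)"
  by (simp add: zero_monoid_def Ob_CommMon zero_object_zeroT)

text \<open>Every element is a multiple of the unit.\<close>

lemma unit_zero:
  assumes A: "CM A" and e: "et A = zr one (mon_ob A)" shows "zeroT (mon_ob A)"
proof -
  let ?a = "mon_ob A"
  have "I ?a = mu A ** (et A >< I ?a) ** li ?a" using A by (simp add: ra[OF mu_et_left])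
  also have "\<dots> = zr ?a ?a" unfolding e using A by simp
  finally show ?thesis using A by (simp add: zeroT_def)
qed

lemma MM_zero: "MM A B f \<Longrightarrow> zeroT (mon_ob A) \<Longrightarrow> zeroT (mon_ob B)"
proof -
  assume f: "MM A B f" and z: "zeroT (mon_ob A)"
  note d = MM_D[OF f]
  have "et B = f ** et A" using d(7) by simp
  also have "\<dots> = zr one (mon_ob B)" using zeroT_to[OF z, of "et A"] d(1-5) by simp
  finally show ?thesis using unit_zero d(2) by blast
qed

section \<open>Diagrams, cocones and colimits in \<open>C\<close>\<close>

definition diag ::
  "('i, 'a, 'y) cat_scheme \<Rightarrow> ('i \<Rightarrow> 'o) \<Rightarrow> ('i \<Rightarrow> 'i \<Rightarrow> 'a \<Rightarrow> ('o, 'm) tarr) \<Rightarrow> bool" where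
  "diag J X G \<longleftrightarrow> (\<forall>i\<in>Ob J. X i \<in> Ob C) \<and>
    (\<forall>i\<in>Ob J. \<forall>j\<in>Ob J. \<forall>v\<in>Hom J i j. ar (G i j v) \<and> dm (G i j v) = X i \<and> cd (G i j v) = X j) \<and>
    (\<forall>i\<in>Ob J. G i i (Idn J i) = I (X i)) \<and>
    (\<forall>i\<in>Ob J. \<forall>j\<in>Ob J. \<forall>k\<in>Ob J. \<forall>v\<in>Hom J i j. \<forall>w\<in>Hom J j k. G i k (w \<cdot>\<^bsub>J\<^esub> v) = G j k w ** G i j v)"

definition cocn ::
  "('i, 'a, 'y) cat_scheme \<Rightarrow> ('i \<Rightarrow> 'o) \<Rightarrow> ('i \<Rightarrow> 'i \<Rightarrow> 'a \<Rightarrow> ('o, 'm) tarr) \<Rightarrow> 'o \<Rightarrow> ('i \<Rightarrow> ('o, 'm) tarr) \<Rightarrow> bool" where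
  "cocn J X G L c \<longleftrightarrow> L \<in> Ob C \<and> (\<forall>i\<in>Ob J. ar (c i) \<and> dm (c i) = X i \<and> cd (c i) = L) \<and>
    (\<forall>i\<in>Ob J. \<forall>j\<in>Ob J. \<forall>v\<in>Hom J i j. c j ** G i j v = c i)"

text \<open>Uniqueness of the induced arrow is encoded as joint epicity of the cocone, which is
  known to survive tensoring.\<close>

definition colim ::
  "('i, 'a, 'y) cat_scheme \<Rightarrow> ('i \<Rightarrow> 'o) \<Rightarrow> ('i \<Rightarrow> 'i \<Rightarrow> 'a \<Rightarrow> ('o, 'm) tarr) \<Rightarrow> 'o \<Rightarrow> ('i \<Rightarrow> ('o, 'm) tarr) \<Rightarrow> bool" where
  "colim J X G L c \<longleftrightarrow> cocn J X G L c \<and> jepi (c ` Ob J) L \<and>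
    (\<forall>N d. cocn J X G N d \<longrightarrow> (\<exists>h. ar h \<and> dm h = L \<and> cd h = N \<and> (\<forall>i\<in>Ob J. h ** c i = d i)))"

lemma diag_D:
  assumes "diag J X G"
  shows "i \<in> Ob J \<Longrightarrow> X i \<in> Ob C" "i \<in> Ob J \<Longrightarrow> j \<in> Ob J \<Longrightarrow> v \<in> Hom J i j \<Longrightarrow> ar (G i j v)"
    "i \<in> Ob J \<Longrightarrow> j \<in> Ob J \<Longrightarrow> v \<in> Hom J i j \<Longrightarrow> dm (G i j v) = X i"
    "i \<in> Ob J \<Longrightarrow> j \<in> Ob J \<Longrightarrow> v \<in> Hom J i j \<Longrightarrow> cd (G i j v) = X j"
    "i \<in> Ob J \<Longrightarrow> G i i (Idn J i) = I (X i)"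
    "i \<in> Ob J \<Longrightarrow> j \<in> Ob J \<Longrightarrow> k \<in> Ob J \<Longrightarrow> v \<in> Hom J i j \<Longrightarrow> w \<in> Hom J j k \<Longrightarrow> G i k (w \<cdot>\<^bsub>J\<^esub> v) = G j k w ** G i j v"
  using assms by (auto simp: diag_def)

lemma cocn_D:
  assumes "cocn J X G L c"
  shows "L \<in> Ob C" "i \<in> Ob J \<Longrightarrow> ar (c i)" "i \<in> Ob J \<Longrightarrow> dm (c i) = X i" "i \<in> Ob J \<Longrightarrow> cd (c i) = L"
    "i \<in> Ob J \<Longrightarrow> j \<in> Ob J \<Longrightarrow> v \<in> Hom J i j \<Longrightarrow> c j ** G i j v = c i"
  using assms by (auto simp: cocn_def)

lemma small_colim:
  fixes J :: "('u, 'u) cat"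
  assumes U: "has_small_colimits U C" and J: "small_cat U J" and G: "diag J X G"
  obtains L c where "colim J X G L c"
proof -
  note g = diag_D[OF G]
  have "is_functor J C X (\<lambda>i j v. un (G i j v))"
    unfolding is_functor_def
  proof (intro conjI ballI)
    fix i j v assume a: "i \<in> Ob J" "j \<in> Ob J" "v \<in> Hom J i j"
    show "un (G i j v) \<in> Hom C (X i) (X j)" using arE(3)[OF g(2)[OF a]] g(3,4)[OF a] by simp
  next
    fix i j k v w assume a: "i \<in> Ob J" "j \<in> Ob J" "k \<in> Ob J" "v \<in> Hom J i j" "w \<in> Hom J j k"
    show "un (G i k (w \<cdot>\<^bsub>J\<^esub> v)) = un (G j k w) \<cdot> un (G i j v)"
      using g(2-4)[OF a(1,2,4)] g(2-4)[OF a(2,3,5)] by (simp add: g(6)[OF a] un_cmp)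
  qed (auto simp: g(1,5) un_I)
  then obtain L c0 where L: "is_colimit J C X (\<lambda>i j v. un (G i j v)) L c0"
    using U J unfolding has_small_colimits_def by blast
  then have co: "is_cocone J C X (\<lambda>i j v. un (G i j v)) L c0"
    and up: "\<And>M d. is_cocone J C X (\<lambda>i j v. un (G i j v)) M d \<Longrightarrow> \<exists>!h. h \<in> Hom C L M \<and> (\<forall>i\<in>Ob J. h \<cdot> c0 i = d i)"
    unfolding is_colimit_def by blast+
  define c where "c i = mk (X i) (c0 i) L" for i
  have LO: "L \<in> Ob C" and c0: "\<And>i. i \<in> Ob J \<Longrightarrow> c0 i \<in> Hom C (X i) L"
    and cc: "\<And>i j v. i \<in> Ob J \<Longrightarrow> j \<in> Ob J \<Longrightarrow> v \<in> Hom J i j \<Longrightarrow> c0 j \<cdot> un (G i j v) = c0 i"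
    using co unfolding is_cocone_def by blast+
  have c: "i \<in> Ob J \<Longrightarrow> ar (c i)" "dm (c i) = X i" "cd (c i) = L" for i using c0 g(1) LO by (auto simp: c_def ar_mk)
  have unc: "i \<in> Ob J \<Longrightarrow> un (c i) = c0 i" for i using c(1) un_mk by (simp add: c_def)
  have coc: "cocn J X G L c"
    unfolding cocn_def
  proof (intro conjI ballI LO)
    fix i j v assume a: "i \<in> Ob J" "j \<in> Ob J" "v \<in> Hom J i j"
    show "c j ** G i j v = c i" using g(2-4)[OF a] c[of i] c[of j] a cc[OF a]
      by (intro un_inject) (auto simp: un_cmp unc)
  qed (use c in auto)
  have raw: "is_cocone J C X (\<lambda>i j v. un (G i j v)) N (\<lambda>i. un (d i))" if d: "cocn J X G N d" for N d
  proof -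
    note D = cocn_D[OF d]
    show ?thesis unfolding is_cocone_def
    proof (intro conjI ballI)
      fix i assume i: "i \<in> Ob J" show "un (d i) \<in> Hom C (X i) N" using arE(3)[OF D(2)[OF i]] D(3,4)[OF i] by simp
      fix j v assume a: "j \<in> Ob J" "v \<in> Hom J i j"
      show "un (d j) \<cdot> un (G i j v) = un (d i)"
        using g(2-4)[OF i a] D(2-4)[OF i] D(2-4)[OF a(1)] arg_cong[OF D(5)[OF i a], of un] by (simp add: un_cmp)
    qed (use D in auto)
  qed
  have je: "jepi (c ` Ob J) L"
    unfolding jepi_def
  proof (intro conjI ballI allI impI)
    fix p q assume p: "ar p" "ar q" "dm p = L" "dm q = L" "cd p = cd q" and e: "\<forall>k\<in>c ` Ob J. p ** k = q ** k"
    have "cocn J X G (cd p) (\<lambda>i. p ** c i)"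
      unfolding cocn_def using cocn_D[OF coc] p by auto
    note r = up[OF raw[OF this]]
    have h: "un p \<in> Hom C L (cd p)" "un q \<in> Hom C L (cd p)" using arE(3)[of p] arE(3)[of q] p by auto
    have "un p \<cdot> c0 i = un (p ** c i)" "un q \<cdot> c0 i = un (p ** c i)" if i: "i \<in> Ob J" for i
    proof -
      show "un p \<cdot> c0 i = un (p ** c i)" using c[of i] p i by (simp add: un_cmp unc)
      have "un q \<cdot> c0 i = un (q ** c i)" using c[of i] p i by (simp add: un_cmp unc)
      then show "un q \<cdot> c0 i = un (p ** c i)" using e i by simp
    qed
    then have "un p = un q" using r h by blast
    then show "p = q" using p by (intro un_inject) auto
  qed (use c in auto)
  have "\<exists>h. ar h \<and> dm h = L \<and> cd h = N \<and> (\<forall>i\<in>Ob J. h ** c i = d i)" if d: "cocn J X G N d" for N d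
  proof -
    note D = cocn_D[OF d]
    obtain h where h: "h \<in> Hom C L N" "\<forall>i\<in>Ob J. h \<cdot> c0 i = un (d i)" using up[OF raw[OF d]] by blast
    have ah: "ar (mk L h N)" using h LO D by (simp add: ar_mk)
    have "mk L h N ** c i = d i" if i: "i \<in> Ob J" for i
      using ah c[of i] D(2-4)[OF i] i h(2) by (intro un_inject) (auto simp: un_cmp unc)
    then show ?thesis using ah by (intro exI[of _ "mk L h N"]) auto
  qed
  then have "colim J X G L c" unfolding colim_def using coc je by blast
  then show ?thesis by (rule that)
qed

text \<open>Transpose the cocone, induce an arrow out of \<open>L\<close>, and transpose back. This
  is the existence half of the preservation of colimits; the uniqueness half is
  \<open>jepi_tns_right\<close>.\<close>

lemma colim_tns_right:
  assumes G: "diag J X G" and L: "colim J X G L c" and y: "y \<in> Ob C" "z \<in> Ob C"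
    and d: "\<And>i. i \<in> Ob J \<Longrightarrow> ar (d i) \<and> dm (d i) = X i \<boxtimes> y \<and> cd (d i) = z"
      "\<And>i j v. i \<in> Ob J \<Longrightarrow> j \<in> Ob J \<Longrightarrow> v \<in> Hom J i j \<Longrightarrow> d j ** (G i j v >< I y) = d i"
  obtains h where "ar h" "dm h = L \<boxtimes> y" "cd h = z" "\<And>i. i \<in> Ob J \<Longrightarrow> h ** (c i >< I y) = d i"
proof -
  note g = diag_D[OF G]
  have co: "cocn J X G L c" and up: "\<And>N d. cocn J X G N d \<Longrightarrow> \<exists>h. ar h \<and> dm h = L \<and> cd h = N \<and> (\<forall>i\<in>Ob J. h ** c i = d i)"
    using L unfolding colim_def by blast+
  note c = cocn_D[OF co]
  obtain H ev where "exponential y z H ev" using ex_exponential y by blast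
  note H = exponentialD(1-4)[OF this] and ex = exponentialD(5)[OF this] and un = exponentialD(6)[OF this]
  have "\<forall>i\<in>Ob J. \<exists>t. ar t \<and> dm t = X i \<and> cd t = H \<and> ev ** (t >< I y) = d i" using ex d(1) g(1) by blast
  then obtain t where t: "\<And>i. i \<in> Ob J \<Longrightarrow> ar (t i) \<and> dm (t i) = X i \<and> cd (t i) = H \<and> ev ** (t i >< I y) = d i" by metis
  have "cocn J X G H t"
    unfolding cocn_def
  proof (intro conjI ballI H(1))
    fix i j v assume a: "i \<in> Ob J" "j \<in> Ob J" "v \<in> Hom J i j"
    note ti = t[OF a(1)] and tj = t[OF a(2)]
    have e: "ev ** (t j >< I y) = d j" using tj by blast
    have "ev ** ((t j ** G i j v) >< I y) = ev ** (t j >< I y) ** (G i j v >< I y)" using g(2-4)[OF a] tj y by (simp add: mg)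
    also have "\<dots> = d i" using ra[OF e] d(2)[OF a] by simp
    also have "\<dots> = ev ** (t i >< I y)" using ti by simp
    finally show "t j ** G i j v = t i" by (rule un) (use g(2-4)[OF a] ti tj in auto)
  qed (use t in auto)
  then obtain h where h: "ar h" "dm h = L" "cd h = H" "\<And>i. i \<in> Ob J \<Longrightarrow> h ** c i = t i" using up by blast
  have "(ev ** (h >< I y)) ** (c i >< I y) = d i" if i: "i \<in> Ob J" for i
    using h(1-3) c(2-4)[OF i] y t[OF i] H by (simp add: mg h(4)[OF i])
  then show ?thesis using that[of "ev ** (h >< I y)"] h H y by simp
qed

lemma colim_tns_left:
  assumes G: "diag J X G" and L: "colim J X G L c" and y: "y \<in> Ob C" "z \<in> Ob C"
    and d: "\<And>i. i \<in> Ob J \<Longrightarrow> ar (d i) \<and> dm (d i) = y \<boxtimes> X i \<and> cd (d i) = z"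
      "\<And>i j v. i \<in> Ob J \<Longrightarrow> j \<in> Ob J \<Longrightarrow> v \<in> Hom J i j \<Longrightarrow> d j ** (I y >< G i j v) = d i"
  obtains h where "ar h" "dm h = y \<boxtimes> L" "cd h = z" "\<And>i. i \<in> Ob J \<Longrightarrow> h ** (I y >< c i) = d i"
proof -
  note g = diag_D[OF G]
  have co: "cocn J X G L c" using L unfolding colim_def by blast
  note c = cocn_D[OF co]
  have "\<And>i j v. i \<in> Ob J \<Longrightarrow> j \<in> Ob J \<Longrightarrow> v \<in> Hom J i j \<Longrightarrow> (d j ** br (X j) y) ** (G i j v >< I y) = d i ** br (X i) y"
  proof -
    fix i j v assume a: "i \<in> Ob J" "j \<in> Ob J" "v \<in> Hom J i j"
    have "(d j ** br (X j) y) ** (G i j v >< I y) = (d j ** (I y >< G i j v)) ** br (X i) y"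
      using g(1-4)[OF a(1)] a d(1)[OF a(2)] y g(2-4)[OF a] by (simp add: br_nat)
    then show "(d j ** br (X j) y) ** (G i j v >< I y) = d i ** br (X i) y" unfolding d(2)[OF a] .
  qed
  moreover have "\<And>i. i \<in> Ob J \<Longrightarrow> ar (d i ** br (X i) y) \<and> dm (d i ** br (X i) y) = X i \<boxtimes> y \<and> cd (d i ** br (X i) y) = z"
    using d(1) g(1) y by simp
  ultimately obtain h where h: "ar h" "dm h = L \<boxtimes> y" "cd h = z" "\<And>i. i \<in> Ob J \<Longrightarrow> h ** (c i >< I y) = d i ** br (X i) y"
    using colim_tns_right[OF G L y, of "\<lambda>i. d i ** br (X i) y"] by metis
  have "(h ** br y L) ** (I y >< c i) = d i" if i: "i \<in> Ob J" for i
  proof -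
    have "(h ** br y L) ** (I y >< c i) = (h ** (c i >< I y)) ** br y (X i)"
      using h(1-3) c(1) c(2-4)[OF i] y by (simp add: br_nat)
    then show ?thesis unfolding h(4)[OF i] using d(1)[OF i] g(1)[OF i] y by simp
  qed
  then show ?thesis using that[of "h ** br y L"] h y c(1) by simp
qed

lemma filtered_pair:
  assumes "is_filtered J" "i \<in> Ob J" "j \<in> Ob J"
  obtains k v w where "k \<in> Ob J" "v \<in> Hom J i k" "w \<in> Hom J j k"
  using assms unfolding is_filtered_def by blast

definition algd where
  "algd J R G \<longleftrightarrow> diag J (\<lambda>i. mon_ob (R i)) G \<and> (\<forall>i\<in>Ob J. CM (R i)) \<and>
     (\<forall>i\<in>Ob J. \<forall>j\<in>Ob J. \<forall>v\<in>Hom J i j. MM (R i) (R j) (G i j v))"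

text \<open>Elements of \<open>R i\<close> and \<open>R j\<close> are multiplied in a common later
  \<open>R k\<close> and sent to \<open>L\<close>. Filteredness makes the result independent of the
  choices, and as tensoring preserves colimits the products extend to \<open>L\<close> one variable
  at a time.\<close>

lemma filtered_colim_monoid:
  fixes J :: "('i, 'a, 'y) cat_scheme"
  assumes J: "category J" and F: "is_filtered J" and A: "algd J R G" and L: "colim J (\<lambda>i. mon_ob (R i)) G L c"
  obtains T where "mon_ob T = L" "\<And>i. i \<in> Ob J \<Longrightarrow> MM (R i) T (c i)"
proof -
  let ?X = "\<lambda>i. mon_ob (R i)"
  have D: "diag J ?X G" and CMR: "\<And>i. i \<in> Ob J \<Longrightarrow> CM (R i)"
    and MG: "\<And>i j v. i \<in> Ob J \<Longrightarrow> j \<in> Ob J \<Longrightarrow> v \<in> Hom J i j \<Longrightarrow> MM (R i) (R j) (G i j v)"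
    using A by (auto simp: algd_def)
  have co: "cocn J ?X G L c" and je: "jepi (c ` Ob J) L" using L unfolding colim_def by blast+
  note g = diag_D[OF D] and c = cocn_D[OF co]
  have Jc: "w \<cdot>\<^bsub>J\<^esub> v \<in> Hom J i k" if "i \<in> Ob J" "j \<in> Ob J" "k \<in> Ob J" "v \<in> Hom J i j" "w \<in> Hom J j k" for i j k v w
    using category.comp_in_hom[OF J that(1-3)] that(4,5) by blast
  note [simp] = c(1)
  define E where "E i j k v w = c k ** mu (R k) ** (G i k v >< G j k w)" for i j k v w
  have push: "E i j k v w = E i j l (t \<cdot>\<^bsub>J\<^esub> v) (t \<cdot>\<^bsub>J\<^esub> w)"
    if a: "i \<in> Ob J" "j \<in> Ob J" "k \<in> Ob J" "l \<in> Ob J" "v \<in> Hom J i k" "w \<in> Hom J j k" "t \<in> Hom J k l" for i j k l v w t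
  proof -
    note m = MM_D[OF MG[OF a(3,4,7)]]
    note [simp] = m(1-5) g(2-4)[OF a(1,3,5)] g(2-4)[OF a(2,3,6)] c(2-4)[OF a(4)] c(2-4)[OF a(3)]
    have "E i j k v w = (c l ** G k l t) ** mu (R k) ** (G i k v >< G j k w)" unfolding E_def c(5)[OF a(3,4,7)] ..
    also have "\<dots> = c l ** mu (R l) ** (G k l t >< G k l t) ** (G i k v >< G j k w)" by (simp add: ra[OF m(6)])
    also have "\<dots> = E i j l (t \<cdot>\<^bsub>J\<^esub> v) (t \<cdot>\<^bsub>J\<^esub> w)"
      unfolding E_def g(6)[OF a(1,3,4,5,7)] g(6)[OF a(2,3,4,6,7)] by (simp add: mg)
    finally show ?thesis .
  qed
  \<comment> \<open>Both choices are brought to a common \<open>l\<close>. One further arrow makes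
    the two paths out of \<open>i\<close> equal, and a second one then does so for the paths out of
    \<open>j\<close>.\<close>
  have indep: "E i j k v w = E i j k' v' w'"
    if a: "i \<in> Ob J" "j \<in> Ob J" "k \<in> Ob J" "k' \<in> Ob J" "v \<in> Hom J i k" "w \<in> Hom J j k" "v' \<in> Hom J i k'" "w' \<in> Hom J j k'" for i j k k' v w v' w'
  proof -
    obtain l t t' where l: "l \<in> Ob J" "t \<in> Hom J k l" "t' \<in> Hom J k' l" using filtered_pair[OF F a(3,4)] by blast
    have eq: "\<exists>l'\<in>Ob J. \<exists>x\<in>Hom J l l'. x \<cdot>\<^bsub>J\<^esub> p = x \<cdot>\<^bsub>J\<^esub> q" if "i \<in> Ob J" "l \<in> Ob J" "p \<in> Hom J i l" "q \<in> Hom J i l" for i l p q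
      using F that unfolding is_filtered_def by blast
    obtain l1 x where x: "l1 \<in> Ob J" "x \<in> Hom J l l1" "x \<cdot>\<^bsub>J\<^esub> (t \<cdot>\<^bsub>J\<^esub> v) = x \<cdot>\<^bsub>J\<^esub> (t' \<cdot>\<^bsub>J\<^esub> v')"
      using eq[OF a(1) l(1) Jc[OF a(1,3) l(1) a(5) l(2)] Jc[OF a(1,4) l(1) a(7) l(3)]] by blast
    obtain l2 y where y: "l2 \<in> Ob J" "y \<in> Hom J l1 l2" "y \<cdot>\<^bsub>J\<^esub> (x \<cdot>\<^bsub>J\<^esub> (t \<cdot>\<^bsub>J\<^esub> w)) = y \<cdot>\<^bsub>J\<^esub> (x \<cdot>\<^bsub>J\<^esub> (t' \<cdot>\<^bsub>J\<^esub> w'))"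
      using eq[OF a(2) x(1) Jc[OF a(2) l(1) x(1) Jc[OF a(2,3) l(1) a(6) l(2)] x(2)] Jc[OF a(2) l(1) x(1) Jc[OF a(2,4) l(1) a(8) l(3)] x(2)]] by blast
    note J1 = Jc[OF a(1,3) l(1) a(5) l(2)] Jc[OF a(2,3) l(1) a(6) l(2)] Jc[OF a(1,4) l(1) a(7) l(3)] Jc[OF a(2,4) l(1) a(8) l(3)]
    note J2 = Jc[OF a(1) l(1) x(1) J1(1) x(2)] Jc[OF a(2) l(1) x(1) J1(2) x(2)] Jc[OF a(1) l(1) x(1) J1(3) x(2)] Jc[OF a(2) l(1) x(1) J1(4) x(2)]
    have "E i j k v w = E i j l2 (y \<cdot>\<^bsub>J\<^esub> (x \<cdot>\<^bsub>J\<^esub> (t \<cdot>\<^bsub>J\<^esub> v))) (y \<cdot>\<^bsub>J\<^esub> (x \<cdot>\<^bsub>J\<^esub> (t \<cdot>\<^bsub>J\<^esub> w)))"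
      using push[OF a(1-3) l(1) a(5,6) l(2)] push[OF a(1,2) l(1) x(1) J1(1,2) x(2)] push[OF a(1,2) x(1) y(1) J2(1,2) y(2)] by simp
    also have "\<dots> = E i j k' v' w'" unfolding x(3) y(3)
      using push[OF a(1,2,4) l(1) a(7,8) l(3)] push[OF a(1,2) l(1) x(1) J1(3,4) x(2)] push[OF a(1,2) x(1) y(1) J2(3,4) y(2)] by simp
    finally show ?thesis .
  qed
  define M where "M i j = (SOME e. \<exists>k\<in>Ob J. \<exists>v\<in>Hom J i k. \<exists>w\<in>Hom J j k. e = E i j k v w)" for i j
  have ME: "M i j = E i j k v w" if a: "i \<in> Ob J" "j \<in> Ob J" "k \<in> Ob J" "v \<in> Hom J i k" "w \<in> Hom J j k" for i j k v w
  proof -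
    have "\<exists>e. \<exists>k\<in>Ob J. \<exists>v\<in>Hom J i k. \<exists>w\<in>Hom J j k. e = E i j k v w" using a by blast
    then have "\<exists>k\<in>Ob J. \<exists>v\<in>Hom J i k. \<exists>w\<in>Hom J j k. M i j = E i j k v w" unfolding M_def by (rule someI_ex)
    then obtain k' v' w' where k': "k' \<in> Ob J" "v' \<in> Hom J i k'" "w' \<in> Hom J j k'" "M i j = E i j k' v' w'" by blast
    show ?thesis unfolding k'(4) by (rule indep[OF a(1,2) k'(1) a(3) k'(2,3) a(4,5)])
  qed
  have Mt: "ar (M i j) \<and> dm (M i j) = ?X i \<boxtimes> ?X j \<and> cd (M i j) = L" if a: "i \<in> Ob J" "j \<in> Ob J" for i j
  proof -
    obtain k v w where k: "k \<in> Ob J" "v \<in> Hom J i k" "w \<in> Hom J j k" using filtered_pair[OF F a] by blast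
    show ?thesis unfolding ME[OF a k] E_def using c(2-4)[OF k(1)] CMR[OF k(1)] g(2-4)[OF a(1) k(1,2)] g(2-4)[OF a(2) k(1,3)] by simp
  qed
  have Ml: "M j l ** (G i j v >< I (?X l)) = M i l" if a: "i \<in> Ob J" "j \<in> Ob J" "l \<in> Ob J" "v \<in> Hom J i j" for i j l v
  proof -
    obtain k x w where k: "k \<in> Ob J" "x \<in> Hom J j k" "w \<in> Hom J l k" using filtered_pair[OF F a(2,3)] by blast
    show ?thesis unfolding ME[OF a(2,3) k] ME[OF a(1,3) k(1) Jc[OF a(1,2) k(1) a(4) k(2)] k(3)] E_def g(6)[OF a(1,2) k(1) a(4) k(2)]
      using g(1)[OF a(3)] g(2-4)[OF a(1,2,4)] g(2-4)[OF a(2) k(1,2)] g(2-4)[OF a(3) k(1,3)] by (simp add: mg)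
  qed
  have Mr: "M l j ** (I (?X l) >< G i j v) = M l i" if a: "i \<in> Ob J" "j \<in> Ob J" "l \<in> Ob J" "v \<in> Hom J i j" for i j l v
  proof -
    obtain k w x where k: "k \<in> Ob J" "w \<in> Hom J l k" "x \<in> Hom J j k" using filtered_pair[OF F a(3,2)] by blast
    show ?thesis unfolding ME[OF a(3,2) k] ME[OF a(3,1) k(1,2) Jc[OF a(1,2) k(1) a(4) k(3)]] E_def g(6)[OF a(1,2) k(1) a(4) k(3)]
      using g(1)[OF a(3)] g(2-4)[OF a(1,2,4)] g(2-4)[OF a(2) k(1,3)] g(2-4)[OF a(3) k(1,2)] by (simp add: mg)
  qed
  \<comment> \<open>First variable: for fixed \<open>j\<close> the products extend from the
    \<open>R i\<close> to \<open>L\<close>.\<close>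
  have "\<forall>j\<in>Ob J. \<exists>e. ar e \<and> dm e = L \<boxtimes> ?X j \<and> cd e = L \<and> (\<forall>i\<in>Ob J. e ** (c i >< I (?X j)) = M i j)"
  proof
    fix j assume j: "j \<in> Ob J"
    obtain h where "ar h" "dm h = L \<boxtimes> ?X j" "cd h = L" "\<And>i. i \<in> Ob J \<Longrightarrow> h ** (c i >< I (?X j)) = M i j"
      using colim_tns_right[OF D L g(1)[OF j] c(1), of "\<lambda>i. M i j"] Mt[OF _ j] Ml[OF _ _ j] by blast
    then show "\<exists>e. ar e \<and> dm e = L \<boxtimes> ?X j \<and> cd e = L \<and> (\<forall>i\<in>Ob J. e ** (c i >< I (?X j)) = M i j)" by blast
  qed
  then obtain e where e: "\<And>j. j \<in> Ob J \<Longrightarrow> ar (e j) \<and> dm (e j) = L \<boxtimes> ?X j \<and> cd (e j) = L"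
    and em: "\<And>i j. i \<in> Ob J \<Longrightarrow> j \<in> Ob J \<Longrightarrow> e j ** (c i >< I (?X j)) = M i j" by metis
  have ee: "e j ** (I L >< G i j v) = e i" if a: "i \<in> Ob J" "j \<in> Ob J" "v \<in> Hom J i j" for i j v
  proof (rule jepiD[OF jepi_tns_right[OF je g(1)[OF a(1)] c(1)]])
    fix k assume "k \<in> (\<lambda>c. c >< I (?X i)) ` c ` Ob J"
    then obtain l where l: "l \<in> Ob J" "k = c l >< I (?X i)" by auto
    note [simp] = g(2-4)[OF a] c(2-4)[OF l(1)] g(1)[OF a(1)] g(1)[OF a(2)] g(1)[OF l(1)]
    have "(e j ** (I L >< G i j v)) ** k = e j ** (c l >< I (?X j)) ** (I (?X l) >< G i j v)" using l(2) by (simp add: mg)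
    also have "\<dots> = e i ** k" using l(2) by (simp add: ra[OF em[OF l(1) a(2)]] Mr[OF a(1,2) l(1) a(3)] em[OF l(1) a(1)])
    finally show "(e j ** (I L >< G i j v)) ** k = e i ** k" .
  qed (use e[OF a(1)] e[OF a(2)] g(2-4)[OF a] in auto)
  \<comment> \<open>Second variable: the maps \<open>e j\<close> extend from the \<open>R j\<close>
    to \<open>L\<close>.\<close>
  obtain m where m: "ar m" "dm m = L \<boxtimes> L" "cd m = L" "\<And>j. j \<in> Ob J \<Longrightarrow> m ** (I L >< c j) = e j"
    using colim_tns_left[OF D L c(1) c(1), of e] e ee by blast
  note [simp] = m(1-3)
  have mc: "m ** (c k >< c k) = c k ** mu (R k)" if k: "k \<in> Ob J" for k
  proof -
    note [simp] = c(2-4)[OF k] g(1)[OF k] CMR[OF k]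
    have i: "Idn J k \<in> Hom J k k" using category.id_in_hom[OF J k] .
    have "m ** (c k >< c k) = (m ** (I L >< c k)) ** (c k >< I (?X k))" by (simp add: mg)
    also have "\<dots> = E k k k (Idn J k) (Idn J k)" unfolding m(4)[OF k] em[OF k k] ME[OF k k k i i] ..
    also have "\<dots> = c k ** mu (R k)" unfolding E_def g(5)[OF k] by simp
    finally show ?thesis .
  qed
  obtain i0 where i0: "i0 \<in> Ob J" using F unfolding is_filtered_def by blast
  define u where "u = c i0 ** et (R i0)"
  have u: "ar u" "dm u = one" "cd u = L" using c(2-4)[OF i0] CMR[OF i0] by (auto simp: u_def)
  note [simp] = u
  have cu: "c i ** et (R i) = u" if i: "i \<in> Ob J" for i
  proof -
    obtain k v w where k: "k \<in> Ob J" "v \<in> Hom J i k" "w \<in> Hom J i0 k" using filtered_pair[OF F i i0] by blast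
    have "c i ** et (R i) = c k ** G i k v ** et (R i)" using ra[OF c(5)[OF i k(1,2)]] by simp
    also have "\<dots> = c k ** G i0 k w ** et (R i0)" using MM_D(7)[OF MG[OF i k(1,2)]] MM_D(7)[OF MG[OF i0 k(1,3)]] by simp
    also have "\<dots> = u" unfolding u_def using ra[OF c(5)[OF i0 k(1,3)]] by simp
    finally show ?thesis .
  qed
  have je1: "jepi ((\<lambda>c. I one >< c) ` c ` Ob J) (one \<boxtimes> L)" by (rule jepi_tns_left[OF je]) auto
  have CMT: "CM (mkmon m u)"
  proof (rule CM_mkmon[of m u L])
    show "m ** (u >< I L) = la L"
    proof (rule jepiD[OF je1])
      fix k assume "k \<in> (\<lambda>c. I one >< c) ` c ` Ob J"
      then obtain l where l: "l \<in> Ob J" "k = I one >< c l" by auto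
      note [simp] = c(2-4)[OF l(1)] g(1)[OF l(1)] CMR[OF l(1)]
      have "(m ** (u >< I L)) ** k = m ** (c l >< c l) ** (et (R l) >< I (?X l))" using l(2) by (simp add: mg cu[OF l(1)])
      also have "\<dots> = la L ** k" using l(2) by (simp add: ra[OF mc[OF l(1)]] mu_et_left la_nat)
      finally show "(m ** (u >< I L)) ** k = la L ** k" .
    qed auto
    \<comment> \<open>Tensoring the cocone in both variables yields tests indexed by pairs; by
      filteredness each of them factors through a diagonal one \<open>c k >< c k\<close>.\<close>
    have je2: "p = q" if p: "ar p" "ar q" "dm p = L \<boxtimes> L" "dm q = L \<boxtimes> L" "cd p = cd q"
      and pq: "\<And>k. k \<in> Ob J \<Longrightarrow> p ** (c k >< c k) = q ** (c k >< c k)" for p q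
    proof (rule jepiD[OF jepi_tns_right[OF je c(1) c(1)] p])
      fix k assume "k \<in> (\<lambda>c. c >< I L) ` c ` Ob J"
      then obtain i where i: "i \<in> Ob J" "k = c i >< I L" by auto
      note [simp] = c(2-4)[OF i(1)] g(1)[OF i(1)]
      show "p ** k = q ** k"
      proof (rule jepiD[OF jepi_tns_left[OF je g(1)[OF i(1)] c(1)]])
        fix k' assume "k' \<in> (\<lambda>d. I (?X i) >< d) ` c ` Ob J"
        then obtain j where j: "j \<in> Ob J" "k' = I (?X i) >< c j" by auto
        obtain k0 v w where k0: "k0 \<in> Ob J" "v \<in> Hom J i k0" "w \<in> Hom J j k0" using filtered_pair[OF F i(1) j(1)] by blast
        note [simp] = c(2-4)[OF j(1)] g(1)[OF j(1)] c(2-4)[OF k0(1)] g(2-4)[OF i(1) k0(1,2)] g(2-4)[OF j(1) k0(1,3)]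
        have kk: "k ** k' = (c k0 >< c k0) ** (G i k0 v >< G j k0 w)"
          using i(2) j(2) by (simp add: mg c(5)[OF i(1) k0(1,2)] c(5)[OF j(1) k0(1,3)])
        show "(p ** k) ** k' = (q ** k) ** k'" using ra[OF pq[OF k0(1)], of "G i k0 v >< G j k0 w"] by (simp add: kk)
      qed (use i p in auto)
    qed
    show "m ** br L L = m"
    proof (rule je2)
      fix k assume k: "k \<in> Ob J"
      note [simp] = c(2-4)[OF k] g(1)[OF k] CMR[OF k]
      show "(m ** br L L) ** (c k >< c k) = m ** (c k >< c k)" by (simp add: br_nat ra[OF mc[OF k]] mc[OF k] mu_comm)
    qed auto
    show "m ** (m >< I L) = m ** (I L >< m) ** al L L L"
    proof -
      have je3: "p = q" if p: "ar p" "ar q" "dm p = (L \<boxtimes> L) \<boxtimes> L" "dm q = (L \<boxtimes> L) \<boxtimes> L" "cd p = cd q"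
        and pq: "\<And>k. k \<in> Ob J \<Longrightarrow> p ** ((c k >< c k) >< c k) = q ** ((c k >< c k) >< c k)" for p q
      proof (rule jepiD[OF jepi_tns_right[OF jepi_tns_right[OF je c(1) c(1)] c(1)] p])
        show "L \<boxtimes> L \<in> Ob C" by simp
        fix k assume "k \<in> (\<lambda>c. c >< I L) ` (\<lambda>c. c >< I L) ` c ` Ob J"
        then obtain i where i: "i \<in> Ob J" "k = (c i >< I L) >< I L" by auto
        note [simp] = c(2-4)[OF i(1)] g(1)[OF i(1)]
        show "p ** k = q ** k"
        proof (rule jepiD[OF jepi_tns_right[OF jepi_tns_left[OF je g(1)[OF i(1)] c(1)] c(1)]])
          show "?X i \<boxtimes> L \<in> Ob C" by simp
          fix k' assume "k' \<in> (\<lambda>c. c >< I L) ` (\<lambda>d. I (?X i) >< d) ` c ` Ob J"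
          then obtain j where j: "j \<in> Ob J" "k' = (I (?X i) >< c j) >< I L" by auto
          note [simp] = c(2-4)[OF j(1)] g(1)[OF j(1)]
          show "(p ** k) ** k' = (q ** k) ** k'"
          proof (rule jepiD[OF jepi_tns_left[OF je tens_Ob[OF g(1)[OF i(1)] g(1)[OF j(1)]] c(1)]])
            fix k'' assume "k'' \<in> (\<lambda>d. I (?X i \<boxtimes> ?X j) >< d) ` c ` Ob J"
            then obtain l where l: "l \<in> Ob J" "k'' = I (?X i \<boxtimes> ?X j) >< c l" by auto
            obtain k1 v1 w1 where k1: "k1 \<in> Ob J" "v1 \<in> Hom J i k1" "w1 \<in> Hom J j k1" using filtered_pair[OF F i(1) j(1)] by blast
            obtain k0 t x where k0: "k0 \<in> Ob J" "t \<in> Hom J k1 k0" "x \<in> Hom J l k0" using filtered_pair[OF F k1(1) l(1)] by blast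
            let ?v = "t \<cdot>\<^bsub>J\<^esub> v1" and ?w = "t \<cdot>\<^bsub>J\<^esub> w1"
            have v: "?v \<in> Hom J i k0" "?w \<in> Hom J j k0" using Jc[OF i(1) k1(1) k0(1) k1(2) k0(2)] Jc[OF j(1) k1(1) k0(1) k1(3) k0(2)] .
            note [simp] = c(2-4)[OF l(1)] g(1)[OF l(1)] c(2-4)[OF k0(1)] g(2-4)[OF i(1) k0(1) v(1)] g(2-4)[OF j(1) k0(1) v(2)] g(2-4)[OF l(1) k0(1,3)]
            have "k ** k' ** k'' = (c i >< c j) >< c l" using i(2) j(2) l(2) by (simp add: mg)
            also have "\<dots> = ((c k0 >< c k0) >< c k0) ** ((G i k0 ?v >< G j k0 ?w) >< G l k0 x)"
              by (simp add: mg c(5)[OF i(1) k0(1) v(1)] c(5)[OF j(1) k0(1) v(2)] c(5)[OF l(1) k0(1,3)])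
            finally have kk: "k ** k' ** k'' = ((c k0 >< c k0) >< c k0) ** ((G i k0 ?v >< G j k0 ?w) >< G l k0 x)" .
            show "((p ** k) ** k') ** k'' = ((q ** k) ** k') ** k''"
              using ra[OF pq[OF k0(1)], of "(G i k0 ?v >< G j k0 ?w) >< G l k0 x"] by (simp add: kk)
          qed (use i j p in auto)
        qed (use i p in auto)
      qed
      show ?thesis
      proof (rule je3)
        fix k assume k: "k \<in> Ob J"
        note [simp] = c(2-4)[OF k] g(1)[OF k] CMR[OF k]
        have "(m ** (m >< I L)) ** ((c k >< c k) >< c k) = m ** ((m ** (c k >< c k)) >< c k)" by (simp add: mg)
        also have "\<dots> = m ** (c k >< c k) ** (mu (R k) >< I (?X k))" unfolding mc[OF k] by (simp add: mg)
        also have "\<dots> = m ** (c k >< c k) ** (I (?X k) >< mu (R k)) ** al (?X k) (?X k) (?X k)"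
          by (simp add: ra[OF mc[OF k]] mu_assoc)
        also have "\<dots> = m ** (c k >< (c k ** mu (R k))) ** al (?X k) (?X k) (?X k)" by (simp add: mg)
        also have "\<dots> = (m ** (I L >< m) ** al L L L) ** ((c k >< c k) >< c k)"
          unfolding mc[OF k, symmetric] by (simp add: al_nat mg)
        finally show "(m ** (m >< I L)) ** ((c k >< c k) >< c k) = (m ** (I L >< m) ** al L L L) ** ((c k >< c k) >< c k)" .
      qed auto
    qed
  qed auto
  note mk = mkmon[OF m(1) u(1) m(3,2) u(2,3)]
  have "MM (R i) (mkmon m u) (c i)" if i: "i \<in> Ob J" for i
    unfolding MM_def using CMT CMR[OF i] c(2-4)[OF i] mk mc[OF i] cu[OF i] by simp
  then show ?thesis using that[of "mkmon m u"] by simp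
qed

section \<open>Functors, colimits and limits in a module category\<close>

lemma functor_Mod:
  assumes A: "CM A" and MD: "\<And>i. i \<in> Ob J \<Longrightarrow> MD A (FO i)"
    and LM: "\<And>i j v. i \<in> Ob J \<Longrightarrow> j \<in> Ob J \<Longrightarrow> v \<in> Hom J i j \<Longrightarrow> LM A (FO i) (FO j) (F i j v)"
    and id: "\<And>i. i \<in> Ob J \<Longrightarrow> F i i (Idn J i) = I (mdl_ob (FO i))"
    and cmp: "\<And>i j k v w. i \<in> Ob J \<Longrightarrow> j \<in> Ob J \<Longrightarrow> k \<in> Ob J \<Longrightarrow> v \<in> Hom J i j \<Longrightarrow> w \<in> Hom J j k \<Longrightarrow>
      F i k (w \<cdot>\<^bsub>J\<^esub> v) = F j k w ** F i j v"
  shows "is_functor J (Mod C A) FO (\<lambda>i j v. un (F i j v))"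
  unfolding is_functor_def Mod_comp Mod_Idn
proof (intro conjI ballI)
  fix i j k v w assume a: "i \<in> Ob J" "j \<in> Ob J" "k \<in> Ob J" "v \<in> Hom J i j" "w \<in> Hom J j k"
  show "un (F i k (w \<cdot>\<^bsub>J\<^esub> v)) = un (F j k w) \<cdot> un (F i j v)"
    using LM_D(3-5)[OF LM[OF a(1,2,4)]] LM_D(3-5)[OF LM[OF a(2,3,5)]] by (simp add: cmp[OF a] un_cmp)
next
  fix i assume i: "i \<in> Ob J"
  show "un (F i i (Idn J i)) = Idn C (mdl_ob (FO i))" unfolding id[OF i] by (rule un_I) (rule MD_Ob[OF MD[OF i]])
qed (use MD LM_un[OF A LM] in \<open>auto simp: Ob_Mod\<close>)

lemma colimit_Mod:
  assumes A: "CM A" and L: "MD A L" and FO: "\<And>i. i \<in> Ob J \<Longrightarrow> MD A (FO i)"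
    and LM: "\<And>i j v. i \<in> Ob J \<Longrightarrow> j \<in> Ob J \<Longrightarrow> v \<in> Hom J i j \<Longrightarrow> LM A (FO i) (FO j) (F i j v)"
    and c: "\<And>i. i \<in> Ob J \<Longrightarrow> LM A (FO i) L (c i)"
    and cc: "\<And>i j v. i \<in> Ob J \<Longrightarrow> j \<in> Ob J \<Longrightarrow> v \<in> Hom J i j \<Longrightarrow> c j ** F i j v = c i"
    and ex: "\<And>N d. MD A N \<Longrightarrow> (\<And>i. i \<in> Ob J \<Longrightarrow> LM A (FO i) N (d i)) \<Longrightarrow>
      (\<And>i j v. i \<in> Ob J \<Longrightarrow> j \<in> Ob J \<Longrightarrow> v \<in> Hom J i j \<Longrightarrow> d j ** F i j v = d i) \<Longrightarrow>
      \<exists>h. LM A L N h \<and> (\<forall>i\<in>Ob J. h ** c i = d i)"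
    and un: "\<And>N h h'. LM A L N h \<Longrightarrow> LM A L N h' \<Longrightarrow> (\<And>i. i \<in> Ob J \<Longrightarrow> h ** c i = h' ** c i) \<Longrightarrow> h = h'"
  shows "is_colimit J (Mod C A) FO (\<lambda>i j v. un (F i j v)) L (\<lambda>i. un (c i))"
  unfolding is_colimit_def
proof (intro conjI allI impI)
  show "is_cocone J (Mod C A) FO (\<lambda>i j v. un (F i j v)) L (\<lambda>i. un (c i))"
    unfolding is_cocone_def Mod_comp
  proof (intro conjI ballI)
    fix i j v assume a: "i \<in> Ob J" "j \<in> Ob J" "v \<in> Hom J i j"
    show "un (c j) \<cdot> un (F i j v) = un (c i)" using LM_un_cmp[OF LM[OF a] c[OF a(2)] c[OF a(1)]] cc[OF a] by simp
  qed (use L LM_un[OF A c] in \<open>auto simp: Ob_Mod\<close>)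
  fix N d assume co: "is_cocone J (Mod C A) FO (\<lambda>i j v. un (F i j v)) N d"
  then have N: "MD A N" and d: "\<And>i. i \<in> Ob J \<Longrightarrow> d i \<in> Hom (Mod C A) (FO i) N"
    and dc: "\<And>i j v. i \<in> Ob J \<Longrightarrow> j \<in> Ob J \<Longrightarrow> v \<in> Hom J i j \<Longrightarrow> d j \<cdot> un (F i j v) = d i"
    unfolding is_cocone_def Mod_comp by (auto simp: Ob_Mod)
  define d' where "d' i = mk (mdl_ob (FO i)) (d i) (mdl_ob N)" for i
  have d': "LM A (FO i) N (d' i)" and u: "un (d' i) = d i" if i: "i \<in> Ob J" for i
  proof -
    show l: "LM A (FO i) N (d' i)" using d[OF i] Hom_Mod[OF A FO[OF i] N] by (simp add: d'_def)
    show "un (d' i) = d i" using LM_D(3)[OF l] by (simp add: d'_def)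
  qed
  have dc': "d' j ** F i j v = d' i" if a: "i \<in> Ob J" "j \<in> Ob J" "v \<in> Hom J i j" for i j v
    using LM_un_cmp[OF LM[OF a] d'[OF a(2)] d'[OF a(1)]] dc[OF a] u a by simp
  obtain h where h: "LM A L N h" "\<forall>i\<in>Ob J. h ** c i = d' i" using ex[OF N d' dc'] by blast
  show "\<exists>!h. h \<in> Hom (Mod C A) L N \<and> (\<forall>i\<in>Ob J. h \<cdot>\<^bsub>Mod C A\<^esub> un (c i) = d i)"
    unfolding Mod_comp ex1_Hom_Mod[OF A L N]
  proof (rule ex1I[of _ h])
    have e: "un t \<cdot> un (c i) = d i \<longleftrightarrow> t ** c i = d' i" if "LM A L N t" "i \<in> Ob J" for t i
      using LM_un_cmp[OF c[OF that(2)] that(1) d'[OF that(2)]] u[OF that(2)] by simp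
    show "LM A L N h \<and> (\<forall>i\<in>Ob J. un h \<cdot> un (c i) = d i)" using h e by blast
    fix t assume t: "LM A L N t \<and> (\<forall>i\<in>Ob J. un t \<cdot> un (c i) = d i)"
    show "t = h" by (rule un[of N]) (use t h e in auto)
  qed
qed

lemma limit_Mod:
  assumes A: "CM A" and L: "MD A L" and FO: "\<And>i. i \<in> Ob J \<Longrightarrow> MD A (FO i)"
    and LM: "\<And>i j v. i \<in> Ob J \<Longrightarrow> j \<in> Ob J \<Longrightarrow> v \<in> Hom J i j \<Longrightarrow> LM A (FO i) (FO j) (F i j v)"
    and c: "\<And>i. i \<in> Ob J \<Longrightarrow> LM A L (FO i) (c i)"
    and cc: "\<And>i j v. i \<in> Ob J \<Longrightarrow> j \<in> Ob J \<Longrightarrow> v \<in> Hom J i j \<Longrightarrow> F i j v ** c i = c j"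
    and ex: "\<And>N d. MD A N \<Longrightarrow> (\<And>i. i \<in> Ob J \<Longrightarrow> LM A N (FO i) (d i)) \<Longrightarrow>
      (\<And>i j v. i \<in> Ob J \<Longrightarrow> j \<in> Ob J \<Longrightarrow> v \<in> Hom J i j \<Longrightarrow> F i j v ** d i = d j) \<Longrightarrow>
      \<exists>h. LM A N L h \<and> (\<forall>i\<in>Ob J. c i ** h = d i)"
    and un: "\<And>N h h'. LM A N L h \<Longrightarrow> LM A N L h' \<Longrightarrow> (\<And>i. i \<in> Ob J \<Longrightarrow> c i ** h = c i ** h') \<Longrightarrow> h = h'"
  shows "is_limit J (Mod C A) FO (\<lambda>i j v. un (F i j v)) L (\<lambda>i. un (c i))"
  unfolding is_limit_def
proof (intro conjI allI impI)
  show "is_cone J (Mod C A) FO (\<lambda>i j v. un (F i j v)) L (\<lambda>i. un (c i))"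
    unfolding is_cone_def Mod_comp
  proof (intro conjI ballI)
    fix i j v assume a: "i \<in> Ob J" "j \<in> Ob J" "v \<in> Hom J i j"
    show "un (F i j v) \<cdot> un (c i) = un (c j)" using LM_un_cmp[OF c[OF a(1)] LM[OF a] c[OF a(2)]] cc[OF a] by simp
  qed (use L LM_un[OF A c] in \<open>auto simp: Ob_Mod\<close>)
  fix N d assume co: "is_cone J (Mod C A) FO (\<lambda>i j v. un (F i j v)) N d"
  then have N: "MD A N" and d: "\<And>i. i \<in> Ob J \<Longrightarrow> d i \<in> Hom (Mod C A) N (FO i)"
    and dc: "\<And>i j v. i \<in> Ob J \<Longrightarrow> j \<in> Ob J \<Longrightarrow> v \<in> Hom J i j \<Longrightarrow> un (F i j v) \<cdot> d i = d j"
    unfolding is_cone_def Mod_comp by (auto simp: Ob_Mod)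
  define d' where "d' i = mk (mdl_ob N) (d i) (mdl_ob (FO i))" for i
  have d': "LM A N (FO i) (d' i)" and u: "un (d' i) = d i" if i: "i \<in> Ob J" for i
  proof -
    show l: "LM A N (FO i) (d' i)" using d[OF i] Hom_Mod[OF A N FO[OF i]] by (simp add: d'_def)
    show "un (d' i) = d i" using LM_D(3)[OF l] by (simp add: d'_def)
  qed
  have dc': "F i j v ** d' i = d' j" if a: "i \<in> Ob J" "j \<in> Ob J" "v \<in> Hom J i j" for i j v
    using LM_un_cmp[OF d'[OF a(1)] LM[OF a] d'[OF a(2)]] dc[OF a] u a by simp
  obtain h where h: "LM A N L h" "\<forall>i\<in>Ob J. c i ** h = d' i" using ex[OF N d' dc'] by blast
  show "\<exists>!h. h \<in> Hom (Mod C A) N L \<and> (\<forall>i\<in>Ob J. un (c i) \<cdot>\<^bsub>Mod C A\<^esub> h = d i)"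
    unfolding Mod_comp ex1_Hom_Mod[OF A N L]
  proof (rule ex1I[of _ h])
    have e: "un (c i) \<cdot> un t = d i \<longleftrightarrow> c i ** t = d' i" if "LM A N L t" "i \<in> Ob J" for t i
      using LM_un_cmp[OF that(1) c[OF that(2)] d'[OF that(2)]] u[OF that(2)] by simp
    show "LM A N L h \<and> (\<forall>i\<in>Ob J. un (c i) \<cdot> un h = d i)" using h e by blast
    fix t assume t: "LM A N L t \<and> (\<forall>i\<in>Ob J. un (c i) \<cdot> un t = d i)"
    show "t = h" by (rule un[of N]) (use t h e in auto)
  qed
qed

text \<open>The objects 0 and 1 have the identities 0 and 1, and the arrows from 0 to 1 are 2 and 3.
  In a composite the first arrow is an identity, that is a number below 2, or else the second one
  is.\<close>

definition parallel_pair :: "(nat, nat) cat" where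
  "parallel_pair = \<lparr>Ob = {0, 1}, Hom = (\<lambda>x y. if x = 0 \<and> y = 0 then {0} else if x = 1 \<and> y = 1 then {1}
      else if x = 0 \<and> y = 1 then {2, 3} else {}),
     Idn = (\<lambda>x. x), Comp = (\<lambda>g f. if f < 2 then g else f)\<rparr>"

lemma parallel_pair: "category parallel_pair" "finite (Ob parallel_pair)" "finite (Arr parallel_pair)"
proof -
  show "category parallel_pair"
    by unfold_locales (auto simp: parallel_pair_def split: if_splits)
qed (auto simp: parallel_pair_def Arr_def)

text \<open>The kernels \<open>K i\<close> of the maps \<open>u i\<close> from \<open>B\<close> to
  \<open>R i\<close> form a filtered system of monomorphisms. Since filtered colimits commute with
  kernels and the \<open>R i\<close> have colimit zero, the colimit of the \<open>K i\<close> is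
  \<open>B\<close>. Finite generation lifts the identity of \<open>B\<close> to some
  \<open>K i\<close>; then \<open>u i\<close> is zero, and so is the unit of
  \<open>R i\<close>.\<close>

lemma filtered_colim_zero:
  fixes U :: "'u set" and J :: "('u, 'u) cat"
  assumes U: "has_small_colimits U C" and J: "small_cat U J" and F: "is_filtered J" and A: "algd J R G"
    and B: "CM B" and u: "\<And>i. i \<in> Ob J \<Longrightarrow> MM B (R i) (u i)"
    and Gu: "\<And>i j v. i \<in> Ob J \<Longrightarrow> j \<in> Ob J \<Longrightarrow> v \<in> Hom J i j \<Longrightarrow> G i j v ** u i = u j"
    and fg: "fin_gen U C B (self_mdl B)"
    and fc: "filtered_colimits_commute_with_finite_limits U (Mod C B)"
    and z: "\<And>T d. (\<And>i. i \<in> Ob J \<Longrightarrow> MM (R i) T (d i)) \<Longrightarrow>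
      (\<And>i j v. i \<in> Ob J \<Longrightarrow> j \<in> Ob J \<Longrightarrow> v \<in> Hom J i j \<Longrightarrow> d j ** G i j v = d i) \<Longrightarrow> zeroT (mon_ob T)"
  shows "\<exists>i\<in>Ob J. zeroT (mon_ob (R i))"
proof -
  let ?X = "\<lambda>i. mon_ob (R i)" and ?b = "mon_ob B"
  have cJ: "category J" using J by (simp add: small_cat_def)
  have D: "diag J ?X G" and CMR: "\<And>i. i \<in> Ob J \<Longrightarrow> CM (R i)"
    and MG: "\<And>i j v. i \<in> Ob J \<Longrightarrow> j \<in> Ob J \<Longrightarrow> v \<in> Hom J i j \<Longrightarrow> MM (R i) (R j) (G i j v)"
    using A by (auto simp: algd_def)
  note g = diag_D[OF D]
  obtain L c where L: "colim J ?X G L c" using small_colim[OF U J D] by blast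
  \<comment> \<open>The colimit in \<open>C\<close> is itself the target of a cocone of monoids, so
    hypothesis \<open>z\<close> makes it zero.\<close>
  obtain T where T: "mon_ob T = L" "\<And>i. i \<in> Ob J \<Longrightarrow> MM (R i) T (c i)"
    using filtered_colim_monoid[OF cJ F A L] by blast
  have co: "cocn J ?X G L c" and up: "\<And>N d. cocn J ?X G N d \<Longrightarrow> \<exists>h. ar h \<and> dm h = L \<and> cd h = N \<and> (\<forall>i\<in>Ob J. h ** c i = d i)"
    using L unfolding colim_def by blast+
  note c = cocn_D[OF co]
  have zL: "zeroT L" using z[OF T(2) c(5)] T(1) by simp
  have zc: "c i = zr (?X i) L" if i: "i \<in> Ob J" for i using zeroT_to[OF zL c(2)[OF i] c(4)[OF i]] c(3)[OF i] by simp
  have dz: "d i = zr (?X i) N" if d: "cocn J ?X G N d" and i: "i \<in> Ob J" for N d i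
  proof -
    obtain h where h: "ar h" "dm h = L" "cd h = N" "\<forall>i\<in>Ob J. h ** c i = d i" using up[OF d] by blast
    then have "d i = h ** c i" using i by simp
    then show ?thesis unfolding zc[OF i] using h(1-3) g(1)[OF i] by simp
  qed
  note [simp] = B
  define M where "M i = rs (u i) (R i) (self_mdl (R i))" for i
  have Mob[simp]: "mdl_ob (M i) = ?X i" for i by (simp add: M_def)
  have MM': "MD B (M i)" if "i \<in> Ob J" for i unfolding M_def by (rule MD_rs_self[OF u[OF that]])
  have acM: "ac B (M i) = mu (R i) ** (u i >< I (?X i))" if "i \<in> Ob J" for i unfolding M_def by (rule ac_rs_self[OF u[OF that]])
  have LG: "LM B (M i) (M j) (G i j v)" if a: "i \<in> Ob J" "j \<in> Ob J" "v \<in> Hom J i j" for i j v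
  proof -
    note m = MM_D[OF MG[OF a]]
    note [simp] = m(1-5) MM_D(1-5)[OF u[OF a(1)]] MM_D(1-5)[OF u[OF a(2)]]
    have "G i j v ** ac B (M i) = mu (R j) ** ((G i j v ** u i) >< G i j v)" by (simp add: acM[OF a(1)] ra[OF m(6)] mg)
    also have "\<dots> = ac B (M j) ** (I ?b >< G i j v)" unfolding Gu[OF a] by (simp add: acM[OF a(2)] mg)
    finally show ?thesis unfolding LM_def using MM'[OF a(1)] MM'[OF a(2)] by simp
  qed
  have Lu: "LM B (self_mdl B) (M i) (u i)" if "i \<in> Ob J" for i unfolding M_def by (rule MM_LM[OF u[OF that]])
  have "\<forall>i\<in>Ob J. \<exists>K k. kernel (u i) k \<and> LM B K (self_mdl B) k"
  proof
    fix i assume i: "i \<in> Ob J"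
    note l = LM_D[OF Lu[OF i]]
    obtain k where k: "kernel (u i) k" using ex_kernelT l(3) by blast
    note kD = kernelD[OF k]
    note [simp] = l(1-5) kD(3,4) MM_D(1-5)[OF u[OF i]]
    have "u i ** mu B ** (I ?b >< k) = ac B (M i) ** (I ?b >< (u i ** k))"
      using ra[OF l(6)] MM'[OF i] by (simp add: mg)
    then have "u i ** ac B (self_mdl B) ** (I ?b >< k) = zr (?b \<boxtimes> dm k) (cd (u i))" using MM'[OF i] by (simp add: kD(5))
    then obtain K where "LM B K (self_mdl B) k" using kernel_mdl[OF B MD_self[OF B] k] by auto
    then show "\<exists>K k. kernel (u i) k \<and> LM B K (self_mdl B) k" using k by blast
  qed
  then obtain K k where k: "\<And>i. i \<in> Ob J \<Longrightarrow> kernel (u i) (k i)" and K: "\<And>i. i \<in> Ob J \<Longrightarrow> LM B (K i) (self_mdl B) (k i)" by metis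
  have mk: "mod_kernel B (K i) (self_mdl B) (M i) (k i) (u i)" if i: "i \<in> Ob J" for i
    by (rule mod_kernelI[OF B K[OF i] Lu[OF i] k[OF i]])
  have ki: "mono (k i)" "ar (k i)" "cd (k i) = ?b" "dm (k i) = mdl_ob (K i)" "u i ** k i = zr (mdl_ob (K i)) (?X i)" "MD B (K i)" if i: "i \<in> Ob J" for i
    using kernelD[OF k[OF i]] LM_D[OF K[OF i]] MM_D(3-5)[OF u[OF i]] by auto
  have "\<forall>i\<in>Ob J. \<forall>j\<in>Ob J. \<forall>v\<in>Hom J i j. \<exists>h. LM B (K i) (K j) h \<and> k j ** h = k i"
  proof (intro ballI)
    fix i j v assume a: "i \<in> Ob J" "j \<in> Ob J" "v \<in> Hom J i j"
    have "u j ** k i = (G i j v ** u i) ** k i" unfolding Gu[OF a] ..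
    also have "\<dots> = zr (mdl_ob (K i)) (mdl_ob (M j))" using ki[OF a(1)] g(2-4)[OF a] MD_Ob by simp
    finally show "\<exists>h. LM B (K i) (K j) h \<and> k j ** h = k i" using mod_kernelE[OF mk[OF a(2)] K[OF a(1)]] by metis
  qed
  then obtain l where "\<forall>i\<in>Ob J. \<forall>j\<in>Ob J. \<forall>v\<in>Hom J i j. LM B (K i) (K j) (l i j v) \<and> k j ** l i j v = k i"
    unfolding Ball_def choice_iff' choice_iff by blast
  then have l: "\<And>i j v. i \<in> Ob J \<Longrightarrow> j \<in> Ob J \<Longrightarrow> v \<in> Hom J i j \<Longrightarrow> LM B (K i) (K j) (l i j v)"
    and kl: "\<And>i j v. i \<in> Ob J \<Longrightarrow> j \<in> Ob J \<Longrightarrow> v \<in> Hom J i j \<Longrightarrow> k j ** l i j v = k i" by blast+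
  let ?K = parallel_pair
  let ?N = "null_mdl B"
  \<comment> \<open>The diagram with value \<open>B\<close> at 0 and \<open>R i\<close> at 1. Arrow
    2 goes to \<open>u i\<close> and arrow 3 to zero, so that its limits are the kernels of the
    \<open>u i\<close>.\<close>
  define FO where "FO x = (if snd x = 0 then self_mdl B else M (fst x))" for x :: "'u \<times> nat"
  define Fm where "Fm x y a = (if snd y = 0 then I ?b else if snd x = 0 then (if snd a = 2 then u (fst y) else zr ?b (?X (fst y)))
    else G (fst x) (fst y) (fst a))" for x y :: "'u \<times> nat" and a :: "'u \<times> nat"
  \<comment> \<open>The colimits along \<open>J\<close>: \<open>B\<close> at 0, where the system is
    constant, and the zero module at 1.\<close>
  define CO where "CO n = (if n = 0 then self_mdl B else ?N)" for n :: nat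
  define Cm where "Cm n n' v = (if n' = 0 then I ?b else if n = 0 then zr ?b null else I null)" for n n' v :: nat
  define cc where "cc j n = (if n = 0 then I ?b else zr (?X j) null)" for j and n :: nat
  define pp where "pp j n = (if n = 0 then k j else zr (mdl_ob (K j)) (?X j))" for j and n :: nat
  define qq where "qq n = (if n = 0 then I ?b else zr ?b null)" for n :: nat
  have LI: "LM B (self_mdl B) (self_mdl B) (I ?b)" using LM_I[OF B MD_self[OF B]] by simp
  have LZ: "LM B N N' (zr (mdl_ob N) (mdl_ob N'))" if "MD B N" "MD B N'" for N N' using LM_zr[OF B that] .
  have LZM: "LM B (self_mdl B) (M i) (zr ?b (?X i))" "LM B (M i) ?N (zr (?X i) null)" if "i \<in> Ob J" for i
    using LZ[OF MD_self[OF B] MM'[OF that]] LZ[OF MM'[OF that] null_mdl[OF B]] by auto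
  have LN: "LM B ?N ?N (I null)" "LM B (self_mdl B) ?N (zr ?b null)" using LM_I[OF B null_mdl[OF B]] LZ[OF MD_self[OF B] null_mdl[OF B]] by auto
  have pk: "Ob ?K = {0, 1}" "Idn ?K n = n" "n \<in> {0, 1} \<Longrightarrow> n' \<in> {0, 1} \<Longrightarrow> v \<in> Hom ?K n n' \<Longrightarrow> (n = 0 \<and> n' = 0 \<and> v = 0) \<or> (n = 1 \<and> n' = 1 \<and> v = 1) \<or> (n = 0 \<and> n' = 1 \<and> (v = 2 \<or> v = 3))" for n n' v
    by (auto simp: parallel_pair_def split: if_splits)
  have pc: "Ob (prod_cat J ?K) = Ob J \<times> {0, 1}" "Hom (prod_cat J ?K) x y = Hom J (fst x) (fst y) \<times> Hom ?K (snd x) (snd y)"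
    "Idn (prod_cat J ?K) x = (Idn J (fst x), snd x)" "b \<cdot>\<^bsub>prod_cat J ?K\<^esub> a = (fst b \<cdot>\<^bsub>J\<^esub> fst a, if snd a < 2 then snd b else snd a)" for x y a b
    by (auto simp: prod_cat_def pk) (simp_all add: parallel_pair_def)
  have LFm: "LM B (FO x) (FO y) (Fm x y a)" if "x \<in> Ob J \<times> {0, 1}" "y \<in> Ob J \<times> {0, 1}" "a \<in> Hom J (fst x) (fst y) \<times> Hom ?K (snd x) (snd y)" for x y a
    using that pk(3)[of "snd x" "snd y" "snd a"] LI Lu LZM LG by (auto simp: FO_def Fm_def)
  have MFO: "MD B (FO x)" if "x \<in> Ob J \<times> {0, 1}" for x using that MM' by (auto simp: FO_def)
  have f1: "is_functor (prod_cat J ?K) (Mod C B) FO (\<lambda>x y a. un (Fm x y a))"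
  proof (rule functor_Mod[OF B])
    fix x y w v t assume a: "x \<in> Ob (prod_cat J ?K)" "y \<in> Ob (prod_cat J ?K)" "w \<in> Ob (prod_cat J ?K)"
      "v \<in> Hom (prod_cat J ?K) x y" "t \<in> Hom (prod_cat J ?K) y w"
    have o: "fst x \<in> Ob J" "fst y \<in> Ob J" "fst w \<in> Ob J" "fst v \<in> Hom J (fst x) (fst y)" "fst t \<in> Hom J (fst y) (fst w)"
      using a by (auto simp: pc)
    note [simp] = g(1)[OF o(1)] g(1)[OF o(2)] g(1)[OF o(3)] g(2-4)[OF o(1,2,4)] g(2-4)[OF o(2,3,5)] MM_D(3-5)[OF u[OF o(1)]] MM_D(3-5)[OF u[OF o(2)]] MM_D(3-5)[OF u[OF o(3)]]
    have "(snd x = 0 \<and> snd y = 0 \<and> snd v = 0) \<or> (snd x = 1 \<and> snd y = 1 \<and> snd v = 1) \<or> (snd x = 0 \<and> snd y = 1 \<and> (snd v = 2 \<or> snd v = 3))"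
      "(snd y = 0 \<and> snd w = 0 \<and> snd t = 0) \<or> (snd y = 1 \<and> snd w = 1 \<and> snd t = 1) \<or> (snd y = 0 \<and> snd w = 1 \<and> (snd t = 2 \<or> snd t = 3))"
      using a unfolding pc mem_Times_iff by (metis pk(3))+
    then show "Fm x w (t \<cdot>\<^bsub>prod_cat J ?K\<^esub> v) = Fm y w t ** Fm x y v"
      unfolding pc by (elim disjE conjE) (simp_all add: Fm_def Gu[OF o(2,3,5)] g(6)[OF o])
  qed (use LFm MFO in \<open>auto simp: pc Fm_def FO_def g(5)\<close>)
  have f2: "is_functor ?K (Mod C B) CO (\<lambda>x y a. un (Cm x y a))"
  proof (rule functor_Mod[OF B])
    fix n n' v assume a: "n \<in> Ob ?K" "n' \<in> Ob ?K" "v \<in> Hom ?K n n'"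
    show "LM B (CO n) (CO n') (Cm n n' v)" using pk(3)[of n n' v] a LI LN unfolding pk(1) by (auto simp: CO_def Cm_def)
  next
    fix n n' n'' v w assume a: "n \<in> Ob ?K" "n' \<in> Ob ?K" "n'' \<in> Ob ?K" "v \<in> Hom ?K n n'" "w \<in> Hom ?K n' n''"
    show "Cm n n'' (w \<cdot>\<^bsub>?K\<^esub> v) = Cm n' n'' w ** Cm n n' v" using pk(3)[of n n' v] pk(3)[of n' n'' w] a unfolding pk(1) by (auto simp: Cm_def)
  qed (auto simp: pk CO_def Cm_def)
  \<comment> \<open>A filtered category is connected, so a cocone under a constant system is a
    single arrow.\<close>
  have con: "d i = d j" if "\<And>i j v. i \<in> Ob J \<Longrightarrow> j \<in> Ob J \<Longrightarrow> v \<in> Hom J i j \<Longrightarrow> d j = d i" "i \<in> Ob J" "j \<in> Ob J" for d :: "'u \<Rightarrow> ('o, 'm) tarr" and i j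
    using filtered_pair[OF F that(2,3)] that by metis
  obtain i0 where i0: "i0 \<in> Ob J" using F unfolding is_filtered_def by blast
  have col0: "is_colimit J (Mod C B) (\<lambda>j. FO (j, 0)) (\<lambda>j j' v. un (Fm (j, 0) (j', 0) (v, Idn ?K 0))) (CO 0) (\<lambda>j. un (cc j 0))"
  proof (rule colimit_Mod[OF B])
    fix N d assume N: "MD B N" and d: "\<And>i. i \<in> Ob J \<Longrightarrow> LM B (FO (i, 0)) N (d i)"
      and dd: "\<And>i j v. i \<in> Ob J \<Longrightarrow> j \<in> Ob J \<Longrightarrow> v \<in> Hom J i j \<Longrightarrow> d j ** Fm (i, 0) (j, 0) (v, Idn ?K 0) = d i"
    have d1: "LM B (self_mdl B) N (d i)" if "i \<in> Ob J" for i using d[OF that] by (simp add: FO_def)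
    have "d j = d i" if "i \<in> Ob J" "j \<in> Ob J" "v \<in> Hom J i j" for i j v
      using dd[OF that] LM_D(3-5)[OF d1[OF that(2)]] by (simp add: Fm_def)
    then have de: "d i = d i0" if "i \<in> Ob J" for i using con[of d, OF _ that i0] by blast
    have "d i0 ** cc i 0 = d i" if "i \<in> Ob J" for i
      using LM_D(3-5)[OF d1[OF i0]] de[OF that] by (simp add: cc_def)
    then show "\<exists>h. LM B (CO 0) N h \<and> (\<forall>i\<in>Ob J. h ** cc i 0 = d i)"
      using d1[OF i0] by (intro exI[of _ "d i0"]) (simp add: CO_def)
  next
    fix N h h' assume h: "LM B (CO 0) N h" "LM B (CO 0) N h'" and e: "\<And>i. i \<in> Ob J \<Longrightarrow> h ** cc i 0 = h' ** cc i 0"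
    show "h = h'" using e[OF i0] LM_D(3-5)[OF h(1)] LM_D(3-5)[OF h(2)] by (simp add: cc_def CO_def)
  qed (use LI in \<open>auto simp: FO_def Fm_def CO_def cc_def\<close>)
  have col1: "is_colimit J (Mod C B) (\<lambda>j. FO (j, 1)) (\<lambda>j j' v. un (Fm (j, 1) (j', 1) (v, Idn ?K 1))) (CO 1) (\<lambda>j. un (cc j 1))"
  proof (rule colimit_Mod[OF B])
    fix N d assume N: "MD B N" and d: "\<And>i. i \<in> Ob J \<Longrightarrow> LM B (FO (i, 1)) N (d i)"
      and dd: "\<And>i j v. i \<in> Ob J \<Longrightarrow> j \<in> Ob J \<Longrightarrow> v \<in> Hom J i j \<Longrightarrow> d j ** Fm (i, 1) (j, 1) (v, Idn ?K 1) = d i"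
    have d1: "LM B (M i) N (d i)" if "i \<in> Ob J" for i using d[OF that] by (simp add: FO_def)
    \<comment> \<open>A linear cocone is also a cocone in \<open>C\<close> and so factors through
      the zero object \<open>L\<close>.\<close>
    have "cocn J ?X G (mdl_ob N) d"
      unfolding cocn_def using LM_D(3-5)[OF d1] dd MD_Ob[OF N] by (auto simp: Fm_def)
    then have "d i = zr (?X i) (mdl_ob N)" if "i \<in> Ob J" for i using dz that by blast
    then show "\<exists>h. LM B (CO 1) N h \<and> (\<forall>i\<in>Ob J. h ** cc i 1 = d i)"
      using LZ[OF null_mdl[OF B] N] MD_Ob[OF N] g(1) by (intro exI[of _ "zr null (mdl_ob N)"]) (simp add: CO_def cc_def)
  next
    fix N h h' assume h: "LM B (CO 1) N h" "LM B (CO 1) N h'"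
    show "h = h'" using from_null[of h] from_null[of h'] LM_D(3-5)[OF h(1)] LM_D(3-5)[OF h(2)] by (simp add: CO_def)
  next
    fix i j v assume a: "i \<in> Ob J" "j \<in> Ob J" "v \<in> Hom J i j"
    show "cc j 1 ** Fm (i, 1) (j, 1) (v, Idn ?K 1) = cc i 1" using g(2-4)[OF a] by (simp add: cc_def Fm_def)
  qed (use LG LZM MM' in \<open>auto simp: FO_def Fm_def CO_def cc_def\<close>)
  have nat1: "un (Cm n n' v) \<cdot>\<^bsub>Mod C B\<^esub> un (cc j n) = un (cc j n') \<cdot>\<^bsub>Mod C B\<^esub> un (Fm (j, n) (j, n') (Idn J j, v))"
    if a: "j \<in> Ob J" "n \<in> Ob ?K" "n' \<in> Ob ?K" "v \<in> Hom ?K n n'" for j n n' v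
  proof -
    note [simp] = g(1)[OF a(1)] MM_D(3-5)[OF u[OF a(1)]] g(5)[OF a(1)]
    have "Cm n n' v ** cc j n = cc j n' ** Fm (j, n) (j, n') (Idn J j, v)"
      using pk(3)[of n n' v] a unfolding pk(1) by (auto simp: Cm_def cc_def Fm_def)
    moreover have "ar (Cm n n' v)" "ar (cc j n)" "ar (cc j n')" "ar (Fm (j, n) (j, n') (Idn J j, v))" "dm (Cm n n' v) = cd (cc j n)"
      "dm (cc j n') = cd (Fm (j, n) (j, n') (Idn J j, v))"
      using pk(3)[of n n' v] a unfolding pk(1) by (auto simp: Cm_def cc_def Fm_def)
    ultimately show ?thesis using un_cmp[of "Cm n n' v" "cc j n"] un_cmp[of "cc j n'" "Fm (j, n) (j, n') (Idn J j, v)"] by simp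
  qed
  have lmono: "l i j v = h" if "i \<in> Ob J" "j \<in> Ob J" "v \<in> Hom J i j" "ar h" "dm h = mdl_ob (K i)" "cd h = mdl_ob (K j)" "k j ** h = k i" for i j v h
    using monoD[OF ki(1)[OF that(2)], of "l i j v" h] kl[OF that(1-3)] LM_D(3-5)[OF l[OF that(1-3)]] that(4-) ki(4)[OF that(2)] by simp
  have f3: "is_functor J (Mod C B) K (\<lambda>i j v. un (l i j v))"
  proof (rule functor_Mod[OF B])
    fix i assume i: "i \<in> Ob J"
    show "l i i (Idn J i) = I (mdl_ob (K i))"
      by (rule lmono) (use i ki[OF i] MD_Ob[OF ki(6)[OF i]] category.id_in_hom[OF cJ i] in auto)
  next
    fix i j n v w assume a: "i \<in> Ob J" "j \<in> Ob J" "n \<in> Ob J" "v \<in> Hom J i j" "w \<in> Hom J j n"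
    show "l i n (w \<cdot>\<^bsub>J\<^esub> v) = l j n w ** l i j v"
      by (rule lmono) (use a category.comp_in_hom[OF cJ a] LM_D(3-5)[OF l[OF a(1,2,4)]] LM_D(3-5)[OF l[OF a(2,3,5)]] kl[OF a(1,2,4)] ra[OF kl[OF a(2,3,5)]] in auto)
  qed (use l ki in auto)
  have lim: "is_limit ?K (Mod C B) (\<lambda>n. FO (j, n)) (\<lambda>n n' v. un (Fm (j, n) (j, n') (Idn J j, v))) (K j) (\<lambda>n. un (pp j n))" if j: "j \<in> Ob J" for j
  proof (rule limit_Mod[OF B])
    note [simp] = g(1)[OF j] MM_D(3-5)[OF u[OF j]] ki(2-6)[OF j] MD_Ob[OF ki(6)[OF j]] g(5)[OF j]
    have iJ: "Idn J j \<in> Hom J j j" using category.id_in_hom[OF cJ j] .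
    {
      fix n n' v assume a: "n \<in> Ob ?K" "n' \<in> Ob ?K" "v \<in> Hom ?K n n'"
      show "LM B (FO (j, n)) (FO (j, n')) (Fm (j, n) (j, n') (Idn J j, v))"
        by (rule LFm) (use a j iJ in \<open>auto simp: pk\<close>)
      show "Fm (j, n) (j, n') (Idn J j, v) ** pp j n = pp j n'"
        using pk(3)[of n n' v] a unfolding pk(1) by (auto simp: pp_def Fm_def)
    next
      fix n assume "n \<in> Ob ?K"
      then show "LM B (K j) (FO (j, n)) (pp j n)" using K[OF j] LZ[OF ki(6)[OF j] MM'[OF j]] unfolding pk(1) by (auto simp: pp_def FO_def)
    next
      fix N d assume N: "MD B N" and d: "\<And>i. i \<in> Ob ?K \<Longrightarrow> LM B N (FO (j, i)) (d i)"
        and dd: "\<And>i i' v. i \<in> Ob ?K \<Longrightarrow> i' \<in> Ob ?K \<Longrightarrow> v \<in> Hom ?K i i' \<Longrightarrow> Fm (j, i) (j, i') (Idn J j, v) ** d i = d i'"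
      have d0: "LM B N (self_mdl B) (d 0)" and d1: "LM B N (M j) (d 1)" using d[of 0] d[of 1] by (auto simp: pk FO_def)
      note [simp] = LM_D(3-5)[OF d0] LM_D(3-5)[OF d1] MD_Ob[OF N]
      have e2: "u j ** d 0 = d 1" using dd[of 0 1 2] by (simp add: parallel_pair_def Fm_def)
      have e3: "zr ?b (?X j) ** d 0 = d 1" using dd[of 0 1 3] by (simp add: parallel_pair_def Fm_def)
      have d1z: "d 1 = zr (mdl_ob N) (?X j)" using e3 by simp
      obtain h where h: "LM B N (K j) h" "k j ** h = d 0" using mod_kernelE[OF mk[OF j] d0] e2 d1z by auto
      then have "\<forall>i\<in>Ob ?K. pp j i ** h = d i" using d1z LM_D(3-5)[OF h(1)] by (auto simp: pk pp_def)
      then show "\<exists>h. LM B N (K j) h \<and> (\<forall>i\<in>Ob ?K. pp j i ** h = d i)" using h by blast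
    next
      fix N h h' assume h: "LM B N (K j) h" "LM B N (K j) h'" and e: "\<And>i. i \<in> Ob ?K \<Longrightarrow> pp j i ** h = pp j i ** h'"
      show "h = h'" by (rule monoD[OF ki(1)[OF j]]) (use e[of 0] h LM_D(3-5)[OF h(1)] LM_D(3-5)[OF h(2)] in \<open>auto simp: pk pp_def\<close>)
    }
  qed (use ki(6)[OF j] MFO j in \<open>auto simp: pk\<close>)
  have nat2: "un (pp j' n) \<cdot>\<^bsub>Mod C B\<^esub> un (l j j' v) = un (Fm (j, n) (j', n) (v, Idn ?K n)) \<cdot>\<^bsub>Mod C B\<^esub> un (pp j n)"
    if a: "n \<in> Ob ?K" "j \<in> Ob J" "j' \<in> Ob J" "v \<in> Hom J j j'" for n j j' v
  proof -
    note [simp] = g(1)[OF a(2)] g(1)[OF a(3)] ki(2-6)[OF a(2)] ki(2-6)[OF a(3)] MD_Ob[OF ki(6)[OF a(2)]] MD_Ob[OF ki(6)[OF a(3)]] g(2-4)[OF a(2-4)] LM_D(3-5)[OF l[OF a(2-4)]]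
    have "pp j' n ** l j j' v = Fm (j, n) (j', n) (v, Idn ?K n) ** pp j n"
      using a unfolding pk(1) by (auto simp: pp_def Fm_def kl[OF a(2-4)])
    moreover have "ar (pp j' n)" "ar (pp j n)" "ar (Fm (j, n) (j', n) (v, Idn ?K n))" "dm (pp j' n) = mdl_ob (K j')" "dm (Fm (j, n) (j', n) (v, Idn ?K n)) = cd (pp j n)"
      using a unfolding pk(1) by (auto simp: pp_def Fm_def)
    ultimately show ?thesis using un_cmp[of "pp j' n" "l j j' v"] un_cmp[of "Fm (j, n) (j', n) (v, Idn ?K n)" "pp j n"] by simp
  qed
  have lim2: "is_limit ?K (Mod C B) CO (\<lambda>x y a. un (Cm x y a)) (self_mdl B) (\<lambda>n. un (qq n))"
  proof (rule limit_Mod[OF B])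
    fix n n' v assume a: "n \<in> Ob ?K" "n' \<in> Ob ?K" "v \<in> Hom ?K n n'"
    show "LM B (CO n) (CO n') (Cm n n' v)" using pk(3)[of n n' v] a LI LN unfolding pk(1) by (auto simp: CO_def Cm_def)
    show "Cm n n' v ** qq n = qq n'" using pk(3)[of n n' v] a unfolding pk(1) by (auto simp: qq_def Cm_def)
  next
    fix N d assume N: "MD B N" and d: "\<And>i. i \<in> Ob ?K \<Longrightarrow> LM B N (CO i) (d i)"
    have d0: "LM B N (self_mdl B) (d 0)" and d1: "LM B N ?N (d 1)" using d[of 0] d[of 1] by (auto simp: pk CO_def)
    note [simp] = LM_D(3-5)[OF d0] LM_D(3-5)[OF d1] MD_Ob[OF N]
    have "d 1 = zr (mdl_ob N) null" using LM_D(3-5)[OF d1] to_null[of "d 1"] by simp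
    then have "\<forall>i\<in>Ob ?K. qq i ** d 0 = d i" by (auto simp: pk qq_def)
    then show "\<exists>h. LM B N (self_mdl B) h \<and> (\<forall>i\<in>Ob ?K. qq i ** h = d i)" using d0 by blast
  next
    fix N h h' assume h: "LM B N (self_mdl B) h" "LM B N (self_mdl B) h'" and e: "\<And>i. i \<in> Ob ?K \<Longrightarrow> qq i ** h = qq i ** h'"
    show "h = h'" using e[of 0] LM_D(3-5)[OF h(1)] LM_D(3-5)[OF h(2)] by (simp add: pk qq_def)
  qed (use LI LN in \<open>auto simp: pk CO_def qq_def\<close>)
  have nat3: "un (k j) \<in> Hom (Mod C B) (K j) (self_mdl B) \<and> (\<forall>n\<in>Ob ?K. un (qq n) \<cdot>\<^bsub>Mod C B\<^esub> un (k j) = un (cc j n) \<cdot>\<^bsub>Mod C B\<^esub> un (pp j n))" if j: "j \<in> Ob J" for j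
  proof (intro conjI ballI)
    show "un (k j) \<in> Hom (Mod C B) (K j) (self_mdl B)" by (rule LM_un[OF B K[OF j]])
    fix n assume n: "n \<in> Ob ?K"
    note [simp] = g(1)[OF j] ki(2-6)[OF j] MD_Ob[OF ki(6)[OF j]]
    have "qq n ** k j = cc j n ** pp j n" using n by (auto simp: pk qq_def cc_def pp_def)
    moreover have "ar (qq n)" "ar (cc j n)" "ar (pp j n)" "dm (qq n) = cd (k j)" "dm (cc j n) = cd (pp j n)"
      using n by (auto simp: pk qq_def cc_def pp_def)
    ultimately show "un (qq n) \<cdot>\<^bsub>Mod C B\<^esub> un (k j) = un (cc j n) \<cdot>\<^bsub>Mod C B\<^esub> un (pp j n)"
      using un_cmp[of "qq n" "k j"] un_cmp[of "cc j n" "pp j n"] by simp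
  qed
  have col: "is_colimit J (Mod C B) (\<lambda>j. FO (j, n)) (\<lambda>j j' v. un (Fm (j, n) (j', n) (v, Idn ?K n))) (CO n) (\<lambda>j. un (cc j n))" if "n \<in> Ob ?K" for n
    using that col0 col1 by (auto simp: pk(1))
  have "is_colimit J (Mod C B) K (\<lambda>i j v. un (l i j v)) (self_mdl B) (\<lambda>j. un (k j))"
    using fc[unfolded filtered_colimits_commute_with_finite_limits_def, rule_format,
      of J ?K FO "\<lambda>x y a. un (Fm x y a)" CO "\<lambda>x y a. un (Cm x y a)" "\<lambda>j n. un (cc j n)" K "\<lambda>i j v. un (l i j v)" "\<lambda>j n. un (pp j n)" "self_mdl B" "\<lambda>n. un (qq n)" "\<lambda>j. un (k j)"]
      J F parallel_pair f1 f2 col nat1 f3 lim nat2 lim2 nat3 by blast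
  \<comment> \<open>Followed by \<open>k j\<close> the transition map becomes the monomorphism
    \<open>k i\<close>.\<close>
  moreover have "monic (Mod C B) (K i) (K j) (un (l i j v))" if a: "i \<in> Ob J" "j \<in> Ob J" "v \<in> Hom J i j" for i j v
    unfolding monic_def Mod_comp
  proof (intro conjI ballI impI LM_un[OF B l[OF a]])
    fix N p q assume N: "N \<in> Ob (Mod C B)" and p: "p \<in> Hom (Mod C B) N (K i)" "q \<in> Hom (Mod C B) N (K i)" and e: "un (l i j v) \<cdot> p = un (l i j v) \<cdot> q"
    have N: "MD B N" using N Ob_Mod by blast
    obtain p' q' where p': "LM B N (K i) p'" "p = un p'" and q': "LM B N (K i) q'" "q = un q'"
      using p Hom_Mod_ex[OF B N ki(6)[OF a(1)]] by blast
    note [simp] = LM_D(3-5)[OF p'(1)] LM_D(3-5)[OF q'(1)] LM_D(3-5)[OF l[OF a]]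
    have lpq: "l i j v ** p' = l i j v ** q'" using e p' q' by (intro un_inject) (auto simp: un_cmp)
    have "k j ** l i j v ** p' = k j ** l i j v ** q'" unfolding lpq ..
    then have "k i ** p' = k i ** q'" by (simp add: ra[OF kl[OF a]])
    then have "p' = q'" by (rule monoD[OF ki(1)[OF a(1)]]) (use ki[OF a(1)] in auto)
    then show "p = q" using p' q' by simp
  qed
  ultimately have hp: "hom_preserves_colimit J (Mod C B) K (\<lambda>i j v. un (l i j v)) (self_mdl B) (\<lambda>j. un (k j)) (self_mdl B)"
    using fg J F f3 unfolding fin_gen_def by blast
  \<comment> \<open>Finite generation is applied to the identity of \<open>B\<close>, which thereby
    lifts to some \<open>K i\<close>.\<close>
  have "un (I ?b) \<in> Hom (Mod C B) (self_mdl B) (self_mdl B)" by (rule LM_un[OF B LI])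
  then obtain i s where i: "i \<in> Ob J" and s: "s \<in> Hom (Mod C B) (self_mdl B) (K i)" "un (k i) \<cdot> s = un (I ?b)"
    using hp unfolding hom_preserves_colimit_def Mod_comp by blast
  obtain s' where s': "LM B (self_mdl B) (K i) s'" "s = un s'" using s(1) Hom_Mod_ex[OF B MD_self[OF B] ki(6)[OF i]] by blast
  note [simp] = LM_D(3-5)[OF s'(1)] ki(2-6)[OF i] MM_D(1-5)[OF u[OF i]]
  have ks: "k i ** s' = I ?b" using s(2) s' by (intro un_inject) (auto simp: un_cmp)
  have "et (R i) = u i ** (k i ** s') ** et B" unfolding ks using MM_D(7)[OF u[OF i]] by simp
  also have "\<dots> = zr (mdl_ob (K i)) (?X i) ** s' ** et B" by (simp add: ra[OF ki(5)[OF i]] del: zr_cmp)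
  also have "\<dots> = zr one (?X i)" by simp
  finally show ?thesis using unit_zero[OF CMR[OF i]] i by blast
qed

text \<open>\<open>B\<close> is the cokernel of the map from zero to \<open>B\<close>, hence
  finitely presented with \<open>m = 0\<close> and \<open>n = 1\<close>.\<close>

lemma noetherian_fin_gen_self:
  assumes B: "CM B" and n: "noetherian_monoid U C B" shows "fin_gen U C B (self_mdl B)"
proof -
  let ?b = "mon_ob B" and ?S = "self_mdl B" and ?N = "null_mdl B"
  note [simp] = B
  have S: "MD B ?S" by simp
  have c0: "is_coproduct (Mod C B) {..<(0::nat)} (\<lambda>_. ?S) ?N undefined"
    using zero_object_Mod[OF B] unfolding is_coproduct_def zero_object_def by simp
  have c1: "is_coproduct (Mod C B) {..<(1::nat)} (\<lambda>_. ?S) ?S (\<lambda>_. Idn C ?b)"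
    unfolding is_coproduct_def Mod_comp
  proof (intro conjI ballI allI impI)
    show "Idn C ?b \<in> Hom (Mod C B) ?S ?S" using LM_un[OF B LM_I[OF B S]] by (simp add: un_I)
    fix Y g assume Y: "Y \<in> Ob (Mod C B)" and g: "\<forall>i\<in>{..<(1::nat)}. g i \<in> Hom (Mod C B) ?S Y"
    have "h \<cdot> Idn C ?b = h" if "h \<in> Hom (Mod C B) ?S Y" for h
      using category.comp_id_right[OF category_Mod[OF B], of ?S Y h] that Y S by (simp add: Ob_Mod)
    then have "h \<in> Hom (Mod C B) ?S Y \<and> (\<forall>i\<in>{..<(1::nat)}. h \<cdot> Idn C ?b = g i) \<longleftrightarrow> h = g 0" for h
      using g by auto
    then show "\<exists>!h. h \<in> Hom (Mod C B) ?S Y \<and> (\<forall>i\<in>{..<(1::nat)}. h \<cdot> Idn C ?b = g i)" by simp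
  qed (auto simp: Ob_Mod)
  have c2: "is_cokernel (Mod C B) ?N ?S ?S (un (zr null ?b)) (un (I ?b))"
  proof -
    have l: "LM B ?S ?S (I ?b)" "LM B ?N ?S (zr null ?b)" using LM_I[OF B S] LM_zr[OF B null_mdl[OF B] S] by auto
    have "mod_cokernel B ?N ?S ?S (zr null ?b) (I ?b)"
      unfolding mod_cokernel_def
    proof (intro conjI allI impI l)
      fix Z g assume g: "LM B ?S Z g"
      have h: "h ** I ?b = h" if "LM B ?S Z h" for h using LM_D(3,4)[OF that] by simp
      show "\<exists>!h. LM B ?S Z h \<and> h ** I ?b = g"
      proof (rule ex1I[of _ g])
        show "LM B ?S Z g \<and> g ** I ?b = g" using g h[OF g] by blast
        fix t assume "LM B ?S Z t \<and> t ** I ?b = g"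
        then show "t = g" using h[of t] by metis
      qed
    qed simp
    then show ?thesis using is_cokernel_Mod[OF B l] by blast
  qed
  have "fin_pres C B ?S" unfolding fin_pres_def
    by (intro exI conjI) (rule c0, rule c1, rule c2)
  then show ?thesis using n[unfolded noetherian_monoid_def, THEN bspec, of ?S] S by (simp add: Ob_Mod)
qed

section \<open>Finite presentation of the projections of a product\<close>

lemma MM_un_cmp: "MM A B f \<Longrightarrow> MM B D g \<Longrightarrow> un g \<cdot> un f = un (g ** f)"
  using MM_D(3-5)[of A B f] MM_D(3-5)[of B D g] by (simp add: un_cmp)

lemma MM_un_eq: "MM A B f \<Longrightarrow> MM A B g \<Longrightarrow> un f = un g \<longleftrightarrow> f = g"
  using MM_mk_un by metis

lemma Hom_CommMon_ex: "CM A \<Longrightarrow> CM B \<Longrightarrow> f \<in> Hom (CommMon C) A B \<longleftrightarrow> (\<exists>g. f = un g \<and> MM A B g)"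
  using Hom_CommMon MM_un MM_D(3) by (metis un_mk)

lemma Ob_CommAlg: "CM R \<Longrightarrow> x \<in> Ob (CommAlg C R) \<longleftrightarrow> (\<exists>B b. x = (B, un b) \<and> MM R B b)"
  unfolding CommAlg_def using Hom_CommMon_ex[of R] MM_D(2) by (fastforce simp: Ob_CommMon)

lemma Hom_CommAlg:
  assumes b: "MM R B b" and d: "MM R D d"
  shows "g \<in> Hom (CommAlg C R) (B, un b) (D, un d) \<longleftrightarrow> (\<exists>h. g = un h \<and> MM B D h \<and> h ** b = d)"
proof -
  have "un h \<cdot> un b = un d \<longleftrightarrow> h ** b = d" if "MM B D h" for h
    using MM_un_cmp[OF b that] MM_un_eq[OF MM_cmp[OF b that] d] by simp
  then show ?thesis unfolding CommAlg_def using Hom_CommMon_ex[OF MM_D(2)[OF b] MM_D(2)[OF d]] by auto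
qed

lemma CommAlg_comp [simp]: "Comp (CommAlg C R) = Comp C" and CommAlg_Idn [simp]: "Idn (CommAlg C R) x = Idn C (mon_ob (fst x))"
  by (simp_all add: CommAlg_def)

text \<open>Linearity gives \<open>s(r(a)) = s(r(1)) a\<close>.\<close>

lemma SP_idem: "SP R S T r s r' s' \<Longrightarrow> s ** r = mu R ** ((s ** r ** et R) >< I (mon_ob R)) ** li (mon_ob R)"
proof -
  assume a: "SP R S T r s r' s'"
  note d = SP_D[OF a] and rD = MM_D[OF SP_D(1)[OF a]]
  note [simp] = d(3-8) rD(1-5)
  have "s ** r = (s ** r) ** mu R ** (et R >< I (mon_ob R)) ** li (mon_ob R)" by (simp add: ra[OF mu_et_left])
  also have "\<dots> = (mu R ** ((s ** r) >< I (mon_ob R))) ** (et R >< I (mon_ob R)) ** li (mon_ob R)"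
    unfolding SP_lin[OF a, symmetric] by simp
  also have "\<dots> = mu R ** ((s ** r ** et R) >< I (mon_ob R)) ** li (mon_ob R)" by (simp add: mg)
  finally show ?thesis .
qed

text \<open>A morphism that kills (1, 0) kills \<open>s ** r\<close>, which is multiplication by
  that element; only the summand through \<open>T\<close> is left.\<close>

lemma SP_factor:
  assumes a: "SP R S T r s r' s'" and k: "MM R X k" and z: "k ** s ** r ** et R = zr one (mon_ob X)"
  shows "MM T X (k ** s')" "k ** s' ** r' = k"
proof -
  note d = SP_D[OF a] and rD = MM_D[OF SP_D(1)[OF a]] and rD' = MM_D[OF SP_D(2)[OF a]] and kD = MM_D[OF k]
  note [simp] = d(3-8) rD(1-5) rD'(1-5) kD(1-5)
  let ?x = "s ** r ** et R"
  have "k ** s ** r = k ** mu R ** (?x >< I (mon_ob R)) ** li (mon_ob R)" using SP_idem[OF a] by simp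
  also have "\<dots> = mu X ** ((k ** ?x) >< k) ** li (mon_ob R)" by (simp add: ra[OF kD(6)] mg)
  also have "\<dots> = zr (mon_ob R) (mon_ob X)" unfolding z by simp
  finally have ksr: "k ** s ** r = zr (mon_ob R) (mon_ob X)" .
  have "k = k ** ((s ** r) \<boxplus> (s' ** r'))" unfolding d(13) by simp
  also have "\<dots> = (k ** s ** r) \<boxplus> (k ** s' ** r')" by (simp add: cmp_add_r)
  also have "\<dots> = k ** s' ** r'" unfolding ksr by simp
  finally show e: "k ** s' ** r' = k" ..
  show "MM T X (k ** s')" by (rule MM_epi_factor[OF d(2,15) k]) (simp_all add: e)
qed

text \<open>Both sides are the element (1, 0) of \<open>R'\<close>; they are compared in the two
  components.\<close>

lemma SP_base_idem:
  assumes a: "SP R S T r s r' s'" and b: "SP R' S' T' q t q' t'" and g: "MM R R' g" and h: "MM S S' h" "MM T T' h'"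
    and e: "h ** r = q ** g" "h' ** r' = q' ** g"
  shows "t ** q ** et R' = g ** s ** r ** et R"
proof (rule SP_jm[OF b])
  note d = SP_D[OF a] and rD = MM_D[OF SP_D(1)[OF a]] and rD' = MM_D[OF SP_D(2)[OF a]] and gD = MM_D[OF g]
  note d2 = SP_D[OF b] and qD = MM_D[OF SP_D(1)[OF b]] and qD' = MM_D[OF SP_D(2)[OF b]] and hD = MM_D[OF h(1)] and hD' = MM_D[OF h(2)]
  note [simp] = d(3-8) rD(1-5) rD'(1-5) gD(1-5) d2(3-8) qD(1-5) qD'(1-5) hD(1-5) hD'(1-5)
  have "q ** g ** s ** r ** et R = h ** r ** s ** r ** et R" by (simp add: ra[OF e(1)])
  also have "\<dots> = et S'" using ra[OF d(9), of "r ** et R"] rD(7) hD(7) by simp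
  finally show "q ** t ** q ** et R' = q ** g ** s ** r ** et R" using ra[OF d2(9), of "q ** et R'"] qD(7) by simp
  have "q' ** g ** s ** r ** et R = h' ** r' ** s ** r ** et R" by (simp add: ra[OF e(2)])
  also have "\<dots> = zr one (mon_ob T')" using ra[OF d(12), of "r ** et R"] by simp
  finally show "q' ** t ** q ** et R' = q' ** g ** s ** r ** et R" using ra[OF d2(12), of "q ** et R'"] by simp
qed (use SP_D[OF a] SP_D[OF b] MM_D[OF g] MM_D[OF SP_D(1)[OF b]] MM_D[OF SP_D(1)[OF a]] in auto)

text \<open>Let \<open>g\<close> be a morphism from \<open>S\<close> to the colimit \<open>L\<close>
  of algebras \<open>A i\<close>. When each \<open>A i\<close> is split, the second factors
  \<open>Q i\<close> admit only zero cocones, because (1, 0) becomes 1 in \<open>L\<close>. Some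
  \<open>Q i\<close> is then zero, and \<open>A i\<close> receives \<open>S\<close> through its
  first factor. The \<open>Q i\<close> are algebras over \<open>B\<close> through \<open>b\<close>.
  Finite generation is asked of \<open>B\<close> and not of \<open>T\<close>: later \<open>T\<close>
  is a piece of an arbitrary monoid, and \<open>B\<close> is a chart.\<close>

lemma SP_fin_pres_alg:
  fixes U :: "'u set"
  assumes a: "SP R S T r s r' s'" and U: "has_small_colimits U C" and b: "MM B T b"
    and fg: "fin_gen U C B (self_mdl B)" and fc: "filtered_colimits_commute_with_finite_limits U (Mod C B)"
  shows "fin_pres_alg U C R S (un r)"
  unfolding fin_pres_alg_def
proof (intro allI impI, elim conjE)
  fix J :: "('u, 'u) cat" and FO FM L0 c0
  assume J: "small_cat U J" and F: "is_filtered J" and fu: "is_functor J (CommAlg C R) FO FM"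
    and col: "is_colimit J (CommAlg C R) FO FM L0 c0"
  have cJ: "category J" using J by (simp add: small_cat_def)
  note d = SP_D[OF a] and rD = MM_D[OF SP_D(1)[OF a]] and rD' = MM_D[OF SP_D(2)[OF a]]
  have R: "CM R" using rD by simp
  have "\<forall>i\<in>Ob J. \<exists>A f. FO i = (A, un f) \<and> MM R A f"
    using fu Ob_CommAlg[OF R] unfolding is_functor_def by blast
  then obtain A f where FO: "\<And>i. i \<in> Ob J \<Longrightarrow> FO i = (A i, un (f i))" and f: "\<And>i. i \<in> Ob J \<Longrightarrow> MM R (A i) (f i)" by metis
  have "\<forall>i\<in>Ob J. \<forall>j\<in>Ob J. \<forall>v\<in>Hom J i j. \<exists>h. FM i j v = un h \<and> MM (A i) (A j) h \<and> h ** f i = f j"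
  proof (intro ballI)
    fix i j v assume ij: "i \<in> Ob J" "j \<in> Ob J" "v \<in> Hom J i j"
    then have "FM i j v \<in> Hom (CommAlg C R) (FO i) (FO j)" using fu unfolding is_functor_def by blast
    then show "\<exists>h. FM i j v = un h \<and> MM (A i) (A j) h \<and> h ** f i = f j"
      using Hom_CommAlg[OF f f] ij FO by simp
  qed
  then obtain G where "\<forall>i\<in>Ob J. \<forall>j\<in>Ob J. \<forall>v\<in>Hom J i j. FM i j v = un (G i j v) \<and> MM (A i) (A j) (G i j v) \<and> G i j v ** f i = f j"
    unfolding Ball_def choice_iff' choice_iff by blast
  then have FM: "\<And>i j v. i \<in> Ob J \<Longrightarrow> j \<in> Ob J \<Longrightarrow> v \<in> Hom J i j \<Longrightarrow> FM i j v = un (G i j v)"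
    and G: "\<And>i j v. i \<in> Ob J \<Longrightarrow> j \<in> Ob J \<Longrightarrow> v \<in> Hom J i j \<Longrightarrow> MM (A i) (A j) (G i j v)"
    and Gf: "\<And>i j v. i \<in> Ob J \<Longrightarrow> j \<in> Ob J \<Longrightarrow> v \<in> Hom J i j \<Longrightarrow> G i j v ** f i = f j" by blast+
  have Gid: "G i i (Idn J i) = I (mon_ob (A i))" if i: "i \<in> Ob J" for i
  proof -
    have "un (G i i (Idn J i)) = Idn C (mon_ob (A i))"
      using fu i FO[OF i] FM[OF i i category.id_in_hom[OF cJ i]] unfolding is_functor_def by simp
    also have "\<dots> = un (I (mon_ob (A i)))" using un_I CM_ar(1) MM_D(2)[OF f[OF i]] by simp
    finally show ?thesis using MM_un_eq[OF G[OF i i category.id_in_hom[OF cJ i]] MM_I] MM_D(2)[OF f[OF i]] by simp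
  qed
  have Gcmp: "G i k (w \<cdot>\<^bsub>J\<^esub> v) = G j k w ** G i j v"
    if ij: "i \<in> Ob J" "j \<in> Ob J" "k \<in> Ob J" "v \<in> Hom J i j" "w \<in> Hom J j k" for i j k v w
  proof -
    have h: "w \<cdot>\<^bsub>J\<^esub> v \<in> Hom J i k" by (rule category.comp_in_hom[OF cJ ij])
    have "FM i k (w \<cdot>\<^bsub>J\<^esub> v) = FM j k w \<cdot> FM i j v" using fu ij unfolding is_functor_def by simp
    then have "un (G i k (w \<cdot>\<^bsub>J\<^esub> v)) = un (G j k w ** G i j v)"
      using FM[OF ij(1,3) h] FM[OF ij(1,2,4)] FM[OF ij(2,3,5)] MM_un_cmp[OF G[OF ij(1,2,4)] G[OF ij(2,3,5)]] by simp
    then show ?thesis using MM_un_eq[OF G[OF ij(1,3) h] MM_cmp[OF G[OF ij(1,2,4)] G[OF ij(2,3,5)]]] by simp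
  qed
  have "L0 \<in> Ob (CommAlg C R)" using col unfolding is_colimit_def is_cocone_def by blast
  then obtain L l where L0: "L0 = (L, un l)" and l: "MM R L l" using Ob_CommAlg[OF R] by blast
  have "\<forall>i\<in>Ob J. \<exists>h. c0 i = un h \<and> MM (A i) L h \<and> h ** f i = l"
  proof
    fix i assume i: "i \<in> Ob J"
    then have "c0 i \<in> Hom (CommAlg C R) (FO i) L0" using col unfolding is_colimit_def is_cocone_def by blast
    then show "\<exists>h. c0 i = un h \<and> MM (A i) L h \<and> h ** f i = l" using Hom_CommAlg[OF f[OF i] l] FO[OF i] L0 by simp
  qed
  then obtain c where c0: "\<And>i. i \<in> Ob J \<Longrightarrow> c0 i = un (c i)" and c: "\<And>i. i \<in> Ob J \<Longrightarrow> MM (A i) L (c i)"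
    and cf: "\<And>i. i \<in> Ob J \<Longrightarrow> c i ** f i = l" by metis
  have up: "\<exists>h. MM L Z h \<and> h ** l = z \<and> (\<forall>i\<in>Ob J. h ** c i = e i)"
    if z: "MM R Z z" and e: "\<And>i. i \<in> Ob J \<Longrightarrow> MM (A i) Z (e i)" and ef: "\<And>i. i \<in> Ob J \<Longrightarrow> e i ** f i = z"
      and eG: "\<And>i j v. i \<in> Ob J \<Longrightarrow> j \<in> Ob J \<Longrightarrow> v \<in> Hom J i j \<Longrightarrow> e j ** G i j v = e i" for Z z e
  proof -
    have "is_cocone J (CommAlg C R) FO FM (Z, un z) (\<lambda>i. un (e i))"
      unfolding is_cocone_def CommAlg_comp
    proof (intro conjI ballI)
      show "(Z, un z) \<in> Ob (CommAlg C R)" using Ob_CommAlg[OF R] z by blast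
      show "un (e i) \<in> Hom (CommAlg C R) (FO i) (Z, un z)" if "i \<in> Ob J" for i
        using Hom_CommAlg[OF f[OF that] z] e[OF that] ef[OF that] FO[OF that] by auto
      show "un (e j) \<cdot> FM i j v = un (e i)" if "i \<in> Ob J" "j \<in> Ob J" "v \<in> Hom J i j" for i j v
        using FM[OF that] MM_un_cmp[OF G[OF that] e[OF that(2)]] eG[OF that] by simp
    qed
    then obtain h0 where h0: "h0 \<in> Hom (CommAlg C R) L0 (Z, un z)" "\<forall>i\<in>Ob J. h0 \<cdot> c0 i = un (e i)"
      using col unfolding is_colimit_def CommAlg_comp by blast
    then obtain h where h: "h0 = un h" "MM L Z h" "h ** l = z" using Hom_CommAlg[OF l z] L0 by blast
    have "h ** c i = e i" if i: "i \<in> Ob J" for i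
    proof -
      have "un (h ** c i) = h0 \<cdot> c0 i" unfolding c0[OF i] h(1) by (rule MM_un_cmp[OF c[OF i] h(2), symmetric])
      also have "\<dots> = un (e i)" using h0(2) i by blast
      finally show ?thesis using MM_un_eq[OF MM_cmp[OF c[OF i] h(2)] e[OF i]] by blast
    qed
    then show ?thesis using h by blast
  qed
  have "\<forall>i\<in>Ob J. \<exists>P Q q t q' t' h h'. SP (A i) P Q q t q' t' \<and> MM S P h \<and> MM T Q h' \<and> h ** r = q ** f i \<and> h' ** r' = q' ** f i"
    using SP_base_change[OF a f] by metis
  then obtain P Q q t q' t' h h' where "\<forall>i\<in>Ob J. SP (A i) (P i) (Q i) (q i) (t i) (q' i) (t' i) \<and> MM S (P i) (h i) \<and> MM T (Q i) (h' i) \<and>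
      h i ** r = q i ** f i \<and> h' i ** r' = q' i ** f i"
    unfolding Ball_def choice_iff' choice_iff by blast
  then have sp: "\<And>i. i \<in> Ob J \<Longrightarrow> SP (A i) (P i) (Q i) (q i) (t i) (q' i) (t' i)" and h: "\<And>i. i \<in> Ob J \<Longrightarrow> MM S (P i) (h i)"
    and h': "\<And>i. i \<in> Ob J \<Longrightarrow> MM T (Q i) (h' i)" and hr: "\<And>i. i \<in> Ob J \<Longrightarrow> h i ** r = q i ** f i"
    and hr': "\<And>i. i \<in> Ob J \<Longrightarrow> h' i ** r' = q' i ** f i" by blast+
  have x: "t i ** q i ** et (A i) = f i ** s ** r ** et R" if i: "i \<in> Ob J" for i
    by (rule SP_base_idem[OF a sp[OF i] f[OF i] h[OF i] h'[OF i] hr[OF i] hr'[OF i]])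
  \<comment> \<open>Transition maps of the second factors; they are well defined because
    \<open>G i j v\<close> respects the idempotents.\<close>
  define H where "H i j v = q' j ** G i j v ** t' i" for i j v
  have H: "MM (Q i) (Q j) (H i j v)" and Hq: "H i j v ** q' i = q' j ** G i j v"
    if ij: "i \<in> Ob J" "j \<in> Ob J" "v \<in> Hom J i j" for i j v
  proof -
    note di = SP_D[OF sp[OF ij(1)]] and dj = SP_D[OF sp[OF ij(2)]]
    note [simp] = MM_D(1-5)[OF di(1)] MM_D(1-5)[OF di(2)] MM_D(1-5)[OF dj(1)] MM_D(1-5)[OF dj(2)] di(3-8) dj(3-8) MM_D(3-5)[OF G[OF ij]]
    have "q' j ** G i j v ** t i ** q i ** et (A i) = q' j ** G i j v ** f i ** s ** r ** et R" unfolding x[OF ij(1)] ..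
    also have "\<dots> = q' j ** f j ** s ** r ** et R" by (simp add: ra[OF Gf[OF ij]])
    also have "\<dots> = q' j ** t j ** q j ** et (A j)" unfolding x[OF ij(2)] ..
    also have "\<dots> = zr (mon_ob (P j)) (mon_ob (Q j)) ** q j ** et (A j)" by (simp only: ra[OF dj(12)])
    also have "\<dots> = zr one (mon_ob (Q j))" by simp
    finally have z: "(q' j ** G i j v) ** t i ** q i ** et (A i) = zr one (mon_ob (Q j))" by simp
    note * = SP_factor[OF sp[OF ij(1)] MM_cmp[OF G[OF ij] dj(2)] z]
    show "MM (Q i) (Q j) (H i j v)" using *(1) by (simp add: H_def)
    show "H i j v ** q' i = q' j ** G i j v" using *(2) by (simp add: H_def)
  qed
  have e: "ar (q' i)" "epi (q' i)" "dm (q' i) = mon_ob (A i)" "cd (q' i) = mon_ob (Q i)" "CM (A i)" "CM (Q i)" if "i \<in> Ob J" for i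
    using SP_D[OF sp[OF that]] MM_D[OF SP_D(2)[OF sp[OF that]]] by auto
  have Qd: "algd J Q H"
    unfolding algd_def diag_def
  proof (intro conjI ballI)
    fix i assume i: "i \<in> Ob J"
    show "CM (Q i)" "mon_ob (Q i) \<in> Ob C" using e[OF i] by auto
    show "H i i (Idn J i) = I (mon_ob (Q i))" unfolding H_def Gid[OF i] using SP_D(3-10)[OF sp[OF i]] e[OF i] by simp
    fix j v assume j: "j \<in> Ob J" "v \<in> Hom J i j"
    show "MM (Q i) (Q j) (H i j v)" by (rule H[OF i j])
    then show "ar (H i j v)" "dm (H i j v) = mon_ob (Q i)" "cd (H i j v) = mon_ob (Q j)" using MM_D(3-5) by auto
  next
    fix i j k v w assume ij: "i \<in> Ob J" "j \<in> Ob J" "k \<in> Ob J" "v \<in> Hom J i j" "w \<in> Hom J j k"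
    have wv: "w \<cdot>\<^bsub>J\<^esub> v \<in> Hom J i k" by (rule category.comp_in_hom[OF cJ ij])
    have "H i k (w \<cdot>\<^bsub>J\<^esub> v) ** q' i = q' k ** G j k w ** G i j v" unfolding Hq[OF ij(1,3) wv] Gcmp[OF ij] ..
    also have "\<dots> = H j k w ** q' j ** G i j v" by (simp add: ra[OF Hq[OF ij(2,3,5)]])
    also have "\<dots> = (H j k w ** H i j v) ** q' i" using Hq[OF ij(1,2,4)] by simp
    finally show "H i k (w \<cdot>\<^bsub>J\<^esub> v) = H j k w ** H i j v"
      by (rule epiD[OF e(2)[OF ij(1)]]) (use e[OF ij(1)] MM_D(3-5)[OF H[OF ij(1,3) wv]] MM_D(3-5)[OF H[OF ij(1,2,4)]] MM_D(3-5)[OF H[OF ij(2,3,5)]] in auto)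
  qed
  have Hh: "H i j v ** h' i = h' j" if ij: "i \<in> Ob J" "j \<in> Ob J" "v \<in> Hom J i j" for i j v
  proof -
    have "(H i j v ** h' i) ** r' = H i j v ** q' i ** f i" using hr'[OF ij(1)] by simp
    also have "\<dots> = q' j ** G i j v ** f i" by (simp add: ra[OF Hq[OF ij]])
    also have "\<dots> = h' j ** r'" using Gf[OF ij] hr'[OF ij(2)] by simp
    finally show ?thesis by (rule epiD[OF d(15)]) (use rD' MM_D(3-5)[OF H[OF ij]] MM_D(3-5)[OF h'[OF ij(1)]] MM_D(3-5)[OF h'[OF ij(2)]] in auto)
  qed
  have ne: "Ob J \<noteq> {}" and ub: "\<And>i j. i \<in> Ob J \<Longrightarrow> j \<in> Ob J \<Longrightarrow> \<exists>k v w. k \<in> Ob J \<and> v \<in> Hom J i k \<and> w \<in> Hom J j k"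
    using F unfolding is_filtered_def by blast+
  show "hom_preserves_colimit J (CommAlg C R) FO FM L0 c0 (S, un r)"
    unfolding hom_preserves_colimit_def CommAlg_comp
  proof (intro conjI ballI impI)
    fix g0 assume "g0 \<in> Hom (CommAlg C R) (S, un r) L0"
    then obtain g where g: "g0 = un g" "MM S L g" "g ** r = l" using Hom_CommAlg[OF d(1) l] L0 by blast
    have "\<exists>i\<in>Ob J. zeroT (mon_ob (Q i))"
    proof (rule filtered_colim_zero[OF U J F Qd MM_D(1)[OF b] _ _ fg fc])
      show "MM B (Q i) (h' i ** b)" if "i \<in> Ob J" for i by (rule MM_cmp[OF b h'[OF that]])
      show "H i j v ** h' i ** b = h' j ** b" if "i \<in> Ob J" "j \<in> Ob J" "v \<in> Hom J i j" for i j v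
        using Hh[OF that] by (rule ra)
      fix Z dd assume dd: "\<And>i. i \<in> Ob J \<Longrightarrow> MM (Q i) Z (dd i)"
        and ddH: "\<And>i j v. i \<in> Ob J \<Longrightarrow> j \<in> Ob J \<Longrightarrow> v \<in> Hom J i j \<Longrightarrow> dd j ** H i j v = dd i"
      obtain i0 where i0: "i0 \<in> Ob J" using ne by blast
      define z where "z = dd i0 ** h' i0 ** r'"
      have zi: "dd i ** h' i ** r' = z" if i: "i \<in> Ob J" for i
      proof -
        obtain k v w where k: "k \<in> Ob J" "v \<in> Hom J i k" "w \<in> Hom J i0 k" using ub[OF i i0] by blast
        have "dd i ** h' i = dd k ** h' k" using ra[OF ddH[OF i k(1,2)], of "h' i"] Hh[OF i k(1,2)] by simp
        moreover have "dd i0 ** h' i0 = dd k ** h' k" using ra[OF ddH[OF i0 k(1,3)], of "h' i0"] Hh[OF i0 k(1,3)] by simp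
        ultimately have "dd i ** h' i = dd i0 ** h' i0" by simp
        from ra[OF this, of r'] show ?thesis by (simp add: z_def)
      qed
      \<comment> \<open>Preceded by the projections, a cocone under the \<open>Q i\<close> becomes
        one under the \<open>A i\<close> and so comes from a morphism out of \<open>L\<close>. In
        its target the image of (1, 0) is 1 on account of \<open>g\<close>, and 0 because
        \<open>z\<close> factors through \<open>r'\<close>.\<close>
      have "\<exists>h. MM L Z h \<and> h ** l = z \<and> (\<forall>i\<in>Ob J. h ** c i = dd i ** q' i)"
      proof (rule up)
        show "MM R Z z" unfolding z_def by (intro MM_cmp[OF MM_cmp[OF d(2) h'[OF i0]] dd[OF i0], simplified])
        show "MM (A i) Z (dd i ** q' i)" if "i \<in> Ob J" for i by (rule MM_cmp[OF SP_D(2)[OF sp[OF that]] dd[OF that]])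
        show "(dd i ** q' i) ** f i = z" if "i \<in> Ob J" for i using zi[OF that] hr'[OF that] by simp
        show "(dd j ** q' j) ** G i j v = dd i ** q' i" if ij: "i \<in> Ob J" "j \<in> Ob J" "v \<in> Hom J i j" for i j v
          using Hq[OF ij, symmetric] ra[OF ddH[OF ij], of "q' i"] by simp
      qed
      then obtain k where k: "MM L Z k" "k ** l = z" by blast
      note [simp] = d(3-8) rD(1-5) rD'(1-5) MM_D(3-5)[OF dd[OF i0]] MM_D(3-5)[OF h'[OF i0]]
      have le: "l ** s ** r ** et R = et L"
      proof -
        have "l ** s ** r ** et R = g ** r ** s ** r ** et R" unfolding g(3)[symmetric] by simp
        also have "\<dots> = g ** r ** et R" by (simp add: ra[OF d(9)])
        also have "\<dots> = et L" using rD(7) MM_D(7)[OF g(2)] by simp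
        finally show ?thesis .
      qed
      have "et Z = k ** l ** s ** r ** et R" unfolding le using MM_D(7)[OF k(1)] by simp
      also have "\<dots> = z ** s ** r ** et R" by (simp add: ra[OF k(2)])
      also have "\<dots> = zr one (mon_ob Z)" by (simp add: z_def ra[OF d(12)])
      finally show "zeroT (mon_ob Z)" using unit_zero MM_D(2)[OF k(1)] by blast
    qed
    then obtain i where i: "i \<in> Ob J" and Qz: "zeroT (mon_ob (Q i))" by blast
    note di = SP_D[OF sp[OF i]] and qD = MM_D[OF SP_D(1)[OF sp[OF i]]] and qD' = MM_D[OF SP_D(2)[OF sp[OF i]]] and hD = MM_D[OF h[OF i]] and fD = MM_D[OF f[OF i]]
    note [simp] = di(3-8) qD(1-5) qD'(1-5) hD(1-5) fD(1-5) rD(1-5) MM_D(3-5)[OF c[OF i]] MM_D(3-5)[OF g(2)]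
    have t'z: "t' i = zr (mon_ob (Q i)) (mon_ob (A i))" using zeroT_from[OF Qz, of "t' i"] by simp
    have z: "I (mon_ob (A i)) ** t' i ** q' i ** et (A i) = zr one (mon_ob (A i))" by (simp add: t'z)
    have t: "MM (P i) (A i) (t i)" using SP_factor(1)[OF SP_sym[OF sp[OF i]] MM_I z] by simp
    have tq: "t i ** q i = I (mon_ob (A i))" using SP_factor(2)[OF SP_sym[OF sp[OF i]] MM_I z] by simp
    \<comment> \<open>As \<open>Q i\<close> is zero, \<open>t i\<close> is a morphism of monoids
      inverse to \<open>q i\<close>, and the lift goes through the first factor.\<close>
    let ?g = "t i ** h i"
    have g': "MM S (A i) ?g" by (rule MM_cmp[OF h[OF i] t])
    have gr: "?g ** r = f i" using hr[OF i] ra[OF tq, of "f i"] by simp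
    have "(c i ** ?g) ** r = g ** r" using gr cf[OF i] g(3) by simp
    then have "c i ** ?g = g" by (rule epiD[OF d(14)]) auto
    then have "c0 i \<cdot> un ?g = g0" using c0[OF i] MM_un_cmp[OF g' c[OF i]] g(1) by simp
    then show "\<exists>i\<in>Ob J. \<exists>g\<in>Hom (CommAlg C R) (S, un r) (FO i). c0 i \<cdot> g = g0"
      using i FO[OF i] Hom_CommAlg[OF d(1) f[OF i]] g' gr by (intro bexI[of _ i] bexI[of _ "un ?g"]) auto
  next
    \<comment> \<open>Injectivity: \<open>r\<close> is epic, so two algebra morphisms out of
      \<open>S\<close> agree at every common upper bound of \<open>i\<close> and
      \<open>j\<close>.\<close>
    fix i j g h assume ij: "i \<in> Ob J" "j \<in> Ob J" and g: "g \<in> Hom (CommAlg C R) (S, un r) (FO i)" and h: "h \<in> Hom (CommAlg C R) (S, un r) (FO j)"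
    obtain g' h' where g': "g = un g'" "MM S (A i) g'" "g' ** r = f i" and h': "h = un h'" "MM S (A j) h'" "h' ** r = f j"
      using g h FO[OF ij(1)] FO[OF ij(2)] Hom_CommAlg[OF d(1) f[OF ij(1)]] Hom_CommAlg[OF d(1) f[OF ij(2)]] by auto
    obtain k v w where k: "k \<in> Ob J" "v \<in> Hom J i k" "w \<in> Hom J j k" using ub[OF ij] by blast
    note [simp] = rD(1-5) MM_D(3-5)[OF g'(2)] MM_D(3-5)[OF h'(2)] MM_D(3-5)[OF G[OF ij(1) k(1,2)]] MM_D(3-5)[OF G[OF ij(2) k(1,3)]]
    have "(G i k v ** g') ** r = (G j k w ** h') ** r" using Gf[OF ij(1) k(1,2)] Gf[OF ij(2) k(1,3)] g'(3) h'(3) by simp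
    then have "G i k v ** g' = G j k w ** h'" by (rule epiD[OF d(14)]) auto
    then have eq: "FM i k v \<cdot> g = FM j k w \<cdot> h"
      using FM[OF ij(1) k(1,2)] FM[OF ij(2) k(1,3)] g'(1) h'(1) MM_un_cmp[OF g'(2) G[OF ij(1) k(1,2)]] MM_un_cmp[OF h'(2) G[OF ij(2) k(1,3)]] by simp
    let ?r = "\<lambda>(i, g) (j, h). i \<in> Ob J \<and> j \<in> Ob J \<and> g \<in> Hom (CommAlg C R) (S, un r) (FO i) \<and> (\<exists>u\<in>Hom J i j. h = FM i j u \<cdot> g)"
    have "\<exists>u\<in>Hom J i k. FM i k v \<cdot> g = FM i k u \<cdot> g" "\<exists>u\<in>Hom J j k. FM i k v \<cdot> g = FM j k u \<cdot> h" using k eq by blast+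
    then have "?r (i, g) (k, FM i k v \<cdot> g)" "?r (j, h) (k, FM i k v \<cdot> g)" using ij k(1) g h by simp_all
    then have "equivclp ?r (i, g) (k, FM i k v \<cdot> g)" "equivclp ?r (k, FM i k v \<cdot> g) (j, h)"
      by (blast intro: r_into_equivclp equivclp_sym)+
    then show "equivclp ?r (i, g) (j, h)" by (rule equivclp_trans)
  qed
qed

end

section \<open>The Zariski topology and the sheaf property of affine schemes\<close>

lemma lesspoll_card_of: "A \<prec> B \<longleftrightarrow> (card_of A, card_of B) \<in> ordLess"
proof -
  have le: "X \<lesssim> Y \<longleftrightarrow> (card_of X, card_of Y) \<in> ordLeq" for X :: "'x set" and Y :: "'y set"
    by (simp add: lepoll_def card_of_ordLeq[symmetric])
  have 1: "A \<prec> B \<longleftrightarrow> A \<lesssim> B \<and> \<not> B \<lesssim> A"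
    unfolding lesspoll_def using lepoll_antisym eqpoll_imp_lepoll eqpoll_sym by blast
  show ?thesis unfolding 1 le
    using not_ordLeq_iff_ordLess[OF card_of_Well_order card_of_Well_order] ordLess_imp_ordLeq by blast
qed

text \<open>The union of two small families has to be indexed inside \<open>'u\<close> again. The
  sum of the index sets is still smaller than \<open>U\<close> because \<open>U\<close> is
  infinite.\<close>

lemma small_set_Plus:
  fixes U :: "'u set"
  assumes U: "infinite U" and I: "small_set U I" "small_set U J"
  obtains K :: "'u set" and g where "small_set U K" "bij_betw g K (I <+> J)"
proof -
  have p: "I <+> J \<prec> U"
    using card_of_Plus_ordLess_infinite[OF U] I unfolding small_set_def lesspoll_card_of by blast
  then obtain f where f: "inj_on f (I <+> J)" "f ` (I <+> J) \<subseteq> U" unfolding lesspoll_def lepoll_def by blast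
  have b: "bij_betw f (I <+> J) (f ` (I <+> J))" using f by (simp add: bij_betw_def)
  then have "f ` (I <+> J) \<approx> I <+> J" using eqpoll_def eqpoll_sym by blast
  then have "small_set U (f ` (I <+> J))" using p unfolding small_set_def by (meson eq_lesspoll_trans)
  then show ?thesis using that bij_betw_inv_into[OF b] by blast
qed

context abelian_symmetric_monoidal
begin

section \<open>Zariski covers by the factors of a product\<close>

lemma aff_zariski_open_D:
  assumes "aff_zariski_open U C A B f"
  obtains g where "f = un g" "MM A B g" "flat C A B (un g)"
  using assms Hom_CommMon_ex[of A B f] unfolding aff_zariski_open_def epic_def Ob_CommMon by blast

lemma SP_aff_zariski_open:
  assumes a: "SP R S T r s r' s'" and U: "has_small_colimits U C" and b: "MM B T b"
    and fg: "fin_gen U C B (self_mdl B)" and fc: "filtered_colimits_commute_with_finite_limits U (Mod C B)"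
  shows "aff_zariski_open U C R S (un r)"
  using SP_epic[OF a] SP_flat[OF a] SP_fin_pres_alg[OF assms] MM_D(1,2)[OF SP_D(1)[OF a]]
  by (simp add: aff_zariski_open_def Ob_CommMon)

lemma Ball_Mod_LM:
  assumes A: "CM A"
  shows "(\<forall>M\<in>Ob (Mod C A). \<forall>N\<in>Ob (Mod C A). \<forall>g\<in>Hom (Mod C A) M N. Q M N g) \<longleftrightarrow> (\<forall>M N g. LM A M N g \<longrightarrow> Q M N (un g))"
proof (intro iffI allI impI ballI)
  fix M N g assume Q: "\<forall>M\<in>Ob (Mod C A). \<forall>N\<in>Ob (Mod C A). \<forall>g\<in>Hom (Mod C A) M N. Q M N g" and g: "LM A M N g"
  show "Q M N (un g)" using Q LM_D(1,2)[OF g] LM_un[OF A g] unfolding Ball_def Ob_Mod by blast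
next
  fix M N g assume Q: "\<forall>M N g. LM A M N g \<longrightarrow> Q M N (un g)" and M: "M \<in> Ob (Mod C A)" "N \<in> Ob (Mod C A)" and g: "g \<in> Hom (Mod C A) M N"
  obtain g' where "LM A M N g'" "g = un g'" using Hom_Mod_ex[OF A M[unfolded Ob_Mod], THEN iffD1, OF g] by blast
  then show "Q M N g" using Q by simp
qed

text \<open>All modules over a zero monoid vanish, so every linear map is an isomorphism and the
  empty family is conservative.\<close>

lemma zariski_cover_empty:
  assumes U: "infinite U" and Z: "zero_monoid C A"
  shows "zariski_cover U C A {} S f"
proof -
  have A: "CM A" "zeroT (mon_ob A)" using Z by (auto simp: zero_monoid_iff)
  note [simp] = A(1)
  have zM: "I (mdl_ob M) = zr (mdl_ob M) (mdl_ob M)" if M: "MD A M" for M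
  proof -
    note [simp] = M MD_Ob[OF M]
    have e: "et A = zr one (mon_ob A)" using zeroT_to[OF A(2), of "et A"] by simp
    have "I (mdl_ob M) = ac A M ** (et A >< I (mdl_ob M)) ** li (mdl_ob M)" by (simp add: ra[OF ac_et])
    also have "\<dots> = zr (mdl_ob M) (mdl_ob M)" unfolding e by simp
    finally show ?thesis .
  qed
  have "is_iso (Mod C A) M N (un g)" if g: "LM A M N g" for M N g
  proof -
    note gD = LM_D[OF g]
    note [simp] = gD(1-5) MD_Ob[OF gD(1)] MD_Ob[OF gD(2)]
    show ?thesis unfolding is_iso_Mod[OF A(1) g] zM[OF gD(1)] zM[OF gD(2)]
      by (intro exI[of _ "zr (mdl_ob N) (mdl_ob M)"]) simp
  qed
  then have "jointly_conservative C A {} S f" unfolding jointly_conservative_def Ball_Mod_LM[OF A(1)] by blast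
  moreover have "small_set U {}" unfolding small_set_def by (rule finite_lesspoll_infinite[OF U]) simp
  ultimately show ?thesis unfolding zariski_cover_def using A by (auto simp: Ob_CommMon)
qed

text \<open>For the empty cover the sheaf condition asks for a unique section subject to no
  conditions.\<close>

lemma sheaf_zero:
  assumes "infinite U" "is_sheaf U C F" "zero_monoid C A"
  shows "\<exists>!t. t \<in> sec F A"
  using assms(2)[unfolded is_sheaf_def, THEN conjunct2, rule_format, of A "{}" undefined undefined undefined] zariski_cover_empty[OF assms(1,3)]
  by simp

lemma SP_zariski_cover:
  fixes U :: "'u set"
  assumes U: "infinite U" and a: "SP R S T r s r' s'" and ij: "i \<noteq> j"
    and o: "aff_zariski_open U C R S (un r)" "aff_zariski_open U C R T (un r')"
  shows "zariski_cover U C R {i, j} (\<lambda>k. if k = i then S else T) (\<lambda>k. if k = i then un r else un r')"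
    (is "zariski_cover U C R ?I ?S ?f")
proof -
  have R: "CM R" using MM_D(1)[OF SP_D(1)[OF a]] .
  have "jointly_conservative C R ?I ?S ?f"
    unfolding jointly_conservative_def Ball_Mod_LM[OF R]
  proof (intro allI impI)
    fix M N g assume g: "LM R M N g" and iso: "\<forall>k\<in>?I. is_iso (Mod C (?S k)) (ext_ob C R (?S k) (?f k) M) (ext_ob C R (?S k) (?f k) N) (ext_mor C R (?S k) (?f k) M N (un g))"
    show "is_iso (Mod C R) M N (un g)"
      by (rule SP_conservative[OF a g]) (use bspec[OF iso, of i] bspec[OF iso, of j] ij in auto)
  qed
  moreover have "small_set U ?I" unfolding small_set_def by (rule finite_lesspoll_infinite[OF U]) simp
  moreover have "finite ?I" by simp
  ultimately show ?thesis unfolding zariski_cover_def using o R by (auto simp: Ob_CommMon)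
qed

lemma presheaf_res:
  assumes "is_presheaf C F" "MM A B f" "x \<in> sec F A"
  shows "res F A B (un f) x \<in> sec F B"
  using assms(1,3) MM_un[OF assms(2)] MM_D(1,2)[OF assms(2)] unfolding is_presheaf_def Ball_def Ob_CommMon by blast

lemma presheaf_res_cmp:
  assumes "is_presheaf C F" "MM A B f" "MM B D g" "x \<in> sec F A"
  shows "res F A D (un (g ** f)) x = res F B D (un g) (res F A B (un f) x)"
proof -
  have "res F A D (un g \<cdot> un f) x = res F B D (un g) (res F A B (un f) x)"
    using assms(1,4) MM_un[OF assms(2)] MM_un[OF assms(3)] MM_D(1,2)[OF assms(2)] MM_D(2)[OF assms(3)]
    unfolding is_presheaf_def Ball_def Ob_CommMon by blast
  then show ?thesis using MM_un_cmp[OF assms(2,3)] by simp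
qed

lemma presheaf_res_I:
  assumes "is_presheaf C F" "CM A" "x \<in> sec F A"
  shows "res F A A (un (I (mon_ob A))) x = x"
  using assms un_I[of "mon_ob A"] CM_ar(1)[of A] unfolding is_presheaf_def Ball_def Ob_CommMon CommMon_Idn by simp

lemma is_pushout_CommMonE:
  assumes f: "MM A B f" and g: "MM A B' g" and po: "is_pushout (CommMon C) A B B' (un f) (un g) P p q"
  obtains p' q' where "p = un p'" "q = un q'" "MM B P p'" "MM B' P q'" "p' ** f = q' ** g"
proof -
  have P: "CM P" and p: "p \<in> Hom (CommMon C) B P" "q \<in> Hom (CommMon C) B' P" and e: "p \<cdot> un f = q \<cdot> un g"
    using po unfolding is_pushout_def CommMon_comp Ob_CommMon by blast+
  obtain p' q' where p': "p = un p'" "MM B P p'" and q': "q = un q'" "MM B' P q'"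
    using p Hom_CommMon_ex[OF MM_D(2)[OF f] P] Hom_CommMon_ex[OF MM_D(2)[OF g] P] by blast
  have "un (p' ** f) = un (q' ** g)" using e p' q' MM_un_cmp[OF f p'(2)] MM_un_cmp[OF g q'(2)] by simp
  then have "p' ** f = q' ** g" using MM_un_eq[OF MM_cmp[OF f p'(2)] MM_cmp[OF g q'(2)]] by blast
  then show ?thesis using that p' q' by blast
qed

text \<open>In elements, \<open>1 = p(r(s(1))) = q(r'(s(1))) = 0\<close>.\<close>

lemma SP_overlap_zero:
  assumes a: "SP R S T r s r' s'" and p: "MM S P p" "MM T P q" and e: "p ** r = q ** r'"
  shows "zeroT (mon_ob P)"
proof (rule unit_zero)
  note d = SP_D[OF a] and rD = MM_D[OF SP_D(1)[OF a]] and rD' = MM_D[OF SP_D(2)[OF a]] and pD = MM_D[OF p(1)] and qD = MM_D[OF p(2)]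
  note [simp] = d(3-8) rD(1-5) rD'(1-5) pD(1-5) qD(1-5)
  show "CM P" by simp
  have "et P = p ** (r ** s) ** et S" unfolding d(9) using pD(7) by simp
  also have "\<dots> = q ** (r' ** s) ** et S" by (simp add: ra[OF e])
  also have "\<dots> = zr one (mon_ob P)" unfolding d(12) by simp
  finally show "et P = zr one (mon_ob P)" .
qed

text \<open>The two factors cover \<open>R\<close> and have zero overlap, so compatibility imposes
  nothing on a pair of sections.\<close>

lemma sheaf_SP:
  fixes U :: "'u set"
  assumes U: "infinite U" and F: "is_sheaf U C F" and a: "SP R S T r s r' s'"
    and o: "aff_zariski_open U C R S (un r)" "aff_zariski_open U C R T (un r')"
    and x: "x \<in> sec F S" "y \<in> sec F T"
  shows "\<exists>!t. t \<in> sec F R \<and> res F R S (un r) t = x \<and> res F R T (un r') t = y"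
proof -
  have pF: "is_presheaf C F" using F by (simp add: is_sheaf_def)
  note d = SP_D[OF a] and rD = MM_D[OF SP_D(1)[OF a]] and rD' = MM_D[OF SP_D(2)[OF a]]
  \<comment> \<open>Covers are indexed by elements of \<open>'u\<close>; an infinite
    \<open>U\<close> provides two different ones.\<close>
  obtain i j :: 'u where ij: "i \<noteq> j" using U by (metis finite.simps infinite_imp_nonempty insertI1 singleton_iff subsetI subset_antisym finite_subset)
  let ?S = "\<lambda>k. if k = i then S else T" and ?f = "\<lambda>k. if k = i then un r else un r'" and ?s = "\<lambda>k. if k = i then x else y"
  \<comment> \<open>Overlap of a factor with itself: the two coprojections agree because
    \<open>f\<close> is epic.\<close>
  have same: "res F B P p z = res F B P q z"
    if po: "is_pushout (CommMon C) R B B (un f) (un f) P p q" and f: "MM R B f" "epi f" for B f P p q z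
  proof -
    obtain p' q' where p': "p = un p'" "q = un q'" "MM B P p'" "MM B P q'" "p' ** f = q' ** f"
      using is_pushout_CommMonE[OF f(1) f(1) po] by metis
    note [simp] = MM_D(3-5)[OF p'(3)] MM_D(3-5)[OF p'(4)] MM_D(3-5)[OF f(1)]
    have "p' = q'" by (rule epiD[OF f(2) p'(5)]) auto
    then show ?thesis using p' by simp
  qed
  \<comment> \<open>Overlap of different factors: it is zero, and a sheaf has only one section
    there.\<close>
  have mix: "res F B P p z = res F B' P q z'"
    if po: "is_pushout (CommMon C) R B B' (un f) (un f') P p q" and sp: "SP R B B' f e f' e'" and z: "z \<in> sec F B" "z' \<in> sec F B'" for B B' f f' e e' P p q z z'
  proof -
    obtain p' q' where p': "p = un p'" "q = un q'" "MM B P p'" "MM B' P q'" "p' ** f = q' ** f'"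
      using is_pushout_CommMonE[OF SP_D(1)[OF sp] SP_D(2)[OF sp] po] by metis
    have "zero_monoid C P" using SP_overlap_zero[OF sp p'(3-5)] MM_D(2)[OF p'(3)] by (simp add: zero_monoid_iff)
    then have "\<exists>!t. t \<in> sec F P" by (rule sheaf_zero[OF U F])
    then show ?thesis using presheaf_res[OF pF p'(3) z(1)] presheaf_res[OF pF p'(4) z(2)] p'(1,2) by blast
  qed
  have "\<exists>!t. t \<in> sec F R \<and> (\<forall>k\<in>{i, j}. res F R (?S k) (?f k) t = ?s k)"
  proof (rule F[unfolded is_sheaf_def, THEN conjunct2, rule_format, OF conjI[OF SP_zariski_cover[OF U a ij o] conjI]])
    show "\<forall>k\<in>{i, j}. ?s k \<in> sec F (?S k)" using x by simp
    show "\<forall>k\<in>{i, j}. \<forall>l\<in>{i, j}. \<forall>P p q. is_pushout (CommMon C) R (?S k) (?S l) (?f k) (?f l) P p q \<longrightarrow>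
        res F (?S k) P p (?s k) = res F (?S l) P q (?s l)"
      using same[of S r, OF _ d(1,14)] same[of T r', OF _ d(2,15)] mix[OF _ a x] mix[OF _ SP_sym[OF a] x(2,1)] ij by simp
  qed
  then show ?thesis using ij by simp
qed

section \<open>Affine schemes are sheaves\<close>

lemma sec_Spec: "CM A \<Longrightarrow> CM B \<Longrightarrow> f \<in> sec (Spec C A) B \<longleftrightarrow> (\<exists>g. f = un g \<and> MM A B g)"
  using Hom_CommMon_ex by (simp add: Spec_def)

lemma res_Spec: "MM A B h \<Longrightarrow> MM B D g \<Longrightarrow> res (Spec C A) B D (un g) (un h) = un (g ** h)"
  using MM_un_cmp by (simp add: Spec_def)

lemma presheaf_Spec:
  assumes A: "CM A" shows "is_presheaf C (Spec C A)"
proof -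
  interpret M: category "CommMon C" by (rule category_CommMon)
  show ?thesis
    using A M.comp_in_hom[of A] M.comp_id_left[of A] M.comp_assoc[of A] unfolding is_presheaf_def Spec_def
    by (simp add: Ob_CommMon)
qed

text \<open>Compatibility on all pushouts is used on the one from \<open>pushout_tens\<close>, whose
  coprojections are those in the hypothesis of \<open>cover_glue\<close>. The glued arrow is a
  morphism of monoids because the \<open>f k\<close> are jointly monic.\<close>

lemma cover_glue_monoid:
  assumes c: "cover T n S f" and R: "CM R" and h: "\<And>k. k < n \<Longrightarrow> MM R (S k) (h k)"
    and compat: "\<And>i k P p q. i < n \<Longrightarrow> k < n \<Longrightarrow> is_pushout (CommMon C) T (S i) (S k) (un (f i)) (un (f k)) P p q \<Longrightarrow>
      p \<cdot> un (h i) = q \<cdot> un (h k)"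
  obtains y where "MM R T y" "\<And>k. k < n \<Longrightarrow> f k ** y = h k"
proof -
  let ?r = "mon_ob R"
  have T: "CM T" and f: "\<And>k. k < n \<Longrightarrow> MM T (S k) (f k)" using c by (auto simp: cover_def)
  note [simp] = R T
  obtain y where y: "ar y" "dm y = ?r" "cd y = mon_ob T" "\<And>k. k < n \<Longrightarrow> f k ** y = h k"
  proof (rule cover_glue[OF c, of ?r h])
    show "?r \<in> Ob C" by simp
    show "ar (h k) \<and> dm (h k) = ?r \<and> cd (h k) = mon_ob (S k)" if "k < n" for k using MM_D(3-5)[OF h[OF that]] by blast
    fix i k assume ik: "i < n" "k < n"
    let ?M = "rs (f i) (S i) (self_mdl (S i))"
    obtain P where P: "MM (S i) P (xe T (S k) (f k) ?M)" "MM (S k) P (xq T (S k) (f k) ?M ** (et (S i) >< I (mon_ob (S k))) ** li (mon_ob (S k)))"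
      "is_pushout (CommMon C) T (S i) (S k) (un (f i)) (un (f k)) P (un (xe T (S k) (f k) ?M)) (un (xq T (S k) (f k) ?M ** (et (S i) >< I (mon_ob (S k))) ** li (mon_ob (S k))))"
      using pushout_tens[OF f[OF ik(1)] f[OF ik(2)]] by blast
    let ?p = "xe T (S k) (f k) ?M" and ?q = "xq T (S k) (f k) ?M ** (et (S i) >< I (mon_ob (S k))) ** li (mon_ob (S k))"
    have "un (?p ** h i) = un (?q ** h k)"
      unfolding MM_un_cmp[OF h[OF ik(1)] P(1), symmetric] MM_un_cmp[OF h[OF ik(2)] P(2), symmetric] by (rule compat[OF ik P(3)])
    then have "?p ** h i = ?q ** h k"
      using MM_un_eq[OF MM_cmp[OF h[OF ik(1)] P(1)] MM_cmp[OF h[OF ik(2)] P(2)]] by blast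
    then show "?p ** h i = xq T (S k) (f k) ?M ** (et (S i) >< I (mon_ob (S k))) ** li (mon_ob (S k)) ** h k" by simp
  qed blast
  note [simp] = y(1-3)
  have "y ** mu R = mu T ** (y >< y)"
  proof (rule cover_jm[OF c])
    fix k assume k: "k < n"
    note fD = MM_D[OF f[OF k]] and hD = MM_D[OF h[OF k]]
    note [simp] = fD(1-5) hD(1-5)
    have "f k ** mu T ** (y >< y) = mu (S k) ** ((f k ** y) >< (f k ** y))" by (simp add: ra[OF fD(6)] mg)
    also have "\<dots> = f k ** y ** mu R" unfolding y(4)[OF k] hD(6)[symmetric] by (simp add: ra[OF y(4)[OF k]])
    finally show "f k ** y ** mu R = f k ** mu T ** (y >< y)" ..
  qed auto
  moreover have "y ** et R = et T"
  proof (rule cover_jm[OF c])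
    fix k assume k: "k < n"
    show "f k ** y ** et R = f k ** et T" using ra[OF y(4)[OF k], of "et R"] MM_D(7)[OF f[OF k]] MM_D(7)[OF h[OF k]] by simp
  qed auto
  ultimately have "MM R T y" unfolding MM_def by simp
  then show ?thesis using that y(4) by blast
qed

text \<open>Enlarging a conservative family keeps it conservative. The room that \<open>K\<close>
  leaves beyond \<open>J\<close> serves to glue at one further index.\<close>

lemma zariski_cover_cover:
  assumes f: "\<And>i. i \<in> L \<Longrightarrow> MM T (S i) (f i) \<and> flat C T (S i) (un (f i))" and T: "CM T"
    and J: "J \<subseteq> K" "K \<subseteq> L" "finite K" and cons: "jointly_conservative C T J S (\<lambda>i. un (f i))"
  obtains n e where "bij_betw e {..<n} K" "cover T n (\<lambda>k. S (e k)) (\<lambda>k. f (e k))"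
proof -
  obtain e where e: "bij_betw e {..<card K} K" using ex_bij_betw_nat_finite[OF J(3)] by (auto simp: atLeast0LessThan)
  have eK: "e k \<in> L" if "k < card K" for k using e J(2) that unfolding bij_betw_def by blast
  have "cover T (card K) (\<lambda>k. S (e k)) (\<lambda>k. f (e k))"
    unfolding cover_def
  proof (intro conjI allI impI T)
    show "MM T (S (e k)) (f (e k))" "flat C T (S (e k)) (un (f (e k)))" if "k < card K" for k using f[OF eK[OF that]] by blast+
    fix M N g assume g: "LM T M N g"
      and iso: "\<forall>k<card K. is_iso (Mod C (S (e k))) (xo T (S (e k)) (f (e k)) M) (xo T (S (e k)) (f (e k)) N) (ext_mor C T (S (e k)) (un (f (e k))) M N (un g))"
    have "is_iso (Mod C (S j)) (xo T (S j) (f j) M) (xo T (S j) (f j) N) (ext_mor C T (S j) (un (f j)) M N (un g))" if "j \<in> J" for j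
    proof -
      have "j \<in> e ` {..<card K}" using that J(1) e unfolding bij_betw_def by blast
      then obtain k where k: "k < card K" "j = e k" by blast
      show ?thesis unfolding k(2) by (rule iso[rule_format, OF k(1)])
    qed
    then show "is_iso (Mod C T) M N (un g)"
      using cons g unfolding jointly_conservative_def Ball_Mod_LM[OF T] by blast
  qed
  then show ?thesis using that e by blast
qed

text \<open>Sections are glued over the finite conservative part \<open>J\<close>. For any other
  index \<open>i\<close>, gluing over \<open>insert i J\<close> gives a second section; it equals
  the first because \<open>J\<close> already separates sections, so the first restricts correctly at
  \<open>i\<close> too.\<close>

lemma sheaf_Spec:
  assumes R: "CM R" shows "is_sheaf U C (Spec C R)"
  unfolding is_sheaf_def
proof (intro conjI allI impI presheaf_Spec[OF R])
  fix T L S fs s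
  assume a: "zariski_cover U C T L S fs \<and> (\<forall>i\<in>L. s i \<in> sec (Spec C R) (S i)) \<and>
    (\<forall>i\<in>L. \<forall>j\<in>L. \<forall>P p q. is_pushout (CommMon C) T (S i) (S j) (fs i) (fs j) P p q \<longrightarrow>
       res (Spec C R) (S i) P p (s i) = res (Spec C R) (S j) P q (s j))"
  have T: "CM T" using a by (simp add: zariski_cover_def Ob_CommMon)
  obtain J where J: "J \<subseteq> L" "finite J" "jointly_conservative C T J S fs" using a unfolding zariski_cover_def by blast
  have "\<forall>i\<in>L. \<exists>f. fs i = un f \<and> MM T (S i) f \<and> flat C T (S i) (un f)"
    using a aff_zariski_open_D[of U T] unfolding zariski_cover_def by metis
  then obtain f where fs: "\<And>i. i \<in> L \<Longrightarrow> fs i = un (f i)" and f: "\<And>i. i \<in> L \<Longrightarrow> MM T (S i) (f i) \<and> flat C T (S i) (un (f i))" by metis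
  have SC: "\<And>i. i \<in> L \<Longrightarrow> CM (S i)" using f MM_D(2) by blast
  have "\<forall>i\<in>L. \<exists>h. s i = un h \<and> MM R (S i) h" using a sec_Spec[OF R SC] by blast
  then obtain h where s: "\<And>i. i \<in> L \<Longrightarrow> s i = un (h i)" and h: "\<And>i. i \<in> L \<Longrightarrow> MM R (S i) (h i)" by metis
  have compat: "p \<cdot> un (h i) = q \<cdot> un (h j)" if ij: "i \<in> L" "j \<in> L" and po: "is_pushout (CommMon C) T (S i) (S j) (un (f i)) (un (f j)) P p q" for i j P p q
  proof -
    have "res (Spec C R) (S i) P p (s i) = res (Spec C R) (S j) P q (s j)" using a ij po fs[OF ij(1)] fs[OF ij(2)] by metis
    then show ?thesis using s ij by (simp add: Spec_def)
  qed
  have J': "jointly_conservative C T J S (\<lambda>i. un (f i))"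
    using J(1,3) fs unfolding jointly_conservative_def by (auto simp: subset_iff)
  have glue: "\<exists>y. MM R T y \<and> (\<forall>k\<in>K. f k ** y = h k)" if K: "J \<subseteq> K" "K \<subseteq> L" "finite K" for K
  proof -
    obtain n e where e: "bij_betw e {..<n} K" "cover T n (\<lambda>k. S (e k)) (\<lambda>k. f (e k))"
      using zariski_cover_cover[OF f T K J'] by blast
    have eI: "e k \<in> L" if "k < n" for k using e(1) K(2) that unfolding bij_betw_def by blast
    obtain y where y: "MM R T y" "\<And>k. k < n \<Longrightarrow> f (e k) ** y = h (e k)"
    proof (rule cover_glue_monoid[OF e(2) R, of "\<lambda>k. h (e k)"])
      show "MM R (S (e k)) (h (e k))" if "k < n" for k by (rule h[OF eI[OF that]])
      show "p \<cdot> un (h (e i)) = q \<cdot> un (h (e k))" if "i < n" "k < n" "is_pushout (CommMon C) T (S (e i)) (S (e k)) (un (f (e i))) (un (f (e k))) P p q" for i k P p q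
        by (rule compat[OF eI[OF that(1)] eI[OF that(2)] that(3)])
    qed blast
    have "f k ** y = h k" if "k \<in> K" for k
    proof -
      obtain l where "l < n" "e l = k" using \<open>k \<in> K\<close> e(1) unfolding bij_betw_def by blast
      then show ?thesis using y(2) by blast
    qed
    then show ?thesis using y(1) by blast
  qed
  have sep: "y = y'" if y: "MM R T y" "MM R T y'" "\<And>k. k \<in> J \<Longrightarrow> f k ** y = f k ** y'" for y y'
  proof -
    obtain n e where e: "bij_betw e {..<n} J" "cover T n (\<lambda>k. S (e k)) (\<lambda>k. f (e k))"
      using zariski_cover_cover[OF f T subset_refl J(1,2) J'] by blast
    have eJ: "e k \<in> J" if "k < n" for k using e(1) that unfolding bij_betw_def by blast
    show ?thesis
      by (rule cover_jm[OF e(2)]) (use y(3)[OF eJ] MM_D(3-5)[OF y(1)] MM_D(3-5)[OF y(2)] in simp_all)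
  qed
  obtain y where y: "MM R T y" "\<forall>k\<in>J. f k ** y = h k" using glue[OF subset_refl J(1,2)] by blast
  have fy: "f i ** y = h i" if i: "i \<in> L" for i
  proof -
    obtain y' where y': "MM R T y'" "\<forall>k\<in>insert i J. f k ** y' = h k" using glue[of "insert i J"] J(1,2) i by blast
    have "y = y'" by (rule sep[OF y(1) y'(1)]) (use y(2) y'(2) in auto)
    then show ?thesis using y'(2) by simp
  qed
  show "\<exists>!t. t \<in> sec (Spec C R) T \<and> (\<forall>i\<in>L. res (Spec C R) T (S i) (fs i) t = s i)"
  proof (rule ex1I[of _ "un y"], intro conjI ballI)
    show "un y \<in> sec (Spec C R) T" using y(1) sec_Spec[OF R T] by blast
    show "res (Spec C R) T (S i) (fs i) (un y) = s i" if "i \<in> L" for i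
      using res_Spec[OF y(1)] f[OF that] fy[OF that] fs[OF that] s[OF that] by simp
    fix t assume t: "t \<in> sec (Spec C R) T \<and> (\<forall>i\<in>L. res (Spec C R) T (S i) (fs i) t = s i)"
    then obtain y' where y': "t = un y'" "MM R T y'" using sec_Spec[OF R T] by blast
    have "f k ** y' = f k ** y" if k: "k \<in> L" for k
    proof -
      have "res (Spec C R) T (S k) (fs k) t = s k" using t k by blast
      then have "un (f k ** y') = un (h k)" unfolding fs[OF k] s[OF k] y'(1) using res_Spec[OF y'(2), of "S k" "f k"] f[OF k] by simp
      then show ?thesis unfolding fy[OF k] using MM_un_eq[OF MM_cmp[OF y'(2)] h[OF k]] f[OF k] by blast
    qed
    then have "y' = y" using sep[OF y'(2) y(1)] J(1) by blast
    then show "t = un y" using y'(1) by simp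
  qed
qed

text \<open>Since \<open>T\<close> is a sheaf, the two restrictions of \<open>h\<close> come from a
  section of \<open>T\<close> over \<open>E\<close>; as the projections of \<open>E\<close> are
  jointly monic, this section is \<open>h\<close>.\<close>

lemma SP_Spec_subsheaf_glue:
  fixes U :: "'u set"
  assumes U: "infinite U" and R: "CM R" and T: "is_subsheaf U C (Spec C R) T" and a: "SP E S S' q s q' s'"
    and o: "aff_zariski_open U C E S (un q)" "aff_zariski_open U C E S' (un q')"
    and h: "MM R E h" "un (q ** h) \<in> T S" "un (q' ** h) \<in> T S'"
  shows "un h \<in> T E"
proof -
  note d = SP_D[OF a]
  have E: "CM E" using MM_D(1)[OF d(1)] .
  let ?F = "\<lparr>sec = T, res = res (Spec C R)\<rparr>"
  obtain t where t: "t \<in> T E" "res (Spec C R) E S (un q) t = un (q ** h)" "res (Spec C R) E S' (un q') t = un (q' ** h)"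
    using sheaf_SP[OF U _ a o, of ?F "un (q ** h)" "un (q' ** h)"] T h(2,3) unfolding is_subsheaf_def by auto
  obtain y where y: "t = un y" "MM R E y" using t(1) T E sec_Spec[OF R E] unfolding is_subsheaf_def Ball_def Ob_CommMon by blast
  have 1: "q ** y = q ** h" using t(2) res_Spec[OF y(2) d(1)] y(1) MM_un_eq[OF MM_cmp[OF y(2) d(1)] MM_cmp[OF h(1) d(1)]] by simp
  have 2: "q' ** y = q' ** h" using t(3) res_Spec[OF y(2) d(2)] y(1) MM_un_eq[OF MM_cmp[OF y(2) d(2)] MM_cmp[OF h(1) d(2)]] by simp
  have "y = h" by (rule SP_jm[OF a _ _ _ _ 1 2]) (use MM_D(3-5)[OF y(2)] MM_D(3-5)[OF h(1)] in auto)
  then show ?thesis using t(1) y(1) by simp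
qed

end

text \<open>Take the intersection of all subsheaves that contain \<open>P\<close>. Compatible
  sections glue in each of them, always to the same section, because gluing in \<open>F\<close> is
  unique.\<close>

lemma sheaf_image_exists:
  assumes F: "is_sheaf U C F" and P: "\<And>A. A \<in> Ob (CommMon C) \<Longrightarrow> P A \<subseteq> sec F A"
  obtains S where "is_sheaf_image U C F P S"
proof -
  let ?T = "\<lambda>T. is_subsheaf U C F T \<and> (\<forall>A\<in>Ob (CommMon C). P A \<subseteq> T A)"
  define S where "S A = {x \<in> sec F A. \<forall>T. ?T T \<longrightarrow> x \<in> T A}" for A
  have pF: "is_presheaf C F" using F by (simp add: is_sheaf_def)
  have pT: "is_presheaf C \<lparr>sec = T, res = res F\<rparr>" if "?T T" for T using that by (simp add: is_subsheaf_def is_sheaf_def)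
  have pS: "is_presheaf C \<lparr>sec = S, res = res F\<rparr>"
    unfolding is_presheaf_def
  proof (intro conjI ballI)
    fix A B f s assume a: "A \<in> Ob (CommMon C)" "B \<in> Ob (CommMon C)" "f \<in> Hom (CommMon C) A B" "s \<in> sec \<lparr>sec = S, res = res F\<rparr> A"
    have "res F A B f s \<in> sec F B" using pF a unfolding is_presheaf_def S_def by simp
    moreover have "res F A B f s \<in> T B" if "?T T" for T using pT[OF that] a that unfolding is_presheaf_def S_def by simp
    ultimately show "res \<lparr>sec = S, res = res F\<rparr> A B f s \<in> sec \<lparr>sec = S, res = res F\<rparr> B" by (simp add: S_def)
  qed (use pF in \<open>auto simp: is_presheaf_def S_def\<close>)
  have "is_sheaf U C \<lparr>sec = S, res = res F\<rparr>"
    unfolding is_sheaf_def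
  proof (intro conjI allI impI pS)
    fix A I As fs s
    assume a: "zariski_cover U C A I As fs \<and> (\<forall>i\<in>I. s i \<in> sec \<lparr>sec = S, res = res F\<rparr> (As i)) \<and>
      (\<forall>i\<in>I. \<forall>j\<in>I. \<forall>P p q. is_pushout (CommMon C) A (As i) (As j) (fs i) (fs j) P p q \<longrightarrow>
         res \<lparr>sec = S, res = res F\<rparr> (As i) P p (s i) = res \<lparr>sec = S, res = res F\<rparr> (As j) P q (s j))"
    then have z: "zariski_cover U C A I As fs" and s: "\<And>i. i \<in> I \<Longrightarrow> s i \<in> S (As i)"
      and c: "\<forall>i\<in>I. \<forall>j\<in>I. \<forall>P p q. is_pushout (CommMon C) A (As i) (As j) (fs i) (fs j) P p q \<longrightarrow> res F (As i) P p (s i) = res F (As j) P q (s j)"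
      by simp_all
    have A: "A \<in> Ob (CommMon C)" using z by (simp add: zariski_cover_def)
    have gF: "\<exists>!t. t \<in> sec F A \<and> (\<forall>i\<in>I. res F A (As i) (fs i) t = s i)"
      by (rule F[unfolded is_sheaf_def, THEN conjunct2, rule_format]) (use z s c in \<open>auto simp: S_def\<close>)
    then obtain t where t: "t \<in> sec F A" "\<forall>i\<in>I. res F A (As i) (fs i) t = s i" by blast
    have "t \<in> T A" if T: "?T T" for T
    proof -
      have "is_sheaf U C \<lparr>sec = T, res = res F\<rparr>" using T by (simp add: is_subsheaf_def)
      then have "\<exists>!t. t \<in> sec \<lparr>sec = T, res = res F\<rparr> A \<and> (\<forall>i\<in>I. res \<lparr>sec = T, res = res F\<rparr> A (As i) (fs i) t = s i)"
        by (rule is_sheaf_def[THEN iffD1, THEN conjunct2, rule_format]) (use z s c T in \<open>auto simp: S_def\<close>)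
      then obtain t' where t': "t' \<in> T A" "\<forall>i\<in>I. res F A (As i) (fs i) t' = s i" by auto
      moreover have "t' \<in> sec F A" using t'(1) T A unfolding is_subsheaf_def by blast
      ultimately show ?thesis using gF t by blast
    qed
    then have "t \<in> S A" using t(1) by (simp add: S_def)
    then show "\<exists>!t. t \<in> sec \<lparr>sec = S, res = res F\<rparr> A \<and> (\<forall>i\<in>I. res \<lparr>sec = S, res = res F\<rparr> A (As i) (fs i) t = s i)"
      using t(2) gF by (auto simp: S_def)
  qed
  then have "is_subsheaf U C F S" unfolding is_subsheaf_def by (auto simp: S_def)
  then have "is_sheaf_image U C F P S" unfolding is_sheaf_image_def using P by (auto simp: S_def)
  then show ?thesis by (rule that)
qed

text \<open>A least subsheaf depends only on which subsheaves contain the given sections.\<close>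

lemma sheaf_image_cong:
  assumes "\<And>T. is_subsheaf U C F T \<Longrightarrow>
    (\<forall>A\<in>Ob (CommMon C). P A \<subseteq> T A) \<longleftrightarrow> (\<forall>A\<in>Ob (CommMon C). P' A \<subseteq> T A)"
  shows "is_sheaf_image U C F P S \<longleftrightarrow> is_sheaf_image U C F P' S"
  using assms unfolding is_sheaf_image_def by meson

section \<open>Gluing disjoint open subschemes\<close>

lemma sheaf_image_least:
  assumes "is_sheaf_image U C F P S" "is_subsheaf U C F T"
  shows "(\<forall>A\<in>Ob (CommMon C). P A \<subseteq> T A) \<longleftrightarrow> (\<forall>A\<in>Ob (CommMon C). S A \<subseteq> T A)"
  using assms unfolding is_sheaf_image_def by (meson order_trans)

context abelian_symmetric_monoidal
begin

text \<open>The two families of affine opens are joined and reindexed inside \<open>'u\<close>.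
  \<open>Q\<close> is related to \<open>P\<close> and \<open>P'\<close> only through the subsheaves
  containing them, because a section in \<open>Q\<close> decomposes only after its base has been
  split.\<close>

lemma zariski_open_subsheaf_Un:
  fixes U :: "'u set"
  assumes U: "infinite U" and R: "CM R"
    and S: "is_sheaf_image U C (Spec C R) P S" "zariski_open_subsheaf U C R S"
    and S': "is_sheaf_image U C (Spec C R) P' S'" "zariski_open_subsheaf U C R S'"
    and Q: "\<And>E. CM E \<Longrightarrow> Q E \<subseteq> sec (Spec C R) E"
    and iff: "\<And>T. is_subsheaf U C (Spec C R) T \<Longrightarrow> (\<forall>E\<in>Ob (CommMon C). Q E \<subseteq> T E) \<longleftrightarrow>
      (\<forall>E\<in>Ob (CommMon C). P E \<subseteq> T E) \<and> (\<forall>E\<in>Ob (CommMon C). P' E \<subseteq> T E)"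
  shows "\<exists>V. is_sheaf_image U C (Spec C R) Q V \<and> zariski_open_subsheaf U C R V"
proof -
  let ?G = "\<lambda>N As fs B. \<Union>i\<in>N. {g \<cdot> fs i | g. g \<in> Hom (CommMon C) (As i) B}"
  obtain N :: "'u set" and As fs where N: "small_set U N" "\<forall>i\<in>N. aff_zariski_open U C R (As i) (fs i)"
    "is_sheaf_image U C (Spec C R) (?G N As fs) S" using S(2) unfolding zariski_open_subsheaf_def by blast
  obtain N' :: "'u set" and As' fs' where N': "small_set U N'" "\<forall>i\<in>N'. aff_zariski_open U C R (As' i) (fs' i)"
    "is_sheaf_image U C (Spec C R) (?G N' As' fs') S'" using S'(2) unfolding zariski_open_subsheaf_def by blast
  obtain K :: "'u set" and e where K: "small_set U K" "bij_betw e K (N <+> N')"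
    using small_set_Plus[OF U N(1) N'(1)] by blast
  let ?A = "\<lambda>k. case_sum As As' (e k)" and ?f = "\<lambda>k. case_sum fs fs' (e k)"
  have eK: "e ` K = Inl ` N \<union> Inr ` N'" using K(2) by (auto simp: bij_betw_def)
  have G: "?G K ?A ?f B = ?G N As fs B \<union> ?G N' As' fs' B" for B
  proof -
    have "?G K ?A ?f B = (\<Union>x\<in>e ` K. {g \<cdot> case_sum fs fs' x | g. g \<in> Hom (CommMon C) (case_sum As As' x) B})" by simp
    then show ?thesis unfolding eK by auto
  qed
  have "aff_zariski_open U C R (case_sum As As' x) (case_sum fs fs' x)" if "x \<in> e ` K" for x
    using that N(2) N'(2) unfolding eK by auto
  then have aff: "\<forall>k\<in>K. aff_zariski_open U C R (?A k) (?f k)" by blast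
  obtain V where V: "is_sheaf_image U C (Spec C R) Q V"
    using sheaf_image_exists[OF sheaf_Spec[OF R, of U], of Q] Q[folded Ob_CommMon] by metis
  have "is_sheaf_image U C (Spec C R) Q V \<longleftrightarrow> is_sheaf_image U C (Spec C R) (?G K ?A ?f) V"
  proof (rule sheaf_image_cong)
    fix T assume T: "is_subsheaf U C (Spec C R) T"
    have "(\<forall>E\<in>Ob (CommMon C). Q E \<subseteq> T E) \<longleftrightarrow> (\<forall>E\<in>Ob (CommMon C). ?G N As fs E \<subseteq> T E) \<and> (\<forall>E\<in>Ob (CommMon C). ?G N' As' fs' E \<subseteq> T E)"
      unfolding iff[OF T] sheaf_image_least[OF S(1) T] sheaf_image_least[OF S'(1) T] sheaf_image_least[OF N(3) T] sheaf_image_least[OF N'(3) T] ..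
    then show "(\<forall>E\<in>Ob (CommMon C). Q E \<subseteq> T E) \<longleftrightarrow> (\<forall>E\<in>Ob (CommMon C). ?G K ?A ?f E \<subseteq> T E)"
      by (simp only: G Un_subset_iff ball_conj_distrib)
  qed
  then have "is_sheaf_image U C (Spec C R) (?G K ?A ?f) V" using V by blast
  then have "zariski_open_subsheaf U C R V"
    unfolding zariski_open_subsheaf_def using K(1) aff by (intro exI[of _ K] exI[of _ ?A] exI[of _ ?f] conjI)
  then show ?thesis using V by blast
qed

section \<open>Sections as morphisms from affine schemes, and sections of fibre products\<close>

lemma yoneda:
  assumes A: "CM A" and \<phi>: "psh_mor C (Spec C A) F \<phi>"
  shows "\<phi> A (un (I (mon_ob A))) \<in> sec F A"
    "MM A E g \<Longrightarrow> \<phi> E (un g) = res F A E (un g) (\<phi> A (un (I (mon_ob A))))"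
proof -
  have i: "un (I (mon_ob A)) \<in> sec (Spec C A) A" using sec_Spec[OF A A] MM_I[OF A] by blast
  then show "\<phi> A (un (I (mon_ob A))) \<in> sec F A" using \<phi> A unfolding psh_mor_def Ball_def Ob_CommMon by blast
  assume g: "MM A E g"
  have "\<phi> E (res (Spec C A) A E (un g) (un (I (mon_ob A)))) = res F A E (un g) (\<phi> A (un (I (mon_ob A))))"
    using \<phi> A MM_D(2)[OF g] MM_un[OF g] i unfolding psh_mor_def Ball_def Ob_CommMon by blast
  then show "\<phi> E (un g) = res F A E (un g) (\<phi> A (un (I (mon_ob A))))"
    unfolding res_Spec[OF MM_I[OF A] g] using MM_D(3,4)[OF g] by simp
qed

lemma yoneda_psh_mor:
  assumes F: "is_presheaf C F" and A: "CM A" and x: "x \<in> sec F A"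
  shows "psh_mor C (Spec C A) F (\<lambda>E g. res F A E g x)"
  unfolding psh_mor_def
proof (intro conjI ballI)
  fix E g assume E: "E \<in> Ob (CommMon C)" and g: "g \<in> sec (Spec C A) E"
  then obtain g' where g': "g = un g'" "MM A E g'" using sec_Spec[OF A] Ob_CommMon by blast
  show "res F A E g x \<in> sec F E" unfolding g'(1) by (rule presheaf_res[OF F g'(2) x])
  fix E' f assume E': "E' \<in> Ob (CommMon C)" and f: "f \<in> Hom (CommMon C) E E'"
  obtain f' where f': "f = un f'" "MM E E' f'" using Hom_CommMon_ex E E' f Ob_CommMon by blast
  show "res F A E' (res (Spec C A) E E' f g) x = res F E E' f (res F A E g x)"
    unfolding g'(1) f'(1) res_Spec[OF g'(2) f'(2)] by (rule presheaf_res_cmp[OF F g'(2) f'(2) x])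
qed

lemma sec_fibre_product_Spec:
  assumes "CM A" "CM B" "CM E"
  shows "p \<in> sec (fibre_product (Spec C A) \<phi> (Spec C B) \<psi>) E \<longleftrightarrow>
    (\<exists>g h. p = (un g, un h) \<and> MM A E g \<and> MM B E h \<and> \<phi> E (un g) = \<psi> E (un h))"
  using sec_Spec[OF assms(1,3)] sec_Spec[OF assms(2,3)] unfolding fibre_product_def by fastforce

lemma trivial_Spec: "zero_monoid C A \<Longrightarrow> trivial_sheaf C (Spec C A)"
  unfolding trivial_sheaf_def psh_iso_def psh_mor_def
  using presheaf_Spec[of A] unfolding is_presheaf_def zero_monoid_iff
  by (intro exI[of _ A] conjI exI[of _ "\<lambda>_ x. x"]) (auto simp: bij_betw_def)

text \<open>A section over \<open>E\<close> gives a morphism from a zero monoid to \<open>E\<close>,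
  which forces 1 = 0 in \<open>E\<close>.\<close>

lemma trivial_sheaf_zero:
  assumes F: "trivial_sheaf C F" and E: "CM E" and x: "x \<in> sec F E" shows "zeroT (mon_ob E)"
proof -
  obtain Z \<phi> where Z: "zero_monoid C Z" "psh_mor C F (Spec C Z) \<phi>" using F unfolding trivial_sheaf_def psh_iso_def by blast
  then have "\<phi> E x \<in> sec (Spec C Z) E" using E x unfolding psh_mor_def Ball_def Ob_CommMon by blast
  then obtain f where "MM Z E f" using sec_Spec[of Z E] Z(1) E zero_monoid_iff by blast
  then show ?thesis using MM_zero Z(1) zero_monoid_iff by blast
qed

text \<open>Pull back along the section \<open>\<phi> E (un u)\<close>, viewed as a morphism from
  \<open>Spec E\<close>. Both \<open>u\<close> and \<open>v\<close> lie over the identity of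
  \<open>E\<close>, and the projection is monic.\<close>

lemma zariski_open_immersion_inj:
  assumes F: "is_presheaf C F" and A: "CM A" and z: "zariski_open_immersion U C (Spec C A) F \<phi>"
    and u: "MM A E u" "MM A E v" and e: "\<phi> E (un u) = \<phi> E (un v)"
  shows "u = v"
proof -
  have E: "CM E" using MM_D(2)[OF u(1)] .
  have m: "psh_mor C (Spec C A) F \<phi>" using z unfolding zariski_open_immersion_def by blast
  let ?x = "\<phi> E (un u)"
  have x: "?x \<in> sec F E" using m E u(1) sec_Spec[OF A E] unfolding psh_mor_def Ball_def Ob_CommMon by blast
  let ?\<zeta> = "\<lambda>E' g. res F E E' g ?x"
  let ?i = "un (I (mon_ob E))"
  let ?P = "fibre_product (Spec C A) \<phi> (Spec C E) ?\<zeta>"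
  have "sheaf_mono C ?P (\<lambda>_. snd)"
    using z yoneda_psh_mor[OF F E x] E unfolding zariski_open_immersion_def Let_def Ball_def Ob_CommMon by blast
  then have inj: "inj_on snd (sec ?P E)" using E unfolding sheaf_mono_def Ball_def Ob_CommMon by blast
  have i: "?\<zeta> E ?i = ?x" by (rule presheaf_res_I[OF F E x])
  have "(un u, ?i) \<in> sec ?P E" "(un v, ?i) \<in> sec ?P E"
    unfolding sec_fibre_product_Spec[OF A E E] using u MM_I[OF E] i e by metis+
  then have "un u = un v" using inj_onD[OF inj, of "(un u, ?i)" "(un v, ?i)"] by simp
  then show ?thesis using MM_un_eq[OF u] by blast
qed

text \<open>Split \<open>E\<close> along \<open>k'\<close>. On the first piece both maps come from
  \<open>A\<close>, and \<open>inj\<close> applies. On the second the same section comes from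
  \<open>A\<close> through \<open>k\<close> and from \<open>B\<close> through \<open>k'\<close>, so
  that piece is zero.\<close>

lemma glued_inj_half:
  assumes F: "is_presheaf C F" and sp: "SP D A B r s r' s'" and t: "t \<in> sec F D"
    and inj: "\<And>E u v. MM A E u \<Longrightarrow> MM A E v \<Longrightarrow> res F A E (un u) (res F D A (un r) t) = res F A E (un v) (res F D A (un r) t) \<Longrightarrow> u = v"
    and disj: "\<And>E u v. MM A E u \<Longrightarrow> MM B E v \<Longrightarrow> res F A E (un u) (res F D A (un r) t) = res F B E (un v) (res F D B (un r') t) \<Longrightarrow> zeroT (mon_ob E)"
    and k: "MM D E k" "MM D E k'" "res F D E (un k) t = res F D E (un k') t" and h: "MM A E h" "h ** r = k"
  shows "k = k'"
proof -
  note d = SP_D[OF sp]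
  obtain E1 E2 q x q' x' m m' where b: "SP E E1 E2 q x q' x'" and m: "MM A E1 m" "MM B E2 m'" "m ** r = q ** k'" "m' ** r' = q' ** k'"
    using SP_base_change[OF sp k(2)] by blast
  note b' = SP_D(1,2)[OF b]
  have g: "res F A E3 (un (p ** h)) (res F D A (un r) t) = res F D E3 (un (p ** k')) t" if p: "MM E E3 p" for E3 p
    unfolding presheaf_res_cmp[OF F d(1) MM_cmp[OF h(1) p] t, symmetric] presheaf_res_cmp[OF F k(2) p t] k(3)[symmetric]
      presheaf_res_cmp[OF F k(1) p t, symmetric] using h(2) by simp
  have "q ** h = m"
  proof (rule inj[OF MM_cmp[OF h(1) b'(1)] m(1)])
    show "res F A E1 (un (q ** h)) (res F D A (un r) t) = res F A E1 (un m) (res F D A (un r) t)"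
      unfolding g[OF b'(1)] presheaf_res_cmp[OF F d(1) m(1) t, symmetric] m(3) ..
  qed
  from ra[OF this, of r] have 1: "q ** k = q ** k'" using h(2) m(3) by simp
  have z: "zeroT (mon_ob E2)"
  proof (rule disj[OF MM_cmp[OF h(1) b'(2)] m(2)])
    show "res F A E2 (un (q' ** h)) (res F D A (un r) t) = res F B E2 (un m') (res F D B (un r') t)"
      unfolding g[OF b'(2)] presheaf_res_cmp[OF F d(2) m(2) t, symmetric] m(4) ..
  qed
  note [simp] = MM_D(3-5)[OF k(1)] MM_D(3-5)[OF k(2)] MM_D(3-5)[OF b'(2)]
  have "q' ** k = zr (mon_ob D) (mon_ob E2)" using zeroT_to[OF z, of "q' ** k"] by simp
  moreover have "q' ** k' = zr (mon_ob D) (mon_ob E2)" using zeroT_to[OF z, of "q' ** k'"] by simp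
  ultimately have 2: "q' ** k = q' ** k'" by simp
  show ?thesis by (rule SP_jm[OF b _ _ _ _ 1 2]) simp_all
qed

text \<open>Split \<open>E\<close> along \<open>k\<close>. On each piece \<open>k\<close> comes from
  one of the factors, which is the situation of \<open>glued_inj_half\<close>.\<close>

lemma glued_inj:
  assumes F: "is_presheaf C F" and sp: "SP D A B r s r' s'" and t: "t \<in> sec F D"
    and inj: "\<And>E u v. MM A E u \<Longrightarrow> MM A E v \<Longrightarrow> res F A E (un u) (res F D A (un r) t) = res F A E (un v) (res F D A (un r) t) \<Longrightarrow> u = v"
    and inj': "\<And>E u v. MM B E u \<Longrightarrow> MM B E v \<Longrightarrow> res F B E (un u) (res F D B (un r') t) = res F B E (un v) (res F D B (un r') t) \<Longrightarrow> u = v"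
    and disj: "\<And>E u v. MM A E u \<Longrightarrow> MM B E v \<Longrightarrow> res F A E (un u) (res F D A (un r) t) = res F B E (un v) (res F D B (un r') t) \<Longrightarrow> zeroT (mon_ob E)"
    and k: "MM D E k" "MM D E k'" "res F D E (un k) t = res F D E (un k') t"
  shows "k = k'"
proof -
  obtain E1 E2 q x q' x' m m' where b: "SP E E1 E2 q x q' x'" and m: "MM A E1 m" "MM B E2 m'" "m ** r = q ** k" "m' ** r' = q' ** k"
    using SP_base_change[OF sp k(1)] by blast
  note b' = SP_D(1,2)[OF b]
  have e: "res F D E3 (un (p ** k)) t = res F D E3 (un (p ** k')) t" if p: "MM E E3 p" for E3 p
    unfolding presheaf_res_cmp[OF F k(2) p t] presheaf_res_cmp[OF F k(1) p t] k(3) ..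
  have disj': "\<And>E u v. MM B E u \<Longrightarrow> MM A E v \<Longrightarrow> res F B E (un u) (res F D B (un r') t) = res F A E (un v) (res F D A (un r) t) \<Longrightarrow> zeroT (mon_ob E)"
    using disj by metis
  have 1: "q ** k = q ** k'"
    by (rule glued_inj_half[OF F sp t inj disj MM_cmp[OF k(1) b'(1)] MM_cmp[OF k(2) b'(1)] e[OF b'(1)] m(1,3)])
  have 2: "q' ** k = q' ** k'"
    by (rule glued_inj_half[OF F SP_sym[OF sp] t inj' disj' MM_cmp[OF k(1) b'(2)] MM_cmp[OF k(2) b'(2)] e[OF b'(2)] m(2,4)])
  show ?thesis by (rule SP_jm[OF b _ _ _ _ 1 2]) (use MM_D(3-5)[OF k(1)] MM_D(3-5)[OF k(2)] in auto)
qed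

text \<open>Images are compared through the subsheaves of \<open>Spec R\<close> that contain them: a
  subsheaf containing the pullbacks of \<open>Spec A\<close> and \<open>Spec B\<close> contains that
  of \<open>Spec D\<close>, by gluing over the two pieces of the base, and conversely by composing
  with the projections of \<open>D\<close>.\<close>

lemma SP_zariski_open_immersion:
  fixes U :: "'u set"
  assumes U: "infinite U" "has_small_colimits U C" and F: "is_sheaf U C F" and sp: "SP D A B r s r' s'"
    and fg: "fin_gen U C A (self_mdl A)" "fin_gen U C B (self_mdl B)"
    and fc: "filtered_colimits_commute_with_finite_limits U (Mod C A)" "filtered_colimits_commute_with_finite_limits U (Mod C B)"
    and z: "zariski_open_immersion U C (Spec C A) F \<phi>" "zariski_open_immersion U C (Spec C B) F \<psi>"
    and disj: "\<And>E u v. MM A E u \<Longrightarrow> MM B E v \<Longrightarrow> \<phi> E (un u) = \<psi> E (un v) \<Longrightarrow> zeroT (mon_ob E)"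
    and t: "t \<in> sec F D" "res F D A (un r) t = \<phi> A (un (I (mon_ob A)))" "res F D B (un r') t = \<psi> B (un (I (mon_ob B)))"
  shows "zariski_open_immersion U C (Spec C D) F (\<lambda>E g. res F D E g t)"
proof -
  have pF: "is_presheaf C F" using F by (simp add: is_sheaf_def)
  note d = SP_D[OF sp]
  have A: "CM A" and B: "CM B" and D: "CM D" using MM_D[OF d(1)] MM_D[OF d(2)] by blast+
  have p\<phi>: "psh_mor C (Spec C A) F \<phi>" "psh_mor C (Spec C B) F \<psi>" using z unfolding zariski_open_immersion_def by blast+
  have r\<phi>: "\<phi> E (un u) = res F D E (un (u ** r)) t" if u: "MM A E u" for E u
    unfolding yoneda(2)[OF A p\<phi>(1) u] t(2)[symmetric] by (rule presheaf_res_cmp[OF pF d(1) u t(1), symmetric])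
  have r\<psi>: "\<psi> E (un u) = res F D E (un (u ** r')) t" if u: "MM B E u" for E u
    unfolding yoneda(2)[OF B p\<phi>(2) u] t(3)[symmetric] by (rule presheaf_res_cmp[OF pF d(2) u t(1), symmetric])
  have inj: "k = k'" if k: "MM D E k" "MM D E k'" "res F D E (un k) t = res F D E (un k') t" for E k k'
  proof (rule glued_inj[OF pF sp t(1) _ _ _ k])
    show "u = v" if u: "MM A E u" "MM A E v" and "res F A E (un u) (res F D A (un r) t) = res F A E (un v) (res F D A (un r) t)" for E u v
      by (rule zariski_open_immersion_inj[OF pF A z(1) u]) (use that(3) in \<open>simp add: yoneda(2)[OF A p\<phi>(1) u(1)] yoneda(2)[OF A p\<phi>(1) u(2)] t(2)\<close>)
    show "u = v" if u: "MM B E u" "MM B E v" and "res F B E (un u) (res F D B (un r') t) = res F B E (un v) (res F D B (un r') t)" for E u v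
      by (rule zariski_open_immersion_inj[OF pF B z(2) u]) (use that(3) in \<open>simp add: yoneda(2)[OF B p\<phi>(2) u(1)] yoneda(2)[OF B p\<phi>(2) u(2)] t(3)\<close>)
    show "zeroT (mon_ob E)" if u: "MM A E u" "MM B E v" and "res F A E (un u) (res F D A (un r) t) = res F B E (un v) (res F D B (un r') t)" for E u v
      by (rule disj[OF u]) (use that(3) in \<open>simp add: yoneda(2)[OF A p\<phi>(1) u(1)] yoneda(2)[OF B p\<phi>(2) u(2)] t(2,3)\<close>)
  qed
  show ?thesis
    unfolding zariski_open_immersion_def Let_def
  proof (intro conjI ballI allI impI)
    show "psh_mor C (Spec C D) F (\<lambda>E g. res F D E g t)" by (rule yoneda_psh_mor[OF pF D t(1)])
    fix R \<zeta> assume "R \<in> Ob (CommMon C)" and \<zeta>: "psh_mor C (Spec C R) F \<zeta>"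
    then have R: "CM R" by (simp add: Ob_CommMon)
    let ?P = "fibre_product (Spec C D) (\<lambda>E g. res F D E g t) (Spec C R) \<zeta>"
    let ?PA = "fibre_product (Spec C A) \<phi> (Spec C R) \<zeta>" and ?PB = "fibre_product (Spec C B) \<psi> (Spec C R) \<zeta>"
    show "sheaf_mono C ?P (\<lambda>_. snd)"
      unfolding sheaf_mono_def
    proof (intro ballI inj_onI)
      fix E p p' assume "E \<in> Ob (CommMon C)" and p: "p \<in> sec ?P E" "p' \<in> sec ?P E" "snd p = snd p'"
      then have E: "CM E" by (simp add: Ob_CommMon)
      obtain g h where g: "p = (un g, un h)" "MM D E g" "res F D E (un g) t = \<zeta> E (un h)"
        using p(1) unfolding sec_fibre_product_Spec[OF D R E] by blast
      obtain g' h' where g': "p' = (un g', un h')" "MM D E g'" "res F D E (un g') t = \<zeta> E (un h')"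
        using p(2) unfolding sec_fibre_product_Spec[OF D R E] by blast
      have "g = g'" by (rule inj[OF g(2) g'(2)]) (use g g' p(3) in simp)
      then show "p = p'" using g(1) g'(1) p(3) by simp
    qed
    have hP: "h \<in> snd ` sec (fibre_product (Spec C V) \<xi> (Spec C R) \<zeta>) E \<longleftrightarrow> (\<exists>u k. h = un k \<and> MM V E u \<and> MM R E k \<and> \<xi> E (un u) = \<zeta> E (un k))"
      if V: "CM V" and E: "CM E" for V \<xi> E h
    proof
      assume "h \<in> snd ` sec (fibre_product (Spec C V) \<xi> (Spec C R) \<zeta>) E"
      then obtain p where p: "p \<in> sec (fibre_product (Spec C V) \<xi> (Spec C R) \<zeta>) E" "h = snd p" by blast
      obtain u k where u: "p = (un u, un k)" "MM V E u" "MM R E k" "\<xi> E (un u) = \<zeta> E (un k)"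
        using p(1) unfolding sec_fibre_product_Spec[OF V R E] by blast
      then have "h = un k" using p(2) by simp
      then show "\<exists>u k. h = un k \<and> MM V E u \<and> MM R E k \<and> \<xi> E (un u) = \<zeta> E (un k)" using u(2-4) by blast
    next
      assume "\<exists>u k. h = un k \<and> MM V E u \<and> MM R E k \<and> \<xi> E (un u) = \<zeta> E (un k)"
      then obtain u k where u: "h = un k" "MM V E u" "MM R E k" "\<xi> E (un u) = \<zeta> E (un k)" by blast
      then have "(un u, un k) \<in> sec (fibre_product (Spec C V) \<xi> (Spec C R) \<zeta>) E"
        unfolding sec_fibre_product_Spec[OF V R E] by blast
      then show "h \<in> snd ` sec (fibre_product (Spec C V) \<xi> (Spec C R) \<zeta>) E" unfolding u(1) by (metis imageI snd_conv)
    qed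
    obtain SA where SA: "is_sheaf_image U C (Spec C R) (\<lambda>E. snd ` sec ?PA E) SA" "zariski_open_subsheaf U C R SA"
      using z(1) \<zeta> R unfolding zariski_open_immersion_def Let_def Ball_def Ob_CommMon by blast
    obtain SB where SB: "is_sheaf_image U C (Spec C R) (\<lambda>E. snd ` sec ?PB E) SB" "zariski_open_subsheaf U C R SB"
      using z(2) \<zeta> R unfolding zariski_open_immersion_def Let_def Ball_def Ob_CommMon by blast
    show "\<exists>S. is_sheaf_image U C (Spec C R) (\<lambda>E. snd ` sec ?P E) S \<and> zariski_open_subsheaf U C R S"
    proof (rule zariski_open_subsheaf_Un[OF U(1) R SA SB])
      show "snd ` sec ?P E \<subseteq> sec (Spec C R) E" for E by (auto simp: fibre_product_def)
      fix T assume T: "is_subsheaf U C (Spec C R) T"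
      show "(\<forall>E\<in>Ob (CommMon C). snd ` sec ?P E \<subseteq> T E) \<longleftrightarrow>
        (\<forall>E\<in>Ob (CommMon C). snd ` sec ?PA E \<subseteq> T E) \<and> (\<forall>E\<in>Ob (CommMon C). snd ` sec ?PB E \<subseteq> T E)"
      proof
        assume P: "\<forall>E\<in>Ob (CommMon C). snd ` sec ?P E \<subseteq> T E"
        have "h \<in> T E" if E: "CM E" and h: "h \<in> snd ` sec ?PA E" for E h
        proof -
          obtain u k where u: "h = un k" "MM A E u" "MM R E k" "\<phi> E (un u) = \<zeta> E (un k)" using h hP[OF A E] by blast
          have "h \<in> snd ` sec ?P E" unfolding hP[OF D E] using u MM_cmp[OF d(1) u(2)] r\<phi>[OF u(2)] by auto
          then show ?thesis using P E Ob_CommMon by blast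
        qed
        moreover have "h \<in> T E" if E: "CM E" and h: "h \<in> snd ` sec ?PB E" for E h
        proof -
          obtain u k where u: "h = un k" "MM B E u" "MM R E k" "\<psi> E (un u) = \<zeta> E (un k)" using h hP[OF B E] by blast
          have "h \<in> snd ` sec ?P E" unfolding hP[OF D E] using u MM_cmp[OF d(2) u(2)] r\<psi>[OF u(2)] by auto
          then show ?thesis using P E Ob_CommMon by blast
        qed
        ultimately show "(\<forall>E\<in>Ob (CommMon C). snd ` sec ?PA E \<subseteq> T E) \<and> (\<forall>E\<in>Ob (CommMon C). snd ` sec ?PB E \<subseteq> T E)"
          unfolding Ball_def Ob_CommMon by blast
      next
        assume P: "(\<forall>E\<in>Ob (CommMon C). snd ` sec ?PA E \<subseteq> T E) \<and> (\<forall>E\<in>Ob (CommMon C). snd ` sec ?PB E \<subseteq> T E)"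
        have "h \<in> T E" if E: "CM E" and h: "h \<in> snd ` sec ?P E" for E h
        proof -
          obtain g k where g: "h = un k" "MM D E g" "MM R E k" "res F D E (un g) t = \<zeta> E (un k)" using hP[OF D E, THEN iffD1, OF h] by blast
          obtain E1 E2 q x q' x' m m' where b: "SP E E1 E2 q x q' x'" and m: "MM A E1 m" "MM B E2 m'" "m ** r = q ** g" "m' ** r' = q' ** g"
            using SP_base_change[OF sp g(2)] by blast
          note b' = SP_D(1,2)[OF b]
          \<comment> \<open>Each projection of \<open>E\<close> is open because the complementary
            piece is an algebra over a chart, through \<open>m'\<close> or \<open>m\<close>.\<close>
          have o: "aff_zariski_open U C E E1 (un q)" "aff_zariski_open U C E E2 (un q')"
            using SP_aff_zariski_open[OF b U(2) m(2) fg(2) fc(2)] SP_aff_zariski_open[OF SP_sym[OF b] U(2) m(1) fg(1) fc(1)] by blast+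
          \<comment> \<open>By naturality of \<open>\<zeta>\<close>, the equation between the two
            sections over \<open>E\<close> restricts to each piece.\<close>
          have \<zeta>q: "res F D E' (un (p ** g)) t = \<zeta> E' (un (p ** k))" if p: "MM E E' p" for E' p
          proof -
            have "\<zeta> E' (res (Spec C R) E E' (un p) (un k)) = res F E E' (un p) (\<zeta> E (un k))"
              using \<zeta> E MM_D(2)[OF p] MM_un[OF p] sec_Spec[OF R E] g(3) unfolding psh_mor_def Ball_def Ob_CommMon by blast
            then show ?thesis unfolding res_Spec[OF g(3) p] presheaf_res_cmp[OF pF g(2) p t(1)] g(4) ..
          qed
          have "un (q ** k) \<in> snd ` sec ?PA E1"
            unfolding hP[OF A MM_D(2)[OF b'(1)]] using m(1) MM_cmp[OF g(3) b'(1)] r\<phi>[OF m(1)] \<zeta>q[OF b'(1)] m(3) by auto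
          moreover have "un (q' ** k) \<in> snd ` sec ?PB E2"
            unfolding hP[OF B MM_D(2)[OF b'(2)]] using m(2) MM_cmp[OF g(3) b'(2)] r\<psi>[OF m(2)] \<zeta>q[OF b'(2)] m(4) by auto
          ultimately have "un (q ** k) \<in> T E1" "un (q' ** k) \<in> T E2"
            using P MM_D(2)[OF b'(1)] MM_D(2)[OF b'(2)] unfolding Ball_def Ob_CommMon by blast+
          then show ?thesis unfolding g(1) by (rule SP_Spec_subsheaf_glue[OF U(1) R T b o g(3)])
        qed
        then show "\<forall>E\<in>Ob (CommMon C). snd ` sec ?P E \<subseteq> T E" unfolding Ball_def Ob_CommMon by blast
      qed
    qed
  qed
qed

text \<open>The endomorphisms \<open>s ** r\<close> and \<open>s' ** r'\<close> have product zero.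
  In a domain one of them vanishes, and with it the identity of its factor.\<close>

lemma SP_not_integral:
  assumes sp: "SP D A B r s r' s'" and i: "integral_monoid C D"
  shows "zeroT (mon_ob A) \<or> zeroT (mon_ob B)"
proof -
  note d = SP_D[OF sp] and rD = MM_D[OF SP_D(1)[OF sp]] and rD' = MM_D[OF SP_D(2)[OF sp]]
  note [simp] = d(3-8) rD(1-5) rD'(1-5)
  let ?d = "mon_ob D" and ?S = "self_mdl D"
  interpret R: domain "End_ring C D" using i by (simp add: integral_monoid_def)
  have S: "MD D ?S" by simp
  have lin: "LM D ?S ?S (s ** r)" if "SP D A B r s r' s'" for A B r s r' s'
  proof -
    note [simp] = SP_D(3-8)[OF that] MM_D(1-5)[OF SP_D(1)[OF that]]
    show ?thesis unfolding LM_def using mu_left_right[OF _ _ _ _ SP_lin[OF that]] by simp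
  qed
  have l: "LM D ?S ?S (s ** r)" "LM D ?S ?S (s' ** r')" using lin[OF sp] lin[OF SP_sym[OF sp]] by blast+
  have z: "\<zero>\<^bsub>End_ring C D\<^esub> = un (zr ?d ?d)" by (simp add: End_ring_def zero_arrow_Mod un_zr)
  have c: "un (s ** r) \<in> carrier (End_ring C D)" "un (s' ** r') \<in> carrier (End_ring C D)"
    using LM_un[OF _ l(1)] LM_un[OF _ l(2)] by (auto simp: End_ring_def)
  have "un (s ** r) \<cdot> un (s' ** r') = un ((s ** r) ** (s' ** r'))" by (subst un_cmp) auto
  also have "\<dots> = un (zr ?d ?d)" by (simp add: ra[OF d(11)])
  finally have "un (s ** r) \<otimes>\<^bsub>End_ring C D\<^esub> un (s' ** r') = \<zero>\<^bsub>End_ring C D\<^esub>" unfolding z by (simp add: End_ring_def)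
  then have "un (s ** r) = un (zr ?d ?d) \<or> un (s' ** r') = un (zr ?d ?d)" using R.integral[OF _ c] z by simp
  then have "s ** r = zr ?d ?d \<or> s' ** r' = zr ?d ?d" using un_inject[of "s ** r" "zr ?d ?d"] un_inject[of "s' ** r'" "zr ?d ?d"] by auto
  moreover have "zeroT (mon_ob A)" if e: "s ** r = zr ?d ?d" and sp: "SP D A B r s r' s'" for A B r s r' s'
  proof -
    note d = SP_D[OF sp]
    note [simp] = d(3-8) MM_D(1-5)[OF SP_D(1)[OF sp]]
    have "I (mon_ob A) = (r ** s) ** (r ** s)" unfolding d(9) by simp
    also have "\<dots> = r ** (s ** r) ** s" by simp
    also have "\<dots> = zr (mon_ob A) (mon_ob A)" unfolding e by simp
    finally show ?thesis unfolding zeroT_def using CM_ar(1) MM_D(2)[OF d(1)] by blast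
  qed
  ultimately show ?thesis using sp SP_sym[OF sp] by blast
qed

lemma irreducible:
  fixes U :: "'u set"
  assumes U: "infinite U" "has_small_colimits U C"
    and fc: "\<And>A. CM A \<Longrightarrow> filtered_colimits_commute_with_finite_limits U (Mod C A)"
    and X: "is_scheme U C X" "noetherian_scheme U C X" "integral_scheme U C X"
  shows "irreducible_scheme U C X"
proof -
  have F: "is_sheaf U C X" using X(1) by (simp add: is_scheme_def)
  have False if a: "(A, \<phi>) \<in> ZarAff U C X" "(B, \<psi>) \<in> ZarAff U C X" and nt: "\<not> trivial_sheaf C (Spec C A)" "\<not> trivial_sheaf C (Spec C B)"
    and tr: "trivial_sheaf C (fibre_product (Spec C A) \<phi> (Spec C B) \<psi>)" for A B \<phi> \<psi>
  proof -
    have A: "CM A" "zariski_open_immersion U C (Spec C A) X \<phi>" and B: "CM B" "zariski_open_immersion U C (Spec C B) X \<psi>"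
      using a by (auto simp: ZarAff_def Ob_CommMon)
    have fg: "fin_gen U C A (self_mdl A)" "fin_gen U C B (self_mdl B)"
      using a X(2) noetherian_fin_gen_self[OF A(1)] noetherian_fin_gen_self[OF B(1)] unfolding noetherian_scheme_def by blast+
    have p\<phi>: "psh_mor C (Spec C A) X \<phi>" "psh_mor C (Spec C B) X \<psi>" using A(2) B(2) unfolding zariski_open_immersion_def by blast+
    \<comment> \<open>A common point of the two charts over \<open>E\<close> is a section of their
      trivial fibre product.\<close>
    have disj: "zeroT (mon_ob E)" if u: "MM A E u" "MM B E v" "\<phi> E (un u) = \<psi> E (un v)" for E u v
    proof (rule trivial_sheaf_zero[OF tr MM_D(2)[OF u(1)]])
      show "(un u, un v) \<in> sec (fibre_product (Spec C A) \<phi> (Spec C B) \<psi>) E"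
        unfolding sec_fibre_product_Spec[OF A(1) B(1) MM_D(2)[OF u(1)]] using u by blast
    qed
    obtain D r s r' s' where sp: "SP D A B r s r' s'" using SP_exists[OF A(1) B(1)] by blast
    note d = SP_D[OF sp]
    have o: "aff_zariski_open U C D A (un r)" "aff_zariski_open U C D B (un r')"
      using SP_aff_zariski_open[OF sp U(2) MM_I[OF B(1)] fg(2) fc[OF B(1)]] SP_aff_zariski_open[OF SP_sym[OF sp] U(2) MM_I[OF A(1)] fg(1) fc[OF A(1)]] by blast+
    \<comment> \<open>By Yoneda, \<open>\<phi>\<close> and \<open>\<psi>\<close> amount to sections
      of \<open>X\<close> over \<open>A\<close> and \<open>B\<close>; any such pair glues over
      \<open>D\<close>.\<close>
    obtain t where t: "t \<in> sec X D" "res X D A (un r) t = \<phi> A (un (I (mon_ob A)))" "res X D B (un r') t = \<psi> B (un (I (mon_ob B)))"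
      using sheaf_SP[OF U(1) F sp o yoneda(1)[OF A(1) p\<phi>(1)] yoneda(1)[OF B(1) p\<phi>(2)]] by blast
    have "zariski_open_immersion U C (Spec C D) X (\<lambda>E g. res X D E g t)"
      by (rule SP_zariski_open_immersion[OF U F sp fg fc[OF A(1)] fc[OF B(1)] A(2) B(2) disj t])
    then have "(D, \<lambda>E g. res X D E g t) \<in> ZarAff U C X" using MM_D(1)[OF d(1)] by (simp add: ZarAff_def Ob_CommMon)
    moreover have nz: "\<not> zeroT (mon_ob A)" "\<not> zeroT (mon_ob B)" using nt trivial_Spec A(1) B(1) zero_monoid_iff by blast+
    moreover have "\<not> zero_monoid C D" using nz(1) MM_zero[OF d(1)] zero_monoid_iff by blast
    ultimately have "integral_monoid C D" using X(3) unfolding integral_scheme_def by blast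
    then show False using SP_not_integral[OF sp] nz by blast
  qed
  then show ?thesis unfolding irreducible_scheme_def using X(1) by blast
qed

end

theorem proposition2p11:
  fixes U :: "'u set"
    and C :: "('o, 'm) smcat"
    and X :: "('o, 'm, 'x) presheaf"
  assumes "infinite U"
    and "abelian_category C"
    and "closed_symmetric_monoidal_category C"
    and "has_small_colimits U C"
    and "locally_finitely_generated U C"
    and "\<And>A. A \<in> Ob (CommMon C) \<Longrightarrow>
           filtered_colimits_commute_with_finite_limits U (Mod C A)"
    and "is_scheme U C X"
    and "noetherian_scheme U C X"
    and "integral_scheme U C X"
  shows "irreducible_scheme U C X"
proof -
  interpret abelian_symmetric_monoidal C
    using assms(2,3) by (simp add: abelian_symmetric_monoidal_def)
  show ?thesis by (rule irreducible[OF assms(1,4) _ assms(7-9)]) (use assms(6) Ob_CommMon in blast)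
qed

end
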